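(* Let $M$ be a connected orientable $n$-dimensional Riemannian manifold without boundary. The linear isometry $D\colon \mathrm{Lip}_0(M)\to L^\infty(M,T^*M)$, $F\mapsto \mathrm{d}F$, is weak$^*$-to-weak$^*$ continuous, where $\mathrm{Lip}_0(M)$ is regarded as the dual of $\mathcal{F}(M)$ and $L^\infty(M,T^*M)$ as the dual of $L^1(M,TM)$.
   Context: $M$ carries its Riemannian distance $d$, a distinguished point $0_M\in M$, and its volume form $\mathrm{d}V$. $\mathrm{Lip}_0(M)$ is the real Banach space of all Lipschitz functions $F\colon M\to\mathbb{R}$ with $F(0_M)=0$, with norm the Lipschitz constant. $\mathcal{F}(M)=\overline{\mathrm{span}\{\delta(x)\colon x\in M\}}\subset \mathrm{Lip}_0(M)^*$, where $\langle F,\delta(x)\rangle=F(x)$; it is a predual of $\mathrm{Lip}_0(M)$. For Lipschitz $F$, $\mathrm{d}F$ is the differential, which exists almost everywhere and coincides with the distributional differential. $L^\infty(M,T^*M)$ is the Banach space of (a.e.-classes of) measurable sections $f$ of $T^*M$ with $\|f\|_{L^\infty}=\operatorname{ess\,sup}_{x}\|f(x)\|_{T_x^*M}<\infty$. $L^1(M,TM)$ is the Banach space of (a.e.-classes of) measurable sections $g$ of $TM$ with $\|g\|_{L^1}=\int_M\|g(x)\|_{T_xM}\,\mathrm{d}V(x)<\infty$. The duality between them is $\langle f,g\rangle_{(L^\infty,L^1)}=\int_M\langle f(x),g(x)\rangle\,\mathrm{d}V(x)$, under which $L^1(M,TM)^*=L^\infty(M,T^*M)$ isometrically. *)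

theory Defs
  imports "HOL-Analysis.Analysis" "HOL-Probability.Essential_Supremum"
begin

section \<open>Smooth manifolds\<close>

text \<open>
  \<open>Ck_on k f S\<close> is meant for open \<open>S\<close>: \<open>f\<close> is \<open>k\<close> times differentiable on \<open>S\<close>, with continuous
  iterated directional derivatives.
\<close>

fun Ck_on :: "nat \<Rightarrow> ('a::euclidean_space \<Rightarrow> 'b::real_normed_vector) \<Rightarrow> 'a set \<Rightarrow> bool" where
  "Ck_on 0 f S \<longleftrightarrow> continuous_on S f"
| "Ck_on (Suc k) f S \<longleftrightarrow>
     f differentiable_on S \<and> (\<forall>v. Ck_on k (\<lambda>x. frechet_derivative f (at x) v) S)"

definition smooth_on :: "('a::euclidean_space \<Rightarrow> 'b::real_normed_vector) \<Rightarrow> 'a set \<Rightarrow> bool" where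
  "smooth_on f S \<longleftrightarrow> (\<forall>k. Ck_on k f S)"

text \<open>
  The manifold is a whole type \<open>'m\<close> (Hausdorff and second countable by its type classes), and its
  dimension is \<open>CARD('n)\<close>. A chart \<open>(U, \<phi>)\<close> consists of its domain and its coordinate map; only the
  values of \<open>\<phi>\<close> on \<open>U\<close> matter.
\<close>

type_synonym ('m, 'n) chart = "'m set \<times> ('m \<Rightarrow> real ^ 'n)"

abbreviation chart_inv :: "('m, 'n) chart \<Rightarrow> real ^ 'n \<Rightarrow> 'm" where
  "chart_inv c \<equiv> inv_into (fst c) (snd c)"

definition is_chart :: "('m::topological_space, 'n::finite) chart \<Rightarrow> bool" where
  "is_chart c \<longleftrightarrow> open (fst c) \<and> open (snd c ` fst c) \<and>
     homeomorphism (fst c) (snd c ` fst c) (snd c) (chart_inv c)"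

definition transition :: "('m, 'n) chart \<Rightarrow> ('m, 'n) chart \<Rightarrow> real ^ 'n \<Rightarrow> real ^ 'n" where
  "transition c c' = snd c' \<circ> chart_inv c"

definition smooth_atlas :: "('m::topological_space, 'n::finite) chart set \<Rightarrow> bool" where
  "smooth_atlas A \<longleftrightarrow>
     (\<forall>c\<in>A. is_chart c) \<and> (\<Union>c\<in>A. fst c) = UNIV \<and>
     (\<forall>c\<in>A. \<forall>c'\<in>A. smooth_on (transition c c') (snd c ` (fst c \<inter> fst c')))"

text \<open>Since \<open>A\<close> need not be maximal, an oriented atlas \<open>B\<close> is only required to be compatible with it.\<close>

definition orientable :: "('m::topological_space, 'n::finite) chart set \<Rightarrow> bool" where
  "orientable A \<longleftrightarrow>
     (\<exists>B. smooth_atlas B \<and> smooth_atlas (A \<union> B) \<and>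
        (\<forall>b\<in>B. \<forall>b'\<in>B. \<forall>p \<in> fst b \<inter> fst b'.
           0 < det (matrix (frechet_derivative (transition b b') (at (snd b p))))))"


section \<open>Tangent and cotangent spaces\<close>

text \<open>
  A tangent vector at \<open>p\<close> is given by its coordinate vectors in all charts around \<open>p\<close>, related by
  the differentials of the transition maps. It is set to \<open>0\<close> at all other charts, so that two
  tangent vectors at \<open>p\<close> are equal iff they have the same coordinates. Likewise, a covector is a
  linear functional on the tangent space which is set to \<open>0\<close> outside of it.
\<close>

type_synonym ('m, 'n) tvec = "('m, 'n) chart \<Rightarrow> real ^ 'n"
type_synonym ('m, 'n) covec = "('m, 'n) tvec \<Rightarrow> real"

definition tangent_space ::
    "('m, 'n::finite) chart set \<Rightarrow> 'm \<Rightarrow> ('m, 'n) tvec set" where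
  "tangent_space A p =
     {v. (\<forall>c\<in>A. \<forall>c'\<in>A. p \<in> fst c \<longrightarrow> p \<in> fst c' \<longrightarrow>
            v c' = frechet_derivative (transition c c') (at (snd c p)) (v c)) \<and>
         (\<forall>c. c \<notin> A \<or> p \<notin> fst c \<longrightarrow> v c = 0)}"

text \<open>The tangent vector at \<open>p\<close> whose coordinate vector in the chart \<open>c\<close> around \<open>p\<close> is \<open>u\<close>:\<close>

definition coord_vec ::
    "('m, 'n::finite) chart set \<Rightarrow> ('m, 'n) chart \<Rightarrow> 'm \<Rightarrow> real ^ 'n \<Rightarrow> ('m, 'n) tvec" where
  "coord_vec A c p u =
     (\<lambda>c'. if c' \<in> A \<and> p \<in> fst c'
           then frechet_derivative (transition c c') (at (snd c p)) u else 0)"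

definition cotangent_space ::
    "('m, 'n::finite) chart set \<Rightarrow> 'm \<Rightarrow> ('m, 'n) covec set" where
  "cotangent_space A p =
     {\<omega>. (\<forall>v \<in> tangent_space A p. \<forall>w \<in> tangent_space A p. \<forall>a b.
            \<omega> (\<lambda>c. a *\<^sub>R v c + b *\<^sub>R w c) = a * \<omega> v + b * \<omega> w) \<and>
         (\<forall>v. v \<notin> tangent_space A p \<longrightarrow> \<omega> v = 0)}"


section \<open>Riemannian metrics, distance and volume\<close>

type_synonym ('m, 'n) metric_tensor = "'m \<Rightarrow> ('m, 'n) tvec \<Rightarrow> ('m, 'n) tvec \<Rightarrow> real"

text \<open>The matrix \<open>(g\<^sub>i\<^sub>j)\<close> of the metric in a chart, as a function on the image of the chart:\<close>

definition gram_matrix ::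
    "('m, 'n::finite) chart set \<Rightarrow> ('m, 'n) metric_tensor \<Rightarrow> ('m, 'n) chart \<Rightarrow>
     real ^ 'n \<Rightarrow> real ^ 'n ^ 'n" where
  "gram_matrix A g c x =
     (\<chi> i j. g (chart_inv c x) (coord_vec A c (chart_inv c x) (axis i 1))
                              (coord_vec A c (chart_inv c x) (axis j 1)))"

definition riemannian_metric ::
    "('m, 'n::finite) chart set \<Rightarrow> ('m, 'n) metric_tensor \<Rightarrow> bool" where
  "riemannian_metric A g \<longleftrightarrow>
     (\<forall>p. \<forall>v \<in> tangent_space A p. \<forall>w \<in> tangent_space A p.
        g p v w = g p w v \<and>
        (v \<noteq> (\<lambda>_. 0) \<longrightarrow> 0 < g p v v) \<and>
        (\<forall>u \<in> tangent_space A p. \<forall>a b.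
           g p (\<lambda>c. a *\<^sub>R v c + b *\<^sub>R w c) u = a * g p v u + b * g p w u)) \<and>
     (\<forall>c\<in>A. smooth_on (gram_matrix A g c) (snd c ` fst c))"

definition tnorm :: "('m, 'n) metric_tensor \<Rightarrow> 'm \<Rightarrow> ('m, 'n) tvec \<Rightarrow> real" where
  "tnorm g p v = sqrt (g p v v)"

definition conorm ::
    "('m, 'n::finite) chart set \<Rightarrow> ('m, 'n) metric_tensor \<Rightarrow> 'm \<Rightarrow> ('m, 'n) covec \<Rightarrow> real" where
  "conorm A g p \<omega> = Sup {\<bar>\<omega> v\<bar> |v. v \<in> tangent_space A p \<and> tnorm g p v \<le> 1}"

text \<open>
  The derivatives at the end points of \<open>{a..b}\<close> are one-sided, so the derivative of a \<open>C\<^sup>1\<close> curve is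
  bounded and the length of a piecewise \<open>C\<^sup>1\<close> curve is finite. (The library's
  \<open>piecewise_C1_differentiable_on\<close> does not ensure that.)
\<close>

definition C1_curve ::
    "('m::topological_space, 'n::finite) chart set \<Rightarrow> real \<Rightarrow> real \<Rightarrow> (real \<Rightarrow> 'm) \<Rightarrow> bool" where
  "C1_curve A a b \<gamma> \<longleftrightarrow>
     continuous_on {a..b} \<gamma> \<and>
     (\<forall>c\<in>A. let T = {t \<in> {a..b}. \<gamma> t \<in> fst c} in
        \<exists>\<gamma>'. continuous_on T \<gamma>' \<and>
          (\<forall>t\<in>T. ((snd c \<circ> \<gamma>) has_vector_derivative \<gamma>' t) (at t within T)))"

definition piecewise_C1_curve ::
    "('m::topological_space, 'n::finite) chart set \<Rightarrow> (real \<Rightarrow> 'm) \<Rightarrow> bool" where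
  "piecewise_C1_curve A \<gamma> \<longleftrightarrow>
     (\<exists>S. finite S \<and> {0, 1} \<subseteq> S \<and> S \<subseteq> {0..1} \<and>
        (\<forall>a\<in>S. \<forall>b\<in>S. a < b \<and> {a<..<b} \<inter> S = {} \<longrightarrow> C1_curve A a b \<gamma>))"

definition velocity ::
    "('m, 'n::finite) chart set \<Rightarrow> (real \<Rightarrow> 'm) \<Rightarrow> real \<Rightarrow> ('m, 'n) tvec" where
  "velocity A \<gamma> t =
     (\<lambda>c. if c \<in> A \<and> \<gamma> t \<in> fst c then vector_derivative (snd c \<circ> \<gamma>) (at t) else 0)"

definition curve_length ::
    "('m, 'n::finite) chart set \<Rightarrow> ('m, 'n) metric_tensor \<Rightarrow> (real \<Rightarrow> 'm) \<Rightarrow> real" where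
  "curve_length A g \<gamma> = integral {0..1} (\<lambda>t. tnorm g (\<gamma> t) (velocity A \<gamma> t))"

definition riem_dist ::
    "('m::topological_space, 'n::finite) chart set \<Rightarrow> ('m, 'n) metric_tensor \<Rightarrow>
     'm \<Rightarrow> 'm \<Rightarrow> real" where
  "riem_dist A g x y =
     Inf {curve_length A g \<gamma> |\<gamma>. piecewise_C1_curve A \<gamma> \<and> \<gamma> 0 = x \<and> \<gamma> 1 = y}"

text \<open>
  The volume is the unique Borel measure with \<open>dV = \<surd>det (g\<^sub>i\<^sub>j) dx\<close> in every chart. It is completed,
  so that measurable sections are Lebesgue measurable in charts.
\<close>

definition riem_volume ::
    "('m::topological_space, 'n::finite) chart set \<Rightarrow> ('m, 'n) metric_tensor \<Rightarrow> 'm measure" where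
  "riem_volume A g = completion (THE \<mu>. sets \<mu> = sets borel \<and>
     (\<forall>c\<in>A. \<forall>E \<in> sets borel. E \<subseteq> fst c \<longrightarrow>
        emeasure \<mu> E =
          (\<integral>\<^sup>+x. ennreal (sqrt (det (gram_matrix A g c x))) * indicator (snd c ` E) x \<partial>lborel)))"


section \<open>The spaces of measurable sections\<close>

definition measurable_vector_fields ::
    "('m::topological_space, 'n::finite) chart set \<Rightarrow> ('m, 'n) metric_tensor \<Rightarrow>
     ('m \<Rightarrow> ('m, 'n) tvec) set" where
  "measurable_vector_fields A g =
     {X. (\<forall>p. X p \<in> tangent_space A p) \<and>
         (\<forall>c\<in>A. (\<lambda>p. X p c) \<in> borel_measurable (restrict_space (riem_volume A g) (fst c)))}"

definition measurable_covector_fields ::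
    "('m::topological_space, 'n::finite) chart set \<Rightarrow> ('m, 'n) metric_tensor \<Rightarrow>
     ('m \<Rightarrow> ('m, 'n) covec) set" where
  "measurable_covector_fields A g =
     {f. (\<forall>p. f p \<in> cotangent_space A p) \<and>
         (\<forall>c\<in>A. \<forall>u. (\<lambda>p. f p (coord_vec A c p u))
            \<in> borel_measurable (restrict_space (riem_volume A g) (fst c)))}"

definition Linf_fields ::
    "('m::topological_space, 'n::finite) chart set \<Rightarrow> ('m, 'n) metric_tensor \<Rightarrow>
     ('m \<Rightarrow> ('m, 'n) covec) set" where
  "Linf_fields A g =
     {f \<in> measurable_covector_fields A g.
        esssup (riem_volume A g) (\<lambda>p. ereal (conorm A g p (f p))) < \<infinity>}"

definition L1_fields ::
    "('m::topological_space, 'n::finite) chart set \<Rightarrow> ('m, 'n) metric_tensor \<Rightarrow>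
     ('m \<Rightarrow> ('m, 'n) tvec) set" where
  "L1_fields A g =
     {X \<in> measurable_vector_fields A g. integrable (riem_volume A g) (\<lambda>p. tnorm g p (X p))}"

definition ae_equal :: "'m measure \<Rightarrow> ('m \<Rightarrow> 'v) set \<Rightarrow> (('m \<Rightarrow> 'v) \<times> ('m \<Rightarrow> 'v)) set" where
  "ae_equal \<mu> S = {(f, f'). f \<in> S \<and> f' \<in> S \<and> (AE p in \<mu>. f p = f' p)}"

definition Linf_space ::
    "('m::topological_space, 'n::finite) chart set \<Rightarrow> ('m, 'n) metric_tensor \<Rightarrow>
     ('m \<Rightarrow> ('m, 'n) covec) set set" where
  "Linf_space A g = Linf_fields A g // ae_equal (riem_volume A g) (Linf_fields A g)"

definition L1_space ::
    "('m::topological_space, 'n::finite) chart set \<Rightarrow> ('m, 'n) metric_tensor \<Rightarrow>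
     ('m \<Rightarrow> ('m, 'n) tvec) set set" where
  "L1_space A g = L1_fields A g // ae_equal (riem_volume A g) (L1_fields A g)"

definition Linf_class ::
    "('m::topological_space, 'n::finite) chart set \<Rightarrow> ('m, 'n) metric_tensor \<Rightarrow>
     ('m \<Rightarrow> ('m, 'n) covec) \<Rightarrow> ('m \<Rightarrow> ('m, 'n) covec) set" where
  "Linf_class A g f = ae_equal (riem_volume A g) (Linf_fields A g) `` {f}"

definition representative :: "'f set \<Rightarrow> 'f" where
  "representative \<Phi> = (SOME f. f \<in> \<Phi>)"

definition Linf_lincomb ::
    "('m::topological_space, 'n::finite) chart set \<Rightarrow> ('m, 'n) metric_tensor \<Rightarrow>
     real \<Rightarrow> ('m \<Rightarrow> ('m, 'n) covec) set \<Rightarrow> real \<Rightarrow> ('m \<Rightarrow> ('m, 'n) covec) set \<Rightarrow>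
     ('m \<Rightarrow> ('m, 'n) covec) set" where
  "Linf_lincomb A g a \<Phi> b \<Psi> =
     Linf_class A g (\<lambda>p v. a * representative \<Phi> p v + b * representative \<Psi> p v)"

definition Linf_norm ::
    "('m::topological_space, 'n::finite) chart set \<Rightarrow> ('m, 'n) metric_tensor \<Rightarrow>
     ('m \<Rightarrow> ('m, 'n) covec) set \<Rightarrow> real" where
  "Linf_norm A g \<Phi> =
     real_of_ereal (esssup (riem_volume A g) (\<lambda>p. ereal (conorm A g p (representative \<Phi> p))))"

definition Linf_L1_pairing ::
    "('m::topological_space, 'n::finite) chart set \<Rightarrow> ('m, 'n) metric_tensor \<Rightarrow>
     ('m \<Rightarrow> ('m, 'n) covec) set \<Rightarrow> ('m \<Rightarrow> ('m, 'n) tvec) set \<Rightarrow> real" where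
  "Linf_L1_pairing A g \<Phi> \<Gamma> =
     (\<integral>p. representative \<Phi> p (representative \<Gamma> p) \<partial>riem_volume A g)"


section \<open>Lipschitz functions and the Lipschitz-free space\<close>

definition lipschitz_bounds ::
    "('m::topological_space, 'n::finite) chart set \<Rightarrow> ('m, 'n) metric_tensor \<Rightarrow>
     ('m \<Rightarrow> real) \<Rightarrow> real set" where
  "lipschitz_bounds A g F = {L. 0 \<le> L \<and> (\<forall>x y. \<bar>F x - F y\<bar> \<le> L * riem_dist A g x y)}"

definition Lip0 ::
    "('m::topological_space, 'n::finite) chart set \<Rightarrow> ('m, 'n) metric_tensor \<Rightarrow> 'm \<Rightarrow>
     ('m \<Rightarrow> real) set" where
  "Lip0 A g z = {F. F z = 0 \<and> lipschitz_bounds A g F \<noteq> {}}"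

definition Lip_norm ::
    "('m::topological_space, 'n::finite) chart set \<Rightarrow> ('m, 'n) metric_tensor \<Rightarrow>
     ('m \<Rightarrow> real) \<Rightarrow> real" where
  "Lip_norm A g F = Inf (lipschitz_bounds A g F)"

text \<open>Functionals on \<open>Lip\<^sub>0(M)\<close> are set to \<open>0\<close> outside of \<open>Lip\<^sub>0(M)\<close>.\<close>

definition Lip0_dual ::
    "('m::topological_space, 'n::finite) chart set \<Rightarrow> ('m, 'n) metric_tensor \<Rightarrow> 'm \<Rightarrow>
     (('m \<Rightarrow> real) \<Rightarrow> real) set" where
  "Lip0_dual A g z =
     {\<phi>. (\<forall>F \<in> Lip0 A g z. \<forall>G \<in> Lip0 A g z. \<forall>a b.
            \<phi> (\<lambda>x. a * F x + b * G x) = a * \<phi> F + b * \<phi> G) \<and>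
         (\<exists>C. \<forall>F \<in> Lip0 A g z. \<bar>\<phi> F\<bar> \<le> C * Lip_norm A g F) \<and>
         (\<forall>F. F \<notin> Lip0 A g z \<longrightarrow> \<phi> F = 0)}"

definition Lip0_dual_norm ::
    "('m::topological_space, 'n::finite) chart set \<Rightarrow> ('m, 'n) metric_tensor \<Rightarrow> 'm \<Rightarrow>
     (('m \<Rightarrow> real) \<Rightarrow> real) \<Rightarrow> real" where
  "Lip0_dual_norm A g z \<phi> = Sup {\<bar>\<phi> F\<bar> |F. F \<in> Lip0 A g z \<and> Lip_norm A g F \<le> 1}"

definition point_eval ::
    "('m::topological_space, 'n::finite) chart set \<Rightarrow> ('m, 'n) metric_tensor \<Rightarrow> 'm \<Rightarrow>
     'm \<Rightarrow> ('m \<Rightarrow> real) \<Rightarrow> real" where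
  "point_eval A g z x = (\<lambda>F. if F \<in> Lip0 A g z then F x else 0)"

definition point_eval_span ::
    "('m::topological_space, 'n::finite) chart set \<Rightarrow> ('m, 'n) metric_tensor \<Rightarrow> 'm \<Rightarrow>
     (('m \<Rightarrow> real) \<Rightarrow> real) set" where
  "point_eval_span A g z = {\<lambda>F. \<Sum>x\<in>S. a x * point_eval A g z x F |S a. finite S}"

definition free_space ::
    "('m::topological_space, 'n::finite) chart set \<Rightarrow> ('m, 'n) metric_tensor \<Rightarrow> 'm \<Rightarrow>
     (('m \<Rightarrow> real) \<Rightarrow> real) set" where
  "free_space A g z =
     {\<phi> \<in> Lip0_dual A g z.
        \<forall>\<epsilon>>0. \<exists>\<psi> \<in> point_eval_span A g z. Lip0_dual_norm A g z (\<lambda>F. \<phi> F - \<psi> F) < \<epsilon>}"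


section \<open>The differential\<close>

definition has_differential ::
    "('m, 'n::finite) chart set \<Rightarrow> ('m \<Rightarrow> real) \<Rightarrow> 'm \<Rightarrow> ('m, 'n) covec \<Rightarrow> bool" where
  "has_differential A F p \<omega> \<longleftrightarrow>
     \<omega> \<in> cotangent_space A p \<and>
     (\<forall>c\<in>A. p \<in> fst c \<longrightarrow>
        ((F \<circ> chart_inv c) has_derivative (\<lambda>u. \<omega> (coord_vec A c p u))) (at (snd c p)))"

text \<open>
  Lipschitz functions are differentiable almost everywhere, so the value \<open>0\<close> at points of
  non-differentiability does not affect the class of the differential.
\<close>

definition differential ::
    "('m, 'n::finite) chart set \<Rightarrow> ('m \<Rightarrow> real) \<Rightarrow> 'm \<Rightarrow> ('m, 'n) covec" where
  "differential A F p =
     (if \<exists>\<omega>. has_differential A F p \<omega> then THE \<omega>. has_differential A F p \<omega> else (\<lambda>_. 0))"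

definition D_op ::
    "('m::topological_space, 'n::finite) chart set \<Rightarrow> ('m, 'n) metric_tensor \<Rightarrow>
     ('m \<Rightarrow> real) \<Rightarrow> ('m \<Rightarrow> ('m, 'n) covec) set" where
  "D_op A g F = Linf_class A g (differential A F)"


section \<open>Weak* topologies\<close>

text \<open>
  The weak* topology of \<open>E\<close> as the dual of \<open>P\<close> with respect to the duality \<open>b\<close> is the coarsest
  topology on \<open>E\<close> for which \<open>\<lambda>x. b x y\<close> is continuous for every \<open>y \<in> P\<close>.
\<close>

definition weak_star_topology :: "'x set \<Rightarrow> 'y set \<Rightarrow> ('x \<Rightarrow> 'y \<Rightarrow> real) \<Rightarrow> 'x topology" where
  "weak_star_topology E P b =
     topology_generated_by (insert E {{x \<in> E. b x y \<in> U} |y U. y \<in> P \<and> open U})"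

definition weak_star_Lip0 ::
    "('m::topological_space, 'n::finite) chart set \<Rightarrow> ('m, 'n) metric_tensor \<Rightarrow> 'm \<Rightarrow>
     ('m \<Rightarrow> real) topology" where
  "weak_star_Lip0 A g z = weak_star_topology (Lip0 A g z) (free_space A g z) (\<lambda>F \<phi>. \<phi> F)"

definition weak_star_Linf ::
    "('m::topological_space, 'n::finite) chart set \<Rightarrow> ('m, 'n) metric_tensor \<Rightarrow>
     ('m \<Rightarrow> ('m, 'n) covec) set topology" where
  "weak_star_Linf A g =
     weak_star_topology (Linf_space A g) (L1_space A g) (Linf_L1_pairing A g)"

end

theory Submission
  imports Defs
begin

text \<open>
  In a chart the theorem becomes a statement about Lipschitz functions on \<open>\<real>\<^sup>n\<close>, and the proof
  rests on three facts about these.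

  Differentiability. On the line, a Lipschitz function is the integral of its lower right Dini
  derivative, and this derivative agrees with the upper one almost everywhere
  (\<open>lipschitz_right_differentiable_AE\<close>). Fubini's theorem transfers this to directional derivatives, and
  integrating difference quotients over bounded sets shows that the directional derivative is
  additive in the direction, almost everywhere. Rademacher's theorem (\<open>rademacher\<close>) follows, so \<open>dF\<close>
  exists almost everywhere on the manifold.

  Isometry. A short coordinate segment in direction \<open>v\<close> has length close to the norm of \<open>v\<close>, so a
  Lipschitz bound for \<open>F\<close> bounds \<open>dF\<close> (\<open>differential_le_lipschitz\<close>). Conversely, let \<open>dF\<close> have norm
  at most \<open>k\<close> almost everywhere. A given curve may lie inside the exceptional null set, but by
  Fubini's theorem almost all of its small translates in a chart meet this set only for a null set of
  parameters. The increment of \<open>F\<close> along such a translate is at most \<open>k\<close> times its length, and the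
  translates converge to the curve (\<open>lipschitz_increment_along_curve\<close>, \<open>lipschitz_bound_of_conorm\<close>).

  Weak* continuity. It has to be shown that for every integrable vector field \<open>X\<close> the functional
  that maps \<open>F\<close> to the integral of \<open>dF(X)\<close> belongs to the Lipschitz-free space, that is, that it can be
  approximated by finite combinations of point evaluations with an error of at most \<open>\<epsilon>\<close> times the
  Lipschitz constant. Cutting \<open>X\<close> into pieces supported in coordinate boxes and expanding it in
  coordinates leads to functionals \<open>f \<mapsto> \<integral> h \<partial>\<^sub>v f\<close> on \<open>\<real>\<^sup>n\<close> with integrable \<open>h\<close>, and by density to
  indicator functions \<open>h\<close> of bounded sets \<open>E\<close>. There the derivative may be replaced by the difference
  quotient \<open>(f (x + t v) - f x) / t\<close>: its integral over \<open>E\<close> is an average of integrals of \<open>\<partial>\<^sub>v f\<close> over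
  translates of \<open>E\<close> by at most \<open>t v\<close>, and \<open>\<partial>\<^sub>v f\<close> is bounded by the Lipschitz constant
  (\<open>averaged_increment\<close>). The integral of the quotient involves only values of \<open>f\<close>, and its Riemann
  sums are combinations of point evaluations (\<open>riemann_sum\<close>). The error bounds are uniform over all
  functions with a given Lipschitz constant; this is why \<open>lip_approx\<close> and \<open>span_approx\<close> are stated as
  they are.

  To integrate in charts, the Riemannian volume has to be shown to exist, to be unique and to have
  density \<open>\<surd>det G\<close> in each chart. This is the change of variables formula applied to the transition
  maps.
\<close>


section \<open>Comparison along the real line\<close>

text \<open>
  By continuity, the supremum of all \<open>x\<close> with \<open>\<phi> x \<le> \<phi> a\<close> is again such a point; if it were below
  \<open>b\<close>, a step forward from it would contradict maximality.
\<close>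

lemma le_of_forward_steps:
  fixes \<phi> :: "real \<Rightarrow> real"
  assumes "a \<le> b" and cont: "continuous_on {a..b} \<phi>"
    and step: "\<And>x. a \<le> x \<Longrightarrow> x < b \<Longrightarrow> \<exists>y. x < y \<and> y \<le> b \<and> \<phi> y \<le> \<phi> x"
  shows "\<phi> b \<le> \<phi> a"
proof -
  define S where "S = {x \<in> {a..b}. \<phi> x \<le> \<phi> a}"
  have "closed S"
    unfolding S_def using cont by (intro continuous_on_closed_Collect_le) auto
  have "a \<in> S" using assms(1) by (auto simp: S_def)
  have bdd: "bdd_above S" by (auto simp: S_def bdd_above_def)
  have sup: "Sup S \<in> S"
    using closed_contains_Sup[of S] \<open>closed S\<close> \<open>a \<in> S\<close> bdd by auto
  show ?thesis
  proof (cases "Sup S = b")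
    case True
    then show ?thesis using sup by (auto simp: S_def)
  next
    case False
    then obtain y where "Sup S < y" "y \<le> b" "\<phi> y \<le> \<phi> (Sup S)"
      using step[of "Sup S"] sup by (auto simp: S_def)
    then have "y \<in> S" using sup by (auto simp: S_def)
    then have "y \<le> Sup S" using bdd by (rule cSup_upper)
    then show ?thesis using \<open>Sup S < y\<close> by simp
  qed
qed

text \<open>
  Replaces a number \<open>y\<close> by the number of levels \<open>k * \<delta>\<close> below it. Applied pointwise, this writes a
  bounded function, up to \<open>\<delta>\<close>, as a sum of indicators of superlevel sets.
\<close>

lemma layer_count_bounds:
  fixes y \<delta> :: real and N :: nat
  assumes "\<delta> > 0" "0 \<le> y" "y \<le> real N * \<delta>"
  defines "J \<equiv> {k. k < N \<and> real k * \<delta> < y}"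
  shows "y \<le> \<delta> * card J" "\<delta> * card J \<le> y + \<delta>"
proof -
  define m where "m = nat \<lceil>y / \<delta>\<rceil>"
  have y0: "0 \<le> y / \<delta>" using assms by simp
  have m1: "y / \<delta> \<le> m" unfolding m_def by linarith
  have m2: "m < y / \<delta> + 1" unfolding m_def using y0 by linarith
  have "y / \<delta> \<le> real N" using assms(1,3) by (simp add: pos_divide_le_eq)
  then have mN: "m \<le> N" unfolding m_def by (simp add: ceiling_le_iff nat_le_iff)
  have "k < m \<longleftrightarrow> real k * \<delta> < y" for k
  proof -
    have "k < m \<longleftrightarrow> int k < \<lceil>y / \<delta>\<rceil>" unfolding m_def by linarith
    also have "\<dots> \<longleftrightarrow> real k < y / \<delta>" by (simp add: less_ceiling_iff)
    also have "\<dots> \<longleftrightarrow> real k * \<delta> < y" using assms(1) by (simp add: pos_less_divide_eq)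
    finally show ?thesis .
  qed
  then have "J = {..<m}" unfolding J_def set_eq_iff mem_Collect_eq lessThan_iff using mN
    by (meson order_less_le_trans)
  then have "card J = m" by simp
  have "y \<le> m * \<delta>" using m1 by (subst (asm) pos_divide_le_eq[OF assms(1)])
  moreover have "m * \<delta> < y + \<delta>"
  proof -
    have "(real m - 1) * \<delta> < y" using m2 pos_less_divide_eq[OF assms(1), of "real m - 1" y] by linarith
    then show ?thesis by (simp add: left_diff_distrib)
  qed
  ultimately show "y \<le> \<delta> * card J" "\<delta> * card J \<le> y + \<delta>"
    using \<open>card J = m\<close> by (simp_all add: mult.commute)
qed

lemma bounded_borel_set_integrable:
  fixes h :: "real \<Rightarrow> real"
  assumes [measurable]: "h \<in> borel_measurable borel" and bd: "\<And>x. x \<in> {a..b} \<Longrightarrow> \<bar>h x\<bar> \<le> C"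
  shows "set_integrable lborel {a..b} h"
  unfolding set_integrable_def
proof (rule Bochner_Integration.integrable_bound)
  show "integrable lborel (\<lambda>x. indicator {a..b} x *\<^sub>R C)"
    by (cases "a \<le> b") auto
  show "AE x in lborel. norm (indicator {a..b} x *\<^sub>R h x) \<le> norm (indicator {a..b} x *\<^sub>R C)"
    using bd by (intro AE_I2) (force simp: indicator_def)
  show "(\<lambda>x. indicator {a..b} x *\<^sub>R h x) \<in> borel_measurable lborel"
    using assms(1) by simp
qed

lemma bounded_borel_integrable_on:
  fixes h :: "real \<Rightarrow> real"
  assumes "h \<in> borel_measurable borel" "\<And>x. x \<in> {a..b} \<Longrightarrow> \<bar>h x\<bar> \<le> C"
  shows "h integrable_on {a..b}"
  using set_borel_integral_eq_integral(1)[OF bounded_borel_set_integrable[OF assms]] by simp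

text \<open>
  The upper half of the Vitali-Caratheodory theorem for bounded functions. Up to \<open>\<delta>\<close>, \<open>h\<close> is a finite
  sum of indicators of superlevel sets; enlarging these to open sets of almost the same measure makes
  the sum lower semicontinuous and changes its integral only a little.
\<close>

lemma lsc_majorant:
  fixes h :: "real \<Rightarrow> real"
  assumes [measurable]: "h \<in> borel_measurable borel" and bd: "\<And>x. \<bar>h x\<bar> \<le> L" and "a \<le> b" "\<epsilon> > 0"
  obtains u where "u integrable_on {a..b}" "integral {a..b} u \<le> integral {a..b} h + \<epsilon>"
    "\<And>x. x \<in> {a..b} \<Longrightarrow> h x < u x"
    "\<And>x. x \<in> {a..b} \<Longrightarrow> \<exists>d>0. \<forall>y. \<bar>y - x\<bar> < d \<longrightarrow> u x \<le> u y"
proof -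
  have L0: "0 \<le> L" using bd[of 0] by linarith
  define \<delta> where "\<delta> = \<epsilon> / (4 * (b - a + 1))"
  have \<delta>: "\<delta> > 0" unfolding \<delta>_def using assms by simp
  (* Enough levels to reach the largest possible value 2 * L of h + L. *)
  define N where "N = nat \<lceil>2 * L / \<delta>\<rceil>"
  have N: "2 * L \<le> real N * \<delta>"
  proof -
    have "2 * L / \<delta> \<le> real N" unfolding N_def by linarith
    then show ?thesis using \<delta> by (simp add: field_simps)
  qed
  (* Each of the N open sets may exceed its superlevel set by \<eta>, at a total cost of \<delta> * N * \<eta>. *)
  define \<eta> where "\<eta> = \<epsilon> / (2 * (\<delta> * N + 1))"
  have \<eta>: "\<eta> > 0" unfolding \<eta>_def using assms(4) \<delta> by (intro divide_pos_pos mult_pos_pos add_nonneg_pos) auto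
  define E where "E k = {x \<in> {a..b}. real k * \<delta> < h x + L}" for k :: nat
  have E[measurable]: "E k \<in> sets borel" for k unfolding E_def by measurable
  have Efin: "emeasure lborel (E k) < \<infinity>" for k
  proof -
    have "emeasure lborel (E k) \<le> emeasure lborel {a..b}" by (rule emeasure_mono) (auto simp: E_def)
    then show ?thesis using \<open>a \<le> b\<close> by (simp add: order_le_less_trans)
  qed
  have "\<exists>U. open U \<and> E k \<subseteq> U \<and> emeasure lborel (U - E k) < \<eta>" for k
    using outer_regular_lborel[OF E \<eta>] by metis
  then obtain U where U: "\<And>k. open (U k)" "\<And>k. E k \<subseteq> U k" "\<And>k. emeasure lborel (U k - E k) < \<eta>"
    by metis
  have Um[measurable]: "U k \<in> sets borel" for k using U(1) by auto
  (* Subtracting L undoes the shift, and the additional \<delta> makes the majorant strict. *)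
  define u where "u x = \<delta> - L + \<delta> * (\<Sum>k<N. indicator (U k) x)" for x
  define J where "J x = {k. k < N \<and> real k * \<delta> < h x + L}" for x
  have cardJ: "h x + L \<le> \<delta> * card (J x)" "\<delta> * card (J x) \<le> h x + L + \<delta>" for x
    using layer_count_bounds[of \<delta> "h x + L" N] \<delta> bd[of x] N unfolding J_def
    by (auto simp: abs_le_iff)
  have sumE: "(\<Sum>k<N. indicator (E k) x) = real (card (J x))" if "x \<in> {a..b}" for x
  proof -
    have "(\<Sum>k<N. indicator (E k) x) = (\<Sum>k<N. if k \<in> J x then 1 else (0::real))"
      using that by (intro sum.cong) (auto simp: E_def J_def indicator_def)
    also have "\<dots> = real (card (J x))"
    proof -
      have "J x = {..<N} \<inter> J x" by (auto simp: J_def)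
      then show ?thesis by (simp add: sum.If_cases)
    qed
    finally show ?thesis .
  qed
  have hi: "h integrable_on {a..b}"
    by (rule bounded_borel_integrable_on[where C = L]) (use bd in auto)
  have mE: "(indicator (E k) :: real \<Rightarrow> real) integrable_on {a..b}" for k
    by (rule bounded_borel_integrable_on[where C = 1]) (auto simp: indicator_def)
  have mU: "(indicator (U k) :: real \<Rightarrow> real) integrable_on {a..b}" for k
    by (rule bounded_borel_integrable_on[where C = 1]) (auto simp: indicator_def)
  have ui: "u integrable_on {a..b}"
    unfolding u_def by (intro integrable_add integrable_on_mult_right integrable_sum mU integrable_const_ivl) auto
  have UE: "integral {a..b} (indicator (U k)) \<le> integral {a..b} (indicator (E k)) + \<eta>" for k
  proof -
    have mUE: "(indicator (U k - E k) :: real \<Rightarrow> real) integrable_on {a..b}"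
      by (rule bounded_borel_integrable_on[where C = 1]) (auto simp: indicator_def)
    have fin: "emeasure lborel ((U k - E k) \<inter> {a..b}) \<le> ennreal \<eta>"
      using U(3)[of k] emeasure_mono[of "(U k - E k) \<inter> {a..b}" "U k - E k" lborel] by auto
    have "((\<lambda>x. 1::real) has_integral measure lborel ((U k - E k) \<inter> {a..b})) ((U k - E k) \<inter> {a..b})"
      using fin by (intro has_integral_measure_lborel) (auto simp: order_le_less_trans)
    then have "((\<lambda>x. if x \<in> U k - E k then 1 else 0 ::real) has_integral measure lborel ((U k - E k) \<inter> {a..b})) {a..b}"
      unfolding has_integral_restrict_Int by (simp add: Int_commute)
    then have "integral {a..b} (indicator (U k - E k)) = measure lborel ((U k - E k) \<inter> {a..b})"
      unfolding indicator_def of_bool_def by (rule integral_unique)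
    also have "\<dots> \<le> \<eta>"
      using fin \<eta> by (simp add: measure_def enn2real_leI)
    finally have "integral {a..b} (indicator (U k - E k)) \<le> \<eta>" .
    moreover have "integral {a..b} (indicator (U k)) = integral {a..b} (\<lambda>x. indicator (E k) x + indicator (U k - E k) x :: real)"
      using U(2)[of k] by (intro Henstock_Kurzweil_Integration.integral_cong) (auto simp: indicator_def)
    ultimately show ?thesis
      by (simp add: Henstock_Kurzweil_Integration.integral_add[OF mE mUE])
  qed
  show thesis
  proof (rule that[OF ui])
    fix x assume x: "x \<in> {a..b}"
    have "real (card (J x)) = (\<Sum>k<N. indicator (E k) x)" using sumE[OF x] by simp
    also have "\<dots> \<le> (\<Sum>k<N. indicator (U k) x)"
      using U(2) by (intro sum_mono) (auto simp: indicator_def)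
    finally have "\<delta> * card (J x) \<le> \<delta> * (\<Sum>k<N. indicator (U k) x)"
      using \<delta> by simp
    then show "h x < u x" unfolding u_def using cardJ(1)[of x] \<delta> by linarith
  next
    fix x assume x: "x \<in> {a..b}"
    define V where "V = (\<Inter>k\<in>{k. k < N \<and> x \<in> U k}. U k)"
    have "open V" unfolding V_def using U(1) by (intro open_INT) auto
    moreover have "x \<in> V" unfolding V_def by auto
    ultimately obtain d where d: "d > 0" "ball x d \<subseteq> V" using openE by blast
    have "u x \<le> u y" if "\<bar>y - x\<bar> < d" for y
    proof -
      have "y \<in> V" using d that by (auto simp: dist_real_def abs_minus_commute)
      then have "(\<Sum>k<N. indicator (U k) x) \<le> (\<Sum>k<N. indicator (U k) y :: real)"
        by (intro sum_mono) (auto simp: V_def indicator_def)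
      then show ?thesis unfolding u_def using \<delta> by simp
    qed
    then show "\<exists>d>0. \<forall>y. \<bar>y - x\<bar> < d \<longrightarrow> u x \<le> u y" using d by blast
  next
    have "integral {a..b} u = (\<delta> - L) * (b - a) + \<delta> * (\<Sum>k<N. integral {a..b} (indicator (U k)))"
      unfolding u_def using \<open>a \<le> b\<close>
      by (subst Henstock_Kurzweil_Integration.integral_add)
         (auto simp: integral_sum mU intro!: integrable_on_mult_right integrable_sum mU)
    also have "\<dots> \<le> (\<delta> - L) * (b - a) + \<delta> * (\<Sum>k<N. integral {a..b} (indicator (E k)) + \<eta>)"
      using \<delta> UE by (intro add_left_mono mult_left_mono sum_mono) auto
    also have "(\<Sum>k<N. integral {a..b} (indicator (E k)) + \<eta>) = integral {a..b} (\<lambda>x. \<Sum>k<N. indicator (E k) x) + N * \<eta>"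
      by (subst integral_sum) (auto simp: mE sum.distrib)
    also have "\<delta> * (integral {a..b} (\<lambda>x. \<Sum>k<N. indicator (E k) x) + N * \<eta>)
        = integral {a..b} (\<lambda>x. \<delta> * (\<Sum>k<N. indicator (E k) x)) + \<delta> * N * \<eta>"
      by (simp add: algebra_simps)
    also have "integral {a..b} (\<lambda>x. \<delta> * (\<Sum>k<N. indicator (E k) x)) \<le> integral {a..b} (\<lambda>x. h x + (L + \<delta>))"
    proof (rule integral_le)
      show "(\<lambda>x. \<delta> * (\<Sum>k<N. indicator (E k) x)) integrable_on {a..b}"
        by (intro integrable_on_mult_right integrable_sum mE) auto
      show "(\<lambda>x. h x + (L + \<delta>)) integrable_on {a..b}"
        by (intro integrable_add hi integrable_const_ivl)
    qed (use sumE cardJ in \<open>auto simp: algebra_simps\<close>)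
    also have "integral {a..b} (\<lambda>x. h x + (L + \<delta>)) = integral {a..b} h + (L + \<delta>) * (b - a)"
      using \<open>a \<le> b\<close> by (subst Henstock_Kurzweil_Integration.integral_add) (auto intro: hi)
    finally have "integral {a..b} u \<le> integral {a..b} h + 2 * \<delta> * (b - a) + \<delta> * N * \<eta>"
      by (simp add: algebra_simps)
    moreover have "2 * \<delta> * (b - a) \<le> \<epsilon> / 2"
    proof -
      have "b - a + 1 \<noteq> 0" using \<open>a \<le> b\<close> by simp
      then have "\<delta> * (b - a + 1) = \<epsilon> / 4" unfolding \<delta>_def by (simp add: divide_simps)
      then show ?thesis using \<delta> by (simp add: algebra_simps)
    qed
    moreover have "\<delta> * N * \<eta> \<le> \<epsilon> / 2"
    proof -
      have "0 < \<delta> * N + 1" using \<delta> by (intro add_nonneg_pos) auto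
      then have "\<delta> * N + 1 \<noteq> 0" by simp
      moreover have "p \<noteq> 0 \<Longrightarrow> \<epsilon> / (2 * p) * p = \<epsilon> / 2" for p :: real by simp
      ultimately have "\<eta> * (\<delta> * N + 1) = \<epsilon> / 2" unfolding \<eta>_def by blast
      then show ?thesis using \<eta> by (simp add: algebra_simps)
    qed
    ultimately show "integral {a..b} u \<le> integral {a..b} h + \<epsilon>" by linarith
  qed
qed

section \<open>Dini derivatives\<close>

definition dini_approx :: "('a::real_normed_vector \<Rightarrow> real) \<Rightarrow> 'a \<Rightarrow> 'a \<Rightarrow> nat \<Rightarrow> real" where
  "dini_approx f v x n = (INF q\<in>{q \<in> \<rat>. 0 < q \<and> q < 1 / real (Suc n)}. (f (x + q *\<^sub>R v) - f x) / q)"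

text \<open>
  The lower right Dini derivative in direction \<open>v\<close>. Steps are restricted to rational numbers, so that
  only countably many infima and suprema occur and measurability in \<open>x\<close> is immediate; the difference
  quotient is continuous in the step, so no limit is lost (see \<open>right_derivative_of_dini\<close>).
\<close>

definition dini :: "('a::real_normed_vector \<Rightarrow> real) \<Rightarrow> 'a \<Rightarrow> 'a \<Rightarrow> real" where
  "dini f v x = (SUP n. dini_approx f v x n)"

lemma quotient_bound:
  fixes f :: "'a::real_normed_vector \<Rightarrow> real"
  assumes "L-lipschitz_on UNIV f" "q > 0"
  shows "\<bar>(f (x + q *\<^sub>R v) - f x) / q\<bar> \<le> L * norm v"
proof -
  have "\<bar>f (x + q *\<^sub>R v) - f x\<bar> \<le> L * norm (q *\<^sub>R v)"
    using lipschitz_onD[OF assms(1), of "x + q *\<^sub>R v" x] by (simp add: dist_norm)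
  also have "\<dots> = (L * norm v) * q" using assms(2) by simp
  finally have "\<bar>f (x + q *\<^sub>R v) - f x\<bar> / q \<le> L * norm v"
    unfolding pos_divide_le_eq[OF assms(2)] .
  then show ?thesis using assms(2) unfolding abs_divide by simp
qed

lemma rat_between: "\<exists>q. q \<in> \<rat> \<and> 0 < q \<and> q < 1 / real (Suc n)"
  using Rats_dense_in_real[of 0 "1 / real (Suc n)"] by auto

lemma dini_inner_bounds:
  fixes f :: "'a::real_normed_vector \<Rightarrow> real"
  assumes "L-lipschitz_on UNIV f"
  shows "\<And>n q. q \<in> \<rat> \<Longrightarrow> 0 < q \<Longrightarrow> q < 1 / real (Suc n) \<Longrightarrow> dini_approx f v x n \<le> (f (x + q *\<^sub>R v) - f x) / q"
    and "\<And>n. \<bar>dini_approx f v x n\<bar> \<le> L * norm v" and "incseq (dini_approx f v x)" and "\<And>n. dini_approx f v x n \<le> dini f v x" and "dini_approx f v x \<longlonglongrightarrow> dini f v x"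
proof -
  define m where "m = dini_approx f v x"
  have bdd: "bdd_below ((\<lambda>q. (f (x + q *\<^sub>R v) - f x) / q) ` {q \<in> \<rat>. 0 < q \<and> q < 1 / real (Suc n)})" for n
  proof (rule bdd_belowI2)
    fix q assume "q \<in> {q \<in> \<rat>. 0 < q \<and> q < 1 / real (Suc n)}"
    then have "q > 0" by simp
    then show "- (L * norm v) \<le> (f (x + q *\<^sub>R v) - f x) / q"
      using quotient_bound[OF assms(1), of q x v] by linarith
  qed
  have le: "m n \<le> (f (x + q *\<^sub>R v) - f x) / q" if "q \<in> \<rat>" "0 < q" "q < 1 / real (Suc n)" for n q
    unfolding m_def dini_approx_def by (rule cINF_lower[OF bdd]) (use that in auto)
  have ge: "c \<le> m n" if "\<And>q. q \<in> \<rat> \<Longrightarrow> 0 < q \<Longrightarrow> q < 1 / real (Suc n) \<Longrightarrow> c \<le> (f (x + q *\<^sub>R v) - f x) / q" for c n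
    unfolding m_def dini_approx_def by (rule cINF_greatest) (use that rat_between[of n] in auto)
  have abs: "\<bar>m n\<bar> \<le> L * norm v" for n
  proof -
    obtain q where q: "q \<in> \<rat>" "0 < q" "q < 1 / real (Suc n)" using rat_between by blast
    have "m n \<le> L * norm v" using le[OF q] quotient_bound[OF assms(1) q(2), of x v] by linarith
    moreover have "- (L * norm v) \<le> m n"
    proof (rule ge)
      fix q :: real assume "q > 0"
      then show "- (L * norm v) \<le> (f (x + q *\<^sub>R v) - f x) / q"
        using quotient_bound[OF assms(1), of q x v] by linarith
    qed
    ultimately show ?thesis by linarith
  qed
  have "incseq m"
  proof (rule incseq_SucI)
    fix n show "m n \<le> m (Suc n)"
    proof (rule ge)
      fix q assume q: "q \<in> \<rat>" "0 < q" "q < 1 / real (Suc (Suc n))"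
      have "1 / real (Suc (Suc n)) \<le> 1 / real (Suc n)" by (intro divide_left_mono) auto
      then show "m n \<le> (f (x + q *\<^sub>R v) - f x) / q" using q by (intro le) auto
    qed
  qed
  have bu: "bdd_above (range m)" using abs by (auto simp: bdd_above_def abs_le_iff)
  have d: "dini f v x = (SUP n. m n)" unfolding dini_def m_def ..
  have up: "m n \<le> dini f v x" for n unfolding d by (rule cSUP_upper[OF _ bu]) auto
  have lim: "m \<longlonglongrightarrow> dini f v x" unfolding d by (rule LIMSEQ_incseq_SUP[OF bu \<open>incseq m\<close>])
  note m_def[simp]
  show "\<And>n q. q \<in> \<rat> \<Longrightarrow> 0 < q \<Longrightarrow> q < 1 / real (Suc n) \<Longrightarrow> dini_approx f v x n \<le> (f (x + q *\<^sub>R v) - f x) / q"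
    using le by simp
  show "\<And>n. \<bar>dini_approx f v x n\<bar> \<le> L * norm v" "incseq (dini_approx f v x)" "\<And>n. dini_approx f v x n \<le> dini f v x" "dini_approx f v x \<longlonglongrightarrow> dini f v x"
    using abs \<open>incseq m\<close> up lim by simp_all
qed

lemma abs_dini_le:
  assumes "L-lipschitz_on UNIV f"
  shows "\<bar>dini f v x\<bar> \<le> L * norm v"
proof (rule LIMSEQ_le_const2)
  show "(\<lambda>n. \<bar>dini_approx f v x n\<bar>)
      \<longlonglongrightarrow> \<bar>dini f v x\<bar>"
    using tendsto_rabs[OF dini_inner_bounds(5)[OF assms]] .
qed (use dini_inner_bounds(2)[OF assms] in auto)

lemma lipschitz_on_uminus_real:
  fixes f :: "'a::metric_space \<Rightarrow> real"
  shows "L-lipschitz_on S f \<Longrightarrow> L-lipschitz_on S (\<lambda>x. - f x)"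
  by (auto simp: lipschitz_on_def dist_real_def abs_minus_commute)

text \<open>
  The right-hand side is the upper right Dini derivative of \<open>f\<close>.
\<close>

lemma dini_le_uminus:
  assumes "L-lipschitz_on UNIV f"
  shows "dini f v x \<le> - dini (\<lambda>x. - f x) v x"
proof -
  let ?m = "\<lambda>f. dini_approx f v x"
  note l = dini_inner_bounds[OF assms, where x=x and v=v]
  note l' = dini_inner_bounds[OF lipschitz_on_uminus_real[OF assms], where x=x and v=v]
  have "?m f n \<le> - ?m (\<lambda>x. - f x) n" for n
  proof -
    obtain q where q: "q \<in> \<rat>" "0 < q" "q < 1 / real (Suc n)" using rat_between by blast
    show ?thesis using l(1)[OF q] l'(1)[OF q] q(2) by (simp add: diff_divide_distrib)
  qed
  then show ?thesis
    using LIMSEQ_le[OF l(5) tendsto_minus[OF l'(5)]] by blast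
qed

lemma dini_eq_limit:
  assumes lip: "L-lipschitz_on UNIV f"
    and lim: "((\<lambda>t. (f (x + t *\<^sub>R v) - f x) / t) \<longlongrightarrow> D) (at_right 0)"
  shows "dini f v x = D"
proof -
  note l = dini_inner_bounds[OF lip, where x=x and v=v]
  show ?thesis
  proof (rule LIMSEQ_unique[OF l(5)], rule LIMSEQ_I)
    fix r :: real assume r: "r > 0"
    then have "\<forall>\<^sub>F t in at_right 0. dist ((f (x + t *\<^sub>R v) - f x) / t) D < r / 2"
      using lim by (intro tendstoD) auto
    then obtain d where d: "d > 0" "\<And>t. 0 < t \<Longrightarrow> t < d \<Longrightarrow> \<bar>(f (x + t *\<^sub>R v) - f x) / t - D\<bar> < r / 2"
      unfolding eventually_at_right_field dist_real_def by auto
    obtain k where k: "1 / real (Suc k) < d" using \<open>d > 0\<close> nat_approx_posE by blast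
    have "norm (dini_approx f v x n - D) < r"
      (is "norm (?m - D) < r") if "k \<le> n" for n
    proof -
      have kn: "1 / real (Suc n) \<le> 1 / real (Suc k)" using that by (intro divide_left_mono) auto
      have "D - r / 2 \<le> ?m"
        unfolding dini_approx_def
      proof (rule cINF_greatest)
        fix q assume "q \<in> {q \<in> \<rat>. 0 < q \<and> q < 1 / real (Suc n)}"
        then have "0 < q" "q < d" using k kn by auto
        then show "D - r / 2 \<le> (f (x + q *\<^sub>R v) - f x) / q"
          using d(2)[of q] by linarith
      qed (use rat_between[of n] in auto)
      moreover have "?m < D + r / 2"
      proof -
        obtain q where q: "q \<in> \<rat>" "0 < q" "q < 1 / real (Suc n)" using rat_between by blast
        have "0 < q" "q < d" using q k kn by auto
        then show ?thesis using l(1)[OF q] d(2)[of q] by linarith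
      qed
      ultimately show ?thesis using r unfolding real_norm_def by linarith
    qed
    then show "\<exists>no. \<forall>n\<ge>no. norm (dini_approx f v x n - D) < r"
      by blast
  qed
qed

lemma lipschitz_quotient_continuous:
  fixes f :: "'a::real_normed_vector \<Rightarrow> real"
  assumes "L-lipschitz_on UNIV f"
  shows "continuous_on {0<..} (\<lambda>t. (f (x + t *\<^sub>R v) - f x) / t)"
proof -
  have "continuous_on UNIV f" using assms by (rule lipschitz_on_continuous_on)
  then have "continuous_on {0<..} (\<lambda>t. f (x + t *\<^sub>R v))"
    by (rule continuous_on_compose2) (auto intro!: continuous_intros)
  then show ?thesis
    by (intro continuous_on_divide continuous_on_diff continuous_on_const continuous_on_id) auto
qed

text \<open>
  The difference quotient has equal lower and upper limits along rational steps. As it depends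
  continuously on the step, it cannot leave a closed interval that contains its values at all small
  rational steps.
\<close>

lemma right_derivative_of_dini:
  fixes f :: "'a::real_normed_vector \<Rightarrow> real"
  assumes lip: "L-lipschitz_on UNIV f" and eq: "dini f v x = - dini (\<lambda>x. - f x) v x"
  shows "((\<lambda>t. (f (x + t *\<^sub>R v) - f x) / t) \<longlongrightarrow> dini f v x) (at_right 0)"
proof (rule tendstoI)
  fix r :: real assume r: "r > 0"
  let ?Q = "\<lambda>t. (f (x + t *\<^sub>R v) - f x) / t"
  let ?m = "\<lambda>f. dini_approx f v x"
  note l = dini_inner_bounds[OF lip, where x=x and v=v]
  note l' = dini_inner_bounds[OF lipschitz_on_uminus_real[OF lip], where x=x and v=v]
  have "\<forall>\<^sub>F n in sequentially. dist (?m f n) (dini f v x) < r / 2"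
    "\<forall>\<^sub>F n in sequentially. dist (?m (\<lambda>x. - f x) n) (dini (\<lambda>x. - f x) v x) < r / 2"
    by (rule tendstoD[OF l(5)], use r in simp) (rule tendstoD[OF l'(5)], use r in simp)
  then have "\<forall>\<^sub>F n in sequentially. dini f v x - r / 2 < ?m f n \<and> - ?m (\<lambda>x. - f x) n < dini f v x + r / 2"
    by eventually_elim (unfold dist_real_def eq, linarith)
  from eventually_happens'[OF sequentially_bot this]
  obtain n where n: "dini f v x - r / 2 < ?m f n" "- ?m (\<lambda>x. - f x) n < dini f v x + r / 2"
    by blast
  have rat: "?Q q \<in> {dini f v x - r / 2 .. dini f v x + r / 2}" if q: "q \<in> \<rat>" "0 < q" "q < 1 / real (Suc n)" for q
  proof -
    have "(- f (x + q *\<^sub>R v) - - f x) / q = - ?Q q" by (simp add: diff_divide_distrib)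
    then show ?thesis using l(1)[OF q] l'(1)[OF q] n unfolding atLeastAtMost_iff by linarith
  qed
  have "?Q t \<in> {dini f v x - r / 2 .. dini f v x + r / 2}" if t: "t \<in> {0<..<1 / real (Suc n)}" for t
  proof (rule ccontr)
    let ?I = "{dini f v x - r / 2 .. dini f v x + r / 2}" and ?S = "{0<..<1 / real (Suc n)}"
    assume "?Q t \<notin> ?I"
    then have t': "t \<in> ?S \<inter> ?Q -` (- ?I)" using t by blast
    have "continuous_on ?S ?Q"
      by (rule continuous_on_subset[OF lipschitz_quotient_continuous[OF lip]]) (simp add: greaterThanLessThan_def)
    then have "open (?S \<inter> ?Q -` (- ?I))"
      by (rule continuous_open_preimage[OF _ open_greaterThanLessThan open_Compl[OF closed_atLeastAtMost]])
    then obtain e where e: "e > 0" "ball t e \<subseteq> ?S \<inter> ?Q -` (- ?I)" using t' openE by blast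
    obtain q where q: "q \<in> \<rat>" "t < q" "q < t + e" using Rats_dense_in_real[of t "t + e"] e(1) less_add_same_cancel1 by blast
    then have "q \<in> ball t e" by (simp add: dist_real_def)
    then have "q \<in> ?S" "?Q q \<notin> ?I" using e(2) by blast+
    then show False using rat[OF q(1)] unfolding greaterThanLessThan_iff by blast
  qed
  then have "dist (?Q t) (dini f v x) < r" if "0 < t" "t < 1 / real (Suc n)" for t
  proof -
    have "t \<in> {0<..<1 / real (Suc n)}" using that by simp
    from \<open>\<And>t. t \<in> {0<..<1 / real (Suc n)} \<Longrightarrow> ?Q t \<in> {dini f v x - r / 2 .. dini f v x + r / 2}\<close>[OF this]
    show ?thesis using r unfolding dist_real_def atLeastAtMost_iff by linarith
  qed
  moreover have "0 < 1 / real (Suc n)" by simp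
  ultimately show "\<forall>\<^sub>F t in at_right 0. dist (?Q t) (dini f v x) < r"
    unfolding eventually_at_right_field by blast
qed

lemma borel_measurable_dini [measurable]:
  fixes f :: "'a::euclidean_space \<Rightarrow> real"
  assumes lip: "L-lipschitz_on UNIV f"
  shows "dini f v \<in> borel_measurable borel"
proof -
  have "continuous_on UNIV f" using lip by (rule lipschitz_on_continuous_on)
  then have [measurable]: "f \<in> borel_measurable borel" by (rule borel_measurable_continuous_onI)
  have cnt: "countable {q \<in> \<rat>. 0 < q \<and> q < 1 / real (Suc n)}" for n
    by (rule countable_subset[OF _ countable_rat]) auto
  have "(\<lambda>x. dini_approx f v x n) \<in> borel_measurable borel" for n
    unfolding dini_approx_def by (rule borel_measurable_cINF_real[OF cnt]) simp
  then show ?thesis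
    unfolding dini_def using dini_inner_bounds(2)[OF lip, where v = v]
    by (intro borel_measurable_cSUP) (auto simp: bdd_above_def abs_le_iff)
qed

text \<open>
  Let \<open>u\<close> be a lower semicontinuous majorant of the Dini derivative. From every \<open>x\<close> there is a step
  along which \<open>f\<close> has slope below \<open>u x\<close>, hence grows by at most the integral of \<open>u\<close>; by
  \<open>le_of_forward_steps\<close> these steps lead all the way to \<open>b\<close>.
\<close>

lemma lipschitz_increment_le_integral_dini:
  fixes f :: "real \<Rightarrow> real"
  assumes lip: "L-lipschitz_on UNIV f" and ab: "a \<le> b"
  shows "f b - f a \<le> integral {a..b} (dini f 1)"
proof (rule field_le_epsilon)
  fix \<epsilon> :: real assume "\<epsilon> > 0"
  have bd: "\<bar>dini f 1 x\<bar> \<le> L" for x using abs_dini_le[OF lip, of 1 x] by simp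
  obtain u where u: "u integrable_on {a..b}" "integral {a..b} u \<le> integral {a..b} (dini f 1) + \<epsilon>"
    and gt: "\<And>x. x \<in> {a..b} \<Longrightarrow> dini f 1 x < u x"
    and lsc: "\<And>x. x \<in> {a..b} \<Longrightarrow> \<exists>d>0. \<forall>y. \<bar>y - x\<bar> < d \<longrightarrow> u x \<le> u y"
    using lsc_majorant[OF borel_measurable_dini[OF lip] bd ab \<open>\<epsilon> > 0\<close>] by blast
  have "f b - integral {a..b} u \<le> f a - integral {a..a} u"
  proof (rule le_of_forward_steps[OF ab])
    show "continuous_on {a..b} (\<lambda>x. f x - integral {a..x} u)"
      by (intro continuous_on_diff indefinite_integral_continuous_1 u)
         (rule lipschitz_on_continuous_on[OF lipschitz_on_subset[OF lip subset_UNIV]])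
  next
    fix x assume x: "a \<le> x" "x < b"
    obtain d where d: "d > 0" "\<And>y. \<bar>y - x\<bar> < d \<Longrightarrow> u x \<le> u y" using lsc[of x] x by auto
    obtain n where n: "1 / real (Suc n) < min d (b - x)"
      using nat_approx_posE[of "min d (b - x)"] d x by auto
    have ne: "{q \<in> \<rat>. 0 < q \<and> q < 1 / real (Suc n)} \<noteq> {}" using rat_between[of n] by auto
    have "dini_approx f 1 x n < u x"
      using dini_inner_bounds(4)[OF lip, of 1 x n] gt[of x] x by simp
    then obtain y where "y \<in> (\<lambda>q. (f (x + q *\<^sub>R 1) - f x) / q) ` {q \<in> \<rat>. 0 < q \<and> q < 1 / real (Suc n)}" "y < u x"
      unfolding dini_approx_def using ne cInf_lessD[of "(\<lambda>q. (f (x + q *\<^sub>R 1) - f x) / q) ` {q \<in> \<rat>. 0 < q \<and> q < 1 / real (Suc n)}" "u x"]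
      by blast
    then obtain q where q: "0 < q" "q < 1 / real (Suc n)" "(f (x + q) - f x) / q < u x" by auto
    have sub: "{x..x + q} \<subseteq> {a..b}" using x q n by auto
    have ui: "u integrable_on {x..x + q}" by (rule integrable_on_subinterval[OF u(1) sub])
    have "f (x + q) - f x \<le> u x * q" using q by (simp add: pos_divide_less_eq)
    also have "u x * q = integral {x..x + q} (\<lambda>_. u x)" using q by simp
    also have "\<dots> \<le> integral {x..x + q} u"
      by (rule integral_le) (use d(2) q n ui in auto)
    also have "\<dots> = integral {a..x + q} u - integral {a..x} u"
      using Henstock_Kurzweil_Integration.integral_combine[of a x "x + q" u] x q sub
        integrable_on_subinterval[OF u(1), of a "x + q"] by auto
    finally show "\<exists>y. x < y \<and> y \<le> b \<and> f y - integral {a..y} u \<le> f x - integral {a..x} u"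
      using q sub by (intro exI[of _ "x + q"]) auto
  qed
  then show "f b - f a \<le> integral {a..b} (dini f 1) + \<epsilon>" using u(2) by simp
qed

text \<open>
  Apply the preceding bound to \<open>f\<close> and to \<open>- f\<close>. The increment of \<open>f\<close> then lies between the integrals of
  the upper and of the lower Dini derivative, in the order opposite to the pointwise one, so that all
  of these are equal and the two derivatives coincide almost everywhere.
\<close>

theorem lipschitz_right_differentiable_AE:
  fixes f :: "real \<Rightarrow> real"
  assumes lip: "L-lipschitz_on UNIV f"
  shows "AE x in lborel. dini f 1 x = - dini (\<lambda>x. - f x) 1 x"
    and "a \<le> b \<Longrightarrow> integral {a..b} (dini f 1) = f b - f a"
proof -
  note lip' = lipschitz_on_uminus_real[OF lip]
  (* The gap between the upper and the lower derivative. *)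
  define k where "k x = - dini (\<lambda>x. - f x) 1 x - dini f 1 x" for x
  have bd: "\<bar>dini f 1 x\<bar> \<le> L" "\<bar>dini (\<lambda>x. - f x) 1 x\<bar> \<le> L" for x
    using abs_dini_le[OF lip, of 1 x] abs_dini_le[OF lip', of 1 x] by auto
  have k0: "0 \<le> k x" for x unfolding k_def using dini_le_uminus[OF lip, of 1 x] by simp
  note [measurable] = borel_measurable_dini[OF lip, of 1] borel_measurable_dini[OF lip', of 1]
  have km[measurable]: "k \<in> borel_measurable borel" unfolding k_def by measurable
  have i1: "dini f 1 integrable_on {a..b}" "(dini (\<lambda>x. - f x) 1) integrable_on {a..b}" for a b
    by (rule bounded_borel_integrable_on[where C = L]; simp add: bd)+
  have ik: "integral {a..b} k = - integral {a..b} (dini (\<lambda>x. - f x) 1) - integral {a..b} (dini f 1)" for a b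
    unfolding k_def using Henstock_Kurzweil_Integration.integral_diff[OF integrable_neg[OF i1(2)] i1(1)] by simp
  have ki: "k integrable_on {a..b}" for a b
    unfolding k_def by (intro integrable_diff integrable_neg i1)
  have k00: "integral {a..b} k = 0" if "a \<le> b" for a b
    using integral_nonneg[OF ki, of a b] k0 ik[of a b]
      lipschitz_increment_le_integral_dini[OF lip that] lipschitz_increment_le_integral_dini[OF lip' that] by simp
  show "integral {a..b} (dini f 1) = f b - f a" if "a \<le> b"
    using k00[OF that] ik[of a b]
      lipschitz_increment_le_integral_dini[OF lip that] lipschitz_increment_le_integral_dini[OF lip' that] by simp
  have "AE x in lborel. x \<in> {- real n..real n} \<longrightarrow> k x = 0" for n
  proof -
    have kb: "\<bar>k x\<bar> \<le> 2 * L" for x using bd[of x] unfolding k_def by linarith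
    have s: "set_integrable lborel {- real n..real n} k"
      by (rule bounded_borel_set_integrable[where C = "2 * L"]) (auto simp: kb)
    then have "(\<integral>x. indicator {- real n..real n} x *\<^sub>R k x \<partial>lborel) = 0"
      using set_borel_integral_eq_integral(2)[OF s] k00[of "- real n" "real n"]
      unfolding set_lebesgue_integral_def by simp
    moreover have "AE x in lborel. 0 \<le> indicator {- real n..real n} x *\<^sub>R k x"
      using k0 by (auto simp: indicator_def)
    ultimately have "AE x in lborel. indicator {- real n..real n} x *\<^sub>R k x = 0"
      using integral_nonneg_eq_0_iff_AE[OF s[unfolded set_integrable_def]] by blast
    then show ?thesis by eventually_elim (auto simp: indicator_def)
  qed
  then have "AE x in lborel. \<forall>n. x \<in> {- real n..real n} \<longrightarrow> k x = 0"
    unfolding AE_all_countable by blast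
  then have "AE x in lborel. k x = 0"
  proof eventually_elim
    case (elim x)
    obtain n where "\<bar>x\<bar> \<le> real n" using real_arch_simple by blast
    then have "x \<in> {- real n..real n}" by auto
    then show ?case using elim by blast
  qed
  then show "AE x in lborel. dini f 1 x = - dini (\<lambda>x. - f x) 1 x"
    by eventually_elim (simp add: k_def)
qed

section \<open>Null sets and translations\<close>

lemma AE_lborel_translate:
  fixes c :: "'a::euclidean_space"
  assumes [measurable]: "N \<in> sets borel" and ae: "AE x in lborel. x \<notin> N"
  shows "AE x in lborel. c + x \<notin> N"
proof -
  have "AE x in distr lborel borel ((+) c). x \<notin> N" unfolding lborel_distr_plus by (rule ae)
  then show ?thesis by (subst (asm) AE_distr_iff) auto
qed

text \<open>
  For each fixed \<open>s\<close> the set of bad \<open>y\<close> is a translate of \<open>N\<close>; Fubini's theorem exchanges the two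
  quantifiers.
\<close>

lemma AE_curve_translates:
  fixes \<eta> :: "real \<Rightarrow> 'a::euclidean_space"
  assumes [measurable]: "N \<in> sets borel" "\<eta> \<in> borel_measurable borel" and ae: "AE x in lborel. x \<notin> N"
  shows "AE y in lborel. AE s in lborel. \<eta> s + y \<notin> N"
proof -
  have "AE s in lborel. AE y in lborel. \<eta> s + y \<notin> N"
    using AE_lborel_translate[OF assms(1) ae] by simp
  moreover have "{x \<in> space (lborel \<Otimes>\<^sub>M lborel). \<eta> (fst x) + snd x \<notin> N} \<in> sets (lborel \<Otimes>\<^sub>M lborel)"
    by measurable
  ultimately show ?thesis
    using lborel_pair.AE_commute[of "\<lambda>s y. \<eta> s + y \<notin> N"] by blast
qed

text \<open>
  By Fubini's theorem some translate of \<open>N\<close> in direction \<open>v\<close> is a null set, hence so is \<open>N\<close>.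
\<close>

lemma AE_of_lines:
  fixes v :: "'a::euclidean_space"
  assumes [measurable]: "N \<in> sets borel" and ae: "\<And>x. AE s in lborel. x + s *\<^sub>R v \<notin> N"
  shows "AE x in lborel. x \<notin> N"
proof -
  have "AE x in lborel. AE s in lborel. x + s *\<^sub>R v \<notin> N" using ae by simp
  moreover have "{y \<in> space (lborel \<Otimes>\<^sub>M lborel). fst y + snd y *\<^sub>R v \<notin> N} \<in> sets (lborel \<Otimes>\<^sub>M lborel)"
    by measurable
  ultimately have "AE s in lborel. AE x in lborel. x + s *\<^sub>R v \<notin> N"
    using lborel_pair.AE_commute[of "\<lambda>x s. x + s *\<^sub>R v \<notin> N"] by blast
  moreover have "ae_filter (lborel :: real measure) \<noteq> bot"
    by (simp add: ae_filter_eq_bot_iff)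
  ultimately obtain s where "AE x in lborel. x + s *\<^sub>R v \<notin> N"
    using eventually_happens' by blast
  then have "AE x in lborel. x \<notin> {x. s *\<^sub>R v + x \<in> N}" by (simp add: add.commute)
  from AE_lborel_translate[OF _ this, of "- (s *\<^sub>R v)"] show ?thesis by simp
qed

lemma dini_line: "dini (\<lambda>s. f (x + s *\<^sub>R v)) 1 s = dini f v (x + s *\<^sub>R v)"
  unfolding dini_def dini_approx_def by (simp add: scaleR_add_left add.assoc)

lemma lipschitz_on_line:
  fixes f :: "'a::real_normed_vector \<Rightarrow> real"
  assumes "L-lipschitz_on UNIV f"
  shows "(L * norm v)-lipschitz_on UNIV (\<lambda>s. f (x + s *\<^sub>R v))"
proof (rule lipschitz_onI)
  fix s t :: real
  have "dist (f (x + s *\<^sub>R v)) (f (x + t *\<^sub>R v)) \<le> L * dist (x + s *\<^sub>R v) (x + t *\<^sub>R v)"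
    by (rule lipschitz_onD[OF assms]) auto
  also have "dist (x + s *\<^sub>R v) (x + t *\<^sub>R v) = norm v * dist s t"
    by (simp add: dist_norm scaleR_diff_left[symmetric])
  finally show "dist (f (x + s *\<^sub>R v)) (f (x + t *\<^sub>R v)) \<le> L * norm v * dist s t" by (simp add: mult.assoc)
qed (use lipschitz_on_nonneg[OF assms] in auto)

lemma lipschitz_directional_AE:
  fixes f :: "'a::euclidean_space \<Rightarrow> real"
  assumes lip: "L-lipschitz_on UNIV f"
  shows "AE x in lborel. dini f v x = - dini (\<lambda>x. - f x) v x"
proof -
  note [measurable] = borel_measurable_dini[OF lip, of v] borel_measurable_dini[OF lipschitz_on_uminus_real[OF lip], of v]
  define N where "N = {x. dini f v x \<noteq> - dini (\<lambda>x. - f x) v x}"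
  have "N \<in> sets borel" unfolding N_def by measurable
  moreover have "AE s in lborel. x + s *\<^sub>R v \<notin> N" for x
    using lipschitz_right_differentiable_AE(1)[OF lipschitz_on_line[OF lip, of v x]]
    unfolding dini_line dini_line[where f = "\<lambda>x. - f x"] N_def by simp
  ultimately have "AE x in lborel. x \<notin> N" by (rule AE_of_lines)
  then show ?thesis unfolding N_def by simp
qed

text \<open>
  Choose a compact \<open>K\<close> inside \<open>E\<close> and an open \<open>U\<close> around \<open>E\<close> of almost the same measure. Translates of
  \<open>K\<close> by short vectors stay in \<open>U\<close>, so \<open>E + v\<close> can leave \<open>E\<close> only within \<open>U - E\<close> or within the translate
  of \<open>E - K\<close>.
\<close>

lemma translate_difference_small:
  fixes E :: "'a::euclidean_space set"
  assumes [measurable]: "E \<in> sets borel" and "bounded E" and "\<epsilon> > 0"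
  shows "\<exists>\<delta>>0. \<forall>v. norm v < \<delta> \<longrightarrow> emeasure lborel {x. x - v \<in> E \<and> x \<notin> E} \<le> ennreal \<epsilon>"
proof -
  obtain K where K: "closed K" "K \<subseteq> E" "emeasure lebesgue (E - K) < ennreal (\<epsilon>/2)"
    using sets_lebesgue_inner_closed[of E "\<epsilon>/2", OF sets_completionI_sets] \<open>\<epsilon> > 0\<close> assms(1)
    by (metis half_gt_zero sets_lborel)
  have Km[measurable]: "K \<in> sets borel" using K by auto
  have K2: "emeasure lborel (E - K) \<le> ennreal (\<epsilon>/2)" using K(3) by (simp add: less_imp_le)
  obtain U where U: "open U" "E \<subseteq> U" "emeasure lborel (U - E) < ennreal (\<epsilon>/2)"
    using outer_regular_lborel[OF assms(1), of "\<epsilon>/2"] \<open>\<epsilon> > 0\<close> half_gt_zero by metis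
  have Um[measurable]: "U \<in> sets borel" using U by auto
  have "compact K" using K \<open>bounded E\<close> by (auto simp: compact_eq_bounded_closed intro: bounded_subset)
  then obtain \<delta> where \<delta>: "\<delta> > 0" "(\<Union>x\<in>K. ball x \<delta>) \<subseteq> U"
    using compact_subset_open_imp_ball_epsilon_subset[of K U] U K by blast
  have "emeasure lborel {x. x - v \<in> E \<and> x \<notin> E} \<le> ennreal \<epsilon>" if v: "norm v < \<delta>" for v
  proof -
    have "{x. x - v \<in> E \<and> x \<notin> E} \<subseteq> (U - E) \<union> {x. - v + x \<in> E - K}"
    proof
      fix x assume x: "x \<in> {x. x - v \<in> E \<and> x \<notin> E}"
      show "x \<in> (U - E) \<union> {x. - v + x \<in> E - K}"
      proof (cases "x - v \<in> K")
        case True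
        have "x \<in> ball (x - v) \<delta>" using v by (simp add: dist_norm)
        then show ?thesis using True \<delta>(2) x by blast
      qed (use x in auto)
    qed
    moreover have m: "{x. - v + x \<in> E - K} \<in> sets borel" by measurable
    ultimately have "emeasure lborel {x. x - v \<in> E \<and> x \<notin> E} \<le> emeasure lborel ((U - E) \<union> {x. - v + x \<in> E - K})"
      by (intro emeasure_mono) auto
    also have "\<dots> \<le> emeasure lborel (U - E) + emeasure lborel {x. - v + x \<in> E - K}"
      by (rule emeasure_subadditive) (use m in auto)
    also have "emeasure lborel {x. - v + x \<in> E - K} = emeasure (distr lborel borel ((+) (- v))) (E - K)"
      by (subst emeasure_distr) (auto simp: vimage_def)
    also have "\<dots> = emeasure lborel (E - K)" unfolding lborel_distr_plus ..
    also have "emeasure lborel (U - E) + emeasure lborel (E - K) \<le> ennreal (\<epsilon>/2) + ennreal (\<epsilon>/2)"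
      using U(3) K2 by (intro add_mono) auto
    also have "\<dots> = ennreal \<epsilon>" using \<open>\<epsilon> > 0\<close> by (simp add: ennreal_plus[symmetric] del: ennreal_plus)
    finally show ?thesis .
  qed
  then show ?thesis using \<delta> by blast
qed

lemma integrable_bounded_on_bounded:
  fixes k :: "'a::euclidean_space \<Rightarrow> real"
  assumes E: "E \<in> sets borel" "bounded E" and k: "k \<in> borel_measurable borel" "\<And>x. x \<in> E \<Longrightarrow> \<bar>k x\<bar> \<le> C"
  shows "integrable lborel (\<lambda>x. indicator E x * k x)"
proof (rule Bochner_Integration.integrable_bound)
  show "integrable lborel (\<lambda>x. indicator E x * C :: real)"
    using E emeasure_bounded_finite[OF E(2)] by (intro integrable_mult_left) (auto intro!: integrable_real_indicator)
  show "(\<lambda>x. indicator E x * k x) \<in> borel_measurable lborel" using E k by simp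
  show "AE x in lborel. norm (indicator E x * k x) \<le> norm (indicator E x * C :: real)"
    using order_trans[OF k(2) abs_ge_self] by (intro AE_I2) (auto simp: indicator_def)
qed

lemma bounded_borel_integrable:
  fixes k :: "'a::euclidean_space \<Rightarrow> real"
  assumes "E \<in> sets borel" "bounded E" "k \<in> borel_measurable borel" "\<And>x. \<bar>k x\<bar> \<le> C"
  shows "integrable lborel (\<lambda>x. indicator E x * k x)"
  using integrable_bounded_on_bounded[OF assms(1-3)] assms(4) by blast

lemma integral_lborel_translate:
  fixes f :: "'a::euclidean_space \<Rightarrow> real"
  assumes "f \<in> borel_measurable borel"
  shows "(\<integral>x. f (x + v) \<partial>lborel) = (\<integral>x. f x \<partial>lborel)"
proof -
  have "(\<integral>x. f x \<partial>lborel) = (\<integral>x. f x \<partial>distr lborel borel ((+) v))" unfolding lborel_distr_plus ..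
  also have "\<dots> = (\<integral>x. f (v + x) \<partial>lborel)" by (rule integral_distr) (use assms in auto)
  finally show ?thesis by (simp add: add.commute)
qed

text \<open>
  Continuity of translation on \<open>L\<^sup>1\<close>, applied to the indicator of \<open>E\<close>. The point is that \<open>\<delta>\<close> does not
  depend on the bounded function \<open>k\<close>.
\<close>

lemma translate_integral_close:
  fixes E :: "'a::euclidean_space set" and \<epsilon> :: real
  assumes E[measurable]: "E \<in> sets borel" and "bounded E" and "\<epsilon> > 0"
  shows "\<exists>\<delta>>0. \<forall>v (k::'a \<Rightarrow> real) C. norm v < \<delta> \<longrightarrow> k \<in> borel_measurable borel \<longrightarrow> (\<forall>x. \<bar>k x\<bar> \<le> C) \<longrightarrow>
    \<bar>(\<integral>x. indicator E x * k (x + v) \<partial>lborel) - (\<integral>x. indicator E x * k x \<partial>lborel)\<bar> \<le> C * \<epsilon>"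
proof -
  obtain \<delta> where \<delta>: "\<delta> > 0"
    "\<And>v. norm v < \<delta> \<Longrightarrow> emeasure lborel {x. x - v \<in> E \<and> x \<notin> E} \<le> ennreal (\<epsilon>/2)"
    using translate_difference_small[OF assms(1,2), of "\<epsilon>/2"] \<open>\<epsilon> > 0\<close> by auto
  have "\<bar>(\<integral>x. indicator E x * k (x + v) \<partial>lborel) - (\<integral>x. indicator E x * k x \<partial>lborel)\<bar> \<le> C * \<epsilon>"
    if v: "norm v < \<delta>" and k[measurable]: "k \<in> borel_measurable borel" and bd: "\<And>x. \<bar>k x\<bar> \<le> C" for v C and k :: "'a \<Rightarrow> real"
  proof -
    define P where "P = {x. x - v \<in> E \<and> x \<notin> E}"
    define Q where "Q = {x. x - v \<notin> E \<and> x \<in> E}"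
    have [measurable]: "P \<in> sets borel" "Q \<in> sets borel" unfolding P_def Q_def by measurable
    have C0: "0 \<le> C" using bd[of 0] by linarith
    have P: "emeasure lborel P \<le> ennreal (\<epsilon>/2)" unfolding P_def by (rule \<delta>(2)[OF v])
    have Q: "emeasure lborel Q \<le> ennreal (\<epsilon>/2)"
    proof -
      have "emeasure lborel Q = emeasure (distr lborel borel ((+) v)) Q" unfolding lborel_distr_plus ..
      also have "\<dots> = emeasure lborel {x. x - (- v) \<in> E \<and> x \<notin> E}"
        by (subst emeasure_distr) (auto simp: Q_def vimage_def add.commute conj_commute)
      also have "\<dots> \<le> ennreal (\<epsilon>/2)" by (rule \<delta>(2)) (use v in simp)
      finally show ?thesis .
    qed
    have mP: "measure lborel P \<le> \<epsilon>/2" "measure lborel Q \<le> \<epsilon>/2"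
      unfolding measure_def using \<open>\<epsilon> > 0\<close> enn2real_leI[OF _ P] enn2real_leI[OF _ Q] by linarith+
    have iP: "integrable lborel (indicator P :: _ \<Rightarrow> real)" "integrable lborel (indicator Q :: _ \<Rightarrow> real)"
      using P Q by (auto intro!: integrable_real_indicator simp: order_le_less_trans[OF _ ennreal_less_top])
    have i1: "integrable lborel (\<lambda>x. indicator E x * k x)"
      by (rule bounded_borel_integrable[OF assms(1,2) k bd])
    have i2: "integrable lborel (\<lambda>x. indicator E (x - v) * k x)"
    proof -
      have "integrable lborel (\<lambda>x. indicator {x. x - v \<in> E} x * k x)"
      proof (rule bounded_borel_integrable[OF _ _ k bd])
        have "{x. x - v \<in> E} = (+) v ` E" by (force simp: image_iff)
        then show "bounded {x. x - v \<in> E}" using \<open>bounded E\<close> by (simp add: bounded_translation)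
      qed measurable
      then show ?thesis by (simp add: indicator_def)
    qed
    have "(\<integral>x. indicator E x * k (x + v) \<partial>lborel) = (\<integral>x. indicator E ((x + v) - v) * k (x + v) \<partial>lborel)" by simp
    also have "\<dots> = (\<integral>x. indicator E (x - v) * k x \<partial>lborel)"
      by (rule integral_lborel_translate) measurable
    finally have "\<bar>(\<integral>x. indicator E x * k (x + v) \<partial>lborel) - (\<integral>x. indicator E x * k x \<partial>lborel)\<bar>
        = \<bar>\<integral>x. indicator E (x - v) * k x - indicator E x * k x \<partial>lborel\<bar>"
      using i1 i2 by simp
    also have "\<dots> \<le> (\<integral>x. C * (indicator P x + indicator Q x) \<partial>lborel)"
    proof (rule integral_abs_bound[THEN order_trans], rule integral_mono)
      show "integrable lborel (\<lambda>x. \<bar>indicator E (x - v) * k x - indicator E x * k x\<bar>)"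
        using i1 i2 by (intro integrable_abs Bochner_Integration.integrable_diff)
      show "integrable lborel (\<lambda>x. C * (indicator P x + indicator Q x))"
        using iP by auto
      show "\<bar>indicator E (x - v) * k x - indicator E x * k x\<bar> \<le> C * (indicator P x + indicator Q x)" for x
        using bd[of x] C0 by (auto simp: P_def Q_def indicator_def)
    qed
    also have "\<dots> = C * (measure lborel P + measure lborel Q)"
      using iP by simp
    also have "\<dots> \<le> C * \<epsilon>" using mP C0 by (intro mult_left_mono) auto
    finally show ?thesis .
  qed
  then show ?thesis using \<delta>(1) by blast
qed

section \<open>Rademacher's theorem\<close>

lemma quotient_tendsto_dini:
  assumes "L-lipschitz_on UNIV f" and "dini f v x = - dini (\<lambda>x. - f x) v x"
  shows "(\<lambda>n. real (Suc n) * (f (x + (1 / real (Suc n)) *\<^sub>R v) - f x)) \<longlonglongrightarrow> dini f v x"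
proof -
  have "filterlim (\<lambda>n. 1 / real (Suc n)) (at_right 0) sequentially"
    unfolding filterlim_at using LIMSEQ_inverse_real_of_nat
    by (auto simp: inverse_eq_divide)
  from filterlim_compose[OF right_derivative_of_dini[OF assms] this]
  show ?thesis by (simp add: mult.commute)
qed

lemma integral_quotient_tendsto:
  fixes f :: "'a::euclidean_space \<Rightarrow> real"
  assumes lip: "L-lipschitz_on UNIV f" and E: "E \<in> sets borel" "bounded E"
  shows "(\<lambda>n. \<integral>x. indicator E x * (real (Suc n) * (f (x + (1 / real (Suc n)) *\<^sub>R v) - f x)) \<partial>lborel)
      \<longlonglongrightarrow> (\<integral>x. indicator E x * dini f v x \<partial>lborel)"
proof (rule integral_dominated_convergence)
  have [measurable]: "f \<in> borel_measurable borel"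
    by (rule borel_measurable_continuous_onI[OF lipschitz_on_continuous_on[OF lip]])
  note [measurable] = borel_measurable_dini[OF lip] E(1)
  show "(\<lambda>x. indicator E x * dini f v x) \<in> borel_measurable lborel" by measurable
  show "(\<lambda>x. indicator E x * (real (Suc n) * (f (x + (1 / real (Suc n)) *\<^sub>R v) - f x))) \<in> borel_measurable lborel" for n
    by measurable
  show "integrable lborel (\<lambda>x. indicator E x * (L * norm v))"
    by (rule bounded_borel_integrable[OF E, where C = "\<bar>L * norm v\<bar>"]) auto
  show "AE x in lborel. (\<lambda>n. indicator E x * (real (Suc n) * (f (x + (1 / real (Suc n)) *\<^sub>R v) - f x)))
      \<longlonglongrightarrow> indicator E x * dini f v x"
    using lipschitz_directional_AE[OF lip, of v]
    by eventually_elim (intro tendsto_mult_left quotient_tendsto_dini[OF lip])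
  show "AE x in lborel. norm (indicator E x * (real (Suc n) * (f (x + (1 / real (Suc n)) *\<^sub>R v) - f x)))
      \<le> indicator E x * (L * norm v)" for n
    using quotient_bound[OF lip, of "1 / real (Suc n)" _ v]
    by (intro AE_I2) (auto simp: indicator_def mult.commute)
qed

text \<open>
  A step along \<open>v + w\<close> is a step along \<open>w\<close> followed by a step along \<open>v\<close> that starts at a shifted point.
  After integration over \<open>E\<close> the shift disappears in the limit by continuity of translations.
\<close>

lemma integral_dini_add:
  fixes f :: "'a::euclidean_space \<Rightarrow> real"
  assumes lip: "L-lipschitz_on UNIV f" and E: "E \<in> sets borel" "bounded E"
  shows "(\<integral>x. indicator E x * dini f (v + w) x \<partial>lborel)
    = (\<integral>x. indicator E x * dini f v x \<partial>lborel) + (\<integral>x. indicator E x * dini f w x \<partial>lborel)"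
proof -
  have [measurable]: "f \<in> borel_measurable borel"
    by (rule borel_measurable_continuous_onI[OF lipschitz_on_continuous_on[OF lip]])
  define q where "q n v x = real (Suc n) * (f (x + (1 / real (Suc n)) *\<^sub>R v) - f x)" for n v x
  define I where "I n v = (\<integral>x. indicator E x * q n v x \<partial>lborel)" for n v
  define J where "J n = (\<integral>x. indicator E x * q n v (x + (1 / real (Suc n)) *\<^sub>R w) \<partial>lborel)" for n
  have qm[measurable]: "q n v \<in> borel_measurable borel" for n v unfolding q_def by measurable
  have qb: "\<bar>q n v x\<bar> \<le> L * norm v" for n v x
    using quotient_bound[OF lip, of "1 / real (Suc n)" x v] by (simp add: q_def mult.commute)
  have Il: "(\<lambda>n. I n v) \<longlonglongrightarrow> (\<integral>x. indicator E x * dini f v x \<partial>lborel)" for v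
    unfolding I_def q_def by (rule integral_quotient_tendsto[OF lip E])
  have split: "q n (v + w) x = q n v (x + (1 / real (Suc n)) *\<^sub>R w) + q n w x" for n x
    unfolding q_def by (simp add: algebra_simps)
  have "I n (v + w) = J n + I n w" for n
  proof -
    have "integrable lborel (\<lambda>x. indicator E x * q n v (x + (1 / real (Suc n)) *\<^sub>R w))"
      by (rule bounded_borel_integrable[OF E, where C = "L * norm v"]) (auto simp: qb)
    moreover have "integrable lborel (\<lambda>x. indicator E x * q n w x)"
      by (rule bounded_borel_integrable[OF E, where C = "L * norm w"]) (auto simp: qb)
    ultimately show ?thesis unfolding I_def J_def split distrib_left by simp
  qed
  moreover have "(\<lambda>n. J n - I n v) \<longlonglongrightarrow> 0"
  proof (rule LIMSEQ_I)
    fix r :: real assume r: "r > 0"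
    define \<epsilon> where "\<epsilon> = r / (2 * (L * norm v + 1))"
    have L0: "0 \<le> L * norm v" using lipschitz_on_nonneg[OF lip] by simp
    have \<epsilon>: "\<epsilon> > 0" unfolding \<epsilon>_def using r L0 by simp
    have \<epsilon>r: "L * norm v * \<epsilon> < r"
    proof -
      have "p \<noteq> 0 \<Longrightarrow> p * (r / (2 * p)) = r / 2" for p by simp
      then have "(L * norm v + 1) * \<epsilon> = r / 2" unfolding \<epsilon>_def using L0 by (metis add_nonneg_eq_0_iff zero_le_one zero_neq_one)
      then show ?thesis using \<epsilon> r by (simp add: distrib_right)
    qed
    obtain \<delta> where \<delta>: "\<delta> > 0" and close: "\<And>u (k::'a \<Rightarrow> real) C. norm u < \<delta> \<Longrightarrow> k \<in> borel_measurable borel \<Longrightarrow> (\<And>x. \<bar>k x\<bar> \<le> C) \<Longrightarrow>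
      \<bar>(\<integral>x. indicator E x * k (x + u) \<partial>lborel) - (\<integral>x. indicator E x * k x \<partial>lborel)\<bar> \<le> C * \<epsilon>"
      using translate_integral_close[OF E \<epsilon>] by blast
    have "(\<lambda>n. (1 / real (Suc n)) *\<^sub>R w) \<longlonglongrightarrow> 0 *\<^sub>R w"
      using LIMSEQ_inverse_real_of_nat by (intro tendsto_scaleR tendsto_const) (simp add: inverse_eq_divide)
    then have "(\<lambda>n. (1 / real (Suc n)) *\<^sub>R w) \<longlonglongrightarrow> 0" by simp
    then obtain no where no: "\<And>n. no \<le> n \<Longrightarrow> norm ((1 / real (Suc n)) *\<^sub>R w) < \<delta>"
      using LIMSEQ_D[OF _ \<delta>] by (metis (no_types, lifting) diff_zero)
    have "norm (J n - I n v - 0) < r" if "no \<le> n" for n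
      using close[OF no[OF that] qm[of n v] qb] \<epsilon>r unfolding J_def I_def by simp
    then show "\<exists>no. \<forall>n\<ge>no. norm (J n - I n v - 0) < r" by blast
  qed
  ultimately have "(\<lambda>n. I n (v + w) - I n v - I n w) \<longlonglongrightarrow> 0" by (simp add: algebra_simps)
  moreover have "(\<lambda>n. I n (v + w) - I n v - I n w) \<longlonglongrightarrow> (\<integral>x. indicator E x * dini f (v + w) x \<partial>lborel)
     - (\<integral>x. indicator E x * dini f v x \<partial>lborel) - (\<integral>x. indicator E x * dini f w x \<partial>lborel)"
    by (intro tendsto_diff Il)
  ultimately show ?thesis using LIMSEQ_unique by fastforce
qed

text \<open>
  The defect of additivity has integral zero over every bounded Borel set.
\<close>

lemma dini_add_AE:
  fixes f :: "'a::euclidean_space \<Rightarrow> real"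
  assumes lip: "L-lipschitz_on UNIV f"
  shows "AE x in lborel. dini f (v + w) x = dini f v x + dini f w x"
proof -
  note [measurable] = borel_measurable_dini[OF lip]
  define k where "k x = dini f (v + w) x - dini f v x - dini f w x" for x
  have i: "integrable lborel (\<lambda>x. indicator E x * dini f v x)" if "E \<in> sets borel" "bounded E" for E v
    by (rule bounded_borel_integrable[OF that, where C = "L * norm v"]) (auto simp: abs_dini_le[OF lip])
  have k: "integrable lborel (\<lambda>x. indicator E x * k x)" "(\<integral>x. indicator E x * k x \<partial>lborel) = 0"
    if E: "E \<in> sets borel" "bounded E" for E
    unfolding k_def right_diff_distrib using i[OF E] integral_dini_add[OF lip E] by auto
  have "AE x in lborel. indicator (ball 0 (real n)) x * k x = 0" for n :: nat
  proof (rule sigma_finite_measure.density_zero[OF lborel.sigma_finite_measure_axioms])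
    show "integrable lborel (\<lambda>x. indicator (ball 0 (real n)) x * k x)" by (rule k) auto
    fix A :: "'a set" assume A: "A \<in> sets lborel"
    have "(\<integral>x. indicator (A \<inter> ball 0 (real n)) x * k x \<partial>lborel) = 0" by (rule k) (use A in auto)
    then show "(LINT x:A|lborel. indicator (ball 0 (real n)) x * k x) = 0"
      by (simp add: set_lebesgue_integral_def indicator_inter_arith mult.assoc)
  qed
  then have "AE x in lborel. \<forall>n::nat. indicator (ball 0 (real n)) x * k x = 0"
    unfolding AE_all_countable by blast
  then show ?thesis
  proof eventually_elim
    case (elim x)
    obtain n where "norm x < real n" using reals_Archimedean2 by blast
    then show ?case using elim[rule_format, of n] by (simp add: k_def indicator_def)
  qed
qed

definition rational_vectors :: "'a::euclidean_space set" where
  "rational_vectors = {w. \<forall>b\<in>Basis. w \<bullet> b \<in> \<rat>}"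

lemma countable_rational_vectors: "countable (rational_vectors :: 'a::euclidean_space set)"
proof -
  have "w \<in> (\<lambda>f. \<Sum>b\<in>Basis. f b *\<^sub>R b) ` (Basis \<rightarrow>\<^sub>E \<rat>)" if "w \<in> rational_vectors" for w :: 'a
    using that by (intro image_eqI[of _ _ "restrict (\<lambda>b. w \<bullet> b) Basis"])
      (auto simp: rational_vectors_def euclidean_representation)
  moreover have "countable ((\<lambda>f. \<Sum>b\<in>Basis. f b *\<^sub>R b) ` (Basis \<rightarrow>\<^sub>E \<rat>) :: 'a set)"
    by (intro countable_image countable_PiE) (auto simp: countable_rat)
  ultimately show ?thesis by (meson countable_subset subsetI)
qed

lemma rational_vectors_dense:
  fixes u :: "'a::euclidean_space"
  assumes "e > 0" shows "\<exists>w\<in>rational_vectors. dist w u < e"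
proof -
  let ?A = "\<Union>f\<in>Basis \<rightarrow> \<rat>. {\<Sum>i\<in>Basis. f i *\<^sub>R i} :: 'a set"
  have "u \<in> closure ?A" by (simp add: closure_rational_coordinates)
  then obtain w where "w \<in> ?A" "dist w u < e" using assms unfolding closure_approachable by blast
  moreover from this have "w \<in> rational_vectors"
    by (auto simp: rational_vectors_def)
  ultimately show ?thesis by blast
qed

lemma dini_scale:
  assumes lip: "L-lipschitz_on UNIV f" and eq: "dini f v x = - dini (\<lambda>x. - f x) v x" and "r > 0"
  shows "dini f (r *\<^sub>R v) x = r * dini f v x"
proof (rule dini_eq_limit[OF lip])
  have "filterlim (\<lambda>t. t * r) (at_right 0) (at_right (0::real))"
    unfolding filterlim_at using \<open>r > 0\<close>
    by (auto intro!: tendsto_eq_intros simp: eventually_at_filter)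
  from filterlim_compose[OF right_derivative_of_dini[OF lip eq] this]
  have "((\<lambda>t. r * ((f (x + (t * r) *\<^sub>R v) - f x) / (t * r))) \<longlongrightarrow> r * dini f v x) (at_right 0)"
    by (intro tendsto_mult_left)
  then show "((\<lambda>t. (f (x + t *\<^sub>R r *\<^sub>R v) - f x) / t) \<longlongrightarrow> r * dini f v x) (at_right 0)"
    using \<open>r > 0\<close> by simp
qed

text \<open>
  Additivity for rational directions together with positive homogeneity gives linearity over the
  rationals; negative factors are reached through \<open>dini f 0 x = 0\<close>.
\<close>

lemma dini_linear_on_rationals:
  fixes f :: "'a::euclidean_space \<Rightarrow> real"
  assumes lip: "L-lipschitz_on UNIV f"
    and eq: "\<And>w. w \<in> rational_vectors \<Longrightarrow> dini f w x = - dini (\<lambda>x. - f x) w x"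
    and add: "\<And>v w. v \<in> rational_vectors \<Longrightarrow> w \<in> rational_vectors \<Longrightarrow> dini f (v + w) x = dini f v x + dini f w x"
    and w: "w \<in> rational_vectors"
  shows "dini f w x = (\<Sum>b\<in>Basis. (w \<bullet> b) * dini f b x)"
proof -
  have zero: "dini f 0 x = 0" using add[of 0 0] by (simp add: rational_vectors_def)
  have scale: "dini f (r *\<^sub>R v) x = r * dini f v x" if v: "v \<in> rational_vectors" and r: "r \<in> \<rat>" for r v
  proof -
    have pos: "dini f (r *\<^sub>R v) x = r * dini f v x" if "r > 0" for r by (rule dini_scale[OF lip eq[OF v] that])
    have mem: "s *\<^sub>R v \<in> rational_vectors" if "s \<in> \<rat>" for s using v that by (auto simp: rational_vectors_def)
    consider "r > 0" | "r = 0" | "r < 0" by linarith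
    then show ?thesis
    proof cases
      case 3
      have "dini f (r *\<^sub>R v + (- r) *\<^sub>R v) x = dini f (r *\<^sub>R v) x + dini f ((- r) *\<^sub>R v) x"
        using mem[OF r] mem[of "- r"] r by (intro add) auto
      then show ?thesis using pos[of "- r"] 3 zero by simp
    qed (use pos zero in auto)
  qed
  have "dini f (\<Sum>b\<in>B. (w \<bullet> b) *\<^sub>R b) x = (\<Sum>b\<in>B. (w \<bullet> b) * dini f b x) \<and> (\<Sum>b\<in>B. (w \<bullet> b) *\<^sub>R b) \<in> rational_vectors"
    if "finite B" "B \<subseteq> Basis" for B
    using that
  proof (induction B)
    case empty
    then show ?case by (simp add: zero rational_vectors_def)
  next
    case (insert b B)
    have b: "b \<in> rational_vectors" "w \<bullet> b \<in> \<rat>" "(w \<bullet> b) *\<^sub>R b \<in> rational_vectors"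
      using insert.prems w by (auto simp: rational_vectors_def inner_Basis)
    let ?s = "\<Sum>b\<in>B. (w \<bullet> b) *\<^sub>R b"
    have s: "?s \<in> rational_vectors" using insert by auto
    then have "(w \<bullet> b) *\<^sub>R b + ?s \<in> rational_vectors" using b by (auto simp: rational_vectors_def inner_add_left)
    then show ?case using insert add[OF b(3) s] scale[OF b(1,2)] by simp
  qed
  from this[of Basis] show ?thesis by (simp add: euclidean_representation)
qed

text \<open>
  Almost every \<open>x\<close> satisfies the countably many conditions that the directional derivatives in
  rational directions exist and are additive, so they are given by a linear map \<open>T\<close>. Finitely many
  rational directions form a net in the unit sphere; convergence of the difference quotients along
  these, with the Lipschitz bound in between, is uniform in all directions.
\<close>

theorem rademacher:
  fixes f :: "'a::euclidean_space \<Rightarrow> real"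
  assumes lip: "L-lipschitz_on UNIV f"
  shows "AE x in lborel. \<exists>D. (f has_derivative D) (at x)"
proof -
  have "AE x in lborel. \<forall>w\<in>rational_vectors. dini f w x = - dini (\<lambda>x. - f x) w x"
    using lipschitz_directional_AE[OF lip] by (subst AE_ball_countable[OF countable_rational_vectors]) blast
  moreover have "AE x in lborel. \<forall>v\<in>rational_vectors. \<forall>w\<in>rational_vectors. dini f (v + w) x = dini f v x + dini f w x"
    using dini_add_AE[OF lip] by (simp add: AE_ball_countable[OF countable_rational_vectors])
  ultimately show ?thesis
  proof eventually_elim
    case (elim x)
    define T where "T h = (\<Sum>b\<in>Basis. (h \<bullet> b) * dini f b x)" for h
    have T: "dini f w x = T w" if "w \<in> rational_vectors" for w
      unfolding T_def by (rule dini_linear_on_rationals[OF lip _ _ that]) (use elim in auto)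
    have bl: "bounded_linear T" unfolding T_def
      by (intro bounded_linear_sum bounded_linear_mult_left[THEN bounded_linear_compose] bounded_linear_inner_left)
    have lT: "linear T" using bl by (rule bounded_linear.linear)
    obtain K where K: "K > 0" "\<And>h. norm (T h) \<le> norm h * K" using bounded_linear.pos_bounded[OF bl] by blast
    have L0: "0 \<le> L" using lip by (rule lipschitz_on_nonneg)
    have "(f has_derivative T) (at x)"
      unfolding has_derivative_at_alt
    proof (intro conjI allI impI)
      show "bounded_linear T" by (rule bl)
      fix e :: real assume e: "e > 0"
      (* Replacing the direction by one of the net costs L * \<eta> for f and K * \<eta> for T; the
         remaining \<eta> is for the difference quotient. *)
      define \<eta> where "\<eta> = e / (L + K + 1)"
      have \<eta>: "\<eta> > 0" unfolding \<eta>_def using e L0 K by simp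
      have \<eta>e: "\<eta> * (L + K + 1) = e" unfolding \<eta>_def using L0 K by simp
      have "sphere (0::'a) 1 \<subseteq> (\<Union>w\<in>rational_vectors. ball w \<eta>)"
        using rational_vectors_dense[OF \<eta>] by (force simp: dist_commute)
      then obtain F where F: "F \<subseteq> rational_vectors" "finite F" "sphere (0::'a) 1 \<subseteq> (\<Union>w\<in>F. ball w \<eta>)"
        using compactE_image[OF compact_sphere, of rational_vectors "\<lambda>w. ball w \<eta>" 0 1] by auto
      have "\<exists>d>0. \<forall>t. 0 < t \<and> t < d \<longrightarrow> \<bar>(f (x + t *\<^sub>R w) - f x) / t - T w\<bar> < \<eta>" if "w \<in> F" for w
      proof -
        have w: "w \<in> rational_vectors" using that F by auto
        have "((\<lambda>t. (f (x + t *\<^sub>R w) - f x) / t) \<longlongrightarrow> T w) (at_right 0)"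
          using right_derivative_of_dini[OF lip, of w x] elim(1) w T[OF w] by simp
        from tendstoD[OF this \<eta>] show ?thesis
          unfolding eventually_at_right_field dist_real_def by auto
      qed
      then obtain d where d: "\<And>w. w \<in> F \<Longrightarrow> d w > 0"
        "\<And>w t. w \<in> F \<Longrightarrow> 0 < t \<Longrightarrow> t < d w \<Longrightarrow> \<bar>(f (x + t *\<^sub>R w) - f x) / t - T w\<bar> < \<eta>"
        by metis
      define \<delta> where "\<delta> = Min (insert 1 (d ` F))"
      have \<delta>: "\<delta> > 0" "\<And>w. w \<in> F \<Longrightarrow> \<delta> \<le> d w" unfolding \<delta>_def using F d by auto
      have "norm (f y - f x - T (y - x)) \<le> e * norm (y - x)" if y: "norm (y - x) < \<delta>" for y
      proof (cases "y = x")
        case True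
        then show ?thesis using linear_0[OF lT] by simp
      next
        case False
        define t where "t = norm (y - x)"
        have t: "t > 0" unfolding t_def using False by simp
        define u where "u = (1 / t) *\<^sub>R (y - x)"
        have "u \<in> sphere 0 1" unfolding u_def t_def using False by simp
        then obtain w where w: "w \<in> F" "dist w u < \<eta>" using F(3) by auto
        have yu: "y = x + t *\<^sub>R u" unfolding u_def using t by simp
        have "\<bar>f y - f (x + t *\<^sub>R w)\<bar> \<le> L * dist y (x + t *\<^sub>R w)"
          using lipschitz_onD[OF lip, of y "x + t *\<^sub>R w"] by (simp add: dist_real_def)
        also have "dist y (x + t *\<^sub>R w) = t * dist w u"
          unfolding yu using t by (simp add: dist_norm scaleR_diff_right[symmetric] norm_minus_commute)
        also have "L * (t * dist w u) \<le> L * (t * \<eta>)" using L0 t w by (intro mult_left_mono) auto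
        finally have 1: "\<bar>f y - f (x + t *\<^sub>R w)\<bar> \<le> L * (t * \<eta>)" .
        have "\<bar>(f (x + t *\<^sub>R w) - f x) / t - T w\<bar> < \<eta>" using d(2)[OF w(1) t] \<delta>(2)[OF w(1)] y t_def by simp
        then have "t * \<bar>(f (x + t *\<^sub>R w) - f x) / t - T w\<bar> \<le> t * \<eta>" using t by simp
        also have "t * \<bar>(f (x + t *\<^sub>R w) - f x) / t - T w\<bar> = \<bar>t * ((f (x + t *\<^sub>R w) - f x) / t - T w)\<bar>"
          using t by (simp add: abs_mult)
        also have "t * ((f (x + t *\<^sub>R w) - f x) / t - T w) = f (x + t *\<^sub>R w) - f x - t * T w"
        proof -
          have "t * (s / t - T w) = s - t * T w" for s using t by (simp add: right_diff_distrib)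
          then show ?thesis .
        qed
        finally have 2: "\<bar>f (x + t *\<^sub>R w) - f x - t * T w\<bar> \<le> t * \<eta>" .
        have Tyx: "T (y - x) = t * T u" unfolding yu using linear_scale[OF lT, of t u] by simp
        have "\<bar>T w - T u\<bar> \<le> norm (w - u) * K"
          using K(2)[of "w - u"] by (simp add: linear_diff[OF lT])
        also have "\<dots> \<le> \<eta> * K" using w K by (intro mult_right_mono) (auto simp: dist_norm)
        finally have "t * \<bar>T w - T u\<bar> \<le> t * (\<eta> * K)" using t by simp
        then have 3: "\<bar>t * T w - t * T u\<bar> \<le> t * (\<eta> * K)" using t by (simp add: abs_mult right_diff_distrib[symmetric])
        have "\<bar>f y - f x - T (y - x)\<bar> \<le> L * (t * \<eta>) + t * \<eta> + t * (\<eta> * K)"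
          using 1 2 3 unfolding Tyx by linarith
        also have "\<dots> = (\<eta> * (L + K + 1)) * t" by (simp add: algebra_simps)
        finally show ?thesis unfolding \<eta>e t_def by simp
      qed
      then show "\<exists>d>0. \<forall>y. norm (y - x) < d \<longrightarrow> norm (f y - f x - T (y - x)) \<le> e * norm (y - x)"
        using \<delta>(1) by blast
    qed
    then show ?case by blast
  qed
qed

lemma directional_quotient_tendsto:
  fixes f :: "'a::real_normed_vector \<Rightarrow> real"
  assumes der: "(f has_derivative D) (at x)"
  shows "((\<lambda>t. (f (x + t *\<^sub>R v) - f x) / t) \<longlongrightarrow> D v) (at_right 0)"
proof -
  have "((\<lambda>t. x + t *\<^sub>R v) has_derivative (\<lambda>t. t *\<^sub>R v)) (at 0)"
    by (auto intro!: derivative_eq_intros)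
  moreover have "(f has_derivative D) (at (x + 0 *\<^sub>R v))" using der by simp
  ultimately have "((\<lambda>t. f (x + t *\<^sub>R v)) has_derivative (\<lambda>t. D (t *\<^sub>R v))) (at (0::real))"
    by (rule has_derivative_compose)
  moreover have "(\<lambda>t. D (t *\<^sub>R v)) = (*) (D v)"
    by (rule ext) (simp add: linear_scale[OF has_derivative_linear[OF der]])
  ultimately have "((\<lambda>t. f (x + t *\<^sub>R v)) has_real_derivative D v) (at 0)"
    unfolding has_field_derivative_def by simp
  then have "((\<lambda>t. (f (x + t *\<^sub>R v) - f x) / t) \<longlongrightarrow> D v) (at 0)"
    by (simp add: has_field_derivative_iff)
  then show ?thesis
    by (rule filterlim_mono) (auto simp: at_le)
qed

lemma dini_eq_derivative:
  fixes f :: "'a::real_normed_vector \<Rightarrow> real"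
  assumes lip: "L-lipschitz_on UNIV f" and der: "(f has_derivative D) (at x)"
  shows "dini f v x = D v"
  by (rule dini_eq_limit[OF lip directional_quotient_tendsto[OF der]])

section \<open>Functionals approximated by point evaluations\<close>

inductive point_sum :: "(('a \<Rightarrow> real) \<Rightarrow> real) \<Rightarrow> bool" where
  zero: "point_sum (\<lambda>f. 0)"
| insert: "point_sum \<psi> \<Longrightarrow> point_sum (\<lambda>f. \<psi> f + a * f x)"

lemma point_sum_add: "point_sum \<psi> \<Longrightarrow> point_sum \<phi> \<Longrightarrow> point_sum (\<lambda>f. \<phi> f + \<psi> f)"
proof (induction rule: point_sum.induct)
  case (insert \<psi> a x)
  from point_sum.insert[OF insert.IH[OF insert.prems], of a x] show ?case by (simp add: add.assoc)
qed simp

lemma point_sum_cmult: "point_sum \<psi> \<Longrightarrow> point_sum (\<lambda>f. c * \<psi> f)"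
proof (induction rule: point_sum.induct)
  case (insert \<psi> a x)
  from point_sum.insert[OF insert.IH, of "c * a" x] show ?case by (simp add: algebra_simps)
qed (simp add: point_sum.zero)

text \<open>
  Membership in the closed linear span of the point evaluations, where functionals are compared on
  Lipschitz functions only and the error is measured relative to the Lipschitz constant.
\<close>

definition lip_approx :: "(('a::metric_space \<Rightarrow> real) \<Rightarrow> real) \<Rightarrow> bool" where
  "lip_approx \<phi> \<longleftrightarrow> (\<forall>\<epsilon>>0. \<exists>\<psi>. point_sum \<psi> \<and> (\<forall>L f. L-lipschitz_on UNIV f \<longrightarrow> \<bar>\<phi> f - \<psi> f\<bar> \<le> \<epsilon> * L))"

lemma lip_approxE:
  assumes "lip_approx \<phi>" "\<epsilon> > 0"
  obtains \<psi> where "point_sum \<psi>" "\<And>L f. L-lipschitz_on UNIV f \<Longrightarrow> \<bar>\<phi> f - \<psi> f\<bar> \<le> \<epsilon> * L"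
  using assms unfolding lip_approx_def by blast

lemma lip_approx_add:
  assumes "lip_approx \<phi>" "lip_approx \<psi>"
  shows "lip_approx (\<lambda>f. \<phi> f + \<psi> f)"
  unfolding lip_approx_def
proof (intro allI impI)
  fix \<epsilon> :: real assume "\<epsilon> > 0"
  then have e: "\<epsilon> / 2 > 0" by simp
  obtain \<phi>' where 1: "point_sum \<phi>'" "\<And>L f. L-lipschitz_on UNIV f \<Longrightarrow> \<bar>\<phi> f - \<phi>' f\<bar> \<le> \<epsilon> / 2 * L"
    using lip_approxE[OF assms(1) e] by blast
  obtain \<psi>' where 2: "point_sum \<psi>'" "\<And>L f. L-lipschitz_on UNIV f \<Longrightarrow> \<bar>\<psi> f - \<psi>' f\<bar> \<le> \<epsilon> / 2 * L"
    using lip_approxE[OF assms(2) e] by blast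
  have "\<bar>\<phi> f + \<psi> f - (\<phi>' f + \<psi>' f)\<bar> \<le> \<epsilon> * L" if "L-lipschitz_on UNIV f" for L f
    using 1(2)[OF that] 2(2)[OF that] by linarith
  then show "\<exists>\<psi>'. point_sum \<psi>' \<and> (\<forall>L f. L-lipschitz_on UNIV f \<longrightarrow> \<bar>\<phi> f + \<psi> f - \<psi>' f\<bar> \<le> \<epsilon> * L)"
    using point_sum_add[OF 2(1) 1(1)] by blast
qed

lemma lip_approx_cmult:
  assumes "lip_approx \<phi>"
  shows "lip_approx (\<lambda>f. c * \<phi> f)"
  unfolding lip_approx_def
proof (intro allI impI)
  fix \<epsilon> :: real assume "\<epsilon> > 0"
  then have e: "\<epsilon> / (\<bar>c\<bar> + 1) > 0" by simp
  obtain \<psi> where 1: "point_sum \<psi>" "\<And>L f. L-lipschitz_on UNIV f \<Longrightarrow> \<bar>\<phi> f - \<psi> f\<bar> \<le> \<epsilon> / (\<bar>c\<bar> + 1) * L"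
    using lip_approxE[OF assms e] by blast
  have "\<bar>c * \<phi> f - c * \<psi> f\<bar> \<le> \<epsilon> * L" if L: "L-lipschitz_on UNIV f" for L f
  proof -
    have "\<bar>c * \<phi> f - c * \<psi> f\<bar> = \<bar>c\<bar> * \<bar>\<phi> f - \<psi> f\<bar>" by (simp add: abs_mult flip: right_diff_distrib)
    also have "\<dots> \<le> (\<bar>c\<bar> + 1) * (\<epsilon> / (\<bar>c\<bar> + 1) * L)" by (intro mult_mono 1(2)[OF L]) auto
    also have "\<dots> = \<epsilon> * L" by simp
    finally show ?thesis .
  qed
  then show "\<exists>\<psi>. point_sum \<psi> \<and> (\<forall>L f. L-lipschitz_on UNIV f \<longrightarrow> \<bar>c * \<phi> f - \<psi> f\<bar> \<le> \<epsilon> * L)"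
    using point_sum_cmult[OF 1(1), of c] by blast
qed

lemma lip_approx_limit:
  assumes "\<And>\<epsilon>. \<epsilon> > 0 \<Longrightarrow> \<exists>\<psi>. lip_approx \<psi> \<and> (\<forall>L f. L-lipschitz_on UNIV f \<longrightarrow> \<bar>\<phi> f - \<psi> f\<bar> \<le> \<epsilon> * L)"
  shows "lip_approx \<phi>"
  unfolding lip_approx_def
proof (intro allI impI)
  fix \<epsilon> :: real assume "\<epsilon> > 0"
  then have e: "\<epsilon> / 2 > 0" by simp
  obtain \<psi> where 1: "lip_approx \<psi>" "\<And>L f. L-lipschitz_on UNIV f \<Longrightarrow> \<bar>\<phi> f - \<psi> f\<bar> \<le> \<epsilon> / 2 * L"
    using assms[OF e] by blast
  obtain \<psi>' where 2: "point_sum \<psi>'" "\<And>L f. L-lipschitz_on UNIV f \<Longrightarrow> \<bar>\<psi> f - \<psi>' f\<bar> \<le> \<epsilon> / 2 * L"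
    using lip_approxE[OF 1(1) e] by blast
  have "\<bar>\<phi> f - \<psi>' f\<bar> \<le> \<epsilon> * L" if "L-lipschitz_on UNIV f" for L f
    using 1(2)[OF that] 2(2)[OF that] by linarith
  then show "\<exists>\<psi>. point_sum \<psi> \<and> (\<forall>L f. L-lipschitz_on UNIV f \<longrightarrow> \<bar>\<phi> f - \<psi> f\<bar> \<le> \<epsilon> * L)"
    using 2(1) by blast
qed

lemma lipschitz_integrable_on_bounded:
  fixes f :: "'a::euclidean_space \<Rightarrow> real"
  assumes lip: "L-lipschitz_on UNIV f" and E: "E \<in> sets borel" "bounded E"
  shows "integrable lborel (\<lambda>x. indicator E x * f (x + u))"
proof -
  have [measurable]: "f \<in> borel_measurable borel"
    by (rule borel_measurable_continuous_onI[OF lipschitz_on_continuous_on[OF lip]])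
  obtain R where R: "\<And>x. x \<in> E \<Longrightarrow> norm x \<le> R" using E(2) unfolding bounded_iff by blast
  have L0: "0 \<le> L" using lip by (rule lipschitz_on_nonneg)
  have "\<bar>f (x + u)\<bar> \<le> \<bar>f u\<bar> + L * R" if "x \<in> E" for x
  proof -
    have "\<bar>f (x + u) - f u\<bar> \<le> L * norm x"
      using lipschitz_onD[OF lip, of "x + u" u] by (simp add: dist_norm)
    also have "\<dots> \<le> L * R" using R[OF that] L0 by (rule mult_left_mono)
    finally show ?thesis by linarith
  qed
  then show ?thesis by (intro integrable_bounded_on_bounded[OF E]) auto
qed

text \<open>
  The balls are removed from \<open>E\<close> one after the other; on the part of \<open>E\<close> in the ball around \<open>p\<close>,
  \<open>f (x + u)\<close> differs from \<open>f (p + u)\<close> by at most \<open>\<epsilon> * L\<close>.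
\<close>

lemma riemann_sum:
  fixes E :: "'a::euclidean_space set"
  assumes "finite X" "E \<in> sets borel" "bounded E" "E \<subseteq> (\<Union>x\<in>X. ball x \<epsilon>)"
  shows "\<exists>\<psi>. point_sum \<psi> \<and> (\<forall>L f. L-lipschitz_on UNIV f \<longrightarrow>
    \<bar>(\<integral>x. indicator E x * f (x + u) \<partial>lborel) - \<psi> f\<bar> \<le> \<epsilon> * L * measure lborel E)"
  using assms
proof (induction X arbitrary: E rule: finite_induct)
  case empty
  then have "E = {}" by simp
  then show ?case by (intro exI[of _ "\<lambda>_. 0"]) (simp add: point_sum.zero)
next
  case (insert p X)
  note [measurable] = insert.prems(1)
  define P where "P = E \<inter> ball p \<epsilon>"
  define R where "R = E - ball p \<epsilon>"
  have P: "P \<in> sets borel" "bounded P" and R: "R \<in> sets borel" "bounded R"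
    unfolding P_def R_def using insert.prems(2) by (auto intro: bounded_subset)
  have fin: "emeasure lborel P < \<infinity>" "emeasure lborel R < \<infinity>" using P R emeasure_bounded_finite by auto
  have "R \<subseteq> (\<Union>x\<in>X. ball x \<epsilon>)" using insert.prems(3) by (auto simp: R_def)
  from insert.IH[OF R this] obtain \<psi> where \<psi>: "point_sum \<psi>"
    "\<And>L f. L-lipschitz_on UNIV f \<Longrightarrow> \<bar>(\<integral>x. indicator R x * f (x + u) \<partial>lborel) - \<psi> f\<bar> \<le> \<epsilon> * L * measure lborel R" by blast
  have "\<bar>(\<integral>x. indicator E x * f (x + u) \<partial>lborel) - (\<psi> f + measure lborel P * f (p + u))\<bar> \<le> \<epsilon> * L * measure lborel E"
    if lip: "L-lipschitz_on UNIV f" for L f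
  proof -
    have L0: "0 \<le> L" using lip by (rule lipschitz_on_nonneg)
    have iP: "integrable lborel (\<lambda>x. indicator P x * f (x + u))" and iR: "integrable lborel (\<lambda>x. indicator R x * f (x + u))"
      using lipschitz_integrable_on_bounded[OF lip] P R by auto
    have iP': "integrable lborel (indicator P :: 'a \<Rightarrow> real)" using P fin by (auto intro!: integrable_real_indicator)
    have "(\<integral>x. indicator E x * f (x + u) \<partial>lborel) = (\<integral>x. indicator P x * f (x + u) + indicator R x * f (x + u) \<partial>lborel)"
      by (intro Bochner_Integration.integral_cong) (auto simp: P_def R_def indicator_def)
    also have "\<dots> = (\<integral>x. indicator P x * f (x + u) \<partial>lborel) + (\<integral>x. indicator R x * f (x + u) \<partial>lborel)"
      using iP iR by simp
    finally have 1: "(\<integral>x. indicator E x * f (x + u) \<partial>lborel) = \<dots>" .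
    have "\<bar>(\<integral>x. indicator P x * f (x + u) \<partial>lborel) - measure lborel P * f (p + u)\<bar>
        = \<bar>\<integral>x. indicator P x * f (x + u) - indicator P x * f (p + u) \<partial>lborel\<bar>"
      using iP iP' by simp
    also have "\<dots> \<le> (\<integral>x. indicator P x * (\<epsilon> * L) \<partial>lborel)"
    proof (rule integral_abs_bound[THEN order_trans], rule integral_mono)
      show "integrable lborel (\<lambda>x. \<bar>indicator P x * f (x + u) - indicator P x * f (p + u)\<bar>)"
        using iP iP' by (intro integrable_abs Bochner_Integration.integrable_diff) auto
      show "integrable lborel (\<lambda>x. indicator P x * (\<epsilon> * L))" using iP' by auto
      show "\<bar>indicator P x * f (x + u) - indicator P x * f (p + u)\<bar> \<le> indicator P x * (\<epsilon> * L)" for x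
      proof (cases "x \<in> P")
        case True
        have "\<bar>f (x + u) - f (p + u)\<bar> \<le> L * dist x p"
          using lipschitz_onD[OF lip, of "x + u" "p + u"] by (simp add: dist_norm)
        also have "\<dots> \<le> L * \<epsilon>" using True L0 by (intro mult_left_mono) (auto simp: P_def dist_commute)
        finally show ?thesis using True by (simp add: mult.commute)
      qed simp
    qed
    also have "\<dots> = \<epsilon> * L * measure lborel P" by simp
    finally have 2: "\<bar>(\<integral>x. indicator P x * f (x + u) \<partial>lborel) - measure lborel P * f (p + u)\<bar> \<le> \<epsilon> * L * measure lborel P" .
    have "measure lborel E = measure lborel (P \<union> R)" by (rule arg_cong[of _ _ "measure lborel"]) (auto simp: P_def R_def)
    also have "\<dots> = measure lborel P + measure lborel R"
      using P R fin by (intro measure_Union) (auto simp: P_def R_def)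
    finally have 3: "measure lborel E = measure lborel P + measure lborel R" .
    show ?thesis using 1 2 \<psi>(2)[OF lip] unfolding 3 distrib_left by linarith
  qed
  then show ?case using point_sum.insert[OF \<psi>(1), of "measure lborel P" "p + u"] by blast
qed

lemma lip_approx_integral:
  fixes E :: "'a::euclidean_space set"
  assumes E: "E \<in> sets borel" "bounded E"
  shows "lip_approx (\<lambda>f. \<integral>x. indicator E x * f (x + u) \<partial>lborel)"
  unfolding lip_approx_def
proof (intro allI impI)
  fix \<epsilon> :: real assume e: "\<epsilon> > 0"
  define \<eta> where "\<eta> = \<epsilon> / (measure lborel E + 1)"
  have \<eta>: "\<eta> > 0" unfolding \<eta>_def using e by (intro divide_pos_pos add_nonneg_pos) auto
  have "compact (closure E)" using E(2) by simp
  moreover have "closure E \<subseteq> (\<Union>x\<in>UNIV. ball x \<eta>)" using centre_in_ball[THEN iffD2, OF \<eta>] by blast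
  ultimately obtain X where X: "finite X" "closure E \<subseteq> (\<Union>x\<in>X. ball x \<eta>)"
    using compactE_image[of "closure E" UNIV "\<lambda>x. ball x \<eta>"] open_ball by metis
  have "E \<subseteq> (\<Union>x\<in>X. ball x \<eta>)" using X(2) closure_subset by blast
  from riemann_sum[OF X(1) E this, of u] obtain \<psi> where \<psi>: "point_sum \<psi>"
    "\<And>L f. L-lipschitz_on UNIV f \<Longrightarrow> \<bar>(\<integral>x. indicator E x * f (x + u) \<partial>lborel) - \<psi> f\<bar> \<le> \<eta> * L * measure lborel E"
    by blast
  have "\<bar>(\<integral>x. indicator E x * f (x + u) \<partial>lborel) - \<psi> f\<bar> \<le> \<epsilon> * L" if lip: "L-lipschitz_on UNIV f" for L f
  proof -
    have "m \<ge> 0 \<Longrightarrow> \<epsilon> / (m + 1) * m \<le> \<epsilon>" for m :: real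
      using e by (simp add: pos_divide_le_eq mult_left_mono)
    then have "\<eta> * measure lborel E \<le> \<epsilon>" unfolding \<eta>_def by simp
    then have "L * (\<eta> * measure lborel E) \<le> L * \<epsilon>" using lipschitz_on_nonneg[OF lip] by (rule mult_left_mono)
    then show ?thesis using \<psi>(2)[OF lip] by (simp add: mult_ac)
  qed
  then show "\<exists>\<psi>. point_sum \<psi> \<and> (\<forall>L f. L-lipschitz_on UNIV f \<longrightarrow>
    \<bar>(\<integral>x. indicator E x * f (x + u) \<partial>lborel) - \<psi> f\<bar> \<le> \<epsilon> * L)" using \<psi>(1) by blast
qed

lemma increment_eq_integral_dini:
  fixes f :: "'a::euclidean_space \<Rightarrow> real"
  assumes lip: "L-lipschitz_on UNIV f" and "t \<ge> 0"
  shows "f (x + t *\<^sub>R v) - f x = (\<integral>s. indicator {0..t} s * dini f v (x + s *\<^sub>R v) \<partial>lborel)"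
proof -
  note lip1 = lipschitz_on_line[OF lip, of v x]
  have s: "set_integrable lborel {0..t} (dini (\<lambda>s. f (x + s *\<^sub>R v)) 1)"
    using abs_dini_le[OF lip1, of 1]
    by (intro bounded_borel_set_integrable[where C = "L * norm v"] borel_measurable_dini[OF lip1]) auto
  have "f (x + t *\<^sub>R v) - f x = integral {0..t} (dini (\<lambda>s. f (x + s *\<^sub>R v)) 1)"
    using lipschitz_right_differentiable_AE(2)[OF lip1 \<open>t \<ge> 0\<close>] by simp
  also have "\<dots> = (\<integral>s. indicator {0..t} s * dini (\<lambda>s. f (x + s *\<^sub>R v)) 1 s \<partial>lborel)"
    using set_borel_integral_eq_integral(2)[OF s] by (simp add: set_lebesgue_integral_def)
  finally show ?thesis unfolding dini_line .
qed

text \<open>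
  The increment of \<open>f\<close> is the integral of \<open>dini f v\<close> along the segment from \<open>x\<close> to \<open>x + t v\<close>. By
  Fubini's theorem its average over \<open>E\<close> is an average, over \<open>s\<close> in \<open>{0..t}\<close>, of integrals of \<open>dini f v\<close>
  over translates of \<open>E\<close>; each of them is close to the integral over \<open>E\<close> itself.
\<close>

lemma averaged_increment:
  fixes f :: "'a::euclidean_space \<Rightarrow> real"
  assumes lip: "L-lipschitz_on UNIV f" and t: "t \<ge> 0" and E: "E \<in> sets borel" "bounded E"
    and close: "\<And>u (k::'a \<Rightarrow> real) C. norm u \<le> t * norm v \<Longrightarrow> k \<in> borel_measurable borel \<Longrightarrow> (\<And>x. \<bar>k x\<bar> \<le> C) \<Longrightarrow>
      \<bar>(\<integral>x. indicator E x * k (x + u) \<partial>lborel) - (\<integral>x. indicator E x * k x \<partial>lborel)\<bar> \<le> C * \<epsilon>"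
  shows "\<bar>(\<integral>x. indicator E x * (f (x + t *\<^sub>R v) - f x) \<partial>lborel) - t * (\<integral>x. indicator E x * dini f v x \<partial>lborel)\<bar>
    \<le> t * (L * norm v * \<epsilon>)"
proof -
  note [measurable] = borel_measurable_dini[OF lip] E(1)
  let ?g = "\<lambda>x s. indicator E x * (indicator {0..t} s * dini f v (x + s *\<^sub>R v))"
  define D where "D = (\<integral>x. indicator E x * dini f v x \<partial>lborel)"
  define J where "J s = (\<integral>x. indicator E x * dini f v (x + s *\<^sub>R v) \<partial>lborel)" for s
  have bd: "\<bar>dini f v x\<bar> \<le> L * norm v" for x by (rule abs_dini_le[OF lip])
  have "integrable (lborel :: ('a \<times> real) measure) (\<lambda>z. indicator (E \<times> {0..t}) z * dini f v (fst z + snd z *\<^sub>R v))"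
  proof (rule bounded_borel_integrable)
    show "E \<times> {0..t} \<in> sets borel" using E(1) by (simp add: borel_Times)
    show "bounded (E \<times> {0..t})" using E(2) by (intro bounded_Times) auto
    show "(\<lambda>z. dini f v (fst z + snd z *\<^sub>R v)) \<in> borel_measurable borel"
      by (rule measurable_compose[OF _ borel_measurable_dini[OF lip]]) (intro borel_measurable_continuous_onI continuous_intros)
    show "\<bar>dini f v (fst z + snd z *\<^sub>R v)\<bar> \<le> L * norm v" for z by (rule bd)
  qed
  then have i: "integrable (lborel \<Otimes>\<^sub>M lborel) (\<lambda>(x, s). ?g x s)"
    unfolding lborel_prod by (simp add: case_prod_beta' indicator_times mult.assoc)
  have "(\<integral>x. indicator E x * (f (x + t *\<^sub>R v) - f x) \<partial>lborel) = (\<integral>x. (\<integral>s. ?g x s \<partial>lborel) \<partial>lborel)"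
    unfolding increment_eq_integral_dini[OF lip t] by simp
  also have "\<dots> = (\<integral>s. (\<integral>x. ?g x s \<partial>lborel) \<partial>lborel)"
    by (rule lborel_pair.Fubini_integral[OF i, symmetric])
  also have "\<dots> = (\<integral>s. indicator {0..t} s * J s \<partial>lborel)"
  proof (rule Bochner_Integration.integral_cong[OF refl])
    fix s show "(\<integral>x. ?g x s \<partial>lborel) = indicator {0..t} s * J s"
      unfolding J_def by (cases "s \<in> {0..t}") auto
  qed
  finally have eq: "(\<integral>x. indicator E x * (f (x + t *\<^sub>R v) - f x) \<partial>lborel) = (\<integral>s. indicator {0..t} s * J s \<partial>lborel)" .
  have i0: "integrable lborel (indicator {0..t} :: real \<Rightarrow> real)"
    by (intro integrable_real_indicator emeasure_bounded_finite) auto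
  have iJ: "integrable lborel (\<lambda>s. indicator {0..t} s * J s)"
  proof -
    have "integrable lborel (\<lambda>s. \<integral>x. ?g x s \<partial>lborel)"
      using lborel_pair.integrable_snd[OF i] by simp
    moreover have "(\<lambda>s. \<integral>x. ?g x s \<partial>lborel) = (\<lambda>s. indicator {0..t} s * J s)"
    proof
      fix s show "(\<integral>x. ?g x s \<partial>lborel) = indicator {0..t} s * J s"
        unfolding J_def by (cases "s \<in> {0..t}") auto
    qed
    ultimately show ?thesis by simp
  qed
  have mt: "measure lborel {0..t} = t" using t by simp
  have "\<bar>(\<integral>s. indicator {0..t} s * J s \<partial>lborel) - t * D\<bar>
      = \<bar>\<integral>s. indicator {0..t} s * J s - indicator {0..t} s * D \<partial>lborel\<bar>"
    using iJ i0 t by simp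
  also have "\<dots> \<le> (\<integral>s. indicator {0..t} s * (L * norm v * \<epsilon>) \<partial>lborel)"
  proof (rule integral_abs_bound[THEN order_trans], rule integral_mono)
    show "integrable lborel (\<lambda>s. \<bar>indicator {0..t} s * J s - indicator {0..t} s * D\<bar>)"
      using iJ i0 by (intro integrable_abs Bochner_Integration.integrable_diff) auto
    show "integrable lborel (\<lambda>s. indicator {0..t} s * (L * norm v * \<epsilon>))" using i0 by auto
    show "\<bar>indicator {0..t} s * J s - indicator {0..t} s * D\<bar> \<le> indicator {0..t} s * (L * norm v * \<epsilon>)" for s
    proof (cases "s \<in> {0..t}")
      case True
      then have "norm (s *\<^sub>R v) \<le> t * norm v" by (auto intro: mult_right_mono)
      from close[OF this borel_measurable_dini[OF lip] bd] True show ?thesis unfolding J_def D_def by simp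
    qed simp
  qed
  also have "\<dots> = t * (L * norm v * \<epsilon>)" using t by simp
  finally show ?thesis unfolding eq D_def .
qed

text \<open>
  Integrals over \<open>E\<close> of the difference quotient with step \<open>t\<close> are approximable because they only
  involve values of \<open>f\<close>, and by \<open>averaged_increment\<close> they approximate the integral of the derivative
  uniformly in \<open>f\<close>.
\<close>

lemma lip_approx_integral_dini:
  fixes E :: "'a::euclidean_space set"
  assumes E: "E \<in> sets borel" "bounded E"
  shows "lip_approx (\<lambda>f. \<integral>x. indicator E x * dini f v x \<partial>lborel)"
proof (rule lip_approx_limit)
  fix \<epsilon> :: real assume e: "\<epsilon> > 0"
  define \<eta> where "\<eta> = \<epsilon> / (norm v + 1)"
  have \<eta>: "\<eta> > 0" unfolding \<eta>_def using e by (intro divide_pos_pos add_nonneg_pos) auto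
  have "m \<ge> 0 \<Longrightarrow> m * (\<epsilon> / (m + 1)) \<le> \<epsilon>" for m :: real
    using e by (simp add: pos_divide_le_eq mult_left_mono mult.commute[of m])
  then have \<eta>e: "norm v * \<eta> \<le> \<epsilon>" unfolding \<eta>_def by simp
  obtain \<delta> where \<delta>: "\<delta> > 0" and close: "\<And>u (k::'a \<Rightarrow> real) C. norm u < \<delta> \<Longrightarrow> k \<in> borel_measurable borel \<Longrightarrow> (\<And>x. \<bar>k x\<bar> \<le> C) \<Longrightarrow>
      \<bar>(\<integral>x. indicator E x * k (x + u) \<partial>lborel) - (\<integral>x. indicator E x * k x \<partial>lborel)\<bar> \<le> C * \<eta>"
    using translate_integral_close[OF E \<eta>] by blast
  define t where "t = \<delta> / (norm v + 1)"
  have t: "t > 0" unfolding t_def using \<delta> by (intro divide_pos_pos add_nonneg_pos) auto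
  have "t * (norm v + 1) = \<delta>" unfolding t_def by (metis add_nonneg_eq_0_iff nonzero_eq_divide_eq norm_ge_zero zero_le_one zero_neq_one)
  then have tv: "t * norm v < \<delta>" using t by (simp add: distrib_left)
  let ?\<psi> = "\<lambda>f. (1 / t) * ((\<integral>x. indicator E x * f (x + t *\<^sub>R v) \<partial>lborel) + (- 1) * (\<integral>x. indicator E x * f (x + 0) \<partial>lborel))"
  have "lip_approx ?\<psi>"
    by (intro lip_approx_cmult lip_approx_add lip_approx_integral E)
  moreover have "\<bar>(\<integral>x. indicator E x * dini f v x \<partial>lborel) - ?\<psi> f\<bar> \<le> \<epsilon> * L" if lip: "L-lipschitz_on UNIV f" for L f
  proof -
    let ?D = "\<integral>x. indicator E x * dini f v x \<partial>lborel" and ?I = "\<integral>x. indicator E x * (f (x + t *\<^sub>R v) - f x) \<partial>lborel"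
    have "?I = (\<integral>x. indicator E x * f (x + t *\<^sub>R v) \<partial>lborel) - (\<integral>x. indicator E x * f (x + 0) \<partial>lborel)"
      using lipschitz_integrable_on_bounded[OF lip E, of "t *\<^sub>R v"] lipschitz_integrable_on_bounded[OF lip E, of 0]
      by (simp add: right_diff_distrib)
    then have p: "?\<psi> f = (1 / t) * ?I" by simp
    have "\<bar>?I - t * ?D\<bar> \<le> t * (L * norm v * \<eta>)"
      by (rule averaged_increment[OF lip less_imp_le[OF t] E]) (use close tv in auto)
    then have "(1 / t) * \<bar>?I - t * ?D\<bar> \<le> (1 / t) * (t * (L * norm v * \<eta>))" using t by (intro mult_left_mono) auto
    also have "(1 / t) * (t * (L * norm v * \<eta>)) = L * (norm v * \<eta>)" using t by simp
    also have "\<dots> \<le> L * \<epsilon>" using \<eta>e lipschitz_on_nonneg[OF lip] by (rule mult_left_mono)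
    also have "(1 / t) * \<bar>?I - t * ?D\<bar> = \<bar>(1 / t) * (?I - t * ?D)\<bar>" using t by (simp add: abs_mult)
    also have "(1 / t) * (?I - t * ?D) = ?\<psi> f - ?D" unfolding p using t by (simp add: right_diff_distrib)
    finally show ?thesis by (simp add: abs_minus_commute mult.commute)
  qed
  ultimately show "\<exists>\<psi>. lip_approx \<psi> \<and> (\<forall>L f. L-lipschitz_on UNIV f \<longrightarrow> \<bar>(\<integral>x. indicator E x * dini f v x \<partial>lborel) - \<psi> f\<bar> \<le> \<epsilon> * L)"
    by blast
qed

lemma integrable_mult_dini:
  fixes f :: "'a::euclidean_space \<Rightarrow> real"
  assumes lip: "L-lipschitz_on UNIV f" and h: "integrable lborel h"
  shows "integrable lborel (\<lambda>x. h x * dini f v x)"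
proof (rule Bochner_Integration.integrable_bound)
  show "integrable lborel (\<lambda>x. h x * (L * norm v))" using h by auto
  show "(\<lambda>x. h x * dini f v x) \<in> borel_measurable lborel"
    using borel_measurable_dini[OF lip] h by auto
  show "AE x in lborel. norm (h x * dini f v x) \<le> norm (h x * (L * norm v))"
    using order_trans[OF abs_dini_le[OF lip] abs_ge_self] by (intro AE_I2) (auto simp: abs_mult intro!: mult_left_mono)
qed

lemma lip_approx_L1_limit:
  fixes h :: "'a::euclidean_space \<Rightarrow> real"
  assumes h: "integrable lborel h" and s: "\<And>i::nat. integrable lborel (s i)"
    and a: "\<And>i. lip_approx (\<lambda>f. \<integral>x. s i x * dini f v x \<partial>lborel)"
    and lim: "(\<lambda>i. \<integral>x. \<bar>h x - s i x\<bar> \<partial>lborel) \<longlonglongrightarrow> 0"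
  shows "lip_approx (\<lambda>f. \<integral>x. h x * dini f v x \<partial>lborel)"
proof (rule lip_approx_limit)
  fix \<epsilon> :: real assume e: "\<epsilon> > 0"
  have "0 < \<epsilon> / (norm v + 1)" using e by (intro divide_pos_pos add_nonneg_pos) auto
  from LIMSEQ_D[OF lim this] obtain i where i: "(\<integral>x. \<bar>h x - s i x\<bar> \<partial>lborel) < \<epsilon> / (norm v + 1)"
    by fastforce
  have m: "m \<ge> 0 \<Longrightarrow> m * (\<epsilon> / (m + 1)) \<le> \<epsilon>" for m :: real
    using e by (simp add: pos_divide_le_eq mult_left_mono mult.commute[of m])
  have "\<bar>(\<integral>x. h x * dini f v x \<partial>lborel) - (\<integral>x. s i x * dini f v x \<partial>lborel)\<bar> \<le> \<epsilon> * L"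
    if lip: "L-lipschitz_on UNIV f" for L f
  proof -
    have L0: "0 \<le> L" using lip by (rule lipschitz_on_nonneg)
    have "\<bar>(\<integral>x. h x * dini f v x \<partial>lborel) - (\<integral>x. s i x * dini f v x \<partial>lborel)\<bar>
        = \<bar>\<integral>x. (h x - s i x) * dini f v x \<partial>lborel\<bar>"
      using integrable_mult_dini[OF lip h] integrable_mult_dini[OF lip s] by (simp add: left_diff_distrib)
    also have "\<dots> \<le> (\<integral>x. \<bar>h x - s i x\<bar> * (L * norm v) \<partial>lborel)"
    proof (rule integral_abs_bound[THEN order_trans], rule integral_mono)
      show "integrable lborel (\<lambda>x. \<bar>(h x - s i x) * dini f v x\<bar>)"
        by (intro integrable_abs integrable_mult_dini[OF lip] Bochner_Integration.integrable_diff h s)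
      show "integrable lborel (\<lambda>x. \<bar>h x - s i x\<bar> * (L * norm v))"
        by (intro integrable_mult_left integrable_abs Bochner_Integration.integrable_diff h s)
      show "\<bar>(h x - s i x) * dini f v x\<bar> \<le> \<bar>h x - s i x\<bar> * (L * norm v)" for x
        unfolding abs_mult by (intro mult_left_mono abs_dini_le[OF lip]) auto
    qed
    also have "\<dots> = (norm v * (\<integral>x. \<bar>h x - s i x\<bar> \<partial>lborel)) * L" by simp
    also have "\<dots> \<le> (norm v * (\<epsilon> / (norm v + 1))) * L"
      using i L0 by (intro mult_right_mono mult_left_mono) auto
    also have "\<dots> \<le> \<epsilon> * L" using m[of "norm v"] L0 by (intro mult_right_mono) auto
    finally show ?thesis .
  qed
  then show "\<exists>\<psi>. lip_approx \<psi> \<and> (\<forall>L f. L-lipschitz_on UNIV f \<longrightarrow> \<bar>(\<integral>x. h x * dini f v x \<partial>lborel) - \<psi> f\<bar> \<le> \<epsilon> * L)"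
    using a by blast
qed

text \<open>
  Simple functions are dense in \<open>L\<^sup>1\<close>, and the derivative is bounded by the Lipschitz constant.
\<close>

theorem lip_approx_L1:
  fixes h :: "'a::euclidean_space \<Rightarrow> real"
  assumes "integrable lborel h"
  shows "lip_approx (\<lambda>f. \<integral>x. h x * dini f v x \<partial>lborel)"
  using assms
proof (induction rule: integrable_induct)
  case (base A c)
  then have [measurable]: "A \<in> sets borel" by simp
  have iA: "integrable lborel (indicator A :: 'a \<Rightarrow> real)" using base by (auto intro!: integrable_real_indicator)
  have "lip_approx (\<lambda>f. \<integral>x. indicator A x * dini f v x \<partial>lborel)"
  proof (rule lip_approx_L1_limit[where s = "\<lambda>i. indicator (A \<inter> ball 0 (real i))"])
    show "integrable lborel (indicator A :: 'a \<Rightarrow> real)" by (rule iA)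
    show "integrable lborel (indicator (A \<inter> ball 0 (real i)) :: 'a \<Rightarrow> real)" for i
      by (intro integrable_real_indicator emeasure_bounded_finite) auto
    show "lip_approx (\<lambda>f. \<integral>x. indicator (A \<inter> ball 0 (real i)) x * dini f v x \<partial>lborel)" for i
      by (rule lip_approx_integral_dini) auto
    have "(\<lambda>i. \<integral>x. \<bar>indicator A x - indicator (A \<inter> ball 0 (real i)) x :: real\<bar> \<partial>lborel) \<longlonglongrightarrow> (\<integral>x. 0 \<partial>(lborel :: 'a measure))"
    proof (rule integral_dominated_convergence[where w = "indicator A"])
      show "AE x in lborel. (\<lambda>i. \<bar>indicator A x - indicator (A \<inter> ball 0 (real i)) x :: real\<bar>) \<longlonglongrightarrow> 0"
      proof (rule AE_I2)
        fix x :: 'a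
        obtain n where n: "norm x < real n" using reals_Archimedean2 by blast
        have "\<bar>indicator A x - indicator (A \<inter> ball 0 (real i)) x :: real\<bar> = 0" if "n \<le> i" for i
          using n that by (auto simp: indicator_def)
        then have "\<forall>\<^sub>F i in sequentially. \<bar>indicator A x - indicator (A \<inter> ball 0 (real i)) x :: real\<bar> = 0"
          unfolding eventually_sequentially by blast
        then show "(\<lambda>i. \<bar>indicator A x - indicator (A \<inter> ball 0 (real i)) x :: real\<bar>) \<longlonglongrightarrow> 0"
          by (rule tendsto_eventually)
      qed
    qed (use iA in \<open>auto simp: indicator_def\<close>)
    then show "(\<lambda>i. \<integral>x. \<bar>indicator A x - indicator (A \<inter> ball 0 (real i)) x :: real\<bar> \<partial>(lborel :: 'a measure)) \<longlonglongrightarrow> 0" by simp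
  qed
  from lip_approx_cmult[OF this, of c] show ?case by (simp add: mult_ac)
next
  case (add f g)
  have "lip_approx (\<lambda>F. (\<integral>x. f x * dini F v x \<partial>lborel) + (\<integral>x. g x * dini F v x \<partial>lborel))"
    by (rule lip_approx_add) (use add in auto)
  moreover have "(\<integral>x. (f x + g x) * dini F v x \<partial>lborel) = (\<integral>x. f x * dini F v x \<partial>lborel) + (\<integral>x. g x * dini F v x \<partial>lborel)"
    if "L-lipschitz_on UNIV F" for L F
    using integrable_mult_dini[OF that add(1)] integrable_mult_dini[OF that add(2)] by (simp add: distrib_right)
  moreover have "0 \<le> \<epsilon> * L" if "\<epsilon> > 0" "L-lipschitz_on UNIV F" for \<epsilon> L and F :: "'a \<Rightarrow> real"
    using that lipschitz_on_nonneg by (intro mult_nonneg_nonneg) auto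
  ultimately show ?case
    by (intro lip_approx_limit exI[of _ "\<lambda>F. (\<integral>x. f x * dini F v x \<partial>lborel) + (\<integral>x. g x * dini F v x \<partial>lborel)"])
       simp
next
  case (lim f s)
  show ?case
  proof (rule lip_approx_L1_limit[OF lim(4) lim(1) lim(5)])
    have "(\<lambda>i. \<integral>x. \<bar>f x - s i x\<bar> \<partial>lborel) \<longlonglongrightarrow> (\<integral>x. 0 \<partial>(lborel :: 'a measure))"
    proof (rule integral_dominated_convergence[where w = "\<lambda>x. 3 * \<bar>f x\<bar>"])
      show "integrable lborel (\<lambda>x. 3 * \<bar>f x\<bar>)" using lim(4) by auto
      show "(\<lambda>x. \<bar>f x - s i x\<bar>) \<in> borel_measurable lborel" for i using lim(1)[of i] lim(4) by auto
      show "AE x in lborel. (\<lambda>i. \<bar>f x - s i x\<bar>) \<longlonglongrightarrow> 0"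
      proof (rule AE_I2)
        fix x
        have "(\<lambda>i. s i x) \<longlonglongrightarrow> f x" using lim(2) by simp
        then have "(\<lambda>i. \<bar>f x - s i x\<bar>) \<longlonglongrightarrow> \<bar>f x - f x\<bar>" by (intro tendsto_intros)
        then show "(\<lambda>i. \<bar>f x - s i x\<bar>) \<longlonglongrightarrow> 0" by simp
      qed
      show "AE x in lborel. norm \<bar>f x - s i x\<bar> \<le> 3 * \<bar>f x\<bar>" for i
      proof (rule AE_I2)
        fix x
        have "\<bar>s i x\<bar> \<le> 2 * \<bar>f x\<bar>" using lim(3)[of x i] by simp
        then show "norm \<bar>f x - s i x\<bar> \<le> 3 * \<bar>f x\<bar>" by simp
      qed
    qed auto
    then show "(\<lambda>i. \<integral>x. \<bar>f x - s i x\<bar> \<partial>lborel) \<longlonglongrightarrow> 0" by simp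
  qed
qed

section \<open>Charts and the metric in coordinates\<close>

abbreviation chart_image :: "('m, 'n) chart \<Rightarrow> (real ^ 'n) set" where
  "chart_image c \<equiv> snd c ` fst c"

definition quad_form :: "real ^ 'n ^ 'n \<Rightarrow> real ^ 'n \<Rightarrow> real" where
  "quad_form G u = (\<Sum>i\<in>UNIV. \<Sum>j\<in>UNIV. u $ i * u $ j * G $ i $ j)"

lemma smooth_onD:
  assumes "smooth_on f S" "open S"
  shows "continuous_on S f"
    and "x \<in> S \<Longrightarrow> (f has_derivative frechet_derivative f (at x)) (at x)"
    and "continuous_on S (\<lambda>x. frechet_derivative f (at x) v)"
proof -
  have "Ck_on 0 f S" using assms(1) unfolding smooth_on_def by blast
  then show "continuous_on S f" by simp
  have 1: "Ck_on (Suc 0) f S" using assms(1) unfolding smooth_on_def by blast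
  then show "continuous_on S (\<lambda>x. frechet_derivative f (at x) v)" by simp
  show "(f has_derivative frechet_derivative f (at x)) (at x)" if "x \<in> S"
  proof -
    have "f differentiable at x within S" using 1 that unfolding Ck_on.simps differentiable_on_def by blast
    then have "f differentiable at x" using at_within_open[OF that assms(2)] by simp
    then show ?thesis by (simp add: frechet_derivative_works)
  qed
qed

locale smooth_manifold =
  fixes A :: "('m::{t2_space, second_countable_topology}, 'n::finite) chart set"
  assumes atlas: "smooth_atlas A"
begin

lemma is_chart: "c \<in> A \<Longrightarrow> is_chart c" using atlas unfolding smooth_atlas_def by blast

lemma chart_cover: obtains c where "c \<in> A" "p \<in> fst c"
  using atlas unfolding smooth_atlas_def by blast

lemma
  assumes "c \<in> A"
  shows open_chart: "open (fst c)" and open_chart_image: "open (chart_image c)"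
    and continuous_chart: "continuous_on (fst c) (snd c)"
    and continuous_chart_inv: "continuous_on (chart_image c) (chart_inv c)"
    and chart_inv_left: "p \<in> fst c \<Longrightarrow> chart_inv c (snd c p) = p"
    and chart_inv_right: "x \<in> chart_image c \<Longrightarrow> snd c (chart_inv c x) = x"
    and chart_inv_mem: "x \<in> chart_image c \<Longrightarrow> chart_inv c x \<in> fst c"
proof -
  have c: "open (fst c)" "open (chart_image c)" "homeomorphism (fst c) (chart_image c) (snd c) (chart_inv c)"
    using is_chart[OF assms] unfolding is_chart_def by auto
  then show "open (fst c)" "open (chart_image c)" "continuous_on (fst c) (snd c)" "continuous_on (chart_image c) (chart_inv c)"
    unfolding homeomorphism_def by blast+
  show "p \<in> fst c \<Longrightarrow> chart_inv c (snd c p) = p" "x \<in> chart_image c \<Longrightarrow> snd c (chart_inv c x) = x"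
    using c(3) unfolding homeomorphism_def by blast+
  show "x \<in> chart_image c \<Longrightarrow> chart_inv c x \<in> fst c" by (rule inv_into_into)
qed

lemma overlap_image:
  assumes "c \<in> A" "open U"
  shows "snd c ` (fst c \<inter> U) = chart_image c \<inter> chart_inv c -` U" and "open (snd c ` (fst c \<inter> U))"
proof -
  show eq: "snd c ` (fst c \<inter> U) = chart_image c \<inter> chart_inv c -` U"
    using chart_inv_left[OF assms(1)] chart_inv_right[OF assms(1)] chart_inv_mem[OF assms(1)]
    by (auto simp: image_iff)
  show "open (snd c ` (fst c \<inter> U))" unfolding eq
    by (rule continuous_open_preimage[OF continuous_chart_inv open_chart_image]) (use assms in auto)
qed

lemma transition_has_derivative:
  assumes "c \<in> A" "c' \<in> A" "p \<in> fst c" "p \<in> fst c'"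
  shows "(transition c c' has_derivative frechet_derivative (transition c c') (at (snd c p))) (at (snd c p))"
proof (rule smooth_onD(2))
  show "smooth_on (transition c c') (snd c ` (fst c \<inter> fst c'))"
    using atlas assms unfolding smooth_atlas_def by blast
  show "open (snd c ` (fst c \<inter> fst c'))" using overlap_image(2) open_chart assms by blast
qed (use assms in auto)

lemma continuous_transition_derivative:
  assumes "c \<in> A" "c' \<in> A"
  shows "continuous_on (snd c ` (fst c \<inter> fst c')) (\<lambda>x. frechet_derivative (transition c c') (at x) u)"
    and "continuous_on (snd c ` (fst c \<inter> fst c')) (transition c c')"
proof -
  have s: "smooth_on (transition c c') (snd c ` (fst c \<inter> fst c'))" "open (snd c ` (fst c \<inter> fst c'))"
    using atlas assms overlap_image(2) open_chart unfolding smooth_atlas_def by blast+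
  show "continuous_on (snd c ` (fst c \<inter> fst c')) (\<lambda>x. frechet_derivative (transition c c') (at x) u)"
    "continuous_on (snd c ` (fst c \<inter> fst c')) (transition c c')"
    using smooth_onD[OF s] by blast+
qed

lemma transition_derivative_compose:
  assumes c: "c \<in> A" "c' \<in> A" "c'' \<in> A" and p: "p \<in> fst c" "p \<in> fst c'" "p \<in> fst c''"
  shows "frechet_derivative (transition c' c'') (at (snd c' p)) (frechet_derivative (transition c c') (at (snd c p)) u)
    = frechet_derivative (transition c c'') (at (snd c p)) u"
proof -
  let ?x = "snd c p"
  have tx: "transition c c' ?x = snd c' p"
    using chart_inv_left[OF c(1) p(1)] by (simp add: transition_def)
  have "(transition c' c'' \<circ> transition c c' has_derivative
      frechet_derivative (transition c' c'') (at (snd c' p)) \<circ> frechet_derivative (transition c c') (at ?x)) (at ?x)"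
    by (rule diff_chain_at[OF transition_has_derivative[OF c(1,2) p(1,2)]])
       (use transition_has_derivative[OF c(2,3) p(2,3)] tx in simp)
  then have "(transition c c'' has_derivative
      frechet_derivative (transition c' c'') (at (snd c' p)) \<circ> frechet_derivative (transition c c') (at ?x)) (at ?x)"
  proof (rule has_derivative_transform_within_open)
    show "open (snd c ` (fst c \<inter> fst c'))" using overlap_image(2) open_chart c by blast
    show "?x \<in> snd c ` (fst c \<inter> fst c')" using p by blast
    fix x assume "x \<in> snd c ` (fst c \<inter> fst c')"
    then obtain q where q: "q \<in> fst c" "q \<in> fst c'" "x = snd c q" by blast
    then show "(transition c' c'' \<circ> transition c c') x = transition c c'' x"
      using chart_inv_left[OF c(1)] chart_inv_left[OF c(2)] by (simp add: transition_def)
  qed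
  from fun_cong[OF has_derivative_unique[OF this transition_has_derivative[OF c(1,3) p(1,3)]], of u]
  show ?thesis by simp
qed

lemma transition_derivative_self:
  assumes "c \<in> A" "p \<in> fst c"
  shows "frechet_derivative (transition c c) (at (snd c p)) u = u"
proof -
  have "((\<lambda>x. x) has_derivative (\<lambda>u. u)) (at (snd c p))" by (rule has_derivative_ident)
  then have "(transition c c has_derivative (\<lambda>u. u)) (at (snd c p))"
  proof (rule has_derivative_transform_within_open)
    show "open (chart_image c)" by (rule open_chart_image[OF assms(1)])
    show "snd c p \<in> chart_image c" using assms(2) by blast
    show "x = transition c c x" if "x \<in> chart_image c" for x
      using chart_inv_right[OF assms(1) that] by (simp add: transition_def)
  qed
  from fun_cong[OF has_derivative_unique[OF this transition_has_derivative[OF assms(1,1) assms(2,2)]], of u]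
  show ?thesis by (rule sym)
qed

lemma coord_vec_self: "c \<in> A \<Longrightarrow> p \<in> fst c \<Longrightarrow> coord_vec A c p u c = u"
  by (simp add: coord_vec_def transition_derivative_self)

lemma coord_vec_mem:
  assumes "c \<in> A" "p \<in> fst c"
  shows "coord_vec A c p u \<in> tangent_space A p"
  unfolding tangent_space_def mem_Collect_eq
proof (intro conjI ballI impI allI)
  fix c1 c2 assume "c1 \<in> A" "c2 \<in> A" "p \<in> fst c1" "p \<in> fst c2"
  then show "coord_vec A c p u c2 = frechet_derivative (transition c1 c2) (at (snd c1 p)) (coord_vec A c p u c1)"
    using transition_derivative_compose[OF assms(1) _ _ assms(2), of c1 c2 u] unfolding coord_vec_def by simp
qed (auto simp: coord_vec_def)

text \<open>
  A tangent vector is a compatible family of coordinate vectors, so one of its entries determines it.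
\<close>

lemma tangent_eq_coord_vec:
  assumes c: "c \<in> A" "p \<in> fst c" and v: "v \<in> tangent_space A p"
  shows "v = coord_vec A c p (v c)"
proof
  fix c'
  show "v c' = coord_vec A c p (v c) c'"
  proof (cases "c' \<in> A \<and> p \<in> fst c'")
    case True
    then have "v c' = frechet_derivative (transition c c') (at (snd c p)) (v c)"
      using v c unfolding tangent_space_def by blast
    then show ?thesis unfolding coord_vec_def if_P[OF True] .
  next
    case False
    then have "v c' = 0" using v unfolding tangent_space_def by blast
    then show ?thesis unfolding coord_vec_def if_not_P[OF False] .
  qed
qed

lemma coord_vec_change:
  assumes "c \<in> A" "c' \<in> A" "p \<in> fst c" "p \<in> fst c'"
  shows "coord_vec A c p u = coord_vec A c' p (frechet_derivative (transition c c') (at (snd c p)) u)"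
proof
  fix c'' show "coord_vec A c p u c'' = coord_vec A c' p (frechet_derivative (transition c c') (at (snd c p)) u) c''"
    using transition_derivative_compose[OF assms(1,2) _ assms(3,4), of c'' u] unfolding coord_vec_def by simp
qed

lemma linear_transition_derivative:
  assumes "c \<in> A" "c' \<in> A" "p \<in> fst c" "p \<in> fst c'"
  shows "linear (frechet_derivative (transition c c') (at (snd c p)))"
  using transition_has_derivative[OF assms] by (rule has_derivative_linear)

lemma coord_vec_lincomb:
  assumes "c \<in> A" "p \<in> fst c"
  shows "coord_vec A c p (a *\<^sub>R u + b *\<^sub>R v) = (\<lambda>c'. a *\<^sub>R coord_vec A c p u c' + b *\<^sub>R coord_vec A c p v c')"
proof
  fix c' show "coord_vec A c p (a *\<^sub>R u + b *\<^sub>R v) c' = a *\<^sub>R coord_vec A c p u c' + b *\<^sub>R coord_vec A c p v c'"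
  proof (cases "c' \<in> A \<and> p \<in> fst c'")
    case True
    then have "linear (frechet_derivative (transition c c') (at (snd c p)))"
      using linear_transition_derivative assms by blast
    then show ?thesis using True by (simp add: coord_vec_def linear_add linear_scale)
  qed (auto simp: coord_vec_def)
qed

lemma coord_vec_zero:
  assumes "c \<in> A" "p \<in> fst c"
  shows "coord_vec A c p u = (\<lambda>_. 0) \<longleftrightarrow> u = 0"
proof
  assume "coord_vec A c p u = (\<lambda>_. 0)"
  then show "u = 0" using coord_vec_self[OF assms, of u] by metis
next
  assume "u = 0"
  then show "coord_vec A c p u = (\<lambda>_. 0)" using coord_vec_lincomb[OF assms, of 0 0 0 0] by simp
qed

lemma linear_covector:
  assumes "\<omega> \<in> cotangent_space A p" "c \<in> A" "p \<in> fst c"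
  shows "linear (\<lambda>u. \<omega> (coord_vec A c p u))"
proof (rule linearI)
  have *: "\<omega> (coord_vec A c p (a *\<^sub>R u + b *\<^sub>R v)) = a * \<omega> (coord_vec A c p u) + b * \<omega> (coord_vec A c p v)" for a b u v
    using assms(1) coord_vec_mem[OF assms(2,3)] unfolding cotangent_space_def coord_vec_lincomb[OF assms(2,3)] by blast
  show "\<omega> (coord_vec A c p (u + v)) = \<omega> (coord_vec A c p u) + \<omega> (coord_vec A c p v)" for u v
    using *[of 1 u 1 v] by simp
  show "\<omega> (coord_vec A c p (r *\<^sub>R u)) = r *\<^sub>R \<omega> (coord_vec A c p u)" for r u
    using *[of r u 0 0] by simp
qed

end

lemma linear_axis_expansion:
  fixes \<phi> :: "real ^ 'n::finite \<Rightarrow> real"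
  assumes "linear \<phi>"
  shows "\<phi> u = (\<Sum>i\<in>UNIV. u $ i * \<phi> (axis i 1))"
proof -
  have "u = (\<Sum>i\<in>UNIV. (u $ i) *\<^sub>R axis i 1)"
    by (simp add: basis_expansion scalar_mult_eq_scaleR[symmetric])
  then have "\<phi> u = \<phi> (\<Sum>i\<in>UNIV. (u $ i) *\<^sub>R axis i 1)" by simp
  also have "\<dots> = (\<Sum>i\<in>UNIV. u $ i * \<phi> (axis i 1))"
    by (simp add: linear_sum[OF assms] linear_scale[OF assms])
  finally show ?thesis .
qed

lemma continuous_quad_form:
  assumes "continuous_on S G" "continuous_on S u"
  shows "continuous_on S (\<lambda>x. quad_form (G x) (u x))"
  unfolding quad_form_def by (intro continuous_intros assms)

lemma quad_form_scale: "quad_form G (r *\<^sub>R u) = r\<^sup>2 * quad_form G u"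
  unfolding quad_form_def sum_distrib_left by (simp add: power2_eq_square mult_ac)

locale riemannian_manifold = smooth_manifold A
  for A :: "('m::{t2_space, second_countable_topology}, 'n::finite) chart set" +
  fixes g :: "('m, 'n) metric_tensor"
  assumes metric: "riemannian_metric A g"
begin

lemma metric_symmetric: "v \<in> tangent_space A p \<Longrightarrow> w \<in> tangent_space A p \<Longrightarrow> g p v w = g p w v"
  and metric_positive: "v \<in> tangent_space A p \<Longrightarrow> v \<noteq> (\<lambda>_. 0) \<Longrightarrow> 0 < g p v v"
  and metric_lincomb: "v \<in> tangent_space A p \<Longrightarrow> w \<in> tangent_space A p \<Longrightarrow> u \<in> tangent_space A p \<Longrightarrow>
    g p (\<lambda>c. a *\<^sub>R v c + b *\<^sub>R w c) u = a * g p v u + b * g p w u"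
  using metric unfolding riemannian_metric_def by blast+

lemma continuous_gram: "c \<in> A \<Longrightarrow> continuous_on (chart_image c) (gram_matrix A g c)"
  using metric smooth_onD(1)[OF _ open_chart_image] unfolding riemannian_metric_def by blast

lemma metric_linear:
  assumes c: "c \<in> A" "p \<in> fst c" and w: "w \<in> tangent_space A p"
  shows "linear (\<lambda>u. g p (coord_vec A c p u) w)"
proof (rule linearI)
  have *: "g p (coord_vec A c p (a *\<^sub>R u + b *\<^sub>R v)) w = a * g p (coord_vec A c p u) w + b * g p (coord_vec A c p v) w" for a b u v
    unfolding coord_vec_lincomb[OF c] using metric_lincomb[OF coord_vec_mem[OF c] coord_vec_mem[OF c] w] .
  show "g p (coord_vec A c p (u + v)) w = g p (coord_vec A c p u) w + g p (coord_vec A c p v) w" for u v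
    using *[of 1 u 1 v] by simp
  show "g p (coord_vec A c p (r *\<^sub>R u)) w = r *\<^sub>R g p (coord_vec A c p u) w" for r u
    using *[of r u 0 0] by simp
qed

lemma metric_eq_gram:
  assumes c: "c \<in> A" "p \<in> fst c"
  shows "g p (coord_vec A c p u) (coord_vec A c p w)
    = (\<Sum>i\<in>UNIV. \<Sum>j\<in>UNIV. u $ i * w $ j * gram_matrix A g c (snd c p) $ i $ j)"
proof -
  note m = coord_vec_mem[OF c]
  have "g p (coord_vec A c p u) (coord_vec A c p w) = (\<Sum>i\<in>UNIV. u $ i * g p (coord_vec A c p (axis i 1)) (coord_vec A c p w))"
    by (rule linear_axis_expansion[OF metric_linear[OF c m]])
  also have "\<dots> = (\<Sum>i\<in>UNIV. u $ i * g p (coord_vec A c p w) (coord_vec A c p (axis i 1)))"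
    by (intro sum.cong refl arg_cong2[where f = "(*)"] metric_symmetric m)
  also have "\<dots> = (\<Sum>i\<in>UNIV. u $ i * (\<Sum>j\<in>UNIV. w $ j * g p (coord_vec A c p (axis j 1)) (coord_vec A c p (axis i 1))))"
    by (subst linear_axis_expansion[OF metric_linear[OF c m], of w]) simp
  also have "\<dots> = (\<Sum>i\<in>UNIV. \<Sum>j\<in>UNIV. u $ i * w $ j * gram_matrix A g c (snd c p) $ i $ j)"
    unfolding sum_distrib_left gram_matrix_def chart_inv_left[OF c] using metric_symmetric[OF m m]
    by (simp add: mult.assoc)
  finally show ?thesis .
qed

lemma tnorm_coord_vec:
  assumes "c \<in> A" "p \<in> fst c"
  shows "tnorm g p (coord_vec A c p u) = sqrt (quad_form (gram_matrix A g c (snd c p)) u)"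
  unfolding tnorm_def metric_eq_gram[OF assms] quad_form_def ..

lemma quad_form_pos:
  assumes c: "c \<in> A" "x \<in> chart_image c" and "u \<noteq> 0"
  shows "0 < quad_form (gram_matrix A g c x) u"
proof -
  let ?p = "chart_inv c x"
  have p: "?p \<in> fst c" "snd c ?p = x" using c chart_inv_mem chart_inv_right by blast+
  have "0 < g ?p (coord_vec A c ?p u) (coord_vec A c ?p u)"
    using metric_positive[OF coord_vec_mem[OF c(1) p(1)]] coord_vec_zero[OF c(1) p(1)] \<open>u \<noteq> 0\<close> by blast
  then show ?thesis using metric_eq_gram[OF c(1) p(1), of u u] p(2) unfolding quad_form_def by simp
qed

lemma quad_form_nonneg: "c \<in> A \<Longrightarrow> x \<in> chart_image c \<Longrightarrow> 0 \<le> quad_form (gram_matrix A g c x) u"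
  using quad_form_pos[of c x u] by (cases "u = 0") (auto simp: quad_form_def)

lemma tnorm_nonneg: assumes "v \<in> tangent_space A p" shows "0 \<le> tnorm g p v"
proof -
  obtain c where c: "c \<in> A" "p \<in> fst c" using chart_cover by blast
  have "tnorm g p (coord_vec A c p (v c)) \<ge> 0"
    unfolding tnorm_coord_vec[OF c] using quad_form_nonneg c by auto
  then show ?thesis using tangent_eq_coord_vec[OF c assms] by simp
qed

text \<open>
  The metric norm of Euclidean unit vectors over \<open>K\<close> is continuous and positive on a compact set.
\<close>

lemma compact_metric_bounds:
  assumes c: "c \<in> A" and K: "compact K" "K \<subseteq> chart_image c"
  obtains m C where "0 < m" "0 < C"
    "\<And>x u. x \<in> K \<Longrightarrow> m * norm u \<le> sqrt (quad_form (gram_matrix A g c x) u)"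
    "\<And>x u. x \<in> K \<Longrightarrow> sqrt (quad_form (gram_matrix A g c x) u) \<le> C * norm u"
proof (cases "K = {}")
  case True
  then show ?thesis using that[of 1 1] by simp
next
  case False
  let ?q = "\<lambda>z. sqrt (quad_form (gram_matrix A g c (fst z)) (snd z))"
  let ?S = "K \<times> sphere (0 :: real ^ 'n) 1"
  have "axis undefined 1 \<in> sphere (0 :: real ^ 'n) 1" by simp
  then have ne: "?S \<noteq> {}" using False by blast
  have cpt: "compact ?S" using K(1) by (intro compact_Times compact_sphere)
  have cont: "continuous_on ?S ?q"
    by (intro continuous_on_real_sqrt continuous_quad_form continuous_on_compose2[OF continuous_gram[OF c], of _ fst])
       (use K(2) in \<open>auto intro!: continuous_intros\<close>)
  obtain z0 where z0: "z0 \<in> ?S" "\<And>z. z \<in> ?S \<Longrightarrow> ?q z0 \<le> ?q z" using continuous_attains_inf[OF cpt ne cont] by blast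
  obtain z1 where z1: "z1 \<in> ?S" "\<And>z. z \<in> ?S \<Longrightarrow> ?q z \<le> ?q z1" using continuous_attains_sup[OF cpt ne cont] by blast
  have scale: "sqrt (quad_form G u) = norm u * sqrt (quad_form G ((1 / norm u) *\<^sub>R u))" if "u \<noteq> 0" for G and u :: "real ^ 'n"
  proof -
    have "u = norm u *\<^sub>R ((1 / norm u) *\<^sub>R u)" using that by simp
    then have "quad_form G u = (norm u)\<^sup>2 * quad_form G ((1 / norm u) *\<^sub>R u)" using quad_form_scale by metis
    then show ?thesis by (simp add: real_sqrt_mult)
  qed
  have pos: "?q z > 0" if "z \<in> ?S" for z
  proof -
    have "fst z \<in> chart_image c" "snd z \<noteq> 0" using that K(2) by auto
    then show ?thesis using quad_form_pos[OF c] by simp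
  qed
  show ?thesis
  proof (rule that[OF pos[OF z0(1)] pos[OF z1(1)]])
    fix x and u :: "real ^ 'n" assume x: "x \<in> K"
    show "?q z0 * norm u \<le> sqrt (quad_form (gram_matrix A g c x) u)"
    proof (cases "u = 0")
      case False
      then have "(x, (1 / norm u) *\<^sub>R u) \<in> ?S" using x by simp
      from z0(2)[OF this] show ?thesis unfolding scale[OF False] by (simp add: mult.commute mult_left_mono)
    qed (simp add: quad_form_def)
    show "sqrt (quad_form (gram_matrix A g c x) u) \<le> ?q z1 * norm u"
    proof (cases "u = 0")
      case False
      then have "(x, (1 / norm u) *\<^sub>R u) \<in> ?S" using x by simp
      from z1(2)[OF this] show ?thesis unfolding scale[OF False] by (simp add: mult.commute mult_left_mono)
    qed (simp add: quad_form_def)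
  qed
qed

end

section \<open>Curves in charts\<close>

text \<open>
  A point of the unit interval lies in a gap of the subdivision \<open>S\<close>. An inner point of \<open>S\<close> borders two
  gaps, whence a version for the gap to the left and one for the gap to the right.
\<close>

lemma consecutive_points:
  fixes S :: "real set"
  assumes S: "finite S" "{0, 1} \<subseteq> S" "S \<subseteq> {0..1}"
  shows "0 < x \<Longrightarrow> x \<le> 1 \<Longrightarrow> \<exists>a\<in>S. \<exists>b\<in>S. a < x \<and> x \<le> b \<and> {a<..<b} \<inter> S = {}"
    and "0 \<le> x \<Longrightarrow> x < 1 \<Longrightarrow> \<exists>a\<in>S. \<exists>b\<in>S. a \<le> x \<and> x < b \<and> {a<..<b} \<inter> S = {}"
proof -
  have gap: "{Max P<..<Min Q} \<inter> S = {}" if "finite P" "finite Q" "S = P \<union> Q" for P Q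
  proof (rule ccontr)
    assume "\<not> ?thesis"
    then obtain r where r: "Max P < r" "r < Min Q" "r \<in> S" by auto
    from r(3) that(3) consider "r \<in> P" | "r \<in> Q" by blast
    then show False
    proof cases
      case 1 then show False using Max_ge[OF that(1)] r(1) by force
    next
      case 2 then show False using Min_le[OF that(2)] r(2) by force
    qed
  qed
  show "\<exists>a\<in>S. \<exists>b\<in>S. a < x \<and> x \<le> b \<and> {a<..<b} \<inter> S = {}" if "0 < x" "x \<le> 1"
  proof -
    let ?P = "{s \<in> S. s < x}" and ?Q = "{s \<in> S. x \<le> s}"
    have fin: "finite ?P" "finite ?Q" using S(1) by auto
    have "0 \<in> ?P" "1 \<in> ?Q" using S(2) that by auto
    then have m: "Max ?P \<in> ?P" "Min ?Q \<in> ?Q" using Max_in[OF fin(1)] Min_in[OF fin(2)] by blast+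
    have "S = ?P \<union> ?Q" by auto
    from gap[OF fin this] m show ?thesis by blast
  qed
  show "\<exists>a\<in>S. \<exists>b\<in>S. a \<le> x \<and> x < b \<and> {a<..<b} \<inter> S = {}" if "0 \<le> x" "x < 1"
  proof -
    let ?P = "{s \<in> S. s \<le> x}" and ?Q = "{s \<in> S. x < s}"
    have fin: "finite ?P" "finite ?Q" using S(1) by auto
    have "0 \<in> ?P" "1 \<in> ?Q" using S(2) that by auto
    then have m: "Max ?P \<in> ?P" "Min ?Q \<in> ?Q" using Max_in[OF fin(1)] Min_in[OF fin(2)] by blast+
    have "S = ?P \<union> ?Q" by auto
    from gap[OF fin this] m show ?thesis by blast
  qed
qed

lemma at_within_relatively_open:
  fixes t :: real
  assumes "open V" "t \<in> V" "t \<in> S" "S \<inter> V \<subseteq> T" "T \<subseteq> S"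
  shows "at t within T = at t within S"
proof (rule at_within_nhd[OF assms(2,1)])
  show "T \<inter> V - {t} = S \<inter> V - {t}" using assms by blast
qed

context smooth_manifold
begin

lemma chart_change_along_curve:
  assumes c: "c \<in> A" "c' \<in> A" and t: "\<gamma> t \<in> fst c" "\<gamma> t \<in> fst c'" "t \<in> S"
    and nbhd: "open V" "t \<in> V" "\<And>s. s \<in> S \<inter> V \<Longrightarrow> \<gamma> s \<in> fst c"
    and der: "((snd c \<circ> \<gamma>) has_vector_derivative w) (at t within S)"
  shows "((snd c' \<circ> \<gamma>) has_vector_derivative frechet_derivative (transition c c') (at (snd c (\<gamma> t))) w) (at t within S)"
proof -
  let ?D = "frechet_derivative (transition c c') (at (snd c (\<gamma> t)))"
  have "(transition c c' has_derivative ?D) (at ((snd c \<circ> \<gamma>) t))"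
    using transition_has_derivative[OF c t(1,2)] by simp
  then have "((transition c c' \<circ> (snd c \<circ> \<gamma>)) has_derivative ?D \<circ> (\<lambda>h. h *\<^sub>R w)) (at t within S)"
    by (rule diff_chain_within[OF der[unfolded has_vector_derivative_def] has_derivative_at_withinI])
  moreover have "?D \<circ> (\<lambda>h. h *\<^sub>R w) = (\<lambda>h. h *\<^sub>R ?D w)"
    by (rule ext) (simp add: linear_scale[OF linear_transition_derivative[OF c t(1,2)]])
  ultimately have "((transition c c' \<circ> (snd c \<circ> \<gamma>)) has_vector_derivative ?D w) (at t within S)"
    unfolding has_vector_derivative_def by simp
  then have "((transition c c' \<circ> (snd c \<circ> \<gamma>)) has_vector_derivative ?D w) (at t within S \<inter> V)"
    by (rule has_vector_derivative_within_subset) simp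
  then have "((snd c' \<circ> \<gamma>) has_vector_derivative ?D w) (at t within S \<inter> V)"
  proof (rule has_vector_derivative_transform[rotated 2])
    show "t \<in> S \<inter> V" using t nbhd by blast
    show "(snd c' \<circ> \<gamma>) s = (transition c c' \<circ> (snd c \<circ> \<gamma>)) s" if "s \<in> S \<inter> V" for s
      using chart_inv_left[OF c(1) nbhd(3)[OF that]] by (simp add: transition_def)
  qed
  then show ?thesis
    unfolding at_within_relatively_open[OF nbhd(1,2) t(3) order_refl Int_lower1] .
qed

lemma velocity_eq_coord_vec:
  assumes c: "c \<in> A" "\<gamma> t \<in> fst c" and cont: "isCont \<gamma> t"
    and der: "((snd c \<circ> \<gamma>) has_vector_derivative w) (at t)"
  shows "velocity A \<gamma> t = coord_vec A c (\<gamma> t) w"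
proof
  fix c' show "velocity A \<gamma> t c' = coord_vec A c (\<gamma> t) w c'"
  proof (cases "c' \<in> A \<and> \<gamma> t \<in> fst c'")
    case True
    obtain V where V: "open V" "t \<in> V" "\<And>s. s \<in> V \<Longrightarrow> \<gamma> s \<in> fst c"
      using cont[unfolded continuous_at_open, THEN spec, of "fst c"] open_chart[OF c(1)] c(2) by metis
    have "((snd c' \<circ> \<gamma>) has_vector_derivative frechet_derivative (transition c c') (at (snd c (\<gamma> t))) w) (at t within UNIV)"
      by (rule chart_change_along_curve[where \<gamma> = \<gamma> and t = t, OF c(1) _ c(2) _ _ V(1,2)]) (simp_all add: True V(3) der)
    then have "vector_derivative (snd c' \<circ> \<gamma>) (at t) = frechet_derivative (transition c c') (at (snd c (\<gamma> t))) w"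
      by (rule vector_derivative_at)
    then show ?thesis unfolding velocity_def coord_vec_def if_P[OF True] .
  next
    case False
    then show ?thesis unfolding velocity_def coord_vec_def by (simp only: if_False)
  qed
qed

lemma C1_curve_piece:
  assumes \<gamma>: "C1_curve A a b \<gamma>" and c: "c \<in> A" and st: "a \<le> s" "s < t" "t \<le> b"
    and im: "\<And>\<tau>. \<tau> \<in> {s..t} \<Longrightarrow> \<gamma> \<tau> \<in> fst c"
  obtains w where "continuous_on {s..t} w"
    "\<And>\<tau>. \<tau> \<in> {s..t} \<Longrightarrow> ((snd c \<circ> \<gamma>) has_vector_derivative w \<tau>) (at \<tau> within {s..t})"
    "\<And>\<tau>. \<tau> \<in> {s<..<t} \<Longrightarrow> velocity A \<gamma> \<tau> = coord_vec A c (\<gamma> \<tau>) (w \<tau>)"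
proof -
  define T where "T = {t \<in> {a..b}. \<gamma> t \<in> fst c}"
  have sub: "{s..t} \<subseteq> T" "{s..t} \<subseteq> {a..b}" using st im unfolding T_def by auto
  obtain w where w: "continuous_on T w" "\<And>\<tau>. \<tau> \<in> T \<Longrightarrow> ((snd c \<circ> \<gamma>) has_vector_derivative w \<tau>) (at \<tau> within T)"
    using \<gamma> c unfolding C1_curve_def T_def Let_def by blast
  have d: "((snd c \<circ> \<gamma>) has_vector_derivative w \<tau>) (at \<tau> within {s..t})" if "\<tau> \<in> {s..t}" for \<tau>
    using has_vector_derivative_within_subset[OF w(2) sub(1)] that sub by blast
  show ?thesis
  proof (rule that[OF continuous_on_subset[OF w(1) sub(1)] d])
    fix \<tau> assume \<tau>: "\<tau> \<in> {s<..<t}"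
    then have \<tau>': "\<tau> \<in> {s..t}" by simp
    have at: "at \<tau> within {s..t} = at \<tau>" using \<tau> by (intro at_within_interior) simp
    have "continuous_on {s..t} \<gamma>" using \<gamma> sub(2) unfolding C1_curve_def by (blast intro: continuous_on_subset)
    then have "isCont \<gamma> \<tau>" using \<tau>' at unfolding continuous_on_eq_continuous_within by metis
    then show "velocity A \<gamma> \<tau> = coord_vec A c (\<gamma> \<tau>) (w \<tau>)"
      using velocity_eq_coord_vec[of c \<gamma> \<tau>, OF c im[OF \<tau>']] d[OF \<tau>'] at by simp
  qed
qed

text \<open>
  A curve that is continuously differentiable in one chart is so in all charts, by the chain rule for
  the transition maps.
\<close>

lemma C1_curve_chart:
  assumes c: "c \<in> A" and w: "continuous_on {a..b} w"
    and der: "\<And>t. t \<in> {a..b} \<Longrightarrow> (\<eta> has_vector_derivative w t) (at t within {a..b})"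
    and im: "\<And>t. t \<in> {a..b} \<Longrightarrow> \<eta> t \<in> chart_image c"
    and \<gamma>: "\<And>t. t \<in> {a..b} \<Longrightarrow> \<gamma> t = chart_inv c (\<eta> t)"
  shows "C1_curve A a b \<gamma>"
proof -
  have \<eta>c: "continuous_on {a..b} \<eta>"
    using der has_vector_derivative_continuous unfolding continuous_on_eq_continuous_within by blast
  have mem: "\<gamma> t \<in> fst c" "snd c (\<gamma> t) = \<eta> t" if "t \<in> {a..b}" for t
    using chart_inv_mem[OF c im[OF that]] chart_inv_right[OF c im[OF that]] \<gamma>[OF that] by simp_all
  have \<gamma>c: "continuous_on {a..b} \<gamma>"
  proof (rule continuous_on_eq)
    show "continuous_on {a..b} (\<lambda>t. chart_inv c (\<eta> t))"
      by (rule continuous_on_compose2[OF continuous_chart_inv[OF c] \<eta>c]) (use im in auto)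
  qed (use \<gamma> in simp)
  have derc: "((snd c \<circ> \<gamma>) has_vector_derivative w t) (at t within {a..b})" if "t \<in> {a..b}" for t
    by (rule has_vector_derivative_transform[OF that _ der[OF that]]) (use mem in auto)
  have "\<exists>\<gamma>'. continuous_on T \<gamma>' \<and> (\<forall>t\<in>T. ((snd c' \<circ> \<gamma>) has_vector_derivative \<gamma>' t) (at t within T))"
    if c': "c' \<in> A" and T: "T = {t \<in> {a..b}. \<gamma> t \<in> fst c'}" for c' T
  proof (intro exI conjI ballI)
    let ?D = "\<lambda>t. frechet_derivative (transition c c') (at (snd c (\<gamma> t)))"
    have Tab: "T \<subseteq> {a..b}" unfolding T by blast
    have lin: "linear (?D t)" if "t \<in> T" for t
      using linear_transition_derivative[OF c c'] mem(1) that Tab unfolding T by blast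
    have exp: "?D t (w t) = (\<Sum>i\<in>UNIV. (w t $ i) *\<^sub>R ?D t (axis i 1))" if "t \<in> T" for t
    proof -
      have "w t = (\<Sum>i\<in>UNIV. (w t $ i) *\<^sub>R axis i 1)"
        by (simp add: basis_expansion scalar_mult_eq_scaleR[symmetric])
      then have "?D t (w t) = ?D t (\<Sum>i\<in>UNIV. (w t $ i) *\<^sub>R axis i 1)" by simp
      also have "\<dots> = (\<Sum>i\<in>UNIV. (w t $ i) *\<^sub>R ?D t (axis i 1))"
        by (simp add: linear_sum[OF lin[OF that]] linear_scale[OF lin[OF that]])
      finally show ?thesis .
    qed
    have cD: "continuous_on T (\<lambda>t. ?D t u)" for u
    proof (rule continuous_on_compose2[OF continuous_transition_derivative(1)[OF c c']])
      show "continuous_on T (\<lambda>t. snd c (\<gamma> t))"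
        using continuous_on_subset[OF \<eta>c Tab] mem(2) Tab by (subst continuous_on_cong[of T T _ \<eta>]) auto
      show "(\<lambda>t. snd c (\<gamma> t)) ` T \<subseteq> snd c ` (fst c \<inter> fst c')" using mem(1) Tab unfolding T by blast
    qed
    have "continuous_on T (\<lambda>t. \<Sum>i\<in>UNIV. (w t $ i) *\<^sub>R ?D t (axis i 1))"
      by (intro continuous_intros cD continuous_on_subset[OF w Tab])
    then show "continuous_on T (\<lambda>t. ?D t (w t))" using exp by (subst continuous_on_cong[OF refl exp]) auto
    fix t assume t: "t \<in> T"
    then have tab: "t \<in> {a..b}" using Tab by blast
    have "((snd c' \<circ> \<gamma>) has_vector_derivative ?D t (w t)) (at t within {a..b})"
      by (rule chart_change_along_curve[where \<gamma> = \<gamma> and t = t, OF c c' mem(1)[OF tab] _ tab open_UNIV UNIV_I])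
         (use t derc[OF tab] mem(1) in \<open>auto simp: T\<close>)
    then show "((snd c' \<circ> \<gamma>) has_vector_derivative ?D t (w t)) (at t within T)"
      by (rule has_vector_derivative_within_subset[OF _ Tab])
  qed
  then show ?thesis unfolding C1_curve_def Let_def using \<gamma>c by blast
qed

lemma C1_curve_cong:
  assumes "C1_curve A a b \<gamma>" and eq: "\<And>t. t \<in> {a..b} \<Longrightarrow> \<gamma>' t = \<gamma> t"
  shows "C1_curve A a b \<gamma>'"
  unfolding C1_curve_def Let_def
proof (intro conjI ballI)
  show "continuous_on {a..b} \<gamma>'"
    using assms(1) eq continuous_on_cong[OF refl, of "{a..b}" \<gamma>' \<gamma>] unfolding C1_curve_def by blast
  fix c assume "c \<in> A"
  have T: "{t \<in> {a..b}. \<gamma>' t \<in> fst c} = {t \<in> {a..b}. \<gamma> t \<in> fst c}" (is "?T' = ?T") using eq by auto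
  obtain w where w: "continuous_on ?T w" "\<And>\<tau>. \<tau> \<in> ?T \<Longrightarrow> ((snd c \<circ> \<gamma>) has_vector_derivative w \<tau>) (at \<tau> within ?T)"
    using assms(1) \<open>c \<in> A\<close> unfolding C1_curve_def Let_def by blast
  have "((snd c \<circ> \<gamma>') has_vector_derivative w \<tau>) (at \<tau> within ?T)" if "\<tau> \<in> ?T" for \<tau>
    by (rule has_vector_derivative_transform[OF that _ w(2)[OF that]]) (use eq in auto)
  then show "\<exists>\<gamma>''. continuous_on ?T' \<gamma>'' \<and> (\<forall>t\<in>?T'. ((snd c \<circ> \<gamma>') has_vector_derivative \<gamma>'' t) (at t within ?T'))"
    unfolding T using w(1) by blast
qed

lemma C1_curve_double_speed:
  assumes "C1_curve A (2 * a) (2 * b) \<gamma>"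
  shows "C1_curve A a b (\<lambda>t. \<gamma> (2 * t))"
  unfolding C1_curve_def Let_def
proof (intro conjI ballI)
  have "continuous_on {2 * a..2 * b} \<gamma>" using assms unfolding C1_curve_def by blast
  then show "continuous_on {a..b} (\<lambda>t. \<gamma> (2 * t))"
    by (rule continuous_on_compose2) (auto intro!: continuous_intros)
  fix c assume "c \<in> A"
  let ?T = "{t \<in> {2 * a..2 * b}. \<gamma> t \<in> fst c}" and ?T' = "{t \<in> {a..b}. \<gamma> (2 * t) \<in> fst c}"
  obtain w where w: "continuous_on ?T w" "\<And>\<tau>. \<tau> \<in> ?T \<Longrightarrow> ((snd c \<circ> \<gamma>) has_vector_derivative w \<tau>) (at \<tau> within ?T)"
    using assms \<open>c \<in> A\<close> unfolding C1_curve_def Let_def by blast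
  have sub: "(\<lambda>t. 2 * t) ` ?T' \<subseteq> ?T" by auto
  show "\<exists>\<gamma>'. continuous_on ?T' \<gamma>' \<and> (\<forall>t\<in>?T'. ((snd c \<circ> (\<lambda>t. \<gamma> (2 * t))) has_vector_derivative \<gamma>' t) (at t within ?T'))"
  proof (intro exI conjI ballI)
    show "continuous_on ?T' (\<lambda>t. 2 *\<^sub>R w (2 * t))"
      by (intro continuous_on_scaleR continuous_on_const continuous_on_compose2[OF w(1) _ sub]) (auto intro!: continuous_intros)
    fix t assume t: "t \<in> ?T'"
    have "((\<lambda>t. 2 * t) has_vector_derivative 2) (at t within ?T')"
      by (auto intro!: derivative_eq_intros)
    moreover have "((snd c \<circ> \<gamma>) has_vector_derivative w (2 * t)) (at (2 * t) within (\<lambda>t. 2 * t) ` ?T')"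
      by (rule has_vector_derivative_within_subset[OF w(2) sub]) (use t in auto)
    ultimately have "((snd c \<circ> \<gamma>) \<circ> (\<lambda>t. 2 * t) has_vector_derivative 2 *\<^sub>R w (2 * t)) (at t within ?T')"
      by (rule vector_diff_chain_within)
    then show "((snd c \<circ> (\<lambda>t. \<gamma> (2 * t))) has_vector_derivative 2 *\<^sub>R w (2 * t)) (at t within ?T')"
      by (simp add: comp_def)
  qed
qed

lemma segment_has_derivative:
  "((\<lambda>t::real. x + (r * t + s) *\<^sub>R (v :: real ^ 'k)) has_vector_derivative r *\<^sub>R v) (at t within S)"
  by (auto intro!: derivative_eq_intros)

lemma segment_point: "t \<in> {0..1} \<Longrightarrow> x + t *\<^sub>R (y - x) \<in> closed_segment x (y :: real ^ 'k)"
  unfolding closed_segment_def by (auto intro!: exI[of _ t] simp: algebra_simps)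

lemma C1_chart_segment:
  assumes c: "c \<in> A" and seg: "closed_segment x y \<subseteq> chart_image c"
    and rs: "\<And>t. t \<in> {a..b} \<Longrightarrow> r * t + s \<in> {0..1}"
  shows "C1_curve A a b (\<lambda>t. chart_inv c (x + (r * t + s) *\<^sub>R (y - x)))"
proof (rule C1_curve_chart[OF c _ segment_has_derivative])
  show "x + (r * t + s) *\<^sub>R (y - x) \<in> chart_image c" if "t \<in> {a..b}" for t
    using segment_point[OF rs[OF that]] seg by blast
qed auto

lemma piecewise_C1_curveE:
  assumes "piecewise_C1_curve A \<gamma>"
  obtains S where "finite S" "{0, 1} \<subseteq> S" "S \<subseteq> {0..1}"
    "\<And>a b. a \<in> S \<Longrightarrow> b \<in> S \<Longrightarrow> a < b \<Longrightarrow> {a<..<b} \<inter> S = {} \<Longrightarrow> C1_curve A a b \<gamma>"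
proof -
  from assms obtain S where S: "finite S \<and> {0, 1} \<subseteq> S \<and> S \<subseteq> {0..1} \<and>
      (\<forall>a\<in>S. \<forall>b\<in>S. a < b \<and> {a<..<b} \<inter> S = {} \<longrightarrow> C1_curve A a b \<gamma>)"
    unfolding piecewise_C1_curve_def by (elim exE)
  show ?thesis
  proof (rule that)
    fix a b assume "a \<in> S" "b \<in> S" "a < b" "{a<..<b} \<inter> S = {}"
    then show "C1_curve A a b \<gamma>" by (intro S[THEN conjunct2, THEN conjunct2, THEN conjunct2, rule_format] conjI)
  qed (rule S[THEN conjunct1] S[THEN conjunct2, THEN conjunct1] S[THEN conjunct2, THEN conjunct2, THEN conjunct1])+
qed

text \<open>
  The curve is run through at double speed on \<open>{0..1/2}\<close>, followed by the coordinate segment on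
  \<open>{1/2..1}\<close>.
\<close>

lemma piecewise_C1_append_segment:
  assumes \<gamma>: "piecewise_C1_curve A \<gamma>" and c: "c \<in> A" and seg: "closed_segment x y \<subseteq> chart_image c"
    and end1: "\<gamma> 1 = chart_inv c x"
  shows "\<exists>\<gamma>'. piecewise_C1_curve A \<gamma>' \<and> \<gamma>' 0 = \<gamma> 0 \<and> \<gamma>' 1 = chart_inv c y"
proof -
  obtain S where S: "finite S" "{0, 1} \<subseteq> S" "S \<subseteq> {0..1}"
    "\<And>a b. a \<in> S \<Longrightarrow> b \<in> S \<Longrightarrow> a < b \<Longrightarrow> {a<..<b} \<inter> S = {} \<Longrightarrow> C1_curve A a b \<gamma>"
    by (rule piecewise_C1_curveE[OF \<gamma>]) blast
  define \<gamma>' where "\<gamma>' t = (if t \<le> 1 / 2 then \<gamma> (2 * t) else chart_inv c (x + (2 * t + - 1) *\<^sub>R (y - x)))" for t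
  define S' where "S' = insert 1 ((\<lambda>s. s / 2) ` S)"
  have halves: "s / 2 \<in> S'" if "s \<in> S" for s unfolding S'_def using that by blast
  have half: "1 / 2 \<in> S'" "0 \<in> S'" using halves[of 1] halves[of 0] S(2) by simp_all
  have cases: "s = 1 \<or> (2 * s \<in> S \<and> 0 \<le> s \<and> s \<le> 1 / 2)" if s: "s \<in> S'" for s
  proof (cases "s = 1")
    case False
    then obtain r where r: "r \<in> S" "s = r / 2" using s unfolding S'_def by blast
    then have "r \<in> {0..1}" using S(3) by blast
    then have "0 \<le> s" "s \<le> 1 / 2" using r(2) by simp_all
    moreover have "2 * s \<in> S" by (rule ssubst[of _ r "\<lambda>x. x \<in> S"]) (simp_all add: r)
    ultimately show ?thesis by blast
  qed simp
  have S'1: "S' \<subseteq> {0..1}"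
  proof
    fix s assume "s \<in> S'" from cases[OF this] show "s \<in> {0..1}" by auto
  qed
  have big: "s = 1" if "s \<in> S'" "s > 1 / 2" for s using cases[OF that(1)] that(2) by linarith
  have small: "2 * s \<in> S" if "s \<in> S'" "s \<le> 1 / 2" for s using cases[OF that(1)] that(2) by auto
  have second: "C1_curve A (1/2) 1 \<gamma>'"
  proof (rule C1_curve_cong[OF C1_chart_segment[OF c seg, of "1/2" 1 2 "- 1"]])
    fix t :: real assume "t \<in> {1/2..1}"
    then show "\<gamma>' t = chart_inv c (x + (2 * t + - 1) *\<^sub>R (y - x))"
    proof (cases "t = 1 / 2")
      case True
      show ?thesis unfolding \<gamma>'_def True by (simp add: end1)
    next
      case False
      then show ?thesis using \<open>t \<in> {1/2..1}\<close> by (simp add: \<gamma>'_def)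
    qed
  qed auto
  have "C1_curve A a b \<gamma>'" if ab: "a \<in> S'" "b \<in> S'" "a < b" "{a<..<b} \<inter> S' = {}" for a b
  proof (cases "b \<le> 1 / 2")
    case True
    have "{2 * a<..<2 * b} \<inter> S = {}"
    proof (rule ccontr)
      assume "{2 * a<..<2 * b} \<inter> S \<noteq> {}"
      then obtain s where "s \<in> S" "2 * a < s" "s < 2 * b" unfolding greaterThanLessThan_iff by fastforce
      then have "s / 2 \<in> {a<..<b} \<inter> S'" using halves[of s] by simp
      then show False using ab by blast
    qed
    moreover have "a \<le> 1 / 2" "2 * a < 2 * b" using True ab(3) by linarith+
    ultimately have "C1_curve A (2 * a) (2 * b) \<gamma>"
      using S(4)[OF small[OF ab(1)] small[OF ab(2) True]] by blast
    from C1_curve_double_speed[OF this] show ?thesis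
    proof (rule C1_curve_cong)
      fix t assume "t \<in> {a..b}"
      then have "t \<le> 1 / 2" using True unfolding atLeastAtMost_iff by linarith
      then show "\<gamma>' t = \<gamma> (2 * t)" unfolding \<gamma>'_def by (rule if_P)
    qed
  next
    case False
    then have b1: "b = 1" using big[OF ab(2)] by linarith
    have "\<not> a < 1 / 2"
    proof
      assume "a < 1 / 2"
      then have "1 / 2 \<in> {a<..<b}" using False by simp
      then show False using half(1) ab(4) by blast
    qed
    moreover have "\<not> a > 1 / 2" using big[OF ab(1)] ab(3) b1 by linarith
    ultimately have "a = 1 / 2" by linarith
    then show ?thesis using second b1 by blast
  qed
  moreover have "finite S'" "{0, 1} \<subseteq> S'" using S(1) half unfolding S'_def by auto
  ultimately have "piecewise_C1_curve A \<gamma>'" unfolding piecewise_C1_curve_def using S'1 by blast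
  moreover have "\<gamma>' 0 = \<gamma> 0" "\<gamma>' 1 = chart_inv c y" unfolding \<gamma>'_def by simp_all
  ultimately show ?thesis by blast
qed

lemma piecewise_C1_segment:
  assumes c: "c \<in> A" and seg: "closed_segment x y \<subseteq> chart_image c"
  shows "piecewise_C1_curve A (\<lambda>t. chart_inv c (x + t *\<^sub>R (y - x)))"
proof -
  have "C1_curve A 0 1 (\<lambda>t. chart_inv c (x + (1 * t + 0) *\<^sub>R (y - x)))"
    by (rule C1_chart_segment[OF c seg]) simp
  then show ?thesis unfolding piecewise_C1_curve_def by (intro exI[of _ "{0, 1}"]) auto
qed

text \<open>
  Inside a coordinate ball any two points are joined by a coordinate segment. Hence reachability from
  \<open>p\<close> is constant on such balls, and the set of reachable points is open and closed.
\<close>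

lemma exists_piecewise_C1_curve:
  assumes "connected (UNIV :: 'm set)"
  shows "\<exists>\<gamma>. piecewise_C1_curve A \<gamma> \<and> \<gamma> 0 = p \<and> \<gamma> 1 = q"
proof -
  define R where "R = {q. \<exists>\<gamma>. piecewise_C1_curve A \<gamma> \<and> \<gamma> 0 = p \<and> \<gamma> 1 = q}"
  have nbhd: "\<exists>U. open U \<and> y \<in> U \<and> (\<forall>q\<in>U. q \<in> R \<longleftrightarrow> y \<in> R)" for y
  proof -
    obtain c where c: "c \<in> A" "y \<in> fst c" using chart_cover by blast
    obtain r where r: "r > 0" "ball (snd c y) r \<subseteq> chart_image c"
      using open_chart_image[OF c(1)] c(2) openE by blast
    define U where "U = fst c \<inter> snd c -` ball (snd c y) r"
    have "open U" unfolding U_def by (rule continuous_open_preimage[OF continuous_chart open_chart]) (use c in auto)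
    moreover have yU: "y \<in> U" unfolding U_def using c r by simp
    have link: "b \<in> R" if ab: "a \<in> U" "b \<in> U" "a \<in> R" for a b
    proof -
      obtain \<gamma> where \<gamma>: "piecewise_C1_curve A \<gamma>" "\<gamma> 0 = p" "\<gamma> 1 = a" using ab(3) unfolding R_def by blast
      have "closed_segment (snd c a) (snd c b) \<subseteq> ball (snd c y) r"
        by (rule closed_segment_subset[OF _ _ convex_ball]) (use ab U_def in auto)
      then have seg: "closed_segment (snd c a) (snd c b) \<subseteq> chart_image c" using r by blast
      have "chart_inv c (snd c a) = a" "chart_inv c (snd c b) = b"
        using chart_inv_left[OF c(1)] ab unfolding U_def by blast+
      then have "\<exists>\<gamma>'. piecewise_C1_curve A \<gamma>' \<and> \<gamma>' 0 = p \<and> \<gamma>' 1 = b"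
        using piecewise_C1_append_segment[OF \<gamma>(1) c(1) seg] \<gamma>(2,3) by simp
      then show ?thesis unfolding R_def by simp
    qed
    have "\<forall>q\<in>U. q \<in> R \<longleftrightarrow> y \<in> R"
    proof (intro ballI iffI)
      show "y \<in> R" if "q \<in> U" "q \<in> R" for q by (rule link[OF that(1) yU that(2)])
      show "q \<in> R" if "q \<in> U" "y \<in> R" for q by (rule link[OF yU that])
    qed
    with \<open>open U\<close> yU show ?thesis by (intro exI[of _ U] conjI)
  qed
  have "open R"
    unfolding open_subopen[of R]
  proof
    fix y assume "y \<in> R"
    moreover obtain U where "open U" "y \<in> U" "\<forall>q\<in>U. q \<in> R \<longleftrightarrow> y \<in> R" using nbhd[of y] by (elim exE conjE)
    ultimately show "\<exists>U. open U \<and> y \<in> U \<and> U \<subseteq> R" by (intro exI[of _ U] conjI subsetI; blast)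
  qed
  moreover have "closed R"
    unfolding closed_def open_subopen[of "- R"]
  proof
    fix y assume "y \<in> - R"
    moreover obtain U where "open U" "y \<in> U" "\<forall>q\<in>U. q \<in> R \<longleftrightarrow> y \<in> R" using nbhd[of y] by (elim exE conjE)
    ultimately show "\<exists>U. open U \<and> y \<in> U \<and> U \<subseteq> - R" by (intro exI[of _ U] conjI subsetI; blast)
  qed
  moreover have "p \<in> R"
  proof -
    obtain c where c: "c \<in> A" "p \<in> fst c" using chart_cover by blast
    have "piecewise_C1_curve A (\<lambda>t. chart_inv c (snd c p + t *\<^sub>R (snd c p - snd c p)))"
      by (rule piecewise_C1_segment[OF c(1)]) (use c(2) in auto)
    then show ?thesis unfolding R_def using chart_inv_left[OF c]
      by (intro CollectI exI[of _ "\<lambda>t. chart_inv c (snd c p + t *\<^sub>R (snd c p - snd c p))"]) simp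
  qed
  ultimately have "R = UNIV"
    using assms[unfolded connected_clopen, THEN spec, of R] by (auto simp: open_openin[symmetric] closed_closedin[symmetric])
  then have "q \<in> R" by simp
  then show ?thesis unfolding R_def by simp
qed

end

context riemannian_manifold
begin

abbreviation speed :: "(real \<Rightarrow> 'm) \<Rightarrow> real \<Rightarrow> real" where
  "speed \<gamma> t \<equiv> tnorm g (\<gamma> t) (velocity A \<gamma> t)"

abbreviation gnorm :: "('m, 'n) chart \<Rightarrow> real ^ 'n \<Rightarrow> real ^ 'n \<Rightarrow> real" where
  "gnorm c x u \<equiv> sqrt (quad_form (gram_matrix A g c x) u)"

text \<open>
  The velocity is determined by the coordinate expression only in the interior of the interval, where
  the derivative is two-sided; this does not affect the integral.
\<close>

lemma speed_in_chart:
  assumes \<gamma>: "C1_curve A a b \<gamma>" and c: "c \<in> A" and st: "a \<le> s" "s < t" "t \<le> b"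
    and im: "\<And>\<tau>. \<tau> \<in> {s..t} \<Longrightarrow> \<gamma> \<tau> \<in> fst c"
  obtains w where "continuous_on {s..t} w"
    "\<And>\<tau>. \<tau> \<in> {s..t} \<Longrightarrow> ((snd c \<circ> \<gamma>) has_vector_derivative w \<tau>) (at \<tau> within {s..t})"
    "continuous_on {s..t} (\<lambda>\<tau>. gnorm c (snd c (\<gamma> \<tau>)) (w \<tau>))"
    "speed \<gamma> integrable_on {s..t}" "integral {s..t} (speed \<gamma>) = integral {s..t} (\<lambda>\<tau>. gnorm c (snd c (\<gamma> \<tau>)) (w \<tau>))"
    "\<And>\<tau>. \<tau> \<in> {s<..<t} \<Longrightarrow> 0 \<le> speed \<gamma> \<tau>"
proof -
  obtain w where w: "continuous_on {s..t} w"
    "\<And>\<tau>. \<tau> \<in> {s..t} \<Longrightarrow> ((snd c \<circ> \<gamma>) has_vector_derivative w \<tau>) (at \<tau> within {s..t})"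
    "\<And>\<tau>. \<tau> \<in> {s<..<t} \<Longrightarrow> velocity A \<gamma> \<tau> = coord_vec A c (\<gamma> \<tau>) (w \<tau>)"
    using C1_curve_piece[OF \<gamma> c st im] by blast
  have "continuous_on {s..t} (snd c \<circ> \<gamma>)"
    using w(2) has_vector_derivative_continuous unfolding continuous_on_eq_continuous_within by blast
  then have c\<eta>: "continuous_on {s..t} (\<lambda>\<tau>. snd c (\<gamma> \<tau>))" by (simp add: comp_def)
  have "continuous_on {s..t} (\<lambda>\<tau>. gram_matrix A g c (snd c (\<gamma> \<tau>)))"
    by (rule continuous_on_compose2[OF continuous_gram[OF c] c\<eta>]) (use im in auto)
  then have cont: "continuous_on {s..t} (\<lambda>\<tau>. gnorm c (snd c (\<gamma> \<tau>)) (w \<tau>))"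
    by (intro continuous_on_real_sqrt continuous_quad_form w(1))
  have eq: "speed \<gamma> \<tau> = gnorm c (snd c (\<gamma> \<tau>)) (w \<tau>)" if "\<tau> \<in> {s<..<t}" for \<tau>
    using w(3)[OF that] tnorm_coord_vec[OF c im] that by simp
  have eq': "gnorm c (snd c (\<gamma> \<tau>)) (w \<tau>) = speed \<gamma> \<tau>" if "\<tau> \<in> {s..t} - {s, t}" for \<tau>
    using eq[of \<tau>] that by auto
  have "(\<lambda>\<tau>. gnorm c (snd c (\<gamma> \<tau>)) (w \<tau>)) integrable_on {s..t}" by (rule integrable_continuous_interval[OF cont])
  then have int: "speed \<gamma> integrable_on {s..t}"
    by (rule integrable_spike_finite[of "{s, t}", rotated 2]) (use eq' in auto)
  have ieq: "integral {s..t} (speed \<gamma>) = integral {s..t} (\<lambda>\<tau>. gnorm c (snd c (\<gamma> \<tau>)) (w \<tau>))"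
    by (rule integral_spike[of "{s, t}"]) (use eq' in auto)
  have "0 \<le> speed \<gamma> \<tau>" if "\<tau> \<in> {s<..<t}" for \<tau>
    unfolding eq[OF that] using quad_form_nonneg[OF c] im[of \<tau>] that by simp
  then show ?thesis using that[OF w(1,2) cont int ieq] by blast
qed

lemma speed_nonneg:
  assumes \<gamma>: "C1_curve A a b \<gamma>" and t: "a < t" "t < b"
  shows "0 \<le> speed \<gamma> t"
proof -
  obtain c where c: "c \<in> A" "\<gamma> t \<in> fst c" using chart_cover by blast
  have cont: "continuous_on {a..b} \<gamma>" using \<gamma> unfolding C1_curve_def by blast
  have "open ({a<..<b} \<inter> \<gamma> -` fst c)"
    by (rule continuous_open_preimage[OF continuous_on_subset[OF cont]]) (use open_chart[OF c(1)] in auto)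
  moreover have "t \<in> {a<..<b} \<inter> \<gamma> -` fst c" using t c by auto
  ultimately obtain e where e: "e > 0" "cball t e \<subseteq> {a<..<b} \<inter> \<gamma> -` fst c" using open_contains_cball by blast
  have sub: "{t - e..t + e} \<subseteq> {a<..<b} \<inter> \<gamma> -` fst c" using e(2) by (simp add: cball_eq_atLeastAtMost)
  have "t - e \<in> {a<..<b}" "t + e \<in> {a<..<b}" using subsetD[OF sub, of "t - e"] subsetD[OF sub, of "t + e"] e(1) by simp_all
  then have st: "a \<le> t - e" "t - e < t + e" "t + e \<le> b" using e(1) by auto
  have im: "\<gamma> \<tau> \<in> fst c" if "\<tau> \<in> {t - e..t + e}" for \<tau> using sub that by blast
  show ?thesis by (rule speed_in_chart[OF \<gamma> c(1) st im]) (use e(1) in auto)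
qed

lemma curve_length_nonneg:
  assumes "piecewise_C1_curve A \<gamma>" shows "0 \<le> curve_length A g \<gamma>"
proof -
  obtain S where S: "finite S" "{0, 1} \<subseteq> S" "S \<subseteq> {0..1}"
    "\<And>a b. a \<in> S \<Longrightarrow> b \<in> S \<Longrightarrow> a < b \<Longrightarrow> {a<..<b} \<inter> S = {} \<Longrightarrow> C1_curve A a b \<gamma>"
    by (rule piecewise_C1_curveE[OF assms]) blast
  have nn: "0 \<le> speed \<gamma> t" if t: "t \<in> {0..1}" "t \<notin> S" for t
  proof -
    have "0 < t" using t S(2) by (auto simp: less_le)
    then obtain a b where ab: "a \<in> S" "b \<in> S" "a < t" "t \<le> b" "{a<..<b} \<inter> S = {}"
      using consecutive_points(1)[OF S(1-3), of t] t(1) by auto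
    have "t < b" using ab(2,4) t(2) by (metis order_le_less)
    note ab = ab(1-3) this ab(5)
    have "C1_curve A a b \<gamma>" using S(4)[OF ab(1,2) _ ab(5)] ab by simp
    then show ?thesis using speed_nonneg ab by blast
  qed
  (* At the break points the velocity is arbitrary, but there are only finitely many of them. *)
  have "curve_length A g \<gamma> = integral {0..1} (\<lambda>t. if t \<in> S then 0 else speed \<gamma> t)"
    unfolding curve_length_def by (rule integral_spike[of S]) (use S(1) in auto)
  also have "0 \<le> \<dots>"
    by (cases "(\<lambda>t. if t \<in> S then 0 else speed \<gamma> t) integrable_on {0..1}")
       (auto simp: not_integrable_integral intro!: integral_nonneg nn)
  finally show ?thesis .
qed

lemma riem_dist_le_curve_length:
  assumes "piecewise_C1_curve A \<gamma>" "\<gamma> 0 = x" "\<gamma> 1 = y"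
  shows "riem_dist A g x y \<le> curve_length A g \<gamma>"
  unfolding riem_dist_def
proof (rule cInf_lower)
  show "bdd_below {curve_length A g \<gamma> |\<gamma>. piecewise_C1_curve A \<gamma> \<and> \<gamma> 0 = x \<and> \<gamma> 1 = y}"
    using curve_length_nonneg by (intro bdd_belowI[of _ 0]) auto
qed (use assms in blast)

lemma riem_dist_segment:
  assumes c: "c \<in> A" and seg: "closed_segment x y \<subseteq> chart_image c"
    and M: "\<And>\<xi>. \<xi> \<in> closed_segment x y \<Longrightarrow> gnorm c \<xi> (y - x) \<le> M"
  shows "riem_dist A g (chart_inv c x) (chart_inv c y) \<le> M"
proof -
  let ?\<gamma> = "\<lambda>t. chart_inv c (x + t *\<^sub>R (y - x))"
  have im: "x + t *\<^sub>R (y - x) \<in> chart_image c" if "t \<in> {0..1}" for t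
    using segment_point[OF that] seg by blast
  have "C1_curve A 0 1 (\<lambda>t. chart_inv c (x + (1 * t + 0) *\<^sub>R (y - x)))"
    by (rule C1_chart_segment[OF c seg]) simp
  then have \<gamma>: "C1_curve A 0 1 ?\<gamma>" by simp
  obtain w where w: "\<And>\<tau>. \<tau> \<in> {0..1} \<Longrightarrow> ((snd c \<circ> ?\<gamma>) has_vector_derivative w \<tau>) (at \<tau> within {0..1})"
    "continuous_on {0..1} (\<lambda>\<tau>. gnorm c (snd c (?\<gamma> \<tau>)) (w \<tau>))"
    "integral {0..1} (speed ?\<gamma>) = integral {0..1} (\<lambda>\<tau>. gnorm c (snd c (?\<gamma> \<tau>)) (w \<tau>))"
    by (rule speed_in_chart[OF \<gamma> c, of 0 1]) (use chart_inv_mem[OF c im] in auto)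
  have wy: "w \<tau> = y - x" if "\<tau> \<in> {0..1}" for \<tau>
  proof -
    have "((\<lambda>t. x + (1 * t + 0) *\<^sub>R (y - x)) has_vector_derivative 1 *\<^sub>R (y - x)) (at \<tau> within {0..1})"
      by (rule segment_has_derivative)
    then have "((snd c \<circ> ?\<gamma>) has_vector_derivative (y - x)) (at \<tau> within {0..1})"
      by (intro has_vector_derivative_transform[OF that, of "snd c \<circ> ?\<gamma>" "\<lambda>t. x + t *\<^sub>R (y - x)"])
         (use chart_inv_right[OF c im] in auto)
    then show ?thesis using vector_derivative_unique_within[OF _ w(1)[OF that]] that
      by (metis islimpt_Icc trivial_limit_within zero_less_one)
  qed
  have "riem_dist A g (chart_inv c x) (chart_inv c y) \<le> curve_length A g ?\<gamma>"
    by (rule riem_dist_le_curve_length[OF piecewise_C1_segment[OF c seg]]) auto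
  also have "\<dots> = integral {0..1} (\<lambda>\<tau>. gnorm c (snd c (?\<gamma> \<tau>)) (w \<tau>))"
    unfolding curve_length_def w(3) ..
  also have "\<dots> \<le> integral {0..1} (\<lambda>\<tau>::real. M)"
  proof (rule integral_le)
    show "(\<lambda>\<tau>. gnorm c (snd c (?\<gamma> \<tau>)) (w \<tau>)) integrable_on {0..1}" by (rule integrable_continuous_interval[OF w(2)])
    show "gnorm c (snd c (?\<gamma> \<tau>)) (w \<tau>) \<le> M" if "\<tau> \<in> {0..1}" for \<tau>
      using M[OF segment_point[OF that]] chart_inv_right[OF c im[OF that]] wy[OF that] by simp
  qed auto
  finally show ?thesis by simp
qed

end

section \<open>The differential\<close>

context smooth_manifold
begin

text \<open>
  Differentiability in a single chart suffices, by the chain rule for the transition maps.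
\<close>

lemma has_differentialI:
  assumes c: "c \<in> A" "p \<in> fst c" and D: "((F \<circ> chart_inv c) has_derivative D) (at (snd c p))"
  shows "has_differential A F p (\<lambda>v. if v \<in> tangent_space A p then D (v c) else 0)"
  unfolding has_differential_def
proof (intro conjI ballI impI)
  let ?\<omega> = "\<lambda>v. if v \<in> tangent_space A p then D (v c) else 0"
  have lD: "linear D" using D by (rule has_derivative_linear)
  show "?\<omega> \<in> cotangent_space A p"
    unfolding cotangent_space_def mem_Collect_eq
  proof (intro conjI ballI allI impI)
    fix v w a b assume v: "v \<in> tangent_space A p" and w: "w \<in> tangent_space A p"
    have "(\<lambda>c'. a *\<^sub>R v c' + b *\<^sub>R w c') = coord_vec A c p (a *\<^sub>R v c + b *\<^sub>R w c)"
      unfolding coord_vec_lincomb[OF c] using tangent_eq_coord_vec[OF c v] tangent_eq_coord_vec[OF c w] by simp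
    then have "(\<lambda>c'. a *\<^sub>R v c' + b *\<^sub>R w c') \<in> tangent_space A p" using coord_vec_mem[OF c] by simp
    then show "?\<omega> (\<lambda>c'. a *\<^sub>R v c' + b *\<^sub>R w c') = a * ?\<omega> v + b * ?\<omega> w"
      using v w by (simp add: linear_add[OF lD] linear_scale[OF lD])
  qed simp
  fix c' assume c': "c' \<in> A" "p \<in> fst c'"
  have tx: "transition c' c (snd c' p) = snd c p"
    using chart_inv_left[OF c'] by (simp add: transition_def)
  have "((F \<circ> chart_inv c) \<circ> transition c' c has_derivative D \<circ> frechet_derivative (transition c' c) (at (snd c' p))) (at (snd c' p))"
    by (rule diff_chain_at[OF transition_has_derivative[OF c'(1) c(1) c'(2) c(2)]]) (simp add: tx D)
  then have "(F \<circ> chart_inv c' has_derivative D \<circ> frechet_derivative (transition c' c) (at (snd c' p))) (at (snd c' p))"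
  proof (rule has_derivative_transform_within_open)
    show "open (snd c' ` (fst c' \<inter> fst c))" by (rule overlap_image(2)[OF c'(1) open_chart[OF c(1)]])
    show "snd c' p \<in> snd c' ` (fst c' \<inter> fst c)" using c c' by blast
    fix x assume "x \<in> snd c' ` (fst c' \<inter> fst c)"
    then obtain q where q: "q \<in> fst c'" "q \<in> fst c" "x = snd c' q" by blast
    then show "((F \<circ> chart_inv c) \<circ> transition c' c) x = (F \<circ> chart_inv c') x"
      using chart_inv_left[OF c(1)] chart_inv_left[OF c'(1)] by (simp add: transition_def)
  qed
  moreover have "D \<circ> frechet_derivative (transition c' c) (at (snd c' p)) = (\<lambda>u. ?\<omega> (coord_vec A c' p u))"
    using coord_vec_mem[OF c'] c by (auto simp: coord_vec_def)
  ultimately show "(F \<circ> chart_inv c' has_derivative (\<lambda>u. ?\<omega> (coord_vec A c' p u))) (at (snd c' p))" by simp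
qed

lemma has_differential_unique:
  assumes "has_differential A F p \<omega>" "has_differential A F p \<omega>'"
  shows "\<omega> = \<omega>'"
proof
  fix v
  obtain c where c: "c \<in> A" "p \<in> fst c" using chart_cover by blast
  show "\<omega> v = \<omega>' v"
  proof (cases "v \<in> tangent_space A p")
    case True
    have "((F \<circ> chart_inv c) has_derivative (\<lambda>u. \<omega> (coord_vec A c p u))) (at (snd c p))"
      "((F \<circ> chart_inv c) has_derivative (\<lambda>u. \<omega>' (coord_vec A c p u))) (at (snd c p))"
      using assms c unfolding has_differential_def by blast+
    from fun_cong[OF has_derivative_unique[OF this], of "v c"] show ?thesis
      using tangent_eq_coord_vec[OF c True] by simp
  next
    case False
    then show ?thesis using assms unfolding has_differential_def cotangent_space_def by simp
  qed
qed

lemma differential_eq: "has_differential A F p \<omega> \<Longrightarrow> differential A F p = \<omega>"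
  unfolding differential_def using has_differential_unique by (metis (mono_tags, lifting) the_equality)

lemma differential_cotangent: "differential A F p \<in> cotangent_space A p"
proof (cases "\<exists>\<omega>. has_differential A F p \<omega>")
  case True
  then obtain \<omega> where \<omega>: "has_differential A F p \<omega>" by blast
  then show ?thesis unfolding differential_eq[OF \<omega>] unfolding has_differential_def by (rule conjunct1)
qed (auto simp: differential_def cotangent_space_def)

lemma differential_coord_vec:
  assumes "c \<in> A" "p \<in> fst c" "((F \<circ> chart_inv c) has_derivative D) (at (snd c p))"
  shows "differential A F p (coord_vec A c p u) = D u"
  unfolding differential_eq[OF has_differentialI[OF assms]]
  using coord_vec_mem[OF assms(1,2)] coord_vec_self[OF assms(1,2)] by simp

lemma has_differential_chart:
  assumes "c \<in> A" "p \<in> fst c" "has_differential A F p \<omega>"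
  shows "((F \<circ> chart_inv c) has_derivative (\<lambda>u. differential A F p (coord_vec A c p u))) (at (snd c p))"
  unfolding differential_eq[OF assms(3)] using assms unfolding has_differential_def by blast

lemma differential_lincomb:
  assumes "has_differential A F p \<omega>" "has_differential A G p \<omega>'"
  shows "differential A (\<lambda>x. a * F x + b * G x) p = (\<lambda>v. a * differential A F p v + b * differential A G p v)"
proof
  fix v
  obtain c where c: "c \<in> A" "p \<in> fst c" using chart_cover by blast
  show "differential A (\<lambda>x. a * F x + b * G x) p v = a * differential A F p v + b * differential A G p v"
  proof (cases "v \<in> tangent_space A p")
    case True
    have "((\<lambda>x. a * (F \<circ> chart_inv c) x + b * (G \<circ> chart_inv c) x) has_derivative
       (\<lambda>u. a * differential A F p (coord_vec A c p u) + b * differential A G p (coord_vec A c p u))) (at (snd c p))"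
      by (intro has_derivative_add has_derivative_mult_right has_differential_chart[OF c assms(1)] has_differential_chart[OF c assms(2)])
    then have "(((\<lambda>x. a * F x + b * G x) \<circ> chart_inv c) has_derivative
       (\<lambda>u. a * differential A F p (coord_vec A c p u) + b * differential A G p (coord_vec A c p u))) (at (snd c p))"
      by (simp add: comp_def)
    from differential_coord_vec[OF c this, of "v c"] show ?thesis
      using tangent_eq_coord_vec[OF c True] by simp
  next
    case False
    then have "differential A H p v = 0" for H
      using differential_cotangent[of H p] unfolding cotangent_space_def by blast
    then show ?thesis by simp
  qed
qed

lemma chart_box:
  assumes "c \<in> A" "p \<in> fst c"
  obtains a b where "snd c p \<in> box a b" "cbox a b \<subseteq> chart_image c"
  using open_contains_cbox[OF open_chart_image[OF assms(1)] imageI[OF assms(2)]] by metis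

end

text \<open>
  The coordinate expression of \<open>F\<close> on the box, extended to the whole space by composition with the
  nearest-point retraction. The retraction does not increase distances, so a function on \<open>M\<close> becomes
  a globally Lipschitz function on \<open>\<real>\<^sup>n\<close>; moreover each value of the extension is a value of \<open>F\<close>.
\<close>

definition chart_ext :: "('m, 'n::finite) chart \<Rightarrow> real ^ 'n \<Rightarrow> real ^ 'n \<Rightarrow> ('m \<Rightarrow> real) \<Rightarrow> real ^ 'n \<Rightarrow> real" where
  "chart_ext c a b F x = F (chart_inv c (closest_point (cbox a b) x))"

lemma chart_ext_eq: "x \<in> cbox a b \<Longrightarrow> chart_ext c a b F x = F (chart_inv c x)"
  by (simp add: chart_ext_def closest_point_self)

lemma chart_ext_has_derivative_iff:
  assumes "x \<in> box a b"
  shows "(chart_ext c a b F has_derivative D) (at x) \<longleftrightarrow> ((F \<circ> chart_inv c) has_derivative D) (at x)"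
proof -
  have eq: "chart_ext c a b F y = (F \<circ> chart_inv c) y" if "y \<in> box a b" for y
    using chart_ext_eq[of y a b c F] that box_subset_cbox by auto
  show ?thesis
    using has_derivative_transform_within_open[OF _ open_box assms, of "chart_ext c a b F" D UNIV "F \<circ> chart_inv c"]
      has_derivative_transform_within_open[OF _ open_box assms, of "F \<circ> chart_inv c" D UNIV "chart_ext c a b F"] eq
    by auto
qed

locale connected_riemannian_manifold = riemannian_manifold A g
  for A :: "('m::{t2_space, second_countable_topology}, 'n::finite) chart set" and g +
  assumes connected: "connected (UNIV :: 'm set)"
begin

lemma riem_dist_greatest:
  assumes "\<And>\<gamma>. piecewise_C1_curve A \<gamma> \<Longrightarrow> \<gamma> 0 = x \<Longrightarrow> \<gamma> 1 = y \<Longrightarrow> K \<le> curve_length A g \<gamma>"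
  shows "K \<le> riem_dist A g x y"
  unfolding riem_dist_def
proof (rule cInf_greatest)
  show "{curve_length A g \<gamma> |\<gamma>. piecewise_C1_curve A \<gamma> \<and> \<gamma> 0 = x \<and> \<gamma> 1 = y} \<noteq> {}"
    using exists_piecewise_C1_curve[OF connected, of x y] by blast
qed (use assms in blast)

lemma riem_dist_nonneg: "0 \<le> riem_dist A g x y"
  by (rule riem_dist_greatest) (rule curve_length_nonneg)

text \<open>
  The infimum in the definition of the Lipschitz norm is attained.
\<close>

lemma Lip_norm_bound:
  assumes "lipschitz_bounds A g F \<noteq> {}"
  shows "Lip_norm A g F \<in> lipschitz_bounds A g F"
proof -
  have ne: "\<And>L. L \<in> lipschitz_bounds A g F \<Longrightarrow> 0 \<le> L" unfolding lipschitz_bounds_def by blast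
  have "\<bar>F x - F y\<bar> \<le> Lip_norm A g F * riem_dist A g x y" for x y
  proof (cases "riem_dist A g x y = 0")
    case True
    obtain L where "L \<in> lipschitz_bounds A g F" using assms by blast
    then have "\<bar>F x - F y\<bar> \<le> L * riem_dist A g x y" unfolding lipschitz_bounds_def by blast
    then show ?thesis unfolding True by simp
  next
    case False
    then have d: "riem_dist A g x y > 0" using riem_dist_nonneg[of x y] by simp
    have "\<bar>F x - F y\<bar> / riem_dist A g x y \<le> Lip_norm A g F"
      unfolding Lip_norm_def
    proof (rule cInf_greatest[OF assms])
      fix L assume "L \<in> lipschitz_bounds A g F"
      then show "\<bar>F x - F y\<bar> / riem_dist A g x y \<le> L" using d unfolding lipschitz_bounds_def by (simp add: pos_divide_le_eq)
    qed
    then show ?thesis using d by (simp add: pos_divide_le_eq)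
  qed
  moreover have "0 \<le> Lip_norm A g F" unfolding Lip_norm_def by (rule cInf_greatest[OF assms ne])
  ultimately show ?thesis unfolding lipschitz_bounds_def by simp
qed

text \<open>
  Two points of the box are joined by a coordinate segment, whose length is at most \<open>C\<close> times the
  Euclidean distance by \<open>compact_metric_bounds\<close>. The same \<open>C\<close> serves all functions \<open>F\<close>.
\<close>

lemma chart_ext_lipschitz:
  assumes c: "c \<in> A" and B: "cbox a b \<subseteq> chart_image c" "cbox a b \<noteq> {}"
  obtains C where "0 < C" "\<And>F L. L \<in> lipschitz_bounds A g F \<Longrightarrow> (L * C)-lipschitz_on UNIV (chart_ext c a b F)"
proof -
  obtain m C where C: "0 < C" "\<And>x u. x \<in> cbox a b \<Longrightarrow> gnorm c x u \<le> C * norm u"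
    using compact_metric_bounds[OF c compact_cbox B(1)] by metis
  have "(L * C)-lipschitz_on UNIV (chart_ext c a b F)" if L: "L \<in> lipschitz_bounds A g F" for F L
  proof (rule lipschitz_onI)
    have L0: "0 \<le> L" and Ld: "\<And>x y. \<bar>F x - F y\<bar> \<le> L * riem_dist A g x y" using L unfolding lipschitz_bounds_def by blast+
    show "0 \<le> L * C" using L0 C by simp
    fix x y
    let ?x = "closest_point (cbox a b) x" and ?y = "closest_point (cbox a b) y"
    have xy: "?x \<in> cbox a b" "?y \<in> cbox a b" using closest_point_in_set[OF closed_cbox B(2)] by blast+
    have seg: "closed_segment ?x ?y \<subseteq> cbox a b" by (rule closed_segment_subset[OF xy convex_box(1)])
    have "riem_dist A g (chart_inv c ?x) (chart_inv c ?y) \<le> C * norm (?y - ?x)"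
      by (rule riem_dist_segment[OF c]) (use seg B(1) C(2) in blast)+
    also have "\<dots> = C * dist ?x ?y" by (simp add: dist_norm norm_minus_commute)
    also have "\<dots> \<le> C * dist x y"
      using C(1) closest_point_lipschitz[OF convex_box(1) closed_cbox B(2), of x y] by (intro mult_left_mono) auto
    finally have "L * riem_dist A g (chart_inv c ?x) (chart_inv c ?y) \<le> L * (C * dist x y)"
      using L0 by (rule mult_left_mono)
    then show "dist (chart_ext c a b F x) (chart_ext c a b F y) \<le> L * C * dist x y"
      using Ld[of "chart_inv c ?x" "chart_inv c ?y"] unfolding chart_ext_def dist_real_def by (simp add: mult.assoc)
  qed
  then show ?thesis using that[OF C(1)] by blast
qed

text \<open>
  By continuity of the metric, the coordinate segment from \<open>x\<close> to \<open>x + t u\<close> has length at most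
  \<open>t * (gnorm c x u + e)\<close> for small \<open>t\<close>, which bounds the difference quotients.
\<close>

lemma differential_le_lipschitz:
  assumes L: "L \<in> lipschitz_bounds A g F" and v: "v \<in> tangent_space A p"
  shows "\<bar>differential A F p v\<bar> \<le> L * tnorm g p v"
proof (cases "\<exists>\<omega>. has_differential A F p \<omega>")
  case False
  then have "differential A F p v = 0" unfolding differential_def by (simp only: if_False)
  moreover have "0 \<le> L" using L unfolding lipschitz_bounds_def by blast
  ultimately show ?thesis using tnorm_nonneg[OF v] by simp
next
  case True
  then obtain \<omega> where \<omega>: "has_differential A F p \<omega>" by blast
  have L0: "0 \<le> L" and Ld: "\<And>x y. \<bar>F x - F y\<bar> \<le> L * riem_dist A g x y" using L unfolding lipschitz_bounds_def by blast+
  obtain c where c: "c \<in> A" "p \<in> fst c" using chart_cover by blast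
  let ?x = "snd c p" and ?u = "v c" and ?f = "F \<circ> chart_inv c"
  have vc: "v = coord_vec A c p ?u" by (rule tangent_eq_coord_vec[OF c v])
  have lim: "((\<lambda>t. (?f (?x + t *\<^sub>R ?u) - ?f ?x) / t) \<longlongrightarrow> differential A F p (coord_vec A c p ?u)) (at_right 0)"
    by (rule directional_quotient_tendsto[OF has_differential_chart[OF c \<omega>]])
  have "\<bar>differential A F p (coord_vec A c p ?u)\<bar> \<le> L * (gnorm c ?x ?u + e)" if e: "e > 0" for e
  proof -
    have x: "?x \<in> chart_image c" using c by blast
    have "continuous_on (chart_image c) (\<lambda>\<xi>. gnorm c \<xi> ?u)"
      by (intro continuous_on_real_sqrt continuous_quad_form continuous_gram[OF c(1)] continuous_on_const)
    then have "isCont (\<lambda>\<xi>. gnorm c \<xi> ?u) ?x"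
      using continuous_on_eq_continuous_at[OF open_chart_image[OF c(1)]] x by blast
    then have "\<forall>\<^sub>F \<xi> in at ?x. gnorm c \<xi> ?u < gnorm c ?x ?u + e"
      unfolding isCont_def by (rule order_tendstoD(2)) (use e in simp)
    then obtain d1 where d1: "d1 > 0" "\<And>\<xi>. \<xi> \<noteq> ?x \<Longrightarrow> dist \<xi> ?x < d1 \<Longrightarrow> gnorm c \<xi> ?u < gnorm c ?x ?u + e"
      unfolding eventually_at by auto
    obtain d2 where d2: "d2 > 0" "ball ?x d2 \<subseteq> chart_image c" using open_chart_image[OF c(1)] x openE by blast
    define d where "d = min d1 d2"
    have d: "d > 0" unfolding d_def using d1 d2 by simp
    have q: "\<bar>(?f (?x + t *\<^sub>R ?u) - ?f ?x) / t\<bar> \<le> L * (gnorm c ?x ?u + e)" if t: "0 < t" "t < d / (norm ?u + 1)" for t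
    proof -
      have n1: "0 < norm ?u + 1" by (simp add: add_nonneg_pos)
      have "t * norm ?u \<le> t * (norm ?u + 1)" using t by simp
      also have "\<dots> < d" using t(2) n1 by (simp add: pos_less_divide_eq)
      finally have tu: "norm (t *\<^sub>R ?u) < d" using t by simp
      have seg: "closed_segment ?x (?x + t *\<^sub>R ?u) \<subseteq> ball ?x d"
        by (rule closed_segment_subset[OF _ _ convex_ball]) (use d tu in \<open>auto simp: dist_norm\<close>)
      have "riem_dist A g (chart_inv c ?x) (chart_inv c (?x + t *\<^sub>R ?u)) \<le> t * (gnorm c ?x ?u + e)"
      proof (rule riem_dist_segment[OF c(1)])
        show "closed_segment ?x (?x + t *\<^sub>R ?u) \<subseteq> chart_image c"
          using seg d2 unfolding d_def by (meson min.cobounded2 subset_ball subset_trans)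
        fix \<xi> assume "\<xi> \<in> closed_segment ?x (?x + t *\<^sub>R ?u)"
        then have "\<xi> \<in> ball ?x d" using seg by blast
        then have "dist \<xi> ?x < d1" by (simp add: d_def dist_commute)
        then have "gnorm c \<xi> ?u \<le> gnorm c ?x ?u + e" using d1(2)[of \<xi>] e by (cases "\<xi> = ?x") auto
        then show "gnorm c \<xi> (?x + t *\<^sub>R ?u - ?x) \<le> t * (gnorm c ?x ?u + e)"
          using t by (simp add: quad_form_scale real_sqrt_mult)
      qed
      then have "L * riem_dist A g (chart_inv c ?x) (chart_inv c (?x + t *\<^sub>R ?u)) \<le> L * (t * (gnorm c ?x ?u + e))"
        using L0 by (rule mult_left_mono)
      then have "\<bar>?f (?x + t *\<^sub>R ?u) - ?f ?x\<bar> \<le> L * (gnorm c ?x ?u + e) * t"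
        using Ld[of "chart_inv c ?x" "chart_inv c (?x + t *\<^sub>R ?u)"] by (simp add: abs_minus_commute mult_ac)
      then have "\<bar>?f (?x + t *\<^sub>R ?u) - ?f ?x\<bar> / t \<le> L * (gnorm c ?x ?u + e)"
        unfolding pos_divide_le_eq[OF t(1)] .
      then show ?thesis using t(1) by (simp add: abs_divide)
    qed
    have "0 < d / (norm ?u + 1)" using d by (intro divide_pos_pos add_nonneg_pos) auto
    then have "\<forall>\<^sub>F t in at_right 0. \<bar>(?f (?x + t *\<^sub>R ?u) - ?f ?x) / t\<bar> \<le> L * (gnorm c ?x ?u + e)"
      unfolding eventually_at_right_field using q by blast
    then show ?thesis by (rule tendsto_upperbound[OF tendsto_rabs[OF lim]]) simp
  qed
  then have "\<bar>differential A F p v\<bar> \<le> L * (gnorm c ?x ?u + e)" if "e > 0" for e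
    using that vc by metis
  moreover have "tnorm g p v = gnorm c ?x ?u" using vc tnorm_coord_vec[OF c, of ?u] by metis
  ultimately have le: "\<And>e. e > 0 \<Longrightarrow> \<bar>differential A F p v\<bar> \<le> L * (tnorm g p v + e)" by simp
  have "((\<lambda>e. L * (tnorm g p v + e)) \<longlongrightarrow> L * (tnorm g p v + 0)) (at_right (0::real))"
    by (intro tendsto_intros)
  then have "\<bar>differential A F p v\<bar> \<le> L * (tnorm g p v + 0)"
    by (rule tendsto_lowerbound) (auto intro!: eventually_at_rightI[of 0 1] le)
  then show ?thesis by simp
qed

end

context riemannian_manifold
begin

lemma tnorm_eq_gnorm:
  assumes "c \<in> A" "p \<in> fst c" "v \<in> tangent_space A p"
  shows "tnorm g p v = gnorm c (snd c p) (v c)"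
  by (rule trans[OF arg_cong[where f = "tnorm g p", OF tangent_eq_coord_vec[OF assms]] tnorm_coord_vec[OF assms(1,2)]])

lemma conorm_le:
  assumes "0 \<le> L" "\<And>v. v \<in> tangent_space A p \<Longrightarrow> \<bar>\<omega> v\<bar> \<le> L * tnorm g p v"
  shows "conorm A g p \<omega> \<le> L"
  unfolding conorm_def
proof (rule cSup_least)
  obtain c where c: "c \<in> A" "p \<in> fst c" using chart_cover by blast
  have "coord_vec A c p 0 \<in> tangent_space A p" "tnorm g p (coord_vec A c p 0) \<le> 1"
    using coord_vec_mem[OF c] tnorm_coord_vec[OF c, of 0] by (simp_all add: quad_form_def)
  then show "{\<bar>\<omega> v\<bar> |v. v \<in> tangent_space A p \<and> tnorm g p v \<le> 1} \<noteq> {}" by blast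
  fix y assume "y \<in> {\<bar>\<omega> v\<bar> |v. v \<in> tangent_space A p \<and> tnorm g p v \<le> 1}"
  then obtain v where v: "y = \<bar>\<omega> v\<bar>" "v \<in> tangent_space A p" "tnorm g p v \<le> 1" by blast
  have "L * tnorm g p v \<le> L * 1" using v(3) assms(1) by (rule mult_left_mono)
  then show "y \<le> L" using assms(2)[OF v(2)] v(1) by simp
qed

text \<open>
  Finite dimension enters here: the supremum that defines \<open>conorm\<close> is finite since the metric norm
  dominates a multiple of the Euclidean norm of the coordinates.
\<close>

lemma covector_le_conorm:
  assumes \<omega>: "\<omega> \<in> cotangent_space A p" and v: "v \<in> tangent_space A p"
  shows "\<bar>\<omega> v\<bar> \<le> conorm A g p \<omega> * tnorm g p v"
proof -
  obtain c where c: "c \<in> A" "p \<in> fst c" using chart_cover by blast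
  have lin: "linear (\<lambda>u. \<omega> (coord_vec A c p u))" by (rule linear_covector[OF \<omega> c])
  then obtain B where B: "B > 0" "\<And>u. \<bar>\<omega> (coord_vec A c p u)\<bar> \<le> norm u * B"
    using bounded_linear.pos_bounded[OF linear_conv_bounded_linear[THEN iffD1]] by (metis real_norm_def)
  have x: "{snd c p} \<subseteq> chart_image c" using c by blast
  obtain m C where m: "0 < m" "\<And>u. m * norm u \<le> gnorm c (snd c p) u"
    using compact_metric_bounds[OF c(1) compact_sing x] by (metis singletonI)
  have bdd: "bdd_above {\<bar>\<omega> v\<bar> |v. v \<in> tangent_space A p \<and> tnorm g p v \<le> 1}"
  proof (rule bdd_aboveI)
    fix y assume "y \<in> {\<bar>\<omega> v\<bar> |v. v \<in> tangent_space A p \<and> tnorm g p v \<le> 1}"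
    then obtain v where v: "y = \<bar>\<omega> v\<bar>" "v \<in> tangent_space A p" "tnorm g p v \<le> 1" by blast
    have \<omega>v: "\<omega> v = \<omega> (coord_vec A c p (v c))" by (rule arg_cong[OF tangent_eq_coord_vec[OF c v(2)]])
    have "m * norm (v c) \<le> 1" using m(2)[of "v c"] tnorm_eq_gnorm[OF c v(2)] v(3) by linarith
    then have "norm (v c) \<le> 1 / m" using m(1) by (simp add: pos_le_divide_eq mult.commute)
    then have "norm (v c) * B \<le> (1 / m) * B" using B(1) by (intro mult_right_mono) auto
    then show "y \<le> (1 / m) * B" using B(2)[of "v c"] v(1) unfolding \<omega>v by linarith
  qed
  let ?u = "v c"
  have \<omega>v: "\<omega> v = \<omega> (coord_vec A c p ?u)" by (rule arg_cong[OF tangent_eq_coord_vec[OF c v]])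
  have tv: "tnorm g p v = gnorm c (snd c p) ?u" by (rule tnorm_eq_gnorm[OF c v])
  show ?thesis
  proof (cases "?u = 0")
    case True
    have "\<omega> (coord_vec A c p 0) = 0" using linear_0[OF lin] by simp
    then have "\<omega> v = 0" unfolding \<omega>v True .
    moreover have "tnorm g p v = 0" unfolding tv True by (simp add: quad_form_def)
    ultimately show ?thesis by simp
  next
    case False
    then have t0: "tnorm g p v > 0" unfolding tv using quad_form_pos[OF c(1) _ False, of "snd c p"] c(2) by simp
    let ?w = "coord_vec A c p ((1 / tnorm g p v) *\<^sub>R ?u)"
    have "tnorm g p ?w = 1"
      unfolding tnorm_coord_vec[OF c] quad_form_scale real_sqrt_mult using t0 tv by simp
    then have "\<bar>\<omega> ?w\<bar> \<le> conorm A g p \<omega>"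
      unfolding conorm_def using coord_vec_mem[OF c] by (intro cSup_upper bdd CollectI exI[of _ ?w]) simp
    moreover have "\<omega> ?w = (1 / tnorm g p v) * \<omega> v"
      using linear_scale[OF lin, of "1 / tnorm g p v" ?u] unfolding \<omega>v by simp
    ultimately have "\<bar>\<omega> v\<bar> / tnorm g p v \<le> conorm A g p \<omega>" using t0 by (simp add: abs_mult)
    then show ?thesis unfolding pos_divide_le_eq[OF t0] .
  qed
qed

end

section \<open>Change of variables over arbitrary finite index types\<close>

text \<open>
  The change of variables formula depends on an order of the coordinates, through the decomposition
  of matrices into elementary ones. The following copy of a finite type is ordered by an injection
  into the natural numbers; reindexing vectors by it preserves Lebesgue measure and determinants and
  thus carries the formula over to every finite index type.
\<close>

typedef 'n ordered_index = "UNIV :: 'n set" morphisms of_index to_index by simp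

lemma index_inverse [simp]: "to_index (of_index i) = i" "of_index (to_index j) = j"
  by (simp_all add: of_index_inverse to_index_inverse)

definition index_code :: "'n::finite \<Rightarrow> nat" where
  "index_code = (SOME f. inj f)"

lemma inj_index_code: "inj (index_code :: 'n::finite \<Rightarrow> nat)"
proof -
  have "\<exists>f :: 'n \<Rightarrow> nat. inj f" using finite_imp_inj_to_nat_seg[of "UNIV :: 'n set"] by auto
  then show ?thesis unfolding index_code_def by (rule someI_ex)
qed

instance ordered_index :: (finite) finite
proof
  have "(UNIV :: 'a ordered_index set) = range to_index" using index_inverse(1) by (intro equalityI subsetI UNIV_I range_eqI[OF sym])
  moreover have "finite (range (to_index :: 'a \<Rightarrow> 'a ordered_index))" by (rule finite_imageI) simp
  ultimately show "finite (UNIV :: 'a ordered_index set)" by (rule ssubst)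
qed

instantiation ordered_index :: (finite) wellorder
begin

definition "(i :: 'a ordered_index) \<le> j \<longleftrightarrow> index_code (of_index i) \<le> index_code (of_index j)"
definition "(i :: 'a ordered_index) < j \<longleftrightarrow> index_code (of_index i) < index_code (of_index j)"

instance
proof
  fix P :: "'a ordered_index \<Rightarrow> bool" and a :: "'a ordered_index"
  assume step: "\<And>x. (\<And>y. y < x \<Longrightarrow> P y) \<Longrightarrow> P x"
  show "P a"
  proof (induction a rule: measure_induct_rule[where f = "\<lambda>x. index_code (of_index x)"])
    case (less x)
    show ?case by (rule step, rule less, simp only: less_ordered_index_def)
  qed
next
  fix x y :: "'a ordered_index" assume "x \<le> y" "y \<le> x"
  then have "index_code (of_index x) = index_code (of_index y)" unfolding less_eq_ordered_index_def by simp
  then have "of_index x = of_index y" by (rule injD[OF inj_index_code])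
  then show "x = y" by (simp add: of_index_inject)
qed (auto simp: less_eq_ordered_index_def less_ordered_index_def)

end

definition reindex :: "real ^ 'n \<Rightarrow> real ^ 'n ordered_index" where
  "reindex x = (\<chi> i. x $ of_index i)"

definition unindex :: "real ^ 'n ordered_index \<Rightarrow> real ^ 'n" where
  "unindex y = (\<chi> j. y $ to_index j)"

lemma reindex_inverse [simp]: "unindex (reindex x) = x" "reindex (unindex y) = y"
  by (simp_all add: reindex_def unindex_def vec_eq_iff)

lemma linear_reindex: "linear (reindex :: real ^ 'n::finite \<Rightarrow> _)" "linear (unindex :: _ \<Rightarrow> real ^ 'n::finite)"
  by (auto intro!: linearI simp: reindex_def unindex_def vec_eq_iff)

lemma continuous_reindex: "continuous_on S (reindex :: real ^ 'n::finite \<Rightarrow> _)" "continuous_on T (unindex :: _ \<Rightarrow> real ^ 'n::finite)"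
  using linear_reindex linear_continuous_on linear_conv_bounded_linear by blast+

lemma measurable_reindex [measurable]:
  "(reindex :: real ^ 'n::finite \<Rightarrow> _) \<in> borel_measurable borel" "(unindex :: _ \<Rightarrow> real ^ 'n::finite) \<in> borel_measurable borel"
  using continuous_reindex borel_measurable_continuous_onI by blast+

lemma bij_index: "bij (of_index :: 'n ordered_index \<Rightarrow> 'n)"
  by (rule bijI) (auto simp: inj_def of_index_inject surj_def intro: exI[of _ "to_index _"])

lemma prod_Basis_vec:
  fixes f :: "real ^ 'n::finite \<Rightarrow> real"
  shows "(\<Prod>b\<in>Basis. f b) = (\<Prod>i\<in>UNIV. f (axis i 1))"
proof -
  have b: "(Basis :: (real ^ 'n) set) = range (\<lambda>i. axis i 1)" by (auto simp: Basis_vec_def)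
  have "inj (\<lambda>i. axis i 1 :: real ^ 'n)" by (auto simp: inj_def axis_eq_axis)
  then show ?thesis unfolding b by (subst prod.reindex) simp_all
qed

lemma distr_reindex: "distr lborel borel (reindex :: real ^ 'n::finite \<Rightarrow> _) = lborel"
proof (rule lborel_eqI[symmetric])
  fix l u :: "real ^ 'n ordered_index" assume le: "\<And>b. b \<in> Basis \<Longrightarrow> l \<bullet> b \<le> u \<bullet> b"
  have le': "l $ i \<le> u $ i" for i using le[of "axis i 1"] by (simp add: inner_axis)
  have eq: "reindex -` box l u = box (unindex l) (unindex u)"
  proof -
    have "(\<forall>i. P (of_index i :: 'n) i) \<longleftrightarrow> (\<forall>j. P j (to_index j))" for P
      by (metis index_inverse)
    from this[of "\<lambda>j i. l $ i < x $ j \<and> x $ j < u $ i" for x] show ?thesis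
      by (auto simp: set_eq_iff mem_box_cart reindex_def unindex_def)
  qed
  have "emeasure (distr lborel borel reindex) (box l u) = emeasure lborel (box (unindex l) (unindex u))"
    by (subst emeasure_distr) (simp_all add: eq)
  also have "\<dots> = ennreal (\<Prod>b\<in>Basis. (unindex u - unindex l) \<bullet> b)"
  proof (rule emeasure_lborel_box)
    show "unindex l \<bullet> b \<le> unindex u \<bullet> b" if "b \<in> Basis" for b :: "real ^ 'n"
      using that le' by (auto simp: Basis_vec_def inner_axis unindex_def)
  qed
  also have "(\<Prod>b\<in>Basis. (unindex u - unindex l) \<bullet> b) = (\<Prod>j\<in>UNIV. u $ to_index j - l $ to_index j)"
    unfolding prod_Basis_vec by (simp add: inner_axis unindex_def)
  also have "\<dots> = (\<Prod>i\<in>UNIV. u $ to_index (of_index i) - l $ to_index (of_index i))"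
    by (rule prod.reindex_bij_betw[OF bij_index, symmetric])
  also have "\<dots> = (\<Prod>b\<in>Basis. (u - l) \<bullet> b)"
    unfolding prod_Basis_vec by (simp add: inner_axis)
  finally show "emeasure (distr lborel borel reindex) (box l u) = ennreal (\<Prod>b\<in>Basis. (u - l) \<bullet> b)" .
qed simp

text \<open>
  Conjugation with the bijection of the index types is a sign-preserving bijection between the
  permutations in the two Leibniz formulas.
\<close>

lemma det_reindex:
  fixes T :: "real ^ 'n::finite \<Rightarrow> real ^ 'n"
  shows "det (matrix (\<lambda>y. reindex (T (unindex y)))) = det (matrix T)"
proof -
  let ?f = "of_index :: 'n ordered_index \<Rightarrow> 'n" and ?U = "UNIV :: 'n set" and ?V = "UNIV :: 'n ordered_index set"
  have inv: "unindex (axis j 1) = axis (of_index j) (1::real)" for j :: "'n ordered_index"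
    by (auto simp: unindex_def axis_def vec_eq_iff)
  have "det (matrix (\<lambda>y. reindex (T (unindex y))))
      = (\<Sum>p | p permutes ?V. of_int (sign p) * (\<Prod>i\<in>?V. T (axis (?f (p i)) 1) $ ?f i))"
    by (simp add: det_def matrix_def reindex_def inv)
  also have "\<dots> = (\<Sum>p | p permutes ?V. of_int (sign (map_permutation ?V ?f p)) * (\<Prod>j\<in>?U. T (axis (map_permutation ?V ?f p j) 1) $ j))"
  proof (rule sum.cong[OF refl])
    fix p assume p: "p \<in> {p. p permutes ?V}"
    have inj: "inj_on ?f ?V" by (rule bij_is_inj[OF bij_index])
    have "(\<Prod>j\<in>?U. T (axis (map_permutation ?V ?f p j) 1) $ j) = (\<Prod>i\<in>?V. T (axis (map_permutation ?V ?f p (?f i)) 1) $ ?f i)"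
      by (rule prod.reindex_bij_betw[OF bij_index, symmetric])
    also have "\<dots> = (\<Prod>i\<in>?V. T (axis (?f (p i)) 1) $ ?f i)"
      by (simp add: map_permutation_apply[OF inj])
    finally show "of_int (sign p) * (\<Prod>i\<in>?V. T (axis (?f (p i)) 1) $ ?f i)
        = of_int (sign (map_permutation ?V ?f p)) * (\<Prod>j\<in>?U. T (axis (map_permutation ?V ?f p j) 1) $ j)"
      using sign_map_permutation[of ?f ?V p] inj p by simp
  qed
  also have "\<dots> = (\<Sum>q | q permutes ?U. of_int (sign q) * (\<Prod>j\<in>?U. T (axis (q j) 1) $ j))"
  proof (rule sum.reindex_bij_betw)
    have b: "bij_betw ?f ?V ?U" using bij_index .
    have b': "bij_betw (to_index :: 'n \<Rightarrow> _) ?U ?V"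
      by (rule bij_betwI[of _ _ _ ?f]) auto
    show "bij_betw (map_permutation ?V ?f) {p. p permutes ?V} {q. q permutes ?U}"
    proof (rule bij_betwI[of _ _ _ "map_permutation ?U to_index"])
      show "map_permutation ?V ?f \<in> {p. p permutes ?V} \<rightarrow> {q. q permutes ?U}"
        using map_permutation_permutes b by blast
      show "map_permutation ?U to_index \<in> {q. q permutes ?U} \<rightarrow> {p. p permutes ?V}"
        using map_permutation_permutes b' by blast
      show "map_permutation ?U to_index (map_permutation ?V ?f p) = p" if "p \<in> {p. p permutes ?V}" for p
        by (rule map_permutation_compose_inv[OF b]) (use that b' in \<open>auto simp: bij_betw_def\<close>)
      show "map_permutation ?V ?f (map_permutation ?U to_index q) = q" if "q \<in> {q. q permutes ?U}" for q
        by (rule map_permutation_compose_inv[OF b']) (use that b in \<open>auto simp: bij_betw_def\<close>)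
    qed
  qed
  also have "\<dots> = det (matrix T)" by (simp add: det_def matrix_def)
  finally show ?thesis .
qed

lemma emeasure_image_wellorder:
  fixes T :: "real ^ 'm::{finite,wellorder} \<Rightarrow> real ^ 'm::_"
  assumes E: "E \<in> sets borel" "T ` E \<in> sets borel"
    and der: "\<And>x. x \<in> E \<Longrightarrow> (T has_derivative T' x) (at x within E)" and inj: "inj_on T E"
    and meas: "(\<lambda>x. indicator E x * \<bar>det (matrix (T' x))\<bar>) \<in> borel_measurable borel"
  shows "emeasure lborel (T ` E) = (\<integral>\<^sup>+x. ennreal (indicator E x * \<bar>det (matrix (T' x))\<bar>) \<partial>lborel)"
    (is "_ = integral\<^sup>N lborel (\<lambda>x. ennreal (?h x))")
proof (cases "emeasure lborel (T ` E) = \<infinity>")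
  case False
  then have "T ` E \<in> lmeasurable" using E(2) by (auto simp: fmeasurable_def less_top)
  then have "((\<lambda>x. \<bar>det (matrix (T' x))\<bar>) has_integral measure lebesgue (T ` E)) E"
    using has_measure_differentiable_image[OF _ der inj, of "measure lebesgue (T ` E)"] E(1) by simp
  then have 1: "(\<integral>\<^sup>+x. ennreal (indicator E x * \<bar>det (matrix (T' x))\<bar>) \<partial>lborel) = ennreal (measure lebesgue (T ` E))"
    by (intro nn_integral_has_integral_lebesgue) auto
  have 2: "measure lebesgue (T ` E) = measure lborel (T ` E)" using E(2) by (intro measure_completion) simp
  have 3: "emeasure lborel (T ` E) = ennreal (measure lborel (T ` E))"
    by (rule emeasure_eq_ennreal_measure) (use False in simp)
  show ?thesis unfolding 1 2 by (rule 3)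
next
  case True
  have "(\<integral>\<^sup>+x. ennreal (?h x) \<partial>lborel) = \<infinity>"
  proof (rule ccontr)
    assume "(\<integral>\<^sup>+x. ennreal (?h x) \<partial>lborel) \<noteq> \<infinity>"
    then obtain r where r: "0 \<le> r" "(\<integral>\<^sup>+x. ennreal (?h x) \<partial>lborel) = ennreal r"
      by (cases "\<integral>\<^sup>+x. ennreal (?h x) \<partial>lborel" rule: ennreal_cases) simp_all
    have "(?h has_integral r) UNIV"
      by (rule nn_integral_has_integral) (use r meas in auto)
    moreover have "?h = (\<lambda>x. if x \<in> E then \<bar>det (matrix (T' x))\<bar> else 0)" by (auto simp: indicator_def)
    ultimately have "((\<lambda>x. \<bar>det (matrix (T' x))\<bar>) has_integral r) E" by (simp add: has_integral_restrict_UNIV)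
    then have "T ` E \<in> lmeasurable"
      using has_measure_differentiable_image[OF _ der inj, of r] E(1) by simp
    then show False using True E(2) by (auto simp: fmeasurable_def)
  qed
  then show ?thesis using True by simp
qed

lemma emeasure_differentiable_image:
  fixes T :: "real ^ 'n::finite \<Rightarrow> real ^ 'n"
  assumes E: "E \<in> sets borel" "T ` E \<in> sets borel"
    and der: "\<And>x. x \<in> E \<Longrightarrow> (T has_derivative T' x) (at x)" and inj: "inj_on T E"
    and meas: "(\<lambda>x. indicator E x * \<bar>det (matrix (T' x))\<bar>) \<in> borel_measurable borel"
  shows "emeasure lborel (T ` E) = (\<integral>\<^sup>+x. ennreal (indicator E x * \<bar>det (matrix (T' x))\<bar>) \<partial>lborel)"
proof -
  define F where "F = unindex -` E"
  define S where "S y = reindex (T (unindex y))" for y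
  define S' where "S' y z = reindex (T' (unindex y) (unindex z))" for y z
  have im: "reindex ` X = unindex -` X" for X :: "(real ^ 'n) set" by (force simp: image_iff)
  have F: "F \<in> sets borel" unfolding F_def using E(1) measurable_sets[OF measurable_reindex(2), of E] by simp
  have SF: "S ` F = unindex -` (T ` E)"
    unfolding im[symmetric] F_def S_def by (force simp: image_iff)
  then have SFm: "S ` F \<in> sets borel" using E(2) measurable_sets[OF measurable_reindex(2), of "T ` E"] by simp
  have bl: "bounded_linear (reindex :: real ^ 'n \<Rightarrow> _)" "bounded_linear (unindex :: _ \<Rightarrow> real ^ 'n)"
    using linear_reindex linear_conv_bounded_linear by blast+
  have derS: "(S has_derivative S' y) (at y within F)" if "y \<in> F" for y
  proof -
    have "(T has_derivative T' (unindex y)) (at (unindex y))" using der that unfolding F_def by simp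
    then have "((\<lambda>y. T (unindex y)) has_derivative (\<lambda>z. T' (unindex y) (unindex z))) (at y)"
      by (rule has_derivative_compose[OF bounded_linear.has_derivative[OF bl(2) has_derivative_ident]])
    then have "(S has_derivative S' y) (at y)"
      unfolding S_def S'_def by (rule bounded_linear.has_derivative[OF bl(1)])
    then show ?thesis by (rule has_derivative_at_withinI)
  qed
  have injS: "inj_on S F"
    using inj unfolding inj_on_def S_def F_def by (metis reindex_inverse vimage_eq)
  have det: "det (matrix (S' y)) = det (matrix (T' (unindex y)))" for y
    unfolding S'_def by (rule det_reindex)
  have ind: "indicator F y = (indicator E (unindex y) :: real)" for y by (auto simp: F_def indicator_def)
  have measS: "(\<lambda>y. indicator F y * \<bar>det (matrix (S' y))\<bar>) \<in> borel_measurable borel"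
    unfolding det ind using measurable_compose[OF measurable_reindex(2) meas] by simp
  have "emeasure lborel (T ` E) = emeasure (distr lborel borel reindex) (S ` F)"
    by (subst emeasure_distr) (use SFm in \<open>auto simp: SF vimage_def\<close>)
  also have "\<dots> = emeasure lborel (S ` F)" unfolding distr_reindex ..
  also have "\<dots> = (\<integral>\<^sup>+y. ennreal (indicator F y * \<bar>det (matrix (S' y))\<bar>) \<partial>lborel)"
    by (rule emeasure_image_wellorder[OF F SFm derS injS measS])
  also have "\<dots> = (\<integral>\<^sup>+y. ennreal (indicator F y * \<bar>det (matrix (S' y))\<bar>) \<partial>distr lborel borel reindex)"
    unfolding distr_reindex ..
  also have "\<dots> = (\<integral>\<^sup>+x. ennreal (indicator F (reindex x) * \<bar>det (matrix (S' (reindex x)))\<bar>) \<partial>lborel)"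
    by (rule nn_integral_distr) (use measS in auto)
  finally show ?thesis unfolding det ind by simp
qed

text \<open>
  By \<open>emeasure_differentiable_image\<close>, the push-forward under \<open>T\<close> of the measure with density
  \<open>\<bar>det T'\<bar>\<close> on \<open>S\<close> is Lebesgue measure on \<open>T ` S\<close>.
\<close>

theorem nn_integral_change_of_variables:
  fixes T :: "real ^ 'n::finite \<Rightarrow> real ^ 'n" and h :: "real ^ 'n \<Rightarrow> ennreal"
  assumes S: "open S" "open (T ` S)"
    and der: "\<And>x. x \<in> S \<Longrightarrow> (T has_derivative T' x) (at x)" and inj: "inj_on T S"
    and cont: "\<And>u. continuous_on S (\<lambda>x. T' x u)"
    and h: "h \<in> borel_measurable borel"
  shows "(\<integral>\<^sup>+y. indicator (T ` S) y * h y \<partial>lborel) = (\<integral>\<^sup>+x. ennreal \<bar>det (matrix (T' x))\<bar> * (indicator S x * h (T x)) \<partial>lborel)"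
proof -
  have [measurable]: "S \<in> sets borel" "T ` S \<in> sets borel" using S by auto
  define J where "J x = \<bar>det (matrix (T' x))\<bar>" for x
  have cJ: "continuous_on S J"
    unfolding J_def det_def matrix_def by (auto intro!: continuous_intros cont)
  have cT: "continuous_on S T"
    using der has_derivative_continuous continuous_at_imp_continuous_on by blast
  have Jm: "(\<lambda>x. indicator E x * J x) \<in> borel_measurable borel" if "E \<subseteq> S" "E \<in> sets borel" for E
  proof -
    have "(\<lambda>x. indicator S x *\<^sub>R J x) \<in> borel_measurable borel"
      using borel_measurable_continuous_on_indicator[OF _ cJ] by simp
    then have "(\<lambda>x. indicator E x * (indicator S x *\<^sub>R J x)) \<in> borel_measurable borel" using that(2) by simp
    moreover have "(\<lambda>x. indicator E x * (indicator S x *\<^sub>R J x)) = (\<lambda>x. indicator E x * J x)"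
      by (rule ext) (use that(1) in \<open>auto simp: indicator_def\<close>)
    ultimately show ?thesis by simp
  qed
  define Tm where "Tm x = (if x \<in> S then T x else 0)" for x
  have "(\<lambda>x. indicator S x *\<^sub>R T x) \<in> borel_measurable borel"
    using borel_measurable_continuous_on_indicator[OF _ cT] by simp
  moreover have "(\<lambda>x. indicator S x *\<^sub>R T x) = Tm" by (auto simp: Tm_def indicator_def)
  ultimately have Tm[measurable]: "Tm \<in> borel_measurable borel" by simp
  let ?N = "density lborel (\<lambda>x. ennreal (indicator S x * J x))"
  have Jm'[measurable]: "(\<lambda>x. ennreal (indicator S x * J x)) \<in> borel_measurable borel" using Jm[of S] by simp
  have eq: "distr ?N borel Tm = density lborel (indicator (T ` S))"
  proof (rule measure_eqI)
    fix G assume "G \<in> sets (distr ?N borel Tm)"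
    then have G[measurable]: "G \<in> sets borel" by simp
    define E where "E = S \<inter> Tm -` G"
    have E[measurable]: "E \<in> sets borel" unfolding E_def using measurable_sets[OF Tm G] by simp
    have TE: "T ` E = T ` S \<inter> G" unfolding E_def Tm_def by auto
    have "emeasure (distr ?N borel Tm) G = emeasure ?N (Tm -` G)" by (subst emeasure_distr) simp_all
    also have "\<dots> = (\<integral>\<^sup>+x. ennreal (indicator S x * J x) * indicator (Tm -` G) x \<partial>lborel)"
      using measurable_sets[OF Tm G] by (subst emeasure_density) simp_all
    also have "\<dots> = (\<integral>\<^sup>+x. ennreal (indicator E x * J x) \<partial>lborel)"
      by (intro nn_integral_cong) (auto simp: E_def indicator_def)
    also have "\<dots> = emeasure lborel (T ` E)"
      unfolding J_def
    proof (rule emeasure_differentiable_image[symmetric])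
      show "T ` E \<in> sets borel" unfolding TE by simp
      show "(T has_derivative T' x) (at x)" if "x \<in> E" for x using der that unfolding E_def by blast
      show "inj_on T E" using inj unfolding E_def by (rule inj_on_subset) blast
      show "(\<lambda>x. indicator E x * \<bar>det (matrix (T' x))\<bar>) \<in> borel_measurable borel"
        using Jm[of E] E unfolding E_def J_def by blast
    qed simp
    also have "\<dots> = emeasure (density lborel (indicator (T ` S))) G"
      unfolding TE by (subst emeasure_density) (auto simp: indicator_inter_arith[symmetric] nn_integral_indicator)
    finally show "emeasure (distr ?N borel Tm) G = emeasure (density lborel (indicator (T ` S))) G" .
  qed simp
  have "(\<integral>\<^sup>+y. indicator (T ` S) y * h y \<partial>lborel) = (\<integral>\<^sup>+y. h y \<partial>density lborel (indicator (T ` S)))"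
    by (subst nn_integral_density) (use h in simp_all)
  also have "\<dots> = (\<integral>\<^sup>+x. h (Tm x) \<partial>?N)"
    unfolding eq[symmetric] by (subst nn_integral_distr) (use h in simp_all)
  also have "\<dots> = (\<integral>\<^sup>+x. ennreal (indicator S x * J x) * h (Tm x) \<partial>lborel)"
    by (subst nn_integral_density) (use measurable_compose[OF Tm h] in simp_all)
  also have "\<dots> = (\<integral>\<^sup>+x. ennreal \<bar>det (matrix (T' x))\<bar> * (indicator S x * h (T x)) \<partial>lborel)"
    by (intro nn_integral_cong) (auto simp: J_def Tm_def indicator_def)
  finally show ?thesis .
qed

section \<open>The Riemannian volume\<close>

lemma quad_form_inner: "quad_form G u = u \<bullet> (G *v u)"
  unfolding quad_form_def inner_vec_def matrix_vector_mult_def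
  by (simp add: sum_distrib_left mult_ac)

lemma det_nonzero_of_quad_form_pos:
  fixes G :: "real ^ 'n::finite ^ 'n"
  assumes "\<And>u. u \<noteq> 0 \<Longrightarrow> 0 < quad_form G u"
  shows "det G \<noteq> 0"
proof -
  have "\<forall>u. G *v u = 0 \<longrightarrow> u = 0"
  proof (intro allI impI, rule ccontr)
    fix u assume "G *v u = 0" "u \<noteq> 0"
    then show False using assms[of u] unfolding quad_form_inner by simp
  qed
  then have "\<exists>B. B ** G = mat 1" unfolding matrix_left_invertible_ker .
  then have "invertible G" by (meson invertible_left_inverse)
  then show ?thesis by (simp add: invertible_det_nz)
qed

text \<open>
  Along the segment from the identity matrix to \<open>G\<close> the quadratic form stays positive definite, so the
  determinant has no zero there and keeps its sign.
\<close>

lemma det_pos_of_quad_form_pos: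
  fixes G :: "real ^ 'n::finite ^ 'n"
  assumes pos: "\<And>u. u \<noteq> 0 \<Longrightarrow> 0 < quad_form G u"
  shows "0 < det G"
proof (rule ccontr)
  assume "\<not> 0 < det G"
  (* The segment from the identity matrix to G. *)
  define H where "H t = (\<chi> i j. (1 - t) * (if i = j then 1 else 0) + t * G $ i $ j)" for t :: real
  have H: "H 0 = mat 1" "H 1 = G" by (simp_all add: H_def mat_def vec_eq_iff)
  have q: "quad_form (H t) u = (1 - t) * (u \<bullet> u) + t * quad_form G u" for t u
  proof -
    have "quad_form (H t) u = (\<Sum>i\<in>UNIV. \<Sum>j\<in>UNIV. (1 - t) * (if i = j then u $ i * u $ j else 0) + t * (u $ i * u $ j * G $ i $ j))"
      unfolding quad_form_def H_def by (intro sum.cong refl) (simp add: algebra_simps)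
    also have "\<dots> = (1 - t) * (\<Sum>i\<in>UNIV. \<Sum>j\<in>UNIV. (if i = j then u $ i * u $ j else 0)) + t * quad_form G u"
      unfolding quad_form_def by (simp only: sum.distrib sum_distrib_left)
    also have "(\<Sum>i\<in>UNIV. \<Sum>j\<in>UNIV. (if i = j then u $ i * u $ j else 0)) = u \<bullet> u"
      by (simp add: inner_vec_def)
    finally show ?thesis .
  qed
  have "det (H t) \<noteq> 0" if "0 \<le> t" "t \<le> 1" for t
  proof (rule det_nonzero_of_quad_form_pos)
    fix u :: "real ^ 'n" assume u: "u \<noteq> 0"
    have uu: "0 < u \<bullet> u" using u by simp
    show "0 < quad_form (H t) u"
    proof (cases "t = 1")
      case True
      then show ?thesis using q[of t u] pos[OF u] by simp
    next
      case False
      then have "0 < (1 - t) * (u \<bullet> u)" using that uu by simp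
      moreover have "0 \<le> t * quad_form G u" using that pos[OF u] by simp
      ultimately show ?thesis unfolding q by linarith
    qed
  qed
  moreover have "\<exists>t. 0 \<le> t \<and> t \<le> 1 \<and> det (H t) = 0"
  proof (rule IVT2')
    show "det (H 1) \<le> 0" unfolding H using \<open>\<not> 0 < det G\<close> by simp
    show "0 \<le> det (H 0)" unfolding H by simp
    show "continuous_on {0..1} (\<lambda>t. det (H t))"
      unfolding det_def H_def by (auto intro!: continuous_intros)
  qed simp
  ultimately show False by blast
qed

context riemannian_manifold
begin

definition vol_density :: "('m, 'n) chart \<Rightarrow> real ^ 'n \<Rightarrow> real" where
  "vol_density c x = sqrt (det (gram_matrix A g c x))"

lemma vol_density_pos:
  assumes "c \<in> A" "x \<in> chart_image c"
  shows "0 < vol_density c x"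
  unfolding vol_density_def using det_pos_of_quad_form_pos[OF quad_form_pos[OF assms]] by simp

text \<open>
  With the Jacobian matrix \<open>J\<close> of the transition map, the Gram matrices are related by \<open>J\<^sup>T G J\<close>.
\<close>

lemma vol_density_change:
  assumes c: "c \<in> A" "c' \<in> A" and p: "p \<in> fst c" "p \<in> fst c'"
  shows "vol_density c (snd c p)
    = \<bar>det (matrix (frechet_derivative (transition c c') (at (snd c p))))\<bar> * vol_density c' (snd c' p)"
proof -
  define D where "D = frechet_derivative (transition c c') (at (snd c p))"
  define J where "J = matrix D"
  have "gram_matrix A g c (snd c p) = transpose J ** gram_matrix A g c' (snd c' p) ** J"
  proof -
    have "gram_matrix A g c (snd c p) $ i $ j = (transpose J ** gram_matrix A g c' (snd c' p) ** J) $ i $ j" for i j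
    proof -
      have "gram_matrix A g c (snd c p) $ i $ j = g p (coord_vec A c' p (D (axis i 1))) (coord_vec A c' p (D (axis j 1)))"
        unfolding gram_matrix_def chart_inv_left[OF c(1) p(1)] D_def coord_vec_change[OF c p] by simp
      also have "\<dots> = (\<Sum>k\<in>UNIV. \<Sum>l\<in>UNIV. J $ k $ i * J $ l $ j * gram_matrix A g c' (snd c' p) $ k $ l)"
        unfolding metric_eq_gram[OF c(2) p(2)] J_def matrix_def by simp
      also have "\<dots> = (\<Sum>l\<in>UNIV. \<Sum>k\<in>UNIV. J $ k $ i * J $ l $ j * gram_matrix A g c' (snd c' p) $ k $ l)"
        by (rule sum.swap)
      also have "\<dots> = (transpose J ** gram_matrix A g c' (snd c' p) ** J) $ i $ j"
        by (simp add: matrix_matrix_mult_def transpose_def sum_distrib_left sum_distrib_right mult_ac)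
      finally show ?thesis .
    qed
    then show ?thesis by (simp add: vec_eq_iff)
  qed
  then have "det (gram_matrix A g c (snd c p)) = (det J)\<^sup>2 * det (gram_matrix A g c' (snd c' p))"
    by (simp add: det_mul det_transpose power2_eq_square)
  then show ?thesis unfolding vol_density_def J_def D_def by (simp add: real_sqrt_mult)
qed

text \<open>
  Outside of the chart image \<open>chart_inv\<close> has no useful properties; a constant value there makes the
  function Borel measurable on all of \<open>\<real>\<^sup>n\<close>.
\<close>

definition cinv :: "('m, 'n) chart \<Rightarrow> real ^ 'n \<Rightarrow> 'm" where
  "cinv c x = (if x \<in> chart_image c then chart_inv c x else undefined)"

definition cdens :: "('m, 'n) chart \<Rightarrow> real ^ 'n \<Rightarrow> real" where
  "cdens c x = indicator (chart_image c) x * vol_density c x"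

lemma cdens_nonneg: "c \<in> A \<Longrightarrow> 0 \<le> cdens c x"
  unfolding cdens_def using vol_density_pos[of c x] by (auto simp: indicator_def)

lemma cdens_pos: "c \<in> A \<Longrightarrow> x \<in> chart_image c \<Longrightarrow> 0 < cdens c x"
  unfolding cdens_def using vol_density_pos[of c x] by simp

lemma continuous_vol_density: "c \<in> A \<Longrightarrow> continuous_on (chart_image c) (vol_density c)"
  unfolding vol_density_def det_def
  by (intro continuous_on_real_sqrt) (auto intro!: continuous_intros continuous_gram)

lemma cdens_measurable [measurable]:
  assumes "c \<in> A" shows "cdens c \<in> borel_measurable borel"
proof -
  have "(\<lambda>x. indicator (chart_image c) x *\<^sub>R vol_density c x) \<in> borel_measurable borel"
    using open_chart_image[OF assms] by (intro borel_measurable_continuous_on_indicator continuous_vol_density[OF assms]) simp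
  moreover have "cdens c = (\<lambda>x. indicator (chart_image c) x *\<^sub>R vol_density c x)"
    by (rule ext) (simp add: cdens_def)
  ultimately show ?thesis by simp
qed

lemma cinv_measurable [measurable]:
  assumes "c \<in> A" shows "cinv c \<in> borel_measurable borel"
proof (rule borel_measurableI)
  fix U :: "'m set" assume U: "open U"
  have o: "open (chart_image c \<inter> chart_inv c -` U)"
    by (rule continuous_open_preimage[OF continuous_chart_inv[OF assms] open_chart_image[OF assms] U])
  have "cinv c -` U = (chart_image c \<inter> chart_inv c -` U) \<union> (if undefined \<in> U then - chart_image c else {})"
    by (auto simp: cinv_def split: if_splits)
  moreover have "\<dots> \<in> sets borel" using o open_chart_image[OF assms] by (intro sets.Un) auto
  ultimately show "cinv c -` U \<inter> space borel \<in> sets borel" by simp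
qed

definition chart_measure :: "('m, 'n) chart \<Rightarrow> 'm measure" where
  "chart_measure c = distr (density lborel (\<lambda>x. ennreal (cdens c x))) borel (cinv c)"

lemma sets_chart_measure [simp]: "sets (chart_measure c) = sets borel"
  by (simp add: chart_measure_def)

lemma emeasure_chart_measure:
  assumes "c \<in> A" "G \<in> sets borel"
  shows "emeasure (chart_measure c) G = (\<integral>\<^sup>+x. ennreal (cdens c x) * indicator G (cinv c x) \<partial>lborel)"
proof -
  have m: "cinv c -` G \<in> sets borel" using measurable_sets[OF cinv_measurable[OF assms(1)] assms(2)] by simp
  have "emeasure (chart_measure c) G = emeasure (density lborel (\<lambda>x. ennreal (cdens c x))) (cinv c -` G)"
    unfolding chart_measure_def using assms cinv_measurable[OF assms(1)] by (subst emeasure_distr) simp_all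
  also have "\<dots> = (\<integral>\<^sup>+x. ennreal (cdens c x) * indicator (cinv c -` G) x \<partial>lborel)"
    using m cdens_measurable[OF assms(1)] by (subst emeasure_density) simp_all
  finally show ?thesis by (simp add: indicator_def)
qed

lemma emeasure_chart_measure_Int:
  assumes "c \<in> A" "G \<in> sets borel"
  shows "emeasure (chart_measure c) (G \<inter> fst c) = emeasure (chart_measure c) G"
proof -
  have "G \<inter> fst c \<in> sets borel" using assms open_chart by (intro sets.Int) auto
  note G' = this
  show ?thesis
    unfolding emeasure_chart_measure[OF assms] emeasure_chart_measure[OF assms(1) G']
  proof (rule nn_integral_cong)
    fix x
    show "ennreal (cdens c x) * indicator (G \<inter> fst c) (cinv c x) = ennreal (cdens c x) * indicator G (cinv c x)"
    proof (cases "x \<in> chart_image c")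
      case True
      then have "cinv c x \<in> fst c" unfolding cinv_def using chart_inv_mem[OF assms(1)] by (simp only: if_True)
      then show ?thesis by (simp add: indicator_def)
    next
      case False
      then have "cdens c x = 0" unfolding cdens_def by simp
      then show ?thesis by simp
    qed
  qed
qed

lemma emeasure_chart_measure_eq_image:
  assumes "c \<in> A" "E \<in> sets borel" "E \<subseteq> fst c"
  shows "emeasure (chart_measure c) E
    = (\<integral>\<^sup>+x. ennreal (sqrt (det (gram_matrix A g c x))) * indicator (snd c ` E) x \<partial>lborel)"
  unfolding emeasure_chart_measure[OF assms(1,2)]
proof (rule nn_integral_cong)
  fix x
  show "ennreal (cdens c x) * indicator E (cinv c x)
      = ennreal (sqrt (det (gram_matrix A g c x))) * indicator (snd c ` E) x"
  proof (cases "x \<in> chart_image c")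
    case True
    have "x \<in> snd c ` E \<longleftrightarrow> cinv c x \<in> E"
    proof
      assume "x \<in> snd c ` E"
      then obtain p where p: "p \<in> E" "x = snd c p" by blast
      then have "cinv c x = p" unfolding cinv_def using True chart_inv_left[OF assms(1)] assms(3) by auto
      then show "cinv c x \<in> E" using p by simp
    next
      assume "cinv c x \<in> E"
      moreover have "x = snd c (cinv c x)" unfolding cinv_def using True chart_inv_right[OF assms(1) True] by simp
      ultimately show "x \<in> snd c ` E" by (rule rev_image_eqI)
    qed
    then show ?thesis using True by (simp add: cdens_def vol_density_def indicator_def)
  next
    case False
    then have "x \<notin> snd c ` E" "cdens c x = 0" unfolding cdens_def using assms(3) by auto
    then show ?thesis by simp
  qed
qed

text \<open>
  Change of variables along the transition map, whose Jacobian is compensated by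
  \<open>vol_density_change\<close>.
\<close>

lemma chart_measure_compatible:
  assumes c: "c \<in> A" "c' \<in> A" and E: "E \<in> sets borel" "E \<subseteq> fst c \<inter> fst c'"
  shows "emeasure (chart_measure c) E = emeasure (chart_measure c') E"
proof -
  let ?T = "transition c c'" and ?S = "snd c ` (fst c \<inter> fst c')"
  let ?h = "\<lambda>y. ennreal (cdens c' y) * indicator E (cinv c' y)"
  have TS: "?T ` ?S = snd c' ` (fst c \<inter> fst c')"
    unfolding image_image by (rule image_cong[OF refl]) (use chart_inv_left[OF c(1)] in \<open>simp add: transition_def\<close>)
  have S: "open ?S" "open (?T ` ?S)"
    unfolding TS using overlap_image(2)[OF c(1) open_chart[OF c(2)]] overlap_image(2)[OF c(2) open_chart[OF c(1)]]
    by (simp_all add: Int_commute)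
  have hm: "?h \<in> borel_measurable borel"
    using cdens_measurable[OF c(2)] measurable_compose[OF cinv_measurable[OF c(2)] borel_measurable_indicator[OF E(1), where 'b = ennreal]]
    by simp
  have "emeasure (chart_measure c') E = (\<integral>\<^sup>+y. indicator (?T ` ?S) y * ?h y \<partial>lborel)"
    unfolding emeasure_chart_measure[OF c(2) E(1)]
  proof (rule nn_integral_cong)
    fix y
    show "?h y = indicator (?T ` ?S) y * ?h y"
    proof (cases "y \<in> chart_image c' \<and> chart_inv c' y \<in> E")
      case True
      then have "y = snd c' (chart_inv c' y)" "chart_inv c' y \<in> fst c \<inter> fst c'"
        using chart_inv_right[OF c(2)] E(2) by auto
      then have "y \<in> ?T ` ?S" unfolding TS by (rule image_eqI)
      then show ?thesis by simp
    next
      case False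
      then have z: "?h y = 0" by (auto simp: cdens_def cinv_def indicator_def)
      show ?thesis unfolding z by (simp only: mult_zero_right)
    qed
  qed
  also have "\<dots> = (\<integral>\<^sup>+x. ennreal \<bar>det (matrix (frechet_derivative ?T (at x)))\<bar> * (indicator ?S x * ?h (?T x)) \<partial>lborel)"
  proof (rule nn_integral_change_of_variables[OF S])
    show "(?T has_derivative frechet_derivative ?T (at x)) (at x)" if "x \<in> ?S" for x
      using that transition_has_derivative[OF c] by auto
    show "inj_on ?T ?S"
    proof (rule inj_onI)
      fix x y assume "x \<in> ?S" "y \<in> ?S" and eq: "?T x = ?T y"
      then obtain p q where pq: "p \<in> fst c" "p \<in> fst c'" "x = snd c p" "q \<in> fst c" "q \<in> fst c'" "y = snd c q" by blast
      then have "snd c' p = snd c' q" using eq chart_inv_left[OF c(1)] by (simp add: transition_def)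
      then have "p = q" using chart_inv_left[OF c(2)] pq by metis
      then show "x = y" using pq by simp
    qed
    show "continuous_on ?S (\<lambda>x. frechet_derivative ?T (at x) u)" for u
      by (rule continuous_transition_derivative(1)[OF c])
  qed (rule hm)
  also have "\<dots> = emeasure (chart_measure c) E"
    unfolding emeasure_chart_measure[OF c(1) E(1)]
  proof (rule nn_integral_cong)
    fix x
    show "ennreal \<bar>det (matrix (frechet_derivative ?T (at x)))\<bar> * (indicator ?S x * ?h (?T x)) = ennreal (cdens c x) * indicator E (cinv c x)"
    proof (cases "x \<in> ?S")
      case True
      then obtain p where p: "p \<in> fst c" "p \<in> fst c'" "x = snd c p" by blast
      have Tx: "?T x = snd c' p" using p chart_inv_left[OF c(1)] by (simp add: transition_def)
      have 1: "cinv c' (?T x) = p" "cinv c x = p"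
        using p chart_inv_left[OF c(1)] chart_inv_left[OF c(2)] unfolding Tx cinv_def by auto
      have 2: "cdens c x = \<bar>det (matrix (frechet_derivative ?T (at x)))\<bar> * cdens c' (?T x)"
        unfolding cdens_def Tx using vol_density_change[OF c p(1,2)] p by simp
      show ?thesis unfolding 1 2 using True by (simp add: ennreal_mult cdens_nonneg[OF c(2)] mult.assoc)
    next
      case False
      have "\<not> (x \<in> chart_image c \<and> chart_inv c x \<in> E)"
      proof
        assume x: "x \<in> chart_image c \<and> chart_inv c x \<in> E"
        then have "x = snd c (chart_inv c x)" "chart_inv c x \<in> fst c \<inter> fst c'"
          using chart_inv_right[OF c(1)] E(2) by auto
        then show False using False by blast
      qed
      then have z: "ennreal (cdens c x) * indicator E (cinv c x) = 0" by (auto simp: cdens_def cinv_def indicator_def)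
      show ?thesis unfolding z using False by simp
    qed
  qed
  finally show ?thesis by simp
qed

lemma countable_open_cover_refine:
  assumes "\<And>p. \<exists>i\<in>I. open (U i) \<and> p \<in> U i"
  shows "\<exists>s :: nat \<Rightarrow> 'i. (\<forall>k. s k \<in> I \<and> open (U (s k))) \<and> (\<Union>k. U (s k)) = (UNIV :: 'm set)"
proof -
  let ?F = "U ` {i \<in> I. open (U i)}"
  have "\<Union>?F = UNIV" using assms by blast
  obtain F' where F': "F' \<subseteq> ?F" "countable F'" "\<Union>F' = \<Union>?F"
    using Lindelof[of ?F] by blast
  have ne: "F' \<noteq> {}" using F'(3) \<open>\<Union>?F = UNIV\<close> by auto
  have "\<exists>i. i \<in> I \<and> open (U i) \<and> U i = from_nat_into F' k" for k
    using from_nat_into[OF ne, of k] F'(1) by blast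
  then obtain s where s: "\<And>k. s k \<in> I \<and> open (U (s k)) \<and> U (s k) = from_nat_into F' k" by metis
  have "(\<Union>k. U (s k)) = \<Union>(range (from_nat_into F'))" using s by simp
  also have "\<dots> = UNIV" using range_from_nat_into[OF ne F'(2)] F'(3) \<open>\<Union>?F = UNIV\<close> by simp
  finally show ?thesis using s by blast
qed

lemma emeasure_eq_suminf_pieces:
  assumes "sets \<mu> = sets borel" and U: "\<And>k. open (U k)" "(\<Union>k::nat. U k) = (UNIV :: 'm set)" and E: "E \<in> sets borel"
  shows "emeasure \<mu> E = (\<Sum>k. emeasure \<mu> (E \<inter> disjointed U k))"
proof -
  have Um: "range U \<subseteq> sets borel" using U(1) by auto
  then have dm: "disjointed U k \<in> sets borel" for k using sets.range_disjointed_sets[of U borel] by auto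
  have "disjoint_family (\<lambda>k. E \<inter> disjointed U k)"
    using disjoint_family_disjointed[of U] unfolding disjoint_family_on_def by blast
  moreover have "range (\<lambda>k. E \<inter> disjointed U k) \<subseteq> sets \<mu>" unfolding assms(1) using E dm by auto
  ultimately have "(\<Sum>k. emeasure \<mu> (E \<inter> disjointed U k)) = emeasure \<mu> (\<Union>k. E \<inter> disjointed U k)"
    by (intro suminf_emeasure)
  also have "(\<Union>k. E \<inter> disjointed U k) = E"
    using UN_disjointed_eq[of U] U(2) by (simp flip: Int_UN_distrib)
  finally show ?thesis by simp
qed

text \<open>
  The description that singles out the Riemannian volume, before completion.
\<close>

definition volume_axioms :: "'m measure \<Rightarrow> bool" where
  "volume_axioms \<mu> \<longleftrightarrow> sets \<mu> = sets borel \<and>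
     (\<forall>c\<in>A. \<forall>E \<in> sets borel. E \<subseteq> fst c \<longrightarrow>
        emeasure \<mu> E =
          (\<integral>\<^sup>+x. ennreal (sqrt (det (gram_matrix A g c x))) * indicator (snd c ` E) x \<partial>lborel))"

lemma volume_axioms_iff:
  "volume_axioms \<mu> \<longleftrightarrow> sets \<mu> = sets borel \<and>
     (\<forall>c\<in>A. \<forall>E \<in> sets borel. E \<subseteq> fst c \<longrightarrow> emeasure \<mu> E = emeasure (chart_measure c) E)"
  unfolding volume_axioms_def using emeasure_chart_measure_eq_image by auto

lemma chart_sequence:
  obtains s where "\<And>k::nat. s k \<in> A" "(\<Union>k. fst (s k)) = UNIV"
proof -
  have "\<exists>c\<in>A. open (fst c) \<and> p \<in> fst c" for p using chart_cover[of p] open_chart by metis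
  from countable_open_cover_refine[of A fst, OF this]
  obtain s where "\<forall>k::nat. s k \<in> A \<and> open (fst (s k))" "(\<Union>k. fst (s k)) = UNIV" by (elim exE conjE)
  then show ?thesis by (intro that[of s]) blast+
qed

lemma volume_unique:
  assumes "volume_axioms \<mu>" "volume_axioms \<nu>" shows "\<mu> = \<nu>"
proof (rule measure_eqI)
  show "sets \<mu> = sets \<nu>" using assms unfolding volume_axioms_iff by simp
  fix E assume "E \<in> sets \<mu>"
  then have E: "E \<in> sets borel" using assms unfolding volume_axioms_iff by simp
  obtain s where s: "\<And>k::nat. s k \<in> A" "(\<Union>k. fst (s k)) = UNIV" using chart_sequence by blast
  have o: "\<And>k. open (fst (s k))" using s(1) open_chart by blast
  have "range (\<lambda>k. fst (s k)) \<subseteq> sets borel" using o by auto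
  then have dm: "disjointed (\<lambda>k. fst (s k)) k \<in> sets borel" for k
    using sets.range_disjointed_sets[of "\<lambda>k. fst (s k)" borel] by auto
  have "emeasure \<mu> (E \<inter> disjointed (\<lambda>k. fst (s k)) k) = emeasure \<nu> (E \<inter> disjointed (\<lambda>k. fst (s k)) k)" for k
  proof -
    have "E \<inter> disjointed (\<lambda>k. fst (s k)) k \<in> sets borel" "E \<inter> disjointed (\<lambda>k. fst (s k)) k \<subseteq> fst (s k)"
      using E dm disjointed_subset[of "\<lambda>k. fst (s k)" k] by auto
    then show ?thesis using assms s(1)[of k] unfolding volume_axioms_iff by metis
  qed
  then show "emeasure \<mu> E = emeasure \<nu> E"
    using emeasure_eq_suminf_pieces[OF _ o s(2) E, of \<mu>] emeasure_eq_suminf_pieces[OF _ o s(2) E, of \<nu>]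
      assms unfolding volume_axioms_iff by simp
qed

text \<open>
  Countably many chart domains cover the manifold. Made disjoint, they are measured in one chart
  each, and \<open>chart_measure_compatible\<close> shows that any other chart gives the same result.
\<close>

lemma volume_exists: "\<exists>\<mu>. volume_axioms \<mu>"
proof -
  obtain s where s: "\<And>k::nat. s k \<in> A" "(\<Union>k. fst (s k)) = UNIV" using chart_sequence by blast
  define P where "P = disjointed (\<lambda>k. fst (s k))"
  have o: "\<And>k. open (fst (s k))" using s(1) open_chart by blast
  have "range (\<lambda>k. fst (s k)) \<subseteq> sets borel" using o by auto
  then have P[measurable]: "P k \<in> sets borel" for k
    unfolding P_def using sets.range_disjointed_sets[of "\<lambda>k. fst (s k)" borel] by auto
  have Psub: "P k \<subseteq> fst (s k)" for k unfolding P_def by (rule disjointed_subset)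
  define m where "m E = (\<Sum>k. emeasure (chart_measure (s k)) (E \<inter> P k))" for E
  define \<mu> where "\<mu> = measure_of UNIV (sets borel) m"
  have sets: "sets \<mu> = sets borel" unfolding \<mu>_def by (metis sets.sets_measure_of_eq space_borel)
  have em: "emeasure \<mu> E = m E" if "E \<in> sets borel" for E
  proof (rule emeasure_measure_of[OF \<mu>_def])
    show "sets borel \<subseteq> Pow (UNIV :: 'm set)" by simp
    show "positive (sets \<mu>) m" by (simp add: positive_def m_def)
    show "E \<in> sets \<mu>" using that sets by simp
    show "countably_additive (sets \<mu>) m"
      unfolding countably_additive_def sets
    proof (intro allI impI)
      fix F :: "nat \<Rightarrow> 'm set" assume F: "range F \<subseteq> sets borel" "disjoint_family F"
      have "m (\<Union>i. F i) = (\<Sum>k. \<Sum>i. emeasure (chart_measure (s k)) (F i \<inter> P k))"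
        unfolding m_def
      proof (rule suminf_cong)
        fix k
        have "(\<Sum>i. emeasure (chart_measure (s k)) (F i \<inter> P k)) = emeasure (chart_measure (s k)) (\<Union>i. F i \<inter> P k)"
        proof (rule suminf_emeasure)
          show "range (\<lambda>i. F i \<inter> P k) \<subseteq> sets (chart_measure (s k))" using F(1) P by auto
          show "disjoint_family (\<lambda>i. F i \<inter> P k)" using F(2) unfolding disjoint_family_on_def by blast
        qed
        then show "emeasure (chart_measure (s k)) ((\<Union>i. F i) \<inter> P k) = (\<Sum>i. emeasure (chart_measure (s k)) (F i \<inter> P k))"
          by (simp add: Int_UN_distrib2)
      qed
      also have "\<dots> = (\<integral>\<^sup>+k. (\<Sum>i. emeasure (chart_measure (s k)) (F i \<inter> P k)) \<partial>count_space UNIV)"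
        by (simp add: nn_integral_count_space_nat)
      also have "\<dots> = (\<Sum>i. \<integral>\<^sup>+k. emeasure (chart_measure (s k)) (F i \<inter> P k) \<partial>count_space UNIV)"
        by (rule nn_integral_suminf) simp
      also have "\<dots> = (\<Sum>i. m (F i))" unfolding m_def by (simp add: nn_integral_count_space_nat)
      finally show "(\<Sum>i. m (F i)) = m (\<Union> (range F))" by simp
    qed
  qed
  have "emeasure \<mu> E = emeasure (chart_measure c) E" if c: "c \<in> A" and E: "E \<in> sets borel" "E \<subseteq> fst c" for c E
  proof -
    have "emeasure (chart_measure (s k)) (E \<inter> P k) = emeasure (chart_measure c) (E \<inter> P k)" for k
      by (rule chart_measure_compatible[OF s(1) c]) (use E P Psub in auto)
    then have "emeasure \<mu> E = (\<Sum>k. emeasure (chart_measure c) (E \<inter> P k))" unfolding em[OF E(1)] m_def by simp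
    also have "\<dots> = emeasure (chart_measure c) E"
      unfolding P_def by (rule emeasure_eq_suminf_pieces[OF _ o s(2) E(1), symmetric]) simp
    finally show ?thesis .
  qed
  then have "volume_axioms \<mu>" unfolding volume_axioms_iff using sets by blast
  then show ?thesis by blast
qed

definition vol :: "'m measure" where "vol = (THE \<mu>. volume_axioms \<mu>)"

lemma riem_volume_eq: "riem_volume A g = completion vol"
  unfolding riem_volume_def vol_def volume_axioms_def ..

lemma volume_axioms_vol: "volume_axioms vol"
  unfolding vol_def using volume_exists volume_unique by (metis theI')

lemma sets_vol [simp]: "sets vol = sets borel"
  using volume_axioms_vol unfolding volume_axioms_iff by simp

lemma space_vol [simp]: "space vol = UNIV"
  using sets_eq_imp_space_eq[OF sets_vol] by simp

lemma measurable_vol [simp]: "measurable vol N = measurable borel N"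
  by (rule measurable_cong_sets[OF sets_vol refl])

lemma emeasure_vol: "c \<in> A \<Longrightarrow> E \<in> sets borel \<Longrightarrow> E \<subseteq> fst c \<Longrightarrow> emeasure vol E = emeasure (chart_measure c) E"
  using volume_axioms_vol unfolding volume_axioms_iff by blast

lemma density_vol_chart:
  assumes "c \<in> A" shows "density vol (indicator (fst c)) = chart_measure c"
proof (rule measure_eqI)
  fix G assume "G \<in> sets (density vol (indicator (fst c)))"
  then have G: "G \<in> sets borel" by simp
  have Uc: "fst c \<in> sets borel" using open_chart[OF assms] by simp
  have "emeasure (density vol (indicator (fst c))) G = (\<integral>\<^sup>+p. indicator (fst c) p * indicator G p \<partial>vol)"
    using G Uc by (subst emeasure_density) auto
  also have "\<dots> = (\<integral>\<^sup>+p. indicator (G \<inter> fst c) p \<partial>vol)"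
    by (intro nn_integral_cong) (auto simp: indicator_def)
  also have "\<dots> = emeasure vol (G \<inter> fst c)" using G Uc by (intro nn_integral_indicator) simp
  also have "\<dots> = emeasure (chart_measure c) (G \<inter> fst c)" using G Uc by (intro emeasure_vol[OF assms]) auto
  also have "\<dots> = emeasure (chart_measure c) G" by (rule emeasure_chart_measure_Int[OF assms G])
  finally show "emeasure (density vol (indicator (fst c))) G = emeasure (chart_measure c) G" .
qed simp

lemma AE_vol_imp_chart:
  assumes c: "c \<in> A" and ae: "AE p in vol. P p"
  shows "AE x in lborel. x \<in> chart_image c \<longrightarrow> P (chart_inv c x)"
proof -
  have "AE p in density vol (indicator (fst c)). P p"
    using ae open_chart[OF c] by (subst AE_density) auto
  then have "AE x in density lborel (\<lambda>x. ennreal (cdens c x)). P (cinv c x)"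
    unfolding density_vol_chart[OF c] chart_measure_def
    by (rule AE_distrD[rotated]) (use cinv_measurable[OF c] in simp)
  then have "AE x in lborel. 0 < ennreal (cdens c x) \<longrightarrow> P (cinv c x)"
    using cdens_measurable[OF c] by (subst (asm) AE_density) simp_all
  then show ?thesis by eventually_elim (use cdens_pos[OF c] in \<open>auto simp: cinv_def\<close>)
qed

lemma chart_preimage_measurable:
  assumes c: "c \<in> A" and N: "N \<in> sets borel"
  shows "{p \<in> fst c. snd c p \<in> N} \<in> sets borel"
proof -
  have "snd c \<in> borel_measurable (restrict_space borel (fst c))"
    by (rule borel_measurable_continuous_on_restrict[OF continuous_chart[OF c]])
  from measurable_sets[OF this N] have "snd c -` N \<inter> fst c \<in> sets (restrict_space borel (fst c))"
    by (simp add: space_restrict_space)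
  then have "snd c -` N \<inter> fst c \<in> sets borel"
    using open_chart[OF c] by (subst (asm) sets_restrict_space_iff) auto
  moreover have "{p \<in> fst c. snd c p \<in> N} = snd c -` N \<inter> fst c" by blast
  ultimately show ?thesis by simp
qed

lemma AE_chart_imp_vol:
  assumes c: "c \<in> A" and N: "AE x in lborel. Q x"
  shows "AE p in vol. p \<in> fst c \<longrightarrow> Q (snd c p)"
proof -
  obtain N where N: "{x \<in> space lborel. \<not> Q x} \<subseteq> N" "emeasure lborel N = 0" "N \<in> sets lborel"
    using N by (rule AE_E)
  let ?Z = "{p \<in> fst c. snd c p \<in> N}"
  have Z: "?Z \<in> sets borel" by (rule chart_preimage_measurable[OF c]) (use N in simp)
  have "emeasure vol ?Z = emeasure (chart_measure c) ?Z" by (rule emeasure_vol[OF c Z]) blast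
  also have "\<dots> = (\<integral>\<^sup>+x. ennreal (cdens c x) * indicator ?Z (cinv c x) \<partial>lborel)"
    by (rule emeasure_chart_measure[OF c Z])
  also have "\<dots> = (\<integral>\<^sup>+x. 0 \<partial>(lborel :: (real ^ 'n) measure))"
  proof (rule nn_integral_cong_AE)
    have "AE x in lborel. x \<notin> N" using N(2,3) by (intro AE_not_in) (simp add: null_sets_def)
    then show "AE x in lborel. ennreal (cdens c x) * indicator ?Z (cinv c x) = 0"
      by eventually_elim (use chart_inv_right[OF c] in \<open>auto simp: cdens_def cinv_def indicator_def\<close>)
  qed
  finally have "?Z \<in> null_sets vol" using Z by (simp add: null_sets_def)
  then have "AE p in vol. p \<notin> ?Z" by (rule AE_not_in)
  then show ?thesis by eventually_elim (use N(1) in auto)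
qed

lemma integral_vol_chart:
  fixes k :: "'m \<Rightarrow> real"
  assumes c: "c \<in> A" and k: "k \<in> borel_measurable borel"
  shows "(\<integral>p. indicator (fst c) p * k p \<partial>vol) = (\<integral>x. cdens c x * k (cinv c x) \<partial>lborel)"
    and "integrable vol (\<lambda>p. indicator (fst c) p * k p) \<longleftrightarrow> integrable lborel (\<lambda>x. cdens c x * k (cinv c x))"
proof -
  have Uc: "fst c \<in> sets borel" using open_chart[OF c] by simp
  have kc: "(\<lambda>x. k (cinv c x)) \<in> borel_measurable borel" by (rule measurable_compose[OF cinv_measurable[OF c] k])
  have e: "density vol (\<lambda>p. ennreal (indicator (fst c) p)) = chart_measure c"
    unfolding density_vol_chart[OF c, symmetric] by (simp add: ennreal_indicator)
  have "(\<integral>p. indicator (fst c) p *\<^sub>R k p \<partial>vol) = (\<integral>p. k p \<partial>chart_measure c)"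
    unfolding e[symmetric] using k Uc by (intro integral_density[symmetric]) auto
  also have "\<dots> = (\<integral>x. k (cinv c x) \<partial>density lborel (\<lambda>x. ennreal (cdens c x)))"
    unfolding chart_measure_def using k cinv_measurable[OF c] by (intro integral_distr) simp_all
  also have "\<dots> = (\<integral>x. cdens c x *\<^sub>R k (cinv c x) \<partial>lborel)"
    using kc cdens_measurable[OF c] cdens_nonneg[OF c] by (intro integral_density) auto
  finally show "(\<integral>p. indicator (fst c) p * k p \<partial>vol) = (\<integral>x. cdens c x * k (cinv c x) \<partial>lborel)" by simp
  have "integrable vol (\<lambda>p. indicator (fst c) p *\<^sub>R k p) \<longleftrightarrow> integrable (chart_measure c) k"
    unfolding e[symmetric] using k Uc by (intro integrable_density[symmetric]) auto
  also have "\<dots> \<longleftrightarrow> integrable (density lborel (\<lambda>x. ennreal (cdens c x))) (\<lambda>x. k (cinv c x))"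
    unfolding chart_measure_def using k cinv_measurable[OF c] by (intro integrable_distr_eq) simp_all
  also have "\<dots> \<longleftrightarrow> integrable lborel (\<lambda>x. cdens c x *\<^sub>R k (cinv c x))"
    using kc cdens_measurable[OF c] cdens_nonneg[OF c] by (intro integrable_density) auto
  finally show "integrable vol (\<lambda>p. indicator (fst c) p * k p) \<longleftrightarrow> integrable lborel (\<lambda>x. cdens c x * k (cinv c x))" by simp
qed

end

section \<open>The differential as a bounded measurable section\<close>

lemma completion_AE_measurable:
  fixes h h' :: "'a \<Rightarrow> 'b::topological_space"
  assumes h': "h' \<in> borel_measurable (completion M)" and ae: "AE p in completion M. h p = h' p"
  shows "h \<in> borel_measurable (completion M)"
proof (rule measurableI)
  fix S :: "'b set" assume S: "S \<in> sets borel"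
  show "h -` S \<inter> space (completion M) \<in> sets (completion M)"
  proof (rule complete_measure.in_sets_AE[OF completion.complete_measure_axioms])
    show "AE p in completion M. p \<in> h' -` S \<inter> space (completion M) \<longleftrightarrow> p \<in> h -` S \<inter> space (completion M)"
      using ae by eventually_elim auto
    show "h' -` S \<inter> space (completion M) \<in> sets (completion M)" by (rule measurable_sets[OF h' S])
  qed auto
qed simp

context connected_riemannian_manifold
begin

text \<open>
  By second countability, countably many coordinate boxes suffice to cover the manifold.
\<close>

lemma box_cover:
  obtains c a b where "\<And>k::nat. c k \<in> A" "\<And>k. cbox (a k) (b k) \<subseteq> chart_image (c k)"
    "\<And>k. open {p \<in> fst (c k). snd (c k) p \<in> box (a k) (b k)}"
    "\<And>p. \<exists>k. p \<in> fst (c k) \<and> snd (c k) p \<in> box (a k) (b k)"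
proof -
  let ?I = "{(c, a, b). c \<in> A \<and> cbox a b \<subseteq> chart_image c}"
  let ?U = "\<lambda>(c, a, b). {p \<in> fst c. snd c p \<in> box a b}"
  have op: "open {p \<in> fst c. snd c p \<in> box a b}" if "c \<in> A" for c a b
  proof -
    have "open (fst c \<inter> snd c -` box a b)"
      by (rule continuous_open_preimage[OF continuous_chart[OF that] open_chart[OF that] open_box])
    moreover have "{p \<in> fst c. snd c p \<in> box a b} = fst c \<inter> snd c -` box a b" by blast
    ultimately show ?thesis by simp
  qed
  have "\<exists>i\<in>?I. open (?U i) \<and> p \<in> ?U i" for p
  proof -
    obtain c where c: "c \<in> A" "p \<in> fst c" using chart_cover by blast
    obtain a b where ab: "snd c p \<in> box a b" "cbox a b \<subseteq> chart_image c" using chart_box[OF c] by blast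
    show ?thesis by (rule bexI[of _ "(c, a, b)"]) (use c ab op[OF c(1)] in simp_all)
  qed
  note cover = this
  from countable_open_cover_refine[of ?I ?U, OF cover]
  obtain s where s: "\<forall>k::nat. s k \<in> ?I \<and> open (?U (s k))" "(\<Union>k. ?U (s k)) = UNIV"
    by (elim exE conjE)
  define c a b where "c k = fst (s k)" and "a k = fst (snd (s k))" and "b k = snd (snd (s k))" for k
  have sk: "s k = (c k, a k, b k)" for k by (simp add: c_def a_def b_def)
  show ?thesis
  proof (rule that[of c a b])
    show "c k \<in> A" "cbox (a k) (b k) \<subseteq> chart_image (c k)" for k using s(1)[rule_format, of k] unfolding sk by simp_all
    show "open {p \<in> fst (c k). snd (c k) p \<in> box (a k) (b k)}" for k using s(1)[rule_format, of k] unfolding sk by simp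
    fix p
    have "p \<in> (\<Union>k. ?U (s k))" unfolding s(2) by simp
    then show "\<exists>k. p \<in> fst (c k) \<and> snd (c k) p \<in> box (a k) (b k)" unfolding sk by simp
  qed
qed

text \<open>
  Rademacher's theorem for \<open>chart_ext\<close> on each of countably many boxes.
\<close>

lemma lipschitz_differentiable_AE:
  assumes L: "L \<in> lipschitz_bounds A g F"
  shows "AE p in vol. \<exists>\<omega>. has_differential A F p \<omega>"
proof -
  obtain c a b where cover: "\<And>k::nat. c k \<in> A" "\<And>k. cbox (a k) (b k) \<subseteq> chart_image (c k)"
    "\<And>p. \<exists>k. p \<in> fst (c k) \<and> snd (c k) p \<in> box (a k) (b k)"
    by (rule box_cover) (rule that; assumption)
  have "AE p in vol. p \<in> fst (c k) \<and> snd (c k) p \<in> box (a k) (b k) \<longrightarrow> (\<exists>\<omega>. has_differential A F p \<omega>)" for k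
  proof (cases "box (a k) (b k) = {}")
    case False
    then have ne: "cbox (a k) (b k) \<noteq> {}" using box_subset_cbox by blast
    obtain C where "(L * C)-lipschitz_on UNIV (chart_ext (c k) (a k) (b k) F)"
      using chart_ext_lipschitz[OF cover(1,2) ne] L by metis
    from AE_chart_imp_vol[OF cover(1)[of k] rademacher[OF this]]
    show ?thesis
    proof eventually_elim
      case (elim p)
      show ?case
      proof
        assume p: "p \<in> fst (c k) \<and> snd (c k) p \<in> box (a k) (b k)"
        then obtain D where "(chart_ext (c k) (a k) (b k) F has_derivative D) (at (snd (c k) p))" using elim by blast
        then have "((F \<circ> chart_inv (c k)) has_derivative D) (at (snd (c k) p))"
          using chart_ext_has_derivative_iff p by blast
        then show "\<exists>\<omega>. has_differential A F p \<omega>" using has_differentialI[OF cover(1)] p by blast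
      qed
    qed
  qed simp
  then have "AE p in vol. \<forall>k. p \<in> fst (c k) \<and> snd (c k) p \<in> box (a k) (b k) \<longrightarrow> (\<exists>\<omega>. has_differential A F p \<omega>)"
    unfolding AE_all_countable by blast
  then show ?thesis
  proof eventually_elim
    case (elim p)
    obtain k where "p \<in> fst (c k) \<and> snd (c k) p \<in> box (a k) (b k)" using cover(3) by blast
    then show ?case using elim by blast
  qed
qed

lemma continuous_lipschitz_in_chart:
  assumes L: "L \<in> lipschitz_bounds A g F" and c: "c \<in> A"
  shows "continuous_on (chart_image c) (\<lambda>x. F (chart_inv c x))"
  unfolding continuous_on_eq_continuous_at[OF open_chart_image[OF c]]
proof
  fix x assume "x \<in> chart_image c"
  then obtain a b where ab: "x \<in> box a b" "cbox a b \<subseteq> chart_image c"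
    using open_contains_cbox[OF open_chart_image[OF c]] by metis
  have ne: "cbox a b \<noteq> {}" using ab(1) box_subset_cbox by blast
  obtain C where "(L * C)-lipschitz_on UNIV (chart_ext c a b F)"
    using chart_ext_lipschitz[OF c ab(2) ne] L by metis
  then have "continuous_on UNIV (chart_ext c a b F)" by (rule lipschitz_on_continuous_on)
  then have "continuous_on (box a b) (chart_ext c a b F)" by (rule continuous_on_subset) simp
  then have "continuous_on (box a b) (\<lambda>x. F (chart_inv c x))"
    by (rule continuous_on_eq) (use chart_ext_eq box_subset_cbox in blast)
  then show "isCont (\<lambda>x. F (chart_inv c x)) x"
    using ab(1) unfolding continuous_on_eq_continuous_at[OF open_box] by blast
qed

definition ccoord :: "('m, 'n) chart \<Rightarrow> 'm \<Rightarrow> real ^ 'n" where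
  "ccoord c p = indicator (fst c) p *\<^sub>R snd c p"

lemma ccoord_eq: "p \<in> fst c \<Longrightarrow> ccoord c p = snd c p"
  by (simp add: ccoord_def)

lemma ccoord_measurable [measurable]: "c \<in> A \<Longrightarrow> ccoord c \<in> borel_measurable borel"
  unfolding ccoord_def
  using borel_measurable_continuous_on_indicator[OF _ continuous_chart, of c] open_chart[of c] by simp

text \<open>
  The derivative in direction \<open>u\<close> is the limit of difference quotients of \<open>F\<close> in the chart with steps
  \<open>1 / Suc n\<close>, continued by zero to make them measurable on all of \<open>\<real>\<^sup>n\<close>.
\<close>

lemma differential_measurable_AE:
  assumes L: "L \<in> lipschitz_bounds A g F" and c: "c \<in> A"
  obtains d where "d \<in> borel_measurable borel"
    "AE p in vol. p \<in> fst c \<longrightarrow> differential A F p (coord_vec A c p u) = d (ccoord c p)"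
proof -
  define f where "f x = indicator (chart_image c) x *\<^sub>R F (chart_inv c x)" for x
  define q where "q n x = real (Suc n) * (f (x + (1 / real (Suc n)) *\<^sub>R u) - f x)" for n x
  define d where "d x = lim (\<lambda>n. q n x)" for x
  have [measurable]: "f \<in> borel_measurable borel"
    unfolding f_def using open_chart_image[OF c]
    by (intro borel_measurable_continuous_on_indicator continuous_lipschitz_in_chart[OF L c]) simp
  have qm: "q n \<in> borel_measurable borel" for n unfolding q_def by measurable
  have "d \<in> borel_measurable borel" unfolding d_def by (rule borel_measurable_lim_metric[OF qm])
  moreover have "AE p in vol. p \<in> fst c \<longrightarrow> differential A F p (coord_vec A c p u) = d (ccoord c p)"
    using lipschitz_differentiable_AE[OF L]
  proof eventually_elim
    case (elim p)
    show ?case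
    proof
      assume p: "p \<in> fst c"
      obtain \<omega> where \<omega>: "has_differential A F p \<omega>" using elim by blast
      let ?D = "\<lambda>u. differential A F p (coord_vec A c p u)"
      have "(f has_derivative ?D) (at (snd c p))"
      proof (rule has_derivative_transform_within_open[OF has_differential_chart[OF c p \<omega>] open_chart_image[OF c]])
        show "snd c p \<in> chart_image c" using p by blast
        show "(F \<circ> chart_inv c) x = f x" if "x \<in> chart_image c" for x using that by (simp add: f_def)
      qed
      from directional_quotient_tendsto[OF this, of u]
      have l: "((\<lambda>t. (f (snd c p + t *\<^sub>R u) - f (snd c p)) / t) \<longlongrightarrow> ?D u) (at_right 0)" .
      have "filterlim (\<lambda>n. 1 / real (Suc n)) (at_right 0) sequentially"
        unfolding filterlim_at using LIMSEQ_inverse_real_of_nat by (auto simp: inverse_eq_divide)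
      from filterlim_compose[OF l this] have "(\<lambda>n. q n (snd c p)) \<longlonglongrightarrow> ?D u"
        unfolding q_def by (simp add: mult.commute)
      then show "?D u = d (ccoord c p)" unfolding d_def ccoord_eq[OF p] by (simp add: limI)
    qed
  qed
  ultimately show ?thesis using that by blast
qed

abbreviation cvol :: "'m measure" where "cvol \<equiv> completion vol"

lemma chart_in_cvol:
  assumes "c \<in> A" shows "fst c \<inter> space cvol \<in> sets cvol"
proof -
  have "fst c \<in> sets vol" unfolding sets_vol by (rule borel_open[OF open_chart[OF assms]])
  then have "fst c \<in> sets cvol" by (rule sets_completionI_sets)
  then show ?thesis unfolding space_completion space_vol Int_UNIV_right .
qed

lemma restrict_cvol_iff:
  fixes h :: "'m \<Rightarrow> real ^ 'k::finite"
  assumes "c \<in> A"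
  shows "h \<in> borel_measurable (restrict_space cvol (fst c)) \<longleftrightarrow> (\<lambda>p. indicator (fst c) p *\<^sub>R h p) \<in> borel_measurable cvol"
  by (rule borel_measurable_restrict_space_iff[OF chart_in_cvol[OF assms]])

lemma restrict_cvol_iff_real:
  fixes h :: "'m \<Rightarrow> real"
  assumes "c \<in> A"
  shows "h \<in> borel_measurable (restrict_space cvol (fst c)) \<longleftrightarrow> (\<lambda>p. indicator (fst c) p * h p) \<in> borel_measurable cvol"
  unfolding borel_measurable_restrict_space_iff[OF chart_in_cvol[OF assms]] real_scaleR_def ..

lemma cvol_measurableI: "h \<in> borel_measurable borel \<Longrightarrow> h \<in> borel_measurable cvol"
  by (rule measurable_completion) (simp only: measurable_vol)

lemma AE_cvol: "(AE p in cvol. P p) \<longleftrightarrow> (AE p in vol. P p)"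
  by (rule AE_completion_iff)

lemma differential_measurable:
  assumes L: "L \<in> lipschitz_bounds A g F"
  shows "differential A F \<in> measurable_covector_fields A g"
  unfolding measurable_covector_fields_def riem_volume_eq mem_Collect_eq
proof (intro conjI allI ballI)
  show "differential A F p \<in> cotangent_space A p" for p by (rule differential_cotangent)
  fix c u assume c: "c \<in> A"
  obtain d where d: "d \<in> borel_measurable borel"
    "AE p in vol. p \<in> fst c \<longrightarrow> differential A F p (coord_vec A c p u) = d (ccoord c p)"
    using differential_measurable_AE[OF L c] by blast
  have "(\<lambda>p. indicator (fst c) p * d (ccoord c p)) \<in> borel_measurable borel"
    using measurable_compose[OF ccoord_measurable[OF c] d(1)] open_chart[OF c] by simp
  note m = this
  have "(\<lambda>p. indicator (fst c) p * differential A F p (coord_vec A c p u)) \<in> borel_measurable cvol"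
  proof (rule completion_AE_measurable[OF cvol_measurableI[OF m]])
    show "AE p in cvol. indicator (fst c) p * differential A F p (coord_vec A c p u) = indicator (fst c) p * d (ccoord c p)"
      unfolding AE_cvol using d(2) by eventually_elim (simp add: indicator_def)
  qed
  then show "(\<lambda>p. differential A F p (coord_vec A c p u)) \<in> borel_measurable (restrict_space cvol (fst c))"
    unfolding restrict_cvol_iff_real[OF c] .
qed

text \<open>
  Countably many directions suffice in the dual norm, by density and continuity. This is what makes
  \<open>conorm\<close> measurable.
\<close>

lemma conorm_eq_SUP:
  assumes c: "c \<in> A" "p \<in> fst c" and \<omega>: "\<omega> \<in> cotangent_space A p"
  shows "bdd_above ((\<lambda>u. \<bar>\<omega> (coord_vec A c p u)\<bar> / gnorm c (snd c p) u) ` rational_vectors)"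
    and "conorm A g p \<omega> = (SUP u\<in>rational_vectors. \<bar>\<omega> (coord_vec A c p u)\<bar> / gnorm c (snd c p) u)"
proof -
  let ?q = "\<lambda>u. \<bar>\<omega> (coord_vec A c p u)\<bar> / gnorm c (snd c p) u"
  have lin: "linear (\<lambda>u. \<omega> (coord_vec A c p u))" by (rule linear_covector[OF \<omega> c])
  have x: "snd c p \<in> chart_image c" using c by blast
  have zero: "(0 :: real ^ 'n) \<in> rational_vectors" by (simp add: rational_vectors_def)
  have w0: "\<omega> (coord_vec A c p 0) = 0" using linear_0[OF lin] .
  have pos: "0 < gnorm c (snd c p) u" if "u \<noteq> 0" for u using quad_form_pos[OF c(1) x that] by simp
  have le: "\<bar>\<omega> (coord_vec A c p u)\<bar> \<le> conorm A g p \<omega> * gnorm c (snd c p) u" for u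
    using covector_le_conorm[OF \<omega> coord_vec_mem[OF c]] unfolding tnorm_coord_vec[OF c] .
  have c0: "0 \<le> conorm A g p \<omega>"
  proof -
    have "0 \<le> conorm A g p \<omega> * gnorm c (snd c p) (axis undefined 1)"
      using le[of "axis undefined 1"] abs_ge_zero order_trans by blast
    moreover have "0 < gnorm c (snd c p) (axis undefined 1)" by (rule pos) (simp add: axis_eq_0_iff)
    ultimately show ?thesis by (simp add: zero_le_mult_iff)
  qed
  have q_le: "?q u \<le> conorm A g p \<omega>" for u
  proof (cases "u = 0")
    case False
    show ?thesis unfolding pos_divide_le_eq[OF pos[OF False]] by (rule le)
  qed (use w0 c0 in simp)
  show bdd: "bdd_above (?q ` rational_vectors)" using q_le by (intro bdd_aboveI2)
  let ?L = "SUP u\<in>rational_vectors. ?q u"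
  have ub: "?q u \<le> ?L" if "u \<in> rational_vectors" for u by (rule cSUP_upper[OF that bdd])
  have L0: "0 \<le> ?L" using ub[OF zero] w0 by simp
  have "?L \<le> conorm A g p \<omega>" by (rule cSUP_least) (use zero q_le in auto)
  moreover have "conorm A g p \<omega> \<le> ?L"
  proof (rule conorm_le[OF L0])
    fix v assume v: "v \<in> tangent_space A p"
    define Z where "Z = {u. \<bar>\<omega> (coord_vec A c p u)\<bar> \<le> ?L * gnorm c (snd c p) u}"
    have "closed Z"
      unfolding Z_def
    proof (rule closed_Collect_le)
      show "continuous_on UNIV (\<lambda>u. \<bar>\<omega> (coord_vec A c p u)\<bar>)"
        using linear_continuous_on[OF linear_conv_bounded_linear[THEN iffD1, OF lin]] by (rule continuous_on_rabs)
      show "continuous_on UNIV (\<lambda>u. ?L * gnorm c (snd c p) u)"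
        by (intro continuous_on_mult continuous_on_real_sqrt continuous_quad_form continuous_on_const continuous_on_id)
    qed
    moreover have "rational_vectors \<subseteq> Z"
    proof
      fix u :: "real ^ 'n" assume u: "u \<in> rational_vectors"
      show "u \<in> Z"
      proof (cases "u = 0")
        case True
        then show ?thesis unfolding Z_def using w0 by (simp add: quad_form_def)
      next
        case False
        from ub[OF u] show ?thesis unfolding Z_def mem_Collect_eq pos_divide_le_eq[OF pos[OF False]] .
      qed
    qed
    ultimately have "closure rational_vectors \<subseteq> Z" by (rule closure_minimal[rotated])
    moreover have "v c \<in> closure rational_vectors"
      unfolding closure_approachable using rational_vectors_dense by blast
    ultimately have "v c \<in> Z" by blast
    moreover have "\<omega> v = \<omega> (coord_vec A c p (v c))" by (rule arg_cong[OF tangent_eq_coord_vec[OF c v]])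
    ultimately show "\<bar>\<omega> v\<bar> \<le> ?L * tnorm g p v" unfolding Z_def tnorm_eq_gnorm[OF c v] by simp
  qed
  ultimately show "conorm A g p \<omega> = ?L" by (rule antisym[rotated])
qed

lemma gnorm_measurable:
  assumes c: "c \<in> A"
  shows "(\<lambda>p. gnorm c (snd c p) u) \<in> borel_measurable (restrict_space cvol (fst c))"
proof -
  have "continuous_on (fst c) (\<lambda>p. gnorm c (snd c p) u)"
    by (intro continuous_on_real_sqrt continuous_quad_form continuous_on_const
        continuous_on_compose2[OF continuous_gram[OF c] continuous_chart[OF c]]) simp
  then have "(\<lambda>p. indicator (fst c) p *\<^sub>R gnorm c (snd c p) u) \<in> borel_measurable borel"
    using open_chart[OF c] by (intro borel_measurable_continuous_on_indicator) auto
  then show ?thesis unfolding restrict_cvol_iff_real[OF c] using cvol_measurableI by simp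
qed

lemma conorm_measurable:
  assumes f: "f \<in> measurable_covector_fields A g"
  shows "(\<lambda>p. conorm A g p (f p)) \<in> borel_measurable cvol"
proof -
  have cot: "\<And>p. f p \<in> cotangent_space A p"
    and fm: "\<And>c u. c \<in> A \<Longrightarrow> (\<lambda>p. f p (coord_vec A c p u)) \<in> borel_measurable (restrict_space cvol (fst c))"
    using f unfolding measurable_covector_fields_def riem_volume_eq by auto
  obtain s where s: "\<And>k::nat. s k \<in> A" "(\<Union>k. fst (s k)) = UNIV" using chart_sequence by blast
  show ?thesis
  proof (rule measurable_piecewise_restrict[of "range (\<lambda>k. fst (s k))"])
    show "space cvol \<subseteq> \<Union> (range (\<lambda>k. fst (s k)))" using s(2) by simp
    fix X assume "X \<in> range (\<lambda>k. fst (s k))"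
    then obtain k where X: "X = fst (s k)" by blast
    show "X \<inter> space cvol \<in> sets cvol" unfolding X using open_chart[OF s(1)] by auto
    show "(\<lambda>p. conorm A g p (f p)) \<in> borel_measurable (restrict_space cvol X)"
      unfolding X
    proof (subst measurable_cong)
      fix p assume "p \<in> space (restrict_space cvol (fst (s k)))"
      then have p: "p \<in> fst (s k)" by (simp add: space_restrict_space)
      show "conorm A g p (f p) = (SUP u\<in>rational_vectors. \<bar>f p (coord_vec A (s k) p u)\<bar> / gnorm (s k) (snd (s k) p) u)"
        by (rule conorm_eq_SUP(2)[OF s(1) p cot])
    next
      show "(\<lambda>p. SUP u\<in>rational_vectors. \<bar>f p (coord_vec A (s k) p u)\<bar> / gnorm (s k) (snd (s k) p) u)
          \<in> borel_measurable (restrict_space cvol (fst (s k)))"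
      proof (rule borel_measurable_cSUP[OF countable_rational_vectors])
        show "(\<lambda>p. \<bar>f p (coord_vec A (s k) p u)\<bar> / gnorm (s k) (snd (s k) p) u) \<in> borel_measurable (restrict_space cvol (fst (s k)))" for u
          by (intro borel_measurable_divide borel_measurable_abs fm[OF s(1)] gnorm_measurable[OF s(1)])
        fix p assume "p \<in> space (restrict_space cvol (fst (s k)))"
        then have p: "p \<in> fst (s k)" by (simp add: space_restrict_space)
        show "bdd_above ((\<lambda>u. \<bar>f p (coord_vec A (s k) p u)\<bar> / gnorm (s k) (snd (s k) p) u) ` rational_vectors)"
          by (rule conorm_eq_SUP(1)[OF s(1) p cot])
      qed
    qed
  qed simp
qed

lemma conorm_ereal_measurable:
  "f \<in> measurable_covector_fields A g \<Longrightarrow> (\<lambda>p. ereal (conorm A g p (f p))) \<in> borel_measurable cvol"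
  using conorm_measurable by (rule borel_measurable_ereal)

lemma Linf_fields_iff:
  "f \<in> Linf_fields A g \<longleftrightarrow> f \<in> measurable_covector_fields A g \<and> esssup cvol (\<lambda>p. ereal (conorm A g p (f p))) < \<infinity>"
  by (simp add: Linf_fields_def riem_volume_eq)

lemma conorm_differential_le:
  assumes "L \<in> lipschitz_bounds A g F"
  shows "conorm A g p (differential A F p) \<le> L"
  by (rule conorm_le) (use assms differential_le_lipschitz[OF assms] in \<open>auto simp: lipschitz_bounds_def\<close>)

lemma differential_Linf:
  assumes L: "L \<in> lipschitz_bounds A g F"
  shows "differential A F \<in> Linf_fields A g"
    and "esssup cvol (\<lambda>p. ereal (conorm A g p (differential A F p))) \<le> ereal L"
proof -
  note m = differential_measurable[OF L]
  show le: "esssup cvol (\<lambda>p. ereal (conorm A g p (differential A F p))) \<le> ereal L"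
    by (rule esssup_I[OF conorm_ereal_measurable[OF m]]) (simp add: conorm_differential_le[OF L])
  have "esssup cvol (\<lambda>p. ereal (conorm A g p (differential A F p))) < \<infinity>"
    by (rule order_le_less_trans[OF le]) simp
  then show "differential A F \<in> Linf_fields A g" unfolding Linf_fields_iff using m by blast
qed

lemma esssup_conorm_cong:
  assumes "f \<in> measurable_covector_fields A g" "f' \<in> measurable_covector_fields A g" "AE p in cvol. f p = f' p"
  shows "esssup cvol (\<lambda>p. ereal (conorm A g p (f p))) = esssup cvol (\<lambda>p. ereal (conorm A g p (f' p)))"
proof (rule esssup_AE_cong[OF conorm_ereal_measurable[OF assms(1)] conorm_ereal_measurable[OF assms(2)]])
  show "AE p in cvol. ereal (conorm A g p (f p)) = ereal (conorm A g p (f' p))"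
    using assms(3) by eventually_elim simp
qed

lemma Linf_fields_AE:
  assumes f: "f \<in> Linf_fields A g" and cot: "\<And>p. f' p \<in> cotangent_space A p" and ae: "AE p in cvol. f p = f' p"
  shows "f' \<in> Linf_fields A g"
proof -
  have fm: "f \<in> measurable_covector_fields A g" using f unfolding Linf_fields_iff by blast
  have f'm: "f' \<in> measurable_covector_fields A g"
    unfolding measurable_covector_fields_def riem_volume_eq mem_Collect_eq
  proof (intro conjI allI ballI)
    show "f' p \<in> cotangent_space A p" for p by (rule cot)
    fix c u assume c: "c \<in> A"
    have "(\<lambda>p. indicator (fst c) p * f p (coord_vec A c p u)) \<in> borel_measurable cvol"
      using fm c unfolding measurable_covector_fields_def riem_volume_eq restrict_cvol_iff_real[OF c, symmetric] by blast
    then have "(\<lambda>p. indicator (fst c) p * f' p (coord_vec A c p u)) \<in> borel_measurable cvol"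
    proof (rule completion_AE_measurable)
      show "AE p in cvol. indicator (fst c) p * f' p (coord_vec A c p u) = indicator (fst c) p * f p (coord_vec A c p u)"
        using ae by eventually_elim simp
    qed
    then show "(\<lambda>p. f' p (coord_vec A c p u)) \<in> borel_measurable (restrict_space cvol (fst c))"
      unfolding restrict_cvol_iff_real[OF c] .
  qed
  then show ?thesis using f esssup_conorm_cong[OF fm f'm ae] unfolding Linf_fields_iff by simp
qed

lemma Linf_class_iff:
  "f' \<in> Linf_class A g f \<longleftrightarrow> f \<in> Linf_fields A g \<and> f' \<in> Linf_fields A g \<and> (AE p in cvol. f p = f' p)"
  by (simp add: Linf_class_def ae_equal_def riem_volume_eq)

lemma representative_Linf:
  assumes f: "f \<in> Linf_fields A g"
  shows "representative (Linf_class A g f) \<in> Linf_fields A g" and "AE p in cvol. f p = representative (Linf_class A g f) p"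
proof -
  have "f \<in> Linf_class A g f" unfolding Linf_class_iff using f by simp
  then have "representative (Linf_class A g f) \<in> Linf_class A g f" unfolding representative_def by (rule someI[where P = "\<lambda>h. h \<in> Linf_class A g f"])
  then show "representative (Linf_class A g f) \<in> Linf_fields A g" "AE p in cvol. f p = representative (Linf_class A g f) p"
    unfolding Linf_class_iff by blast+
qed

lemma Linf_class_cong:
  assumes f: "f \<in> Linf_fields A g" "f' \<in> Linf_fields A g" and ae: "AE p in cvol. f p = f' p"
  shows "Linf_class A g f = Linf_class A g f'"
proof (rule set_eqI)
  fix h
  have "(AE p in cvol. f p = h p) \<longleftrightarrow> (AE p in cvol. f' p = h p)"
    using ae by (intro eventually_subst) (auto elim!: eventually_mono)
  then show "h \<in> Linf_class A g f \<longleftrightarrow> h \<in> Linf_class A g f'" unfolding Linf_class_iff using f by simp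
qed

lemma Lip0_lincomb:
  assumes "F \<in> Lip0 A g z" "G \<in> Lip0 A g z"
  shows "(\<lambda>x. a * F x + b * G x) \<in> Lip0 A g z"
proof -
  obtain L M where L: "L \<in> lipschitz_bounds A g F" and M: "M \<in> lipschitz_bounds A g G"
    using assms unfolding Lip0_def by blast
  have "\<bar>a * F x + b * G x - (a * F y + b * G y)\<bar> \<le> (\<bar>a\<bar> * L + \<bar>b\<bar> * M) * riem_dist A g x y" for x y
  proof -
    have "\<bar>a * F x + b * G x - (a * F y + b * G y)\<bar> = \<bar>a * (F x - F y) + b * (G x - G y)\<bar>" by (simp add: algebra_simps)
    also have "\<dots> \<le> \<bar>a\<bar> * \<bar>F x - F y\<bar> + \<bar>b\<bar> * \<bar>G x - G y\<bar>" unfolding abs_mult[symmetric] by (rule abs_triangle_ineq)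
    also have "\<dots> \<le> \<bar>a\<bar> * (L * riem_dist A g x y) + \<bar>b\<bar> * (M * riem_dist A g x y)"
      using L M unfolding lipschitz_bounds_def by (intro add_mono mult_left_mono) auto
    finally show ?thesis by (simp add: algebra_simps)
  qed
  then have "\<bar>a\<bar> * L + \<bar>b\<bar> * M \<in> lipschitz_bounds A g (\<lambda>x. a * F x + b * G x)"
    using L M unfolding lipschitz_bounds_def by simp
  then show ?thesis using assms unfolding Lip0_def by auto
qed

lemma D_op_space:
  assumes "F \<in> Lip0 A g z" shows "D_op A g F \<in> Linf_space A g"
proof -
  obtain L where L: "L \<in> lipschitz_bounds A g F" using assms unfolding Lip0_def by blast
  show ?thesis unfolding D_op_def Linf_space_def Linf_class_def using differential_Linf(1)[OF L] by (rule quotientI)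
qed

lemma D_op_lincomb:
  assumes F: "F \<in> Lip0 A g z" and G: "G \<in> Lip0 A g z"
  shows "D_op A g (\<lambda>x. a * F x + b * G x) = Linf_lincomb A g a (D_op A g F) b (D_op A g G)"
proof -
  let ?H = "\<lambda>x. a * F x + b * G x"
  obtain L M K where L: "L \<in> lipschitz_bounds A g F" and M: "M \<in> lipschitz_bounds A g G" and K: "K \<in> lipschitz_bounds A g ?H"
    using F G Lip0_lincomb[OF F G, of a b] unfolding Lip0_def by blast
  define f where "f = representative (D_op A g F)"
  define h where "h = representative (D_op A g G)"
  have f: "f \<in> Linf_fields A g" "AE p in cvol. differential A F p = f p"
    and h: "h \<in> Linf_fields A g" "AE p in cvol. differential A G p = h p"
    unfolding f_def h_def D_op_def using representative_Linf[OF differential_Linf(1)[OF L]] representative_Linf[OF differential_Linf(1)[OF M]] by blast+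
  have "AE p in cvol. \<exists>\<omega>. has_differential A F p \<omega>" "AE p in cvol. \<exists>\<omega>. has_differential A G p \<omega>"
    unfolding AE_cvol using lipschitz_differentiable_AE[OF L] lipschitz_differentiable_AE[OF M] by blast+
  then have ae: "AE p in cvol. differential A ?H p = (\<lambda>v. a * f p v + b * h p v)"
    using f(2) h(2)
  proof eventually_elim
    case (elim p)
    then obtain \<omega> \<omega>' where "has_differential A F p \<omega>" "has_differential A G p \<omega>'" by blast
    from differential_lincomb[OF this, of a b] show ?case using elim by simp
  qed
  have "(\<lambda>p v. a * f p v + b * h p v) \<in> Linf_fields A g"
  proof (rule Linf_fields_AE[OF differential_Linf(1)[OF K] _ ae])
    fix p
    have "f p \<in> cotangent_space A p" "h p \<in> cotangent_space A p"
      using f(1) h(1) unfolding Linf_fields_iff measurable_covector_fields_def by blast+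
    then show "(\<lambda>v. a * f p v + b * h p v) \<in> cotangent_space A p"
      unfolding cotangent_space_def by (simp add: algebra_simps)
  qed
  from Linf_class_cong[OF differential_Linf(1)[OF K] this ae]
  show ?thesis unfolding D_op_def[of A g ?H] Linf_lincomb_def f_def h_def .
qed

end

section \<open>The differential is isometric\<close>

text \<open>
  The bound on the derivative holds outside of a null set \<open>N\<close>, which may contain the curve. By
  \<open>AE_curve_translates\<close> there are arbitrarily short \<open>y\<close> such that \<open>\<eta> + y\<close> meets \<open>N\<close> only for a null set of
  parameters. Along such a translate the increment of \<open>f\<close> is the integral of a derivative that obeys
  the bound, and all terms depend continuously on \<open>y\<close>.
\<close>

lemma lipschitz_increment_along_curve:
  fixes f :: "'a::euclidean_space \<Rightarrow> real" and \<eta> w :: "real \<Rightarrow> 'a"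
  assumes lip: "L-lipschitz_on UNIV f" and st: "s < t"
    and w: "continuous_on {s..t} w"
    and der: "\<And>\<tau>. \<tau> \<in> {s..t} \<Longrightarrow> (\<eta> has_vector_derivative w \<tau>) (at \<tau> within {s..t})"
    and B: "open B" "\<And>\<tau>. \<tau> \<in> {s..t} \<Longrightarrow> \<eta> \<tau> \<in> B"
    and nrm: "continuous_on (B \<times> UNIV) (\<lambda>z. nrm (fst z) (snd z))"
    and ae: "AE x in lborel. x \<in> B \<longrightarrow> (\<exists>D. (f has_derivative D) (at x) \<and> (\<forall>u. D u \<le> nrm x u))"
  shows "f (\<eta> t) - f (\<eta> s) \<le> integral {s..t} (\<lambda>\<tau>. nrm (\<eta> \<tau>) (w \<tau>))"
proof -
  have \<eta>c: "continuous_on {s..t} \<eta>"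
    using der has_vector_derivative_continuous unfolding continuous_on_eq_continuous_within by blast
  have L0: "0 \<le> L" using lip by (rule lipschitz_on_nonneg)
  obtain M where "\<forall>x\<in>w ` {s..t}. norm x \<le> M"
    using compact_imp_bounded[OF compact_continuous_image[OF w compact_Icc]] unfolding bounded_iff by blast
  then have M: "norm (w \<tau>) \<le> M" if "\<tau> \<in> {s..t}" for \<tau> using that by blast
  have M0: "0 \<le> M" using order_trans[OF norm_ge_zero M[of s]] st by simp
  have \<eta>lip: "dist (\<eta> x) (\<eta> y) \<le> M * dist x y" if "x \<in> {s..t}" "y \<in> {s..t}" for x y
  proof -
    have "norm (\<eta> x - \<eta> y) \<le> M * norm (x - y)"
    proof (rule differentiable_bound[where S = "{s..t}" and f' = "\<lambda>\<tau> h. h *\<^sub>R w \<tau>"])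
      show "(\<eta> has_derivative (\<lambda>h. h *\<^sub>R w \<tau>)) (at \<tau> within {s..t})" if "\<tau> \<in> {s..t}" for \<tau>
        using der[OF that] unfolding has_vector_derivative_def .
      show "onorm (\<lambda>h. h *\<^sub>R w \<tau>) \<le> M" if "\<tau> \<in> {s..t}" for \<tau>
        by (rule onorm_bound[OF M0]) (use mult_right_mono[OF M[OF that] abs_ge_zero] in \<open>simp add: mult.commute\<close>)
    qed (use that in auto)
    then show ?thesis by (simp add: dist_norm)
  qed
  (* Constant continuation beyond the end points gives a Lipschitz curve on the whole line. *)
  define clamp where "clamp \<tau> = max s (min t \<tau>)" for \<tau>
  have clamp: "clamp \<tau> \<in> {s..t}" for \<tau> using st by (auto simp: clamp_def)
  have clamp_id: "clamp \<tau> = \<tau>" if "\<tau> \<in> {s..t}" for \<tau> using that by (auto simp: clamp_def)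
  have clamp_lip: "dist (clamp x) (clamp y) \<le> dist x y" for x y
    using st unfolding clamp_def dist_real_def by (auto simp: max_def min_def)
  define \<xi> where "\<xi> \<tau> = \<eta> (clamp \<tau>)" for \<tau>
  have \<xi>lip: "dist (\<xi> x) (\<xi> y) \<le> M * dist x y" for x y
    unfolding \<xi>_def using \<eta>lip[OF clamp clamp, of x y] mult_left_mono[OF clamp_lip M0, of x y] by linarith
  then have "M-lipschitz_on UNIV \<xi>" by (intro lipschitz_onI M0)
  then have \<xi>m: "\<xi> \<in> borel_measurable borel"
    by (intro borel_measurable_continuous_onI lipschitz_on_continuous_on)
  obtain N where N: "{x \<in> space lborel. \<not> (x \<in> B \<longrightarrow> (\<exists>D. (f has_derivative D) (at x) \<and> (\<forall>u. D u \<le> nrm x u)))} \<subseteq> N"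
      "emeasure lborel N = 0" "N \<in> sets lborel"
    using ae by (rule AE_E)
  have "AE x in lborel. x \<notin> N" using N(2,3) by (intro AE_not_in) (simp add: null_sets_def)
  then have good: "AE y in lborel. AE \<tau> in lborel. \<xi> \<tau> + y \<notin> N"
    using N(3) by (intro AE_curve_translates \<xi>m) simp_all
  have cpt: "compact (\<eta> ` {s..t})" by (rule compact_continuous_image[OF \<eta>c compact_Icc])
  have sub: "\<eta> ` {s..t} \<subseteq> B" using B(2) by blast
  obtain \<delta> where \<delta>: "\<delta> > 0" "(\<Union>x\<in>\<eta> ` {s..t}. ball x \<delta>) \<subseteq> B"
    using compact_subset_open_imp_ball_epsilon_subset[OF cpt B(1) sub] by metis
  have inB: "\<eta> \<tau> + y \<in> B" if "\<tau> \<in> {s..t}" "norm y < \<delta>" for \<tau> y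
  proof -
    have "\<eta> \<tau> + y \<in> ball (\<eta> \<tau>) \<delta>" using that(2) by (simp add: dist_norm)
    then show ?thesis using \<delta>(2) that(1) by blast
  qed
  have contn: "continuous_on {s..t} (\<lambda>\<tau>. nrm (\<eta> \<tau> + y) (w \<tau>))" if "norm y < \<delta>" for y
  proof -
    have "continuous_on {s..t} (\<lambda>\<tau>. (\<eta> \<tau> + y, w \<tau>))" by (intro continuous_intros \<eta>c w)
    moreover have "(\<lambda>\<tau>. (\<eta> \<tau> + y, w \<tau>)) ` {s..t} \<subseteq> B \<times> UNIV" using inB[OF _ that] by blast
    ultimately show ?thesis using continuous_on_compose2[OF nrm, of "{s..t}" "\<lambda>\<tau>. (\<eta> \<tau> + y, w \<tau>)"] by simp
  qed
  have step: "f (\<eta> t + y) - f (\<eta> s + y) \<le> integral {s..t} (\<lambda>\<tau>. nrm (\<eta> \<tau> + y) (w \<tau>))"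
    if y: "norm y < \<delta>" and yN: "AE \<tau> in lborel. \<xi> \<tau> + y \<notin> N" for y
  proof -
    define \<phi> where "\<phi> \<tau> = f (\<xi> \<tau> + y)" for \<tau>
    have \<phi>lip: "(L * M)-lipschitz_on UNIV \<phi>"
    proof (rule lipschitz_onI)
      fix p q :: real
      have "dist (\<phi> p) (\<phi> q) \<le> L * dist (\<xi> p + y) (\<xi> q + y)" unfolding \<phi>_def by (rule lipschitz_onD[OF lip]) auto
      also have "\<dots> \<le> L * (M * dist p q)" using \<xi>lip[of p q] L0 by (intro mult_left_mono) (auto simp: dist_norm)
      finally show "dist (\<phi> p) (\<phi> q) \<le> L * M * dist p q" by (simp add: mult.assoc)
    qed (use L0 M0 in simp)
    have le: "dini \<phi> 1 \<tau> \<le> nrm (\<eta> \<tau> + y) (w \<tau>)" if \<tau>: "\<tau> \<in> {s<..<t}" and \<tau>N: "\<xi> \<tau> + y \<notin> N" for \<tau>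
    proof -
      have \<tau>': "\<tau> \<in> {s..t}" using \<tau> by simp
      have \<xi>\<tau>: "\<xi> \<tau> = \<eta> \<tau>" unfolding \<xi>_def clamp_id[OF \<tau>'] ..
      have "\<eta> \<tau> + y \<in> B" by (rule inB[OF \<tau>' y])
      moreover have "\<eta> \<tau> + y \<in> B \<longrightarrow> (\<exists>D. (f has_derivative D) (at (\<eta> \<tau> + y)) \<and> (\<forall>u. D u \<le> nrm (\<eta> \<tau> + y) u))"
        using N(1) \<tau>N unfolding \<xi>\<tau> space_lborel space_borel by blast
      ultimately obtain D where D: "(f has_derivative D) (at (\<eta> \<tau> + y))" "\<And>u. D u \<le> nrm (\<eta> \<tau> + y) u"
        by blast
      have "(\<eta> has_vector_derivative w \<tau>) (at \<tau>)"
        using der[OF \<tau>'] at_within_interior[of \<tau> "{s..t}"] \<tau> by simp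
      then have "(\<eta> has_derivative (\<lambda>h. h *\<^sub>R w \<tau>)) (at \<tau>)" unfolding has_vector_derivative_def .
      then have "(\<xi> has_derivative (\<lambda>h. h *\<^sub>R w \<tau>)) (at \<tau>)"
        by (rule has_derivative_transform_within_open[OF _ open_greaterThanLessThan \<tau>])
           (simp add: \<xi>_def clamp_id)
      then have "((\<lambda>\<tau>. \<xi> \<tau> + y) has_derivative (\<lambda>h. h *\<^sub>R w \<tau>)) (at \<tau>)" by (auto intro!: derivative_eq_intros)
      from has_derivative_compose[OF this, of f D] D(1)
      have "(\<phi> has_derivative (\<lambda>h. D (h *\<^sub>R w \<tau>))) (at \<tau>)" unfolding \<phi>_def \<xi>\<tau> by simp
      then have "dini \<phi> 1 \<tau> = D (1 *\<^sub>R w \<tau>)" by (rule dini_eq_derivative[OF \<phi>lip])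
      then show ?thesis using D(2)[of "w \<tau>"] by simp
    qed
    (* The end points are among the exceptional parameters, as \<eta> is differentiable there from one
       side only. *)
    define Z where "Z = {\<tau> \<in> {s..t}. \<not> dini \<phi> 1 \<tau> \<le> nrm (\<eta> \<tau> + y) (w \<tau>)}"
    have negZ: "negligible Z"
    proof -
      obtain N' where N': "{\<tau> \<in> space lborel. \<not> \<xi> \<tau> + y \<notin> N} \<subseteq> N'" "emeasure lborel N' = 0" "N' \<in> sets lborel"
        using yN by (rule AE_E)
      have "N' \<in> null_sets lebesgue" using N'(2,3) by (intro null_sets_completionI) (simp add: null_sets_def)
      then have "negligible N'" by (simp add: negligible_iff_null_sets)
      moreover have "Z \<subseteq> N' \<union> {s, t}"
      proof
        fix \<tau> assume \<tau>: "\<tau> \<in> Z"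
        show "\<tau> \<in> N' \<union> {s, t}"
        proof (cases "\<tau> = s \<or> \<tau> = t")
          case False
          then have "\<tau> \<in> {s<..<t}" using \<tau> unfolding Z_def by auto
          then have "\<not> \<xi> \<tau> + y \<notin> N" using le \<tau> unfolding Z_def by blast
          then show ?thesis using N'(1) by auto
        qed auto
      qed
      ultimately show ?thesis by (meson negligible_Un negligible_finite finite.emptyI finite.insertI negligible_subset)
    qed
    have di: "dini \<phi> 1 integrable_on {s..t}"
      by (rule bounded_borel_integrable_on[OF borel_measurable_dini[OF \<phi>lip], where C = "L * M"])
         (use abs_dini_le[OF \<phi>lip, of 1] in simp)
    have ni: "(\<lambda>\<tau>. nrm (\<eta> \<tau> + y) (w \<tau>)) integrable_on {s..t}" by (rule integrable_continuous_interval[OF contn[OF y]])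
    let ?h = "\<lambda>\<tau>. if \<tau> \<in> Z then nrm (\<eta> \<tau> + y) (w \<tau>) else dini \<phi> 1 \<tau>"
    have hi: "?h integrable_on {s..t}" by (rule integrable_spike[OF di negZ]) simp
    have "f (\<eta> t + y) - f (\<eta> s + y) = \<phi> t - \<phi> s" using st by (simp add: \<phi>_def \<xi>_def clamp_id)
    also have "\<dots> = integral {s..t} (dini \<phi> 1)"
      using lipschitz_right_differentiable_AE(2)[OF \<phi>lip, of s t] st by simp
    also have "\<dots> = integral {s..t} ?h" by (rule integral_spike[OF negZ]) simp
    also have "\<dots> \<le> integral {s..t} (\<lambda>\<tau>. nrm (\<eta> \<tau> + y) (w \<tau>))"
      by (rule integral_le[OF hi ni]) (auto simp: Z_def)
    finally show ?thesis .
  qed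
  show ?thesis
  proof (rule field_le_epsilon)
    fix e :: real assume e: "e > 0"
    let ?K = "{s..t} \<times> cball (0::'a) (\<delta>/2)"
    let ?g = "\<lambda>z. nrm (\<eta> (fst z) + snd z) (w (fst z))"
    have half: "norm y < \<delta>" if "y \<in> cball 0 (\<delta>/2)" for y :: 'a using that \<delta>(1) by simp
    have "continuous_on ?K (\<lambda>z. (\<eta> (fst z) + snd z, w (fst z)))"
      by (intro continuous_intros continuous_on_compose2[OF \<eta>c continuous_on_fst] continuous_on_compose2[OF w continuous_on_fst]) auto
    from continuous_on_compose2[OF nrm this] have cg: "continuous_on ?K ?g" using inB half by force
    have "uniformly_continuous_on ?K ?g"
      by (rule compact_uniformly_continuous[OF cg]) (intro compact_Times compact_Icc compact_cball)
    moreover have e1: "e / (2 * (t - s)) > 0" using e st by simp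
    ultimately obtain r where r: "r > 0" "\<And>z z'. z \<in> ?K \<Longrightarrow> z' \<in> ?K \<Longrightarrow> dist z' z < r \<Longrightarrow> dist (?g z') (?g z) < e / (2 * (t - s))"
      unfolding uniformly_continuous_on_def by metis
    (* Short enough for the integrand to change by e / (2 * (t - s)), for the translate to stay in B,
       and for f to change by at most e / 4 at either end point. *)
    define \<rho> where "\<rho> = Min {r, \<delta> / 2, e / (4 * (L + 1))}"
    have \<rho>: "\<rho> > 0" unfolding \<rho>_def using r(1) \<delta>(1) e L0 by simp
    have "\<rho> \<le> r" "\<rho> \<le> \<delta> / 2" "\<rho> \<le> e / (4 * (L + 1))" unfolding \<rho>_def by (rule Min_le; simp)+
    note \<rho> = \<rho> this
    have "\<exists>y. y \<in> ball 0 \<rho> \<and> (AE \<tau> in lborel. \<xi> \<tau> + y \<notin> N)"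
    proof (rule ccontr)
      assume no: "\<not> ?thesis"
      have "AE y in lborel. y \<notin> ball (0::'a) \<rho>" using good by eventually_elim (use no in blast)
      then have "ball (0::'a) \<rho> \<in> null_sets lborel" by (subst (asm) AE_iff_null_sets[symmetric]) auto
      then have "negligible (ball (0::'a) \<rho>)" by (simp add: negligible_iff_null_sets null_sets_completionI)
      then show False using open_not_negligible[of "ball (0::'a) \<rho>"] \<rho>(1) by simp
    qed
    then obtain y where y: "norm y < \<rho>" "AE \<tau> in lborel. \<xi> \<tau> + y \<notin> N" by auto
    have y\<delta>: "norm y < \<delta>" using y(1) \<rho>(3) \<delta>(1) by linarith
    have Ly: "L * norm y \<le> e / 4"
    proof -
      have "(L + 1) * \<rho> \<le> e / 4" using \<rho>(4) L0 by (simp add: pos_le_divide_eq mult_ac)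
      moreover have "L * norm y \<le> (L + 1) * \<rho>" using y(1) L0 by (intro mult_mono) auto
      ultimately show ?thesis by linarith
    qed
    have sh: "\<bar>f (x + y) - f x\<bar> \<le> e / 4" for x
      using lipschitz_onD[OF lip, of "x + y" x] Ly by (simp add: dist_norm)
    have "integral {s..t} (\<lambda>\<tau>. nrm (\<eta> \<tau> + y) (w \<tau>)) \<le> integral {s..t} (\<lambda>\<tau>. nrm (\<eta> \<tau>) (w \<tau>) + e / (2 * (t - s)))"
    proof (rule integral_le)
      show "(\<lambda>\<tau>. nrm (\<eta> \<tau> + y) (w \<tau>)) integrable_on {s..t}" by (rule integrable_continuous_interval[OF contn[OF y\<delta>]])
      show "(\<lambda>\<tau>. nrm (\<eta> \<tau>) (w \<tau>) + e / (2 * (t - s))) integrable_on {s..t}"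
        using contn[of 0] \<delta>(1) by (intro integrable_continuous_interval continuous_on_add continuous_on_const) simp
      fix \<tau> assume \<tau>: "\<tau> \<in> {s..t}"
      have "dist (?g (\<tau>, y)) (?g (\<tau>, 0)) < e / (2 * (t - s))"
        by (rule r(2)) (use \<tau> y(1) \<rho> \<delta>(1) in \<open>auto simp: dist_Pair_Pair\<close>)
      then show "nrm (\<eta> \<tau> + y) (w \<tau>) \<le> nrm (\<eta> \<tau>) (w \<tau>) + e / (2 * (t - s))"
        unfolding dist_real_def fst_conv snd_conv add_0_right by linarith
    qed
    also have "\<dots> = integral {s..t} (\<lambda>\<tau>. nrm (\<eta> \<tau>) (w \<tau>)) + (t - s) * (e / (2 * (t - s)))"
      using contn[of 0] \<delta>(1) st
      by (subst Henstock_Kurzweil_Integration.integral_add) (auto intro!: integrable_continuous_interval)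
    also have "(t - s) * (e / (2 * (t - s))) = e / 2" using st by (simp add: divide_eq_eq eq_divide_eq)
    finally show "f (\<eta> t) - f (\<eta> s) \<le> integral {s..t} (\<lambda>\<tau>. nrm (\<eta> \<tau>) (w \<tau>)) + e"
      using step[OF y\<delta> y(2)] sh[of "\<eta> t"] sh[of "\<eta> s"] unfolding abs_le_iff by linarith
  qed
qed

context connected_riemannian_manifold
begin

definition length_bound :: "('m \<Rightarrow> real) \<Rightarrow> real \<Rightarrow> (real \<Rightarrow> 'm) \<Rightarrow> real \<Rightarrow> real \<Rightarrow> bool" where
  "length_bound F k \<gamma> s t \<longleftrightarrow> speed \<gamma> integrable_on {s..t} \<and> \<bar>F (\<gamma> t) - F (\<gamma> s)\<bar> \<le> k * integral {s..t} (speed \<gamma>)"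

lemma length_bound_refl: "length_bound F k \<gamma> s s"
  using integrable_on_refl[of "speed \<gamma>" s] by (simp add: length_bound_def)

lemma length_bound_trans:
  assumes "length_bound F k \<gamma> s t" "length_bound F k \<gamma> t u" "s \<le> t" "t \<le> u"
  shows "length_bound F k \<gamma> s u"
proof -
  have i: "speed \<gamma> integrable_on {s..u}"
    using assms Henstock_Kurzweil_Integration.integrable_combine[OF assms(3,4)] unfolding length_bound_def by blast
  have "integral {s..u} (speed \<gamma>) = integral {s..t} (speed \<gamma>) + integral {t..u} (speed \<gamma>)"
    using Henstock_Kurzweil_Integration.integral_combine[OF assms(3,4) i] by simp
  then have e: "k * integral {s..u} (speed \<gamma>) = k * integral {s..t} (speed \<gamma>) + k * integral {t..u} (speed \<gamma>)"
    by (simp add: distrib_left)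
  show ?thesis using assms(1,2) i unfolding length_bound_def e by linarith
qed

text \<open>
  \<open>lipschitz_increment_along_curve\<close> for the coordinate expressions of \<open>F\<close> and of \<open>- F\<close>, with \<open>k\<close> times
  the metric norm as the bound on the derivative.
\<close>

lemma length_bound_in_box:
  assumes L: "L \<in> lipschitz_bounds A g F" and k: "0 \<le> k"
    and ae: "AE p in vol. conorm A g p (differential A F p) \<le> k"
    and c: "c \<in> A" and ab: "cbox a b \<subseteq> chart_image c"
    and \<gamma>: "C1_curve A \<alpha> \<beta> \<gamma>" and st: "\<alpha> \<le> s" "s < t" "t \<le> \<beta>"
    and im: "\<And>\<tau>. \<tau> \<in> {s..t} \<Longrightarrow> \<gamma> \<tau> \<in> fst c" "\<And>\<tau>. \<tau> \<in> {s..t} \<Longrightarrow> snd c (\<gamma> \<tau>) \<in> box a b"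
  shows "length_bound F k \<gamma> s t"
proof -
  let ?f = "chart_ext c a b F" and ?\<eta> = "\<lambda>\<tau>. snd c (\<gamma> \<tau>)"
  obtain w where w: "continuous_on {s..t} w"
    "\<And>\<tau>. \<tau> \<in> {s..t} \<Longrightarrow> ((snd c \<circ> \<gamma>) has_vector_derivative w \<tau>) (at \<tau> within {s..t})"
    "speed \<gamma> integrable_on {s..t}" "integral {s..t} (speed \<gamma>) = integral {s..t} (\<lambda>\<tau>. gnorm c (?\<eta> \<tau>) (w \<tau>))"
    by (rule speed_in_chart[OF \<gamma> c st]) (erule im(1), (rule that; assumption))
  have ne: "cbox a b \<noteq> {}" using im(2)[of s] st box_subset_cbox by force
  obtain C where lip: "(L * C)-lipschitz_on UNIV ?f" using chart_ext_lipschitz[OF c ab ne] L by metis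
  have bsub: "box a b \<subseteq> chart_image c" using ab box_subset_cbox by blast
  have nrm: "continuous_on (box a b \<times> UNIV) (\<lambda>z. k * gnorm c (fst z) (snd z))"
  proof (intro continuous_on_mult continuous_on_const continuous_on_real_sqrt continuous_quad_form)
    show "continuous_on (box a b \<times> UNIV) (\<lambda>z :: (real ^ 'n) \<times> (real ^ 'n). gram_matrix A g c (fst z))"
      by (rule continuous_on_compose2[OF continuous_gram[OF c] continuous_on_fst]) (use bsub in auto)
  qed (rule continuous_on_snd, rule continuous_on_id)
  have "AE p in vol. (\<exists>\<omega>. has_differential A F p \<omega>) \<and> conorm A g p (differential A F p) \<le> k"
    using lipschitz_differentiable_AE[OF L] ae by eventually_elim simp
  from AE_vol_imp_chart[OF c this]
  have good: "AE x in lborel. x \<in> box a b \<longrightarrow> (\<exists>D. (?f has_derivative D) (at x) \<and> (\<forall>u. \<bar>D u\<bar> \<le> k * gnorm c x u))"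
  proof eventually_elim
    case (elim x)
    show ?case
    proof
      assume x: "x \<in> box a b"
      then have xi: "x \<in> chart_image c" using bsub by blast
      let ?p = "chart_inv c x"
      have p: "?p \<in> fst c" "snd c ?p = x" using chart_inv_mem[OF c xi] chart_inv_right[OF c xi] by auto
      obtain \<omega> where \<omega>: "has_differential A F ?p \<omega>" and cn: "conorm A g ?p (differential A F ?p) \<le> k" using elim xi by blast
      let ?D = "\<lambda>u. differential A F ?p (coord_vec A c ?p u)"
      have "(?f has_derivative ?D) (at x)"
        using has_differential_chart[OF c p(1) \<omega>] unfolding chart_ext_has_derivative_iff[OF x] p(2) .
      moreover have "\<bar>?D u\<bar> \<le> k * gnorm c x u" for u
      proof -
        have "\<bar>?D u\<bar> \<le> conorm A g ?p (differential A F ?p) * gnorm c x u"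
          using covector_le_conorm[OF differential_cotangent coord_vec_mem[OF c p(1)], of F u]
          unfolding tnorm_coord_vec[OF c p(1)] p(2) .
        also have "\<dots> \<le> k * gnorm c x u" using cn quad_form_nonneg[OF c xi] by (intro mult_right_mono) auto
        finally show ?thesis .
      qed
      ultimately show "\<exists>D. (?f has_derivative D) (at x) \<and> (\<forall>u. \<bar>D u\<bar> \<le> k * gnorm c x u)" by blast
    qed
  qed
  have der: "\<And>\<tau>. \<tau> \<in> {s..t} \<Longrightarrow> (?\<eta> has_vector_derivative w \<tau>) (at \<tau> within {s..t})"
    using w(2) by (simp add: comp_def)
  have up: "h (?\<eta> t) - h (?\<eta> s) \<le> integral {s..t} (\<lambda>\<tau>. k * gnorm c (?\<eta> \<tau>) (w \<tau>))"
    if "(L * C)-lipschitz_on UNIV h"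
      "AE x in lborel. x \<in> box a b \<longrightarrow> (\<exists>D. (h has_derivative D) (at x) \<and> (\<forall>u. D u \<le> k * gnorm c x u))" for h
    by (rule lipschitz_increment_along_curve[OF that(1) st(2) w(1) der open_box im(2) nrm that(2)])
  have 1: "?f (?\<eta> t) - ?f (?\<eta> s) \<le> integral {s..t} (\<lambda>\<tau>. k * gnorm c (?\<eta> \<tau>) (w \<tau>))"
  proof (rule up[OF lip])
    show "AE x in lborel. x \<in> box a b \<longrightarrow> (\<exists>D. (?f has_derivative D) (at x) \<and> (\<forall>u. D u \<le> k * gnorm c x u))"
      using good by eventually_elim (meson abs_le_D1)
  qed
  have 2: "- ?f (?\<eta> t) - - ?f (?\<eta> s) \<le> integral {s..t} (\<lambda>\<tau>. k * gnorm c (?\<eta> \<tau>) (w \<tau>))"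
  proof (rule up[OF lipschitz_on_uminus_real[OF lip]])
    show "AE x in lborel. x \<in> box a b \<longrightarrow> (\<exists>D. ((\<lambda>x. - ?f x) has_derivative D) (at x) \<and> (\<forall>u. D u \<le> k * gnorm c x u))"
      using good
    proof eventually_elim
      case (elim x)
      show ?case
      proof
        assume "x \<in> box a b"
        then obtain D where D: "(?f has_derivative D) (at x)" "\<forall>u. \<bar>D u\<bar> \<le> k * gnorm c x u" using elim by blast
        have "((\<lambda>x. - ?f x) has_derivative (\<lambda>u. - D u)) (at x)" by (rule has_derivative_minus[OF D(1)])
        moreover have "\<forall>u. - D u \<le> k * gnorm c x u" using D(2) abs_le_D2 by blast
        ultimately show "\<exists>D. ((\<lambda>x. - ?f x) has_derivative D) (at x) \<and> (\<forall>u. D u \<le> k * gnorm c x u)" by blast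
      qed
    qed
  qed
  have fF: "?f (?\<eta> \<tau>) = F (\<gamma> \<tau>)" if "\<tau> \<in> {s..t}" for \<tau>
    using chart_ext_eq[of "?\<eta> \<tau>" a b c F] im(2)[OF that] box_subset_cbox chart_inv_left[OF c im(1)[OF that]] by auto
  have e: "integral {s..t} (\<lambda>\<tau>. k * gnorm c (?\<eta> \<tau>) (w \<tau>)) = k * integral {s..t} (speed \<gamma>)"
    unfolding w(4) by simp
  have "\<bar>F (\<gamma> t) - F (\<gamma> s)\<bar> \<le> k * integral {s..t} (speed \<gamma>)"
    using 1 2 fF[of s] fF[of t] st unfolding e by (simp add: abs_le_iff)
  then show ?thesis unfolding length_bound_def using w(3) by blast
qed

lemma length_bound_C1:
  assumes L: "L \<in> lipschitz_bounds A g F" and k: "0 \<le> k"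
    and ae: "AE p in vol. conorm A g p (differential A F p) \<le> k"
    and \<gamma>: "C1_curve A \<alpha> \<beta> \<gamma>" and st: "\<alpha> \<le> s" "s \<le> t" "t \<le> \<beta>"
  shows "length_bound F k \<gamma> s t"
proof -
  have cont: "continuous_on {\<alpha>..\<beta>} \<gamma>" using \<gamma> unfolding C1_curve_def by blast
  have "\<alpha> \<le> s \<longrightarrow> t \<le> \<beta> \<longrightarrow> length_bound F k \<gamma> s t"
    using st(2)
  proof (induction s t rule: Bolzano[where P = "\<lambda>s t. \<alpha> \<le> s \<longrightarrow> t \<le> \<beta> \<longrightarrow> length_bound F k \<gamma> s t", consumes 1])
    case (trans x y z)
    then show ?case using length_bound_trans[of F k \<gamma> x y z] by linarith
  next
    case (local x)
    then have x: "x \<in> {\<alpha>..\<beta>}" using st by auto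
    obtain c where c: "c \<in> A" "\<gamma> x \<in> fst c" using chart_cover by blast
    obtain a b where ab: "snd c (\<gamma> x) \<in> box a b" "cbox a b \<subseteq> chart_image c" using chart_box[OF c] by blast
    have "open (fst c \<inter> snd c -` box a b)"
      by (rule continuous_open_preimage[OF continuous_chart[OF c(1)] open_chart[OF c(1)] open_box])
    moreover have "\<gamma> x \<in> fst c \<inter> snd c -` box a b" using c ab by blast
    ultimately have "\<exists>d>0. \<forall>\<tau>\<in>{\<alpha>..\<beta>}. dist \<tau> x < d \<longrightarrow> \<gamma> \<tau> \<in> fst c \<inter> snd c -` box a b"
      using cont x unfolding continuous_on_topological eventually_at_topological
      by (metis (no_types, lifting) open_dist)
    then obtain d where d: "d > 0" "\<And>\<tau>. \<tau> \<in> {\<alpha>..\<beta>} \<Longrightarrow> dist \<tau> x < d \<Longrightarrow> \<gamma> \<tau> \<in> fst c \<inter> snd c -` box a b" by blast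
    have "length_bound F k \<gamma> s' t'" if st': "s' \<le> x" "x \<le> t'" "t' - s' < d" "\<alpha> \<le> s'" "t' \<le> \<beta>" for s' t'
    proof (cases "s' = t'")
      case True
      then show ?thesis by (simp add: length_bound_refl)
    next
      case False
      then have lt: "s' < t'" using st' by linarith
      have mem: "\<gamma> \<tau> \<in> fst c \<inter> snd c -` box a b" if "\<tau> \<in> {s'..t'}" for \<tau>
        by (rule d(2)) (use that st' in \<open>auto simp: dist_real_def\<close>)
      show ?thesis
        by (rule length_bound_in_box[OF L k ae c(1) ab(2) \<gamma> st'(4) lt st'(5)]) (use mem in blast)+
    qed
    then show ?case using d(1) by blast
  qed
  then show ?thesis using st by blast
qed

text \<open>
  Curve pieces inside a coordinate box satisfy the length bound, and the bound is additive under
  concatenation. A compactness argument in the form of \<open>Bolzano\<close> extends it first to \<open>C\<^sup>1\<close> curves and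
  then across the break points of a piecewise \<open>C\<^sup>1\<close> curve.
\<close>

theorem lipschitz_bound_of_conorm:
  assumes L: "L \<in> lipschitz_bounds A g F" and k: "0 \<le> k"
    and ae: "AE p in vol. conorm A g p (differential A F p) \<le> k"
  shows "k \<in> lipschitz_bounds A g F"
proof -
  have "\<bar>F y - F x\<bar> \<le> k * curve_length A g \<gamma>" if \<gamma>: "piecewise_C1_curve A \<gamma>" "\<gamma> 0 = x" "\<gamma> 1 = y" for \<gamma> x y
  proof -
    obtain S where S: "finite S" "{0, 1} \<subseteq> S" "S \<subseteq> {0..1}"
      "\<And>a b. a \<in> S \<Longrightarrow> b \<in> S \<Longrightarrow> a < b \<Longrightarrow> {a<..<b} \<inter> S = {} \<Longrightarrow> C1_curve A a b \<gamma>"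
      by (rule piecewise_C1_curveE[OF \<gamma>(1)]) blast
    have piece: "length_bound F k \<gamma> s t"
      if "a \<in> S" "b \<in> S" "a < b" "{a<..<b} \<inter> S = {}" "a \<le> s" "s \<le> t" "t \<le> b" for a b s t
      by (rule length_bound_C1[OF L k ae S(4)[OF that(1-4)] that(5-7)])
    have left: "\<exists>d>0. \<forall>s. 0 \<le> s \<and> s \<le> u \<and> u - s < d \<longrightarrow> length_bound F k \<gamma> s u" if u: "0 \<le> u" "u \<le> 1" for u
    proof (cases "u = 0")
      case True
      then have "length_bound F k \<gamma> s u" if "0 \<le> s \<and> s \<le> u \<and> u - s < 1" for s
        using that length_bound_refl[of F k \<gamma> u] by (metis antisym)
      then show ?thesis by (intro exI[of _ 1]) simp
    next
      case False
      then obtain a b where ab: "a \<in> S" "b \<in> S" "a < u" "u \<le> b" "{a<..<b} \<inter> S = {}"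
        using consecutive_points(1)[OF S(1-3), of u] u by force
      have "length_bound F k \<gamma> s u" if "s \<le> u" "u - s < u - a" for s
        by (rule piece[OF ab(1,2) _ ab(5)]) (use ab that in linarith)+
      then show ?thesis using ab(3) by (intro exI[of _ "u - a"]) simp
    qed
    have right: "\<exists>d>0. \<forall>t. u \<le> t \<and> t \<le> 1 \<and> t - u < d \<longrightarrow> length_bound F k \<gamma> u t" if u: "0 \<le> u" "u \<le> 1" for u
    proof (cases "u = 1")
      case True
      then have "length_bound F k \<gamma> u t" if "u \<le> t \<and> t \<le> 1 \<and> t - u < 1" for t
        using that length_bound_refl[of F k \<gamma> u] by (metis antisym)
      then show ?thesis by (intro exI[of _ 1]) simp
    next
      case False
      then obtain a b where ab: "a \<in> S" "b \<in> S" "a \<le> u" "u < b" "{a<..<b} \<inter> S = {}"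
        using consecutive_points(2)[OF S(1-3), of u] u by force
      have "length_bound F k \<gamma> u t" if "u \<le> t" "t - u < b - u" for t
        by (rule piece[OF ab(1,2) _ ab(5)]) (use ab that in linarith)+
      then show ?thesis using ab(4) by (intro exI[of _ "b - u"]) simp
    qed
    have "0 \<le> (0::real) \<longrightarrow> (1::real) \<le> 1 \<longrightarrow> length_bound F k \<gamma> 0 1"
    proof (rule Bolzano[where P = "\<lambda>s t. 0 \<le> s \<longrightarrow> t \<le> 1 \<longrightarrow> length_bound F k \<gamma> s t"])
      show "(0::real) \<le> 1" by simp
      fix p q r :: real assume "0 \<le> p \<longrightarrow> q \<le> 1 \<longrightarrow> length_bound F k \<gamma> p q" "0 \<le> q \<longrightarrow> r \<le> 1 \<longrightarrow> length_bound F k \<gamma> q r" "p \<le> q" "q \<le> r"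
      then show "0 \<le> p \<longrightarrow> r \<le> 1 \<longrightarrow> length_bound F k \<gamma> p r" using length_bound_trans[of F k \<gamma> p q r] by linarith
    next
      fix u :: real assume u: "0 \<le> u" "u \<le> 1"
      obtain d1 where d1: "d1 > 0" "\<And>s. 0 \<le> s \<and> s \<le> u \<and> u - s < d1 \<Longrightarrow> length_bound F k \<gamma> s u" using left[OF u] by blast
      obtain d2 where d2: "d2 > 0" "\<And>t. u \<le> t \<and> t \<le> 1 \<and> t - u < d2 \<Longrightarrow> length_bound F k \<gamma> u t" using right[OF u] by blast
      have "length_bound F k \<gamma> s t" if "s \<le> u" "u \<le> t" "t - s < min d1 d2" "0 \<le> s" "t \<le> 1" for s t
      proof (rule length_bound_trans[OF _ _ that(1,2)])
        show "length_bound F k \<gamma> s u" by (rule d1(2)) (use that in auto)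
        show "length_bound F k \<gamma> u t" by (rule d2(2)) (use that in auto)
      qed
      then show "\<exists>d>0. \<forall>a b. a \<le> u \<and> u \<le> b \<and> b - a < d \<longrightarrow> 0 \<le> a \<longrightarrow> b \<le> 1 \<longrightarrow> length_bound F k \<gamma> a b"
        using d1(1) d2(1) by (intro exI[of _ "min d1 d2"]) simp
    qed
    then show ?thesis using \<gamma>(2,3) unfolding length_bound_def curve_length_def by simp
  qed
  note bound = this
  have "\<bar>F x - F y\<bar> \<le> k * riem_dist A g x y" for x y
  proof (cases "k = 0")
    case True
    obtain \<gamma> where "piecewise_C1_curve A \<gamma>" "\<gamma> 0 = y" "\<gamma> 1 = x" using exists_piecewise_C1_curve[OF connected, of y x] by blast
    from bound[OF this] show ?thesis using True by simp
  next
    case False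
    then have k0: "0 < k" using k by simp
    have "\<bar>F x - F y\<bar> / k \<le> riem_dist A g x y"
    proof (rule riem_dist_greatest)
      fix \<gamma> assume "piecewise_C1_curve A \<gamma>" "\<gamma> 0 = x" "\<gamma> 1 = y"
      from bound[OF this] show "\<bar>F x - F y\<bar> / k \<le> curve_length A g \<gamma>"
        using k0 by (simp add: pos_divide_le_eq mult.commute abs_minus_commute)
    qed
    then show ?thesis using k0 by (simp add: pos_divide_le_eq mult.commute)
  qed
  then show ?thesis unfolding lipschitz_bounds_def using k by blast
qed

text \<open>
  Without this, the essential supremum of a nonnegative function could be \<open>- \<infinity>\<close>.
\<close>

lemma cvol_nontrivial: "\<not> (AE p in cvol. False)"
proof
  assume "AE p in cvol. False"
  then have "AE p in vol. False" unfolding AE_cvol .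
  obtain c where c: "c \<in> A" "undefined \<in> fst c" using chart_cover by blast
  have "AE x in lborel. x \<in> chart_image c \<longrightarrow> False" by (rule AE_vol_imp_chart[OF c(1) \<open>AE p in vol. False\<close>])
  then have "AE x in lborel. x \<notin> chart_image c" by simp
  then have "chart_image c \<in> null_sets lborel"
    using open_chart_image[OF c(1)] by (subst (asm) AE_iff_null_sets[symmetric]) auto
  then have "negligible (chart_image c)" by (simp add: negligible_iff_null_sets null_sets_completionI)
  then show False using open_not_negligible[OF open_chart_image[OF c(1)]] c(2) by blast
qed

text \<open>
  The essential supremum \<open>k\<close> of the dual norm of \<open>dF\<close> is at most every Lipschitz bound by
  \<open>differential_Linf\<close>, and it is a Lipschitz bound itself by \<open>lipschitz_bound_of_conorm\<close>.
\<close>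

lemma D_op_isometry:
  assumes "F \<in> Lip0 A g z"
  shows "Linf_norm A g (D_op A g F) = Lip_norm A g F"
proof -
  have ne: "lipschitz_bounds A g F \<noteq> {}" using assms unfolding Lip0_def by blast
  then obtain L where L: "L \<in> lipschitz_bounds A g F" by blast
  define f where "f = representative (D_op A g F)"
  have f: "f \<in> Linf_fields A g" "AE p in cvol. differential A F p = f p"
    unfolding f_def D_op_def using representative_Linf[OF differential_Linf(1)[OF L]] by blast+
  define K where "K = esssup cvol (\<lambda>p. ereal (conorm A g p (differential A F p)))"
  have "f \<in> measurable_covector_fields A g" using f(1) unfolding Linf_fields_iff by blast
  then have Kf: "K = esssup cvol (\<lambda>p. ereal (conorm A g p (f p)))"
    unfolding K_def by (rule esssup_conorm_cong[OF differential_measurable[OF L] _ f(2)])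
  have KL: "K \<le> ereal M" if "M \<in> lipschitz_bounds A g F" for M unfolding K_def by (rule differential_Linf(2)[OF that])
  have ae: "AE p in cvol. ereal (conorm A g p (differential A F p)) \<le> K" unfolding K_def by (rule esssup_AE)
  have pos: "0 \<le> conorm A g p (differential A F p)" for p
  proof -
    obtain c where c: "c \<in> A" "p \<in> fst c" using chart_cover by blast
    let ?v = "coord_vec A c p (axis undefined 1)"
    have "0 \<le> conorm A g p (differential A F p) * gnorm c (snd c p) (axis undefined 1)"
      using covector_le_conorm[OF differential_cotangent coord_vec_mem[OF c], of F "axis undefined 1"]
      unfolding tnorm_coord_vec[OF c] by (meson abs_ge_zero order_trans)
    moreover have "0 < gnorm c (snd c p) (axis undefined 1)"
      using quad_form_pos[OF c(1), of "snd c p" "axis undefined 1"] c(2) by (simp add: axis_eq_0_iff)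
    ultimately show ?thesis by (simp add: zero_le_mult_iff)
  qed
  have "0 \<le> K"
  proof (rule ccontr)
    assume "\<not> 0 \<le> K"
    have "AE p in cvol. False"
      using ae
    proof eventually_elim
      case (elim p)
      have "0 \<le> ereal (conorm A g p (differential A F p))" using pos by simp
      then show False using elim \<open>\<not> 0 \<le> K\<close> by (meson order_trans)
    qed
    then show False using cvol_nontrivial by blast
  qed
  then obtain k where k: "K = ereal k" "0 \<le> k" using KL[OF L] by (cases K) auto
  have "AE p in vol. conorm A g p (differential A F p) \<le> k" using ae unfolding k(1) AE_cvol by simp
  then have kb: "k \<in> lipschitz_bounds A g F" by (rule lipschitz_bound_of_conorm[OF L k(2)])
  have kl: "k \<le> M" if "M \<in> lipschitz_bounds A g F" for M using KL[OF that] unfolding k(1) by simp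
  have "Lip_norm A g F = k" unfolding Lip_norm_def by (rule cInf_eq_minimum[OF kb kl])
  moreover have "Linf_norm A g (D_op A g F) = k"
    unfolding Linf_norm_def riem_volume_eq f_def[symmetric] Kf[symmetric] k(1) by simp
  ultimately show ?thesis by simp
qed

end

section \<open>Integration against an integrable vector field is a limit of point evaluations\<close>

context connected_riemannian_manifold
begin

text \<open>
  The counterpart of \<open>lip_approx\<close> on the manifold: approximation by \<open>point_eval_span\<close> with an error
  relative to any Lipschitz bound.
\<close>

definition span_approx :: "'m \<Rightarrow> (('m \<Rightarrow> real) \<Rightarrow> real) \<Rightarrow> bool" where
  "span_approx z \<phi> \<longleftrightarrow> (\<forall>\<epsilon>>0. \<exists>\<psi>\<in>point_eval_span A g z. \<forall>F\<in>Lip0 A g z. \<forall>L\<in>lipschitz_bounds A g F. \<bar>\<phi> F - \<psi> F\<bar> \<le> \<epsilon> * L)"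

lemma span_approxE:
  assumes "span_approx z \<phi>" "\<epsilon> > 0"
  obtains \<psi> where "\<psi> \<in> point_eval_span A g z"
    "\<And>F L. F \<in> Lip0 A g z \<Longrightarrow> L \<in> lipschitz_bounds A g F \<Longrightarrow> \<bar>\<phi> F - \<psi> F\<bar> \<le> \<epsilon> * L"
  using assms unfolding span_approx_def by blast

lemma point_eval_span_zero: "(\<lambda>F. 0) \<in> point_eval_span A g z"
  unfolding point_eval_span_def mem_Collect_eq by (rule exI[of _ "{}"]) simp

lemma point_eval_span_insert:
  assumes "\<psi> \<in> point_eval_span A g z"
  shows "(\<lambda>F. \<psi> F + b * point_eval A g z x F) \<in> point_eval_span A g z"
proof -
  obtain S a where S: "finite S" "\<psi> = (\<lambda>F. \<Sum>y\<in>S. a y * point_eval A g z y F)"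
    using assms unfolding point_eval_span_def by blast
  (* The point x may already occur in S, in which case its coefficients are added. *)
  define a' where "a' y = (if y \<in> S then a y else 0) + (if y = x then b else 0)" for y
  have "(\<Sum>y\<in>insert x S. a' y * e y) = (\<Sum>y\<in>S. a y * e y) + b * e x" for e :: "'m \<Rightarrow> real"
  proof -
    have "(\<Sum>y\<in>insert x S. a' y * e y) = (\<Sum>y\<in>insert x S. (if y \<in> S then a y * e y else 0)) + (\<Sum>y\<in>insert x S. (if y = x then b * e y else 0))"
      unfolding sum.distrib[symmetric] by (rule sum.cong) (auto simp: a'_def distrib_right)
    also have "(\<Sum>y\<in>insert x S. (if y \<in> S then a y * e y else 0)) = (\<Sum>y\<in>S. a y * e y)"
      by (rule sum.mono_neutral_cong_right) (use S(1) in auto)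
    also have "(\<Sum>y\<in>insert x S. (if y = x then b * e y else 0)) = b * e x" using S(1) by (simp add: sum.delta)
    finally show ?thesis .
  qed
  then have "(\<lambda>F. \<psi> F + b * point_eval A g z x F) = (\<lambda>F. \<Sum>y\<in>insert x S. a' y * point_eval A g z y F)"
    unfolding S(2) by simp
  then show ?thesis using S(1) unfolding point_eval_span_def by blast
qed

lemma point_eval_span_add:
  assumes "\<psi> \<in> point_eval_span A g z" "\<psi>' \<in> point_eval_span A g z"
  shows "(\<lambda>F. \<psi> F + \<psi>' F) \<in> point_eval_span A g z"
proof -
  obtain S a where S: "finite S" "\<psi>' = (\<lambda>F. \<Sum>y\<in>S. a y * point_eval A g z y F)"
    using assms(2) unfolding point_eval_span_def by blast
  have "(\<lambda>F. \<psi> F + (\<Sum>y\<in>S. a y * point_eval A g z y F)) \<in> point_eval_span A g z"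
    using S(1)
  proof (induction S rule: finite_induct)
    case (insert x S)
    have "(\<lambda>F. \<psi> F + (\<Sum>y\<in>insert x S. a y * point_eval A g z y F)) =
        (\<lambda>F. (\<psi> F + (\<Sum>y\<in>S. a y * point_eval A g z y F)) + a x * point_eval A g z x F)"
      using insert.hyps by (simp add: add_ac)
    then show ?case using point_eval_span_insert[OF insert.IH, of "a x" x] by simp
  qed (use assms(1) in simp)
  then show ?thesis unfolding S(2) .
qed

lemma span_approx_cong:
  assumes "span_approx z \<phi>" "\<And>F. F \<in> Lip0 A g z \<Longrightarrow> \<phi>' F = \<phi> F"
  shows "span_approx z \<phi>'"
  using assms unfolding span_approx_def by simp

lemma span_approx_zero: "span_approx z (\<lambda>F. 0)"
  unfolding span_approx_def
proof (intro allI impI bexI[OF _ point_eval_span_zero] ballI)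
  fix \<epsilon> :: real and F L assume "0 < \<epsilon>" "L \<in> lipschitz_bounds A g F"
  then show "\<bar>0 - 0\<bar> \<le> \<epsilon> * L" unfolding lipschitz_bounds_def by simp
qed

lemma span_approx_add:
  assumes "span_approx z \<phi>" "span_approx z \<phi>'"
  shows "span_approx z (\<lambda>F. \<phi> F + \<phi>' F)"
  unfolding span_approx_def
proof (intro allI impI)
  fix \<epsilon> :: real assume "\<epsilon> > 0"
  then have e: "\<epsilon> / 2 > 0" by simp
  obtain \<psi> where \<psi>: "\<psi> \<in> point_eval_span A g z"
    "\<And>F L. F \<in> Lip0 A g z \<Longrightarrow> L \<in> lipschitz_bounds A g F \<Longrightarrow> \<bar>\<phi> F - \<psi> F\<bar> \<le> \<epsilon> / 2 * L"
    by (rule span_approxE[OF assms(1) e]) (rule that; assumption)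
  obtain \<psi>' where \<psi>': "\<psi>' \<in> point_eval_span A g z"
    "\<And>F L. F \<in> Lip0 A g z \<Longrightarrow> L \<in> lipschitz_bounds A g F \<Longrightarrow> \<bar>\<phi>' F - \<psi>' F\<bar> \<le> \<epsilon> / 2 * L"
    by (rule span_approxE[OF assms(2) e]) (rule that; assumption)
  show "\<exists>\<psi>\<in>point_eval_span A g z. \<forall>F\<in>Lip0 A g z. \<forall>L\<in>lipschitz_bounds A g F. \<bar>\<phi> F + \<phi>' F - \<psi> F\<bar> \<le> \<epsilon> * L"
  proof (intro bexI[OF _ point_eval_span_add[OF \<psi>(1) \<psi>'(1)]] ballI)
    fix F L assume "F \<in> Lip0 A g z" "L \<in> lipschitz_bounds A g F"
    from \<psi>(2)[OF this] \<psi>'(2)[OF this] show "\<bar>\<phi> F + \<phi>' F - (\<psi> F + \<psi>' F)\<bar> \<le> \<epsilon> * L" by linarith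
  qed
qed

lemma span_approx_sum:
  assumes "finite I" "\<And>i. i \<in> I \<Longrightarrow> span_approx z (\<phi> i)"
  shows "span_approx z (\<lambda>F. \<Sum>i\<in>I. \<phi> i F)"
  using assms
proof (induction I rule: finite_induct)
  case (insert i I)
  have "span_approx z (\<lambda>F. \<phi> i F + (\<Sum>i\<in>I. \<phi> i F))" using insert by (intro span_approx_add) auto
  then show ?case using insert.hyps by simp
qed (simp add: span_approx_zero)

lemma span_approx_limit:
  assumes "\<And>\<epsilon>. \<epsilon> > 0 \<Longrightarrow> \<exists>\<phi>'. span_approx z \<phi>' \<and> (\<forall>F\<in>Lip0 A g z. \<forall>L\<in>lipschitz_bounds A g F. \<bar>\<phi> F - \<phi>' F\<bar> \<le> \<epsilon> * L)"
  shows "span_approx z \<phi>"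
  unfolding span_approx_def
proof (intro allI impI)
  fix \<epsilon> :: real assume "\<epsilon> > 0"
  then have e: "\<epsilon> / 2 > 0" by simp
  obtain \<phi>' where \<phi>': "span_approx z \<phi>'"
    "\<forall>F\<in>Lip0 A g z. \<forall>L\<in>lipschitz_bounds A g F. \<bar>\<phi> F - \<phi>' F\<bar> \<le> \<epsilon> / 2 * L"
    using assms[OF e] by blast
  obtain \<psi> where \<psi>: "\<psi> \<in> point_eval_span A g z"
    "\<And>F L. F \<in> Lip0 A g z \<Longrightarrow> L \<in> lipschitz_bounds A g F \<Longrightarrow> \<bar>\<phi>' F - \<psi> F\<bar> \<le> \<epsilon> / 2 * L"
    by (rule span_approxE[OF \<phi>'(1) e]) (rule that; assumption)
  show "\<exists>\<psi>\<in>point_eval_span A g z. \<forall>F\<in>Lip0 A g z. \<forall>L\<in>lipschitz_bounds A g F. \<bar>\<phi> F - \<psi> F\<bar> \<le> \<epsilon> * L"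
  proof (intro bexI[OF _ \<psi>(1)] ballI)
    fix F L assume FL: "F \<in> Lip0 A g z" "L \<in> lipschitz_bounds A g F"
    have "\<bar>\<phi> F - \<phi>' F\<bar> \<le> \<epsilon> / 2 * L" using \<phi>'(2) FL by blast
    with \<psi>(2)[OF FL] show "\<bar>\<phi> F - \<psi> F\<bar> \<le> \<epsilon> * L" by linarith
  qed
qed

lemma point_sum_chart_ext:
  assumes "point_sum \<psi>"
  shows "\<exists>\<psi>'\<in>point_eval_span A g z. \<forall>F\<in>Lip0 A g z. \<psi>' F = \<psi> (chart_ext c a b F)"
  using assms
proof (induction rule: point_sum.induct)
  case zero
  show ?case using point_eval_span_zero by (intro bexI[where x = "\<lambda>F. 0"]) simp_all
next
  case (insert \<psi> t x)
  then obtain \<psi>' where \<psi>': "\<psi>' \<in> point_eval_span A g z" "\<forall>F\<in>Lip0 A g z. \<psi>' F = \<psi> (chart_ext c a b F)" by blast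
  let ?y = "chart_inv c (closest_point (cbox a b) x)"
  show ?case
    by (rule bexI[OF _ point_eval_span_insert[OF \<psi>'(1), of t ?y]])
       (use \<psi>'(2) in \<open>simp add: point_eval_def chart_ext_def[of c a b _ x]\<close>)
qed

text \<open>
  The values of \<open>chart_ext\<close> are values of \<open>F\<close>, so a combination of point evaluations in the chart is one
  on the manifold.
\<close>

lemma span_approx_chart_ext:
  assumes \<phi>: "lip_approx \<phi>" and c: "c \<in> A" and ab: "cbox a b \<subseteq> chart_image c" "cbox a b \<noteq> {}"
  shows "span_approx z (\<lambda>F. \<phi> (chart_ext c a b F))"
  unfolding span_approx_def
proof (intro allI impI)
  fix \<epsilon> :: real assume e: "\<epsilon> > 0"
  obtain C where C: "0 < C" "\<And>F L. L \<in> lipschitz_bounds A g F \<Longrightarrow> (L * C)-lipschitz_on UNIV (chart_ext c a b F)"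
    using chart_ext_lipschitz[OF c ab] by blast
  have "\<epsilon> / C > 0" using e C(1) by simp
  then obtain \<psi> where \<psi>: "point_sum \<psi>" "\<And>L f. L-lipschitz_on UNIV f \<Longrightarrow> \<bar>\<phi> f - \<psi> f\<bar> \<le> \<epsilon> / C * L"
    by (rule lip_approxE[OF \<phi>]) (rule that; assumption)
  obtain \<psi>' where \<psi>': "\<psi>' \<in> point_eval_span A g z" "\<forall>F\<in>Lip0 A g z. \<psi>' F = \<psi> (chart_ext c a b F)"
    using point_sum_chart_ext[OF \<psi>(1)] by blast
  show "\<exists>\<psi>\<in>point_eval_span A g z. \<forall>F\<in>Lip0 A g z. \<forall>L\<in>lipschitz_bounds A g F. \<bar>\<phi> (chart_ext c a b F) - \<psi> F\<bar> \<le> \<epsilon> * L"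
  proof (intro bexI[OF _ \<psi>'(1)] ballI)
    fix F L assume F: "F \<in> Lip0 A g z" and L: "L \<in> lipschitz_bounds A g F"
    have "\<bar>\<phi> (chart_ext c a b F) - \<psi>' F\<bar> \<le> \<epsilon> / C * (L * C)" using \<psi>(2)[OF C(2)[OF L]] \<psi>'(2) F by simp
    then show "\<bar>\<phi> (chart_ext c a b F) - \<psi>' F\<bar> \<le> \<epsilon> * L" using C(1) by simp
  qed
qed

text \<open>
  In the chart, the integral becomes one of \<open>h * dini (chart_ext c a b F) e\<close> with \<open>h\<close> integrable and
  independent of \<open>F\<close>; then \<open>lip_approx_L1\<close> applies.
\<close>

lemma span_approx_coordinate:
  assumes c: "c \<in> A" and ab: "cbox a b \<subseteq> chart_image c" "cbox a b \<noteq> {}"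
    and u: "integrable cvol u" and u0: "\<And>p. \<not> (p \<in> fst c \<and> snd c p \<in> box a b) \<Longrightarrow> u p = 0"
  shows "span_approx z (\<lambda>F. \<integral>p. u p * differential A F p (coord_vec A c p e) \<partial>cvol)"
proof -
  let ?E = "{p \<in> fst c. snd c p \<in> box a b}"
  obtain u' where u': "u' \<in> borel_measurable vol" "AE p in vol. u p = u' p"
    using completion_ex_borel_measurable_real[OF borel_measurable_integrable[OF u]] by blast
  define v where "v p = indicator ?E p * u' p" for p
  have E: "?E \<in> sets borel" by (rule chart_preimage_measurable[OF c]) simp
  have u'b: "u' \<in> borel_measurable borel" using u'(1) unfolding measurable_vol .
  have vm: "v \<in> borel_measurable borel" unfolding v_def
    by (intro borel_measurable_times borel_measurable_indicator E u'b)
  have uv: "AE p in vol. u p = v p"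
    using u'(2)
  proof eventually_elim
    case (elim p)
    then show ?case using u0[of p] by (cases "p \<in> ?E") (auto simp: v_def)
  qed
  have "integrable cvol v"
    using integrable_cong_AE[OF borel_measurable_integrable[OF u] cvol_measurableI[OF vm]] u uv unfolding AE_cvol by blast
  then have "integrable vol v" using vm by (subst (asm) integrable_completion) (simp_all only: measurable_vol)
  moreover have vi: "v = (\<lambda>p. indicator (fst c) p * v p)" by (auto simp: v_def indicator_def)
  ultimately have "integrable vol (\<lambda>p. indicator (fst c) p * v p)" by simp
  then have h: "integrable lborel (\<lambda>x. cdens c x * v (cinv c x))" unfolding integral_vol_chart(2)[OF c vm] .
  show ?thesis
  proof (rule span_approx_cong[OF span_approx_chart_ext[OF lip_approx_L1[OF h] c ab]])
    fix F assume "F \<in> Lip0 A g z"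
    then obtain L where L: "L \<in> lipschitz_bounds A g F" unfolding Lip0_def by blast
    let ?f = "chart_ext c a b F"
    obtain C where lip: "(L * C)-lipschitz_on UNIV ?f" using chart_ext_lipschitz[OF c ab] L by metis
    have dm: "dini ?f e \<in> borel_measurable borel" by (rule borel_measurable_dini[OF lip])
    define k where "k p = v p * dini ?f e (ccoord c p)" for p
    have km: "k \<in> borel_measurable borel" unfolding k_def
      by (intro borel_measurable_times vm measurable_compose[OF ccoord_measurable[OF c] dm])
    have ae: "AE p in cvol. u p * differential A F p (coord_vec A c p e) = k p"
      unfolding AE_cvol using uv lipschitz_differentiable_AE[OF L]
    proof eventually_elim
      case (elim p)
      show ?case
      proof (cases "p \<in> ?E")
        case True
        then have p: "p \<in> fst c" "snd c p \<in> box a b" by auto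
        obtain \<omega> where \<omega>: "has_differential A F p \<omega>" using elim by blast
        have "(?f has_derivative (\<lambda>u. differential A F p (coord_vec A c p u))) (at (snd c p))"
          unfolding chart_ext_has_derivative_iff[OF p(2)] by (rule has_differential_chart[OF c p(1) \<omega>])
        from dini_eq_derivative[OF lip this, of e] show ?thesis
          unfolding k_def ccoord_eq[OF p(1)] elim(1) by simp
      next
        case False
        then show ?thesis using u0[of p] unfolding k_def v_def by auto
      qed
    qed
    have "(\<integral>p. u p * differential A F p (coord_vec A c p e) \<partial>cvol) = (\<integral>p. k p \<partial>cvol)"
      by (rule integral_cong_AE[OF completion_AE_measurable[OF cvol_measurableI[OF km] ae] cvol_measurableI[OF km] ae])
    also have "\<dots> = (\<integral>p. k p \<partial>vol)" by (rule integral_completion) (simp only: measurable_vol km)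
    also have "\<dots> = (\<integral>p. indicator (fst c) p * k p \<partial>vol)"
      by (rule Bochner_Integration.integral_cong) (auto simp: k_def v_def indicator_def)
    also have "\<dots> = (\<integral>x. cdens c x * k (cinv c x) \<partial>lborel)" by (rule integral_vol_chart(1)[OF c km])
    also have "\<dots> = (\<integral>x. cdens c x * v (cinv c x) * dini ?f e x \<partial>lborel)"
    proof (rule Bochner_Integration.integral_cong[OF refl])
      fix x
      show "cdens c x * k (cinv c x) = cdens c x * v (cinv c x) * dini ?f e x"
      proof (cases "x \<in> chart_image c")
        case True
        then show ?thesis using chart_inv_mem[OF c True] chart_inv_right[OF c True]
          by (simp add: k_def cinv_def ccoord_eq)
      qed (simp add: cdens_def)
    qed
    finally show "(\<integral>p. u p * differential A F p (coord_vec A c p e) \<partial>cvol) = (\<integral>x. cdens c x * v (cinv c x) * dini ?f e x \<partial>lborel)" .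
  qed
qed

lemma L1_fieldsD:
  assumes "X \<in> L1_fields A g"
  shows "X p \<in> tangent_space A p" "integrable cvol (\<lambda>p. tnorm g p (X p))"
    "c \<in> A \<Longrightarrow> (\<lambda>p. indicator (fst c) p *\<^sub>R X p c) \<in> borel_measurable cvol"
proof -
  show "X p \<in> tangent_space A p" "integrable cvol (\<lambda>p. tnorm g p (X p))"
    using assms unfolding L1_fields_def measurable_vector_fields_def riem_volume_eq by auto
  show "(\<lambda>p. indicator (fst c) p *\<^sub>R X p c) \<in> borel_measurable cvol" if "c \<in> A"
    using assms that unfolding L1_fields_def measurable_vector_fields_def riem_volume_eq restrict_cvol_iff[OF that, symmetric] by blast
qed

text \<open>
  On a piece \<open>E\<close> of a coordinate box, the components of \<open>X\<close> are integrable since the metric norm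
  dominates the Euclidean one, and \<open>dF(X)\<close> is the sum of the components times partial derivatives.
\<close>

lemma span_approx_piece:
  assumes X: "X \<in> L1_fields A g" and c: "c \<in> A" and ab: "cbox a b \<subseteq> chart_image c"
    and E: "E \<in> sets borel" "\<And>p. p \<in> E \<Longrightarrow> p \<in> fst c \<and> snd c p \<in> box a b"
  shows "span_approx z (\<lambda>F. \<integral>p. indicator E p * differential A F p (X p) \<partial>cvol)"
    and "L \<in> lipschitz_bounds A g F \<Longrightarrow> (\<lambda>p. indicator E p * differential A F p (X p)) \<in> borel_measurable cvol"
proof -
  obtain m C where mC: "0 < m" "0 < C" "\<And>x u. x \<in> cbox a b \<Longrightarrow> m * norm u \<le> gnorm c x u"
      "\<And>x u. x \<in> cbox a b \<Longrightarrow> gnorm c x u \<le> C * norm u"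
    by (rule compact_metric_bounds[OF c compact_cbox ab]) (rule that; assumption)
  have Ec: "p \<in> fst c" "snd c p \<in> cbox a b" if "p \<in> E" for p using E(2)[OF that] box_subset_cbox by blast+
  have Em: "(indicator E :: 'm \<Rightarrow> real) \<in> borel_measurable cvol"
    by (rule cvol_measurableI) (rule borel_measurable_indicator[OF E(1)])
  define u where "u i p = indicator E p * (X p c $ i)" for i p
  let ?e = "\<lambda>F i p. differential A F p (coord_vec A c p (axis i 1))"
  have um: "u i \<in> borel_measurable cvol" for i
  proof -
    have "(\<lambda>p. indicator E p * ((indicator (fst c) p *\<^sub>R X p c) $ i)) \<in> borel_measurable cvol"
      by (intro borel_measurable_times Em measurable_compose[OF L1_fieldsD(3)[OF X c]]
        borel_measurable_continuous_onI continuous_intros)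
    moreover have "(\<lambda>p. indicator E p * ((indicator (fst c) p *\<^sub>R X p c) $ i)) = u i"
      using Ec(1) by (auto simp: u_def indicator_def)
    ultimately show ?thesis by simp
  qed
  have ui: "integrable cvol (u i)" for i
  proof (rule Bochner_Integration.integrable_bound[OF _ um])
    show "integrable cvol (\<lambda>p. (1 / m) * tnorm g p (X p))" by (intro integrable_mult_right L1_fieldsD(2)[OF X])
    show "AE p in cvol. norm (u i p) \<le> norm ((1 / m) * tnorm g p (X p))"
    proof (rule AE_I2)
      fix p
      show "norm (u i p) \<le> norm ((1 / m) * tnorm g p (X p))"
      proof (cases "p \<in> E")
        case True
        have "m * \<bar>X p c $ i\<bar> \<le> m * norm (X p c)" using mC(1) component_le_norm_cart[of "X p c" i] by simp
        also have "\<dots> \<le> tnorm g p (X p)"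
          using mC(3)[OF Ec(2)[OF True]] tnorm_eq_gnorm[OF c Ec(1)[OF True] L1_fieldsD(1)[OF X]] by simp
        finally have "\<bar>X p c $ i\<bar> \<le> tnorm g p (X p) / m" using mC(1) by (simp add: pos_le_divide_eq mult.commute)
        then show ?thesis using True mC(1) tnorm_nonneg[OF L1_fieldsD(1)[OF X, of p]] by (simp add: u_def)
      qed (simp add: u_def)
    qed
  qed
  have prod: "integrable cvol (\<lambda>p. u i p * ?e F i p)" if L: "L \<in> lipschitz_bounds A g F" for i F L
  proof (rule Bochner_Integration.integrable_bound)
    show "integrable cvol (\<lambda>p. (L * C) * u i p)" by (intro integrable_mult_right ui)
    have "(\<lambda>p. u i p * (indicator (fst c) p * ?e F i p)) \<in> borel_measurable cvol"
    proof (rule borel_measurable_times[OF um])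
      show "(\<lambda>p. indicator (fst c) p * ?e F i p) \<in> borel_measurable cvol"
        using differential_measurable[OF L] c
        unfolding measurable_covector_fields_def riem_volume_eq restrict_cvol_iff_real[OF c, symmetric] by blast
    qed
    moreover have "(\<lambda>p. u i p * (indicator (fst c) p * ?e F i p)) = (\<lambda>p. u i p * ?e F i p)"
      using Ec(1) by (auto simp: u_def indicator_def)
    ultimately show "(\<lambda>p. u i p * ?e F i p) \<in> borel_measurable cvol" by simp
    show "AE p in cvol. norm (u i p * ?e F i p) \<le> norm ((L * C) * u i p)"
    proof (rule AE_I2)
      fix p
      show "norm (u i p * ?e F i p) \<le> norm ((L * C) * u i p)"
      proof (cases "p \<in> E")
        case True
        have L0: "0 \<le> L" using L unfolding lipschitz_bounds_def by blast
        have "\<bar>?e F i p\<bar> \<le> L * gnorm c (snd c p) (axis i 1)"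
          using differential_le_lipschitz[OF L coord_vec_mem[OF c Ec(1)[OF True]]] unfolding tnorm_coord_vec[OF c Ec(1)[OF True]] .
        also have "\<dots> \<le> L * C" using mC(4)[OF Ec(2)[OF True], of "axis i 1"] L0 by (intro mult_left_mono) simp_all
        finally have "\<bar>u i p\<bar> * \<bar>?e F i p\<bar> \<le> \<bar>u i p\<bar> * (L * C)" by (intro mult_left_mono) simp_all
        then show ?thesis using L0 mC(2) by (simp add: abs_mult mult_ac)
      qed (simp add: u_def)
    qed
  qed
  have expand: "indicator E p * differential A F p (X p) = (\<Sum>i\<in>UNIV. u i p * ?e F i p)" for F p
  proof (cases "p \<in> E")
    case True
    have "differential A F p (X p) = differential A F p (coord_vec A c p (X p c))"
      by (rule arg_cong[OF tangent_eq_coord_vec[OF c Ec(1)[OF True] L1_fieldsD(1)[OF X]]])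
    also have "\<dots> = (\<Sum>i\<in>UNIV. X p c $ i * ?e F i p)"
      by (rule linear_axis_expansion[OF linear_covector[OF differential_cotangent c Ec(1)[OF True]]])
    finally show ?thesis using True by (simp add: u_def)
  qed (simp add: u_def)
  show "(\<lambda>p. indicator E p * differential A F p (X p)) \<in> borel_measurable cvol" if "L \<in> lipschitz_bounds A g F"
    unfolding expand by (intro borel_measurable_sum borel_measurable_integrable prod[OF that])
  show "span_approx z (\<lambda>F. \<integral>p. indicator E p * differential A F p (X p) \<partial>cvol)"
  proof (cases "cbox a b = {}")
    case True
    then have "E = {}" using Ec(2) by blast
    then show ?thesis by (simp add: span_approx_zero)
  next
    case False
    have "span_approx z (\<lambda>F. \<Sum>i\<in>UNIV. \<integral>p. u i p * ?e F i p \<partial>cvol)"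
    proof (rule span_approx_sum)
      show "span_approx z (\<lambda>F. \<integral>p. u i p * ?e F i p \<partial>cvol)" for i
      proof (rule span_approx_coordinate[OF c ab False ui])
        show "u i p = 0" if "\<not> (p \<in> fst c \<and> snd c p \<in> box a b)" for p
        proof -
          have "p \<notin> E" using E(2)[of p] that by blast
          then show ?thesis by (simp add: u_def)
        qed
      qed
    qed simp
    then show ?thesis
    proof (rule span_approx_cong)
      fix F assume "F \<in> Lip0 A g z"
      then obtain L where L: "L \<in> lipschitz_bounds A g F" unfolding Lip0_def by blast
      show "(\<integral>p. indicator E p * differential A F p (X p) \<partial>cvol) = (\<Sum>i\<in>UNIV. \<integral>p. u i p * ?e F i p \<partial>cvol)"
        unfolding expand by (rule Bochner_Integration.integral_sum[OF prod[OF L]])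
    qed
  qed
qed

text \<open>
  Exhaust the manifold by the finite unions \<open>V k\<close> of coordinate boxes. Restricted to \<open>V k\<close> the
  functional is a finite sum of the preceding kind, and the remainder is at most \<open>L\<close> times the
  integral of the norm of \<open>X\<close> over the complement of \<open>V k\<close>, which tends to zero uniformly in \<open>F\<close>.
\<close>

lemma integration_against_field:
  assumes X: "X \<in> L1_fields A g"
  shows "L \<in> lipschitz_bounds A g F \<Longrightarrow> integrable cvol (\<lambda>p. differential A F p (X p))"
    and "span_approx z (\<lambda>F. \<integral>p. differential A F p (X p) \<partial>cvol)"
proof -
  obtain c a b where cover: "\<And>k::nat. c k \<in> A" "\<And>k. cbox (a k) (b k) \<subseteq> chart_image (c k)"
    "\<And>k. open {p \<in> fst (c k). snd (c k) p \<in> box (a k) (b k)}"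
    "\<And>p. \<exists>k. p \<in> fst (c k) \<and> snd (c k) p \<in> box (a k) (b k)"
    by (rule box_cover) (rule that; assumption)
  define U where "U k = {p \<in> fst (c k). snd (c k) p \<in> box (a k) (b k)}" for k
  define V where "V k = (\<Union>j<k. U j)" for k
  define N where "N p = tnorm g p (X p)" for p
  have N0: "0 \<le> N p" for p unfolding N_def by (rule tnorm_nonneg[OF L1_fieldsD(1)[OF X]])
  have Ni: "integrable cvol N" unfolding N_def by (rule L1_fieldsD(2)[OF X])
  let ?d = "\<lambda>F p. differential A F p (X p)"
  have bound: "\<bar>?d F p\<bar> \<le> L * N p" if "L \<in> lipschitz_bounds A g F" for F L p
    unfolding N_def by (rule differential_le_lipschitz[OF that L1_fieldsD(1)[OF X]])
  have Uo: "open (U k)" for k unfolding U_def by (rule cover(3))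
  have Vo: "open (V k)" for k unfolding V_def using Uo by blast
  have V0: "V 0 = {}" by (simp add: V_def)
  have VS: "indicator (V (Suc k)) p = indicator (V k) p + (indicator (U k - V k) p :: real)" for k p
    unfolding V_def lessThan_Suc by (auto simp: indicator_def)
  have Vin: "\<forall>\<^sub>F k in sequentially. p \<in> V k" for p
  proof -
    obtain j where "p \<in> U j" using cover(4) unfolding U_def by blast
    then show ?thesis unfolding V_def eventually_sequentially by (intro exI[of _ "Suc j"]) auto
  qed
  have Em: "U k - V k \<in> sets borel" for k using Uo Vo by (intro sets.Diff borel_open)
  have Ein: "p \<in> fst (c k) \<and> snd (c k) p \<in> box (a k) (b k)" if "p \<in> U k - V k" for k p
    using that unfolding U_def by blast
  have piece_m: "(\<lambda>p. indicator (U k - V k) p * ?d F p) \<in> borel_measurable cvol"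
    if "L \<in> lipschitz_bounds A g F" for k F L
    by (rule span_approx_piece(2)[OF X cover(1)[of k] cover(2) Em Ein that])
  have piece_a: "span_approx z (\<lambda>F. \<integral>p. indicator (U k - V k) p * ?d F p \<partial>cvol)" for k
    by (rule span_approx_piece(1)[OF X cover(1)[of k] cover(2) Em Ein])
  have Vm: "(\<lambda>p. indicator (V k) p * ?d F p) \<in> borel_measurable cvol" if "L \<in> lipschitz_bounds A g F" for k F L
  proof (induction k)
    case (Suc k)
    show ?case unfolding VS distrib_right by (rule borel_measurable_add[OF Suc piece_m[OF that]])
  qed (simp add: V0)
  have dm: "?d F \<in> borel_measurable cvol" if "L \<in> lipschitz_bounds A g F" for F L
  proof (rule borel_measurable_LIMSEQ_real[OF _ Vm[OF that]])
    fix p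
    have "\<forall>\<^sub>F k in sequentially. indicator (V k) p * ?d F p = ?d F p"
      using Vin[of p] by eventually_elim simp
    then show "(\<lambda>k. indicator (V k) p * ?d F p) \<longlonglongrightarrow> ?d F p" by (rule tendsto_eventually)
  qed
  have dom: "integrable cvol (\<lambda>p. s p * ?d F p)"
    if L: "L \<in> lipschitz_bounds A g F" and m: "(\<lambda>p. s p * ?d F p) \<in> borel_measurable cvol" and s: "\<And>p. \<bar>s p\<bar> \<le> 1" for F L s
  proof (rule Bochner_Integration.integrable_bound[OF _ m])
    show "integrable cvol (\<lambda>p. L * N p)" by (intro integrable_mult_right Ni)
    show "AE p in cvol. norm (s p * ?d F p) \<le> norm (L * N p)"
    proof (rule AE_I2)
      fix p
      have "\<bar>s p\<bar> * \<bar>?d F p\<bar> \<le> 1 * (L * N p)" by (rule mult_mono[OF s bound[OF L]]) simp_all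
      then show "norm (s p * ?d F p) \<le> norm (L * N p)" by (simp add: abs_mult[symmetric])
    qed
  qed
  show di: "integrable cvol (?d F)" if "L \<in> lipschitz_bounds A g F" for F L
    using dom[OF that, of "\<lambda>_. 1"] dm[OF that] by simp
  have Vi: "integrable cvol (\<lambda>p. indicator (V k) p * ?d F p)" if "L \<in> lipschitz_bounds A g F" for k F L
    by (rule dom[OF that Vm[OF that]]) (simp add: indicator_def)
  have pi: "integrable cvol (\<lambda>p. indicator (U k - V k) p * ?d F p)" if "L \<in> lipschitz_bounds A g F" for k F L
    by (rule dom[OF that piece_m[OF that]]) (simp add: indicator_def)
  have Va: "span_approx z (\<lambda>F. \<integral>p. indicator (V k) p * ?d F p \<partial>cvol)" for k
  proof (induction k)
    case 0
    show ?case unfolding V0 by (simp add: span_approx_zero)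
  next
    case (Suc k)
    show ?case
    proof (rule span_approx_cong[OF span_approx_add[OF Suc piece_a[of k]]])
      fix F assume "F \<in> Lip0 A g z"
      then obtain L where L: "L \<in> lipschitz_bounds A g F" unfolding Lip0_def by blast
      show "(\<integral>p. indicator (V (Suc k)) p * ?d F p \<partial>cvol) =
          (\<integral>p. indicator (V k) p * ?d F p \<partial>cvol) + (\<integral>p. indicator (U k - V k) p * ?d F p \<partial>cvol)"
        unfolding VS distrib_right by (rule Bochner_Integration.integral_add[OF Vi[OF L] pi[OF L]])
    qed
  qed
  have Vind: "indicator (V k) \<in> borel_measurable cvol" for k
    by (rule cvol_measurableI) (rule borel_measurable_indicator[OF borel_open[OF Vo]])
  have tm: "(\<lambda>p. (1 - indicator (V k) p) * N p) \<in> borel_measurable cvol" for k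
    by (intro borel_measurable_times borel_measurable_diff borel_measurable_const Vind borel_measurable_integrable Ni)
  have ti: "integrable cvol (\<lambda>p. (1 - indicator (V k) p) * N p)" for k
    by (rule Bochner_Integration.integrable_bound[OF Ni tm]) (auto simp: indicator_def)
  have tail: "(\<lambda>k. \<integral>p. (1 - indicator (V k) p) * N p \<partial>cvol) \<longlonglongrightarrow> (\<integral>p. 0 \<partial>cvol)"
  proof (rule integral_dominated_convergence[where w = N])
    show "AE p in cvol. (\<lambda>k. (1 - indicator (V k) p) * N p) \<longlonglongrightarrow> 0"
    proof (rule AE_I2)
      fix p
      have "\<forall>\<^sub>F k in sequentially. (1 - indicator (V k) p) * N p = 0" using Vin[of p] by eventually_elim simp
      then show "(\<lambda>k. (1 - indicator (V k) p) * N p) \<longlonglongrightarrow> 0" by (rule tendsto_eventually)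
    qed
    show "AE p in cvol. norm ((1 - indicator (V k) p) * N p) \<le> N p" for k
      using N0 by (intro AE_I2) (auto simp: indicator_def)
  qed (use tm Ni in auto)
  show "span_approx z (\<lambda>F. \<integral>p. ?d F p \<partial>cvol)"
  proof (rule span_approx_limit)
    fix \<epsilon> :: real assume e: "\<epsilon> > 0"
    have "\<forall>\<^sub>F k in sequentially. (\<integral>p. (1 - indicator (V k) p) * N p \<partial>cvol) < \<epsilon>"
      using order_tendstoD(2)[OF tail, of \<epsilon>] e by simp
    then obtain k where k: "(\<integral>p. (1 - indicator (V k) p) * N p \<partial>cvol) < \<epsilon>"
      unfolding eventually_sequentially by blast
    show "\<exists>\<phi>'. span_approx z \<phi>' \<and> (\<forall>F\<in>Lip0 A g z. \<forall>L\<in>lipschitz_bounds A g F. \<bar>(\<integral>p. ?d F p \<partial>cvol) - \<phi>' F\<bar> \<le> \<epsilon> * L)"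
    proof (intro exI[of _ "\<lambda>F. \<integral>p. indicator (V k) p * ?d F p \<partial>cvol"] conjI Va ballI)
      fix F L assume L: "L \<in> lipschitz_bounds A g F"
      have L0: "0 \<le> L" using L unfolding lipschitz_bounds_def by blast
      have ri: "integrable cvol (\<lambda>p. ?d F p - indicator (V k) p * ?d F p)"
        by (rule Bochner_Integration.integrable_diff[OF di[OF L] Vi[OF L]])
      have "(\<integral>p. ?d F p \<partial>cvol) - (\<integral>p. indicator (V k) p * ?d F p \<partial>cvol) = (\<integral>p. ?d F p - indicator (V k) p * ?d F p \<partial>cvol)"
        by (rule Bochner_Integration.integral_diff[OF di[OF L] Vi[OF L], symmetric])
      also have "\<bar>\<dots>\<bar> \<le> (\<integral>p. \<bar>?d F p - indicator (V k) p * ?d F p\<bar> \<partial>cvol)" by (rule integral_abs_bound)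
      also have "\<dots> \<le> (\<integral>p. L * ((1 - indicator (V k) p) * N p) \<partial>cvol)"
        by (rule integral_mono[OF integrable_abs[OF ri] integrable_mult_right[OF ti]])
           (use bound[OF L] in \<open>auto simp: indicator_def\<close>)
      also have "\<dots> = L * (\<integral>p. (1 - indicator (V k) p) * N p \<partial>cvol)" by (rule integral_mult_right_zero)
      also have "\<dots> \<le> L * \<epsilon>" using k L0 by (intro mult_left_mono) simp_all
      finally show "\<bar>(\<integral>p. ?d F p \<partial>cvol) - (\<integral>p. indicator (V k) p * ?d F p \<partial>cvol)\<bar> \<le> \<epsilon> * L"
        by (simp add: mult.commute)
    qed
  qed
qed

section \<open>Weak* continuity\<close>

lemma zero_Lip0: "(\<lambda>_. 0) \<in> Lip0 A g z" and Lip_norm_zero: "Lip_norm A g (\<lambda>_. 0) \<le> 0"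
proof -
  have 0: "0 \<in> lipschitz_bounds A g (\<lambda>_. 0)" by (simp add: lipschitz_bounds_def)
  then show "(\<lambda>_. 0) \<in> Lip0 A g z" unfolding Lip0_def by auto
  show "Lip_norm A g (\<lambda>_. 0) \<le> 0" unfolding Lip_norm_def
    by (rule cInf_lower[OF 0]) (auto simp: lipschitz_bounds_def intro!: bdd_belowI[of _ 0])
qed

lemma representative_L1:
  assumes "\<Gamma> \<in> L1_space A g" shows "representative \<Gamma> \<in> L1_fields A g"
proof -
  obtain X where X: "X \<in> L1_fields A g" "\<Gamma> = ae_equal (riem_volume A g) (L1_fields A g) `` {X}"
    using assms unfolding L1_space_def by (rule quotientE)
  have "X \<in> \<Gamma>" unfolding X(2) ae_equal_def using X(1) by simp
  then have "representative \<Gamma> \<in> \<Gamma>" unfolding representative_def by (rule someI[where P = "\<lambda>h. h \<in> \<Gamma>"])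
  moreover have "\<Gamma> \<subseteq> L1_fields A g" unfolding X(2) ae_equal_def by blast
  ultimately show ?thesis by blast
qed

lemma pairing_D_op:
  assumes F: "F \<in> Lip0 A g z" and \<Gamma>: "\<Gamma> \<in> L1_space A g"
  shows "Linf_L1_pairing A g (D_op A g F) \<Gamma> = (\<integral>p. differential A F p (representative \<Gamma> p) \<partial>cvol)"
proof -
  obtain L where L: "L \<in> lipschitz_bounds A g F" using F unfolding Lip0_def by blast
  let ?f = "representative (D_op A g F)" and ?X = "representative \<Gamma>"
  have ae0: "AE p in cvol. differential A F p = ?f p"
    unfolding D_op_def by (rule representative_Linf(2)[OF differential_Linf(1)[OF L]])
  have ae: "AE p in cvol. ?f p (?X p) = differential A F p (?X p)"
    using ae0 by eventually_elim simp
  have m: "(\<lambda>p. differential A F p (?X p)) \<in> borel_measurable cvol"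
    by (rule borel_measurable_integrable[OF integration_against_field(1)[OF representative_L1[OF \<Gamma>] L]])
  show ?thesis unfolding Linf_L1_pairing_def riem_volume_eq
    by (rule integral_cong_AE[OF completion_AE_measurable[OF m ae] m ae])
qed

text \<open>
  The preadjoint of the differential: it maps \<open>L\<^sup>1(M,TM)\<close> into the Lipschitz-free space.
\<close>

lemma pairing_in_free_space:
  assumes \<Gamma>: "\<Gamma> \<in> L1_space A g"
  shows "(\<lambda>F. if F \<in> Lip0 A g z then Linf_L1_pairing A g (D_op A g F) \<Gamma> else 0) \<in> free_space A g z"
proof -
  define X where "X = representative \<Gamma>"
  have X: "X \<in> L1_fields A g" unfolding X_def by (rule representative_L1[OF \<Gamma>])
  define \<phi> where "\<phi> F = (if F \<in> Lip0 A g z then Linf_L1_pairing A g (D_op A g F) \<Gamma> else 0)" for F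
  have \<phi>: "\<phi> F = (\<integral>p. differential A F p (X p) \<partial>cvol)" if "F \<in> Lip0 A g z" for F
    using pairing_D_op[OF that \<Gamma>] that unfolding \<phi>_def X_def by simp
  have norm_bound: "Lip_norm A g F \<in> lipschitz_bounds A g F" if "F \<in> Lip0 A g z" for F
    by (rule Lip_norm_bound) (use that in \<open>auto simp: Lip0_def\<close>)
  have int: "integrable cvol (\<lambda>p. differential A F p (X p))" if "F \<in> Lip0 A g z" for F
    by (rule integration_against_field(1)[OF X norm_bound[OF that]])
  have dual: "\<phi> \<in> Lip0_dual A g z"
    unfolding Lip0_dual_def mem_Collect_eq
  proof (intro conjI ballI allI impI)
    fix F G a b assume F: "F \<in> Lip0 A g z" and G: "G \<in> Lip0 A g z"
    let ?H = "\<lambda>x. a * F x + b * G x"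
    have H: "?H \<in> Lip0 A g z" by (rule Lip0_lincomb[OF F G])
    have "AE p in cvol. \<exists>\<omega>. has_differential A F p \<omega>" "AE p in cvol. \<exists>\<omega>. has_differential A G p \<omega>"
      unfolding AE_cvol by (rule lipschitz_differentiable_AE[OF norm_bound[OF F]] lipschitz_differentiable_AE[OF norm_bound[OF G]])+
    then have ae: "AE p in cvol. differential A ?H p (X p) = a * differential A F p (X p) + b * differential A G p (X p)"
    proof eventually_elim
      case (elim p)
      then obtain \<omega> \<omega>' where "has_differential A F p \<omega>" "has_differential A G p \<omega>'" by blast
      from differential_lincomb[OF this, of a b] show ?case by simp
    qed
    have i: "integrable cvol (\<lambda>p. a * differential A F p (X p))" "integrable cvol (\<lambda>p. b * differential A G p (X p))"
      by (rule integrable_mult_right[OF int[OF F]], rule integrable_mult_right[OF int[OF G]])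
    have "\<phi> ?H = (\<integral>p. a * differential A F p (X p) + b * differential A G p (X p) \<partial>cvol)"
      unfolding \<phi>[OF H]
      by (rule integral_cong_AE[OF borel_measurable_integrable[OF int[OF H]] borel_measurable_integrable[OF Bochner_Integration.integrable_add[OF i]] ae])
    also have "\<dots> = a * \<phi> F + b * \<phi> G"
      unfolding \<phi>[OF F] \<phi>[OF G] Bochner_Integration.integral_add[OF i] integral_mult_right_zero ..
    finally show "\<phi> ?H = a * \<phi> F + b * \<phi> G" .
  next
    show "\<exists>C. \<forall>F\<in>Lip0 A g z. \<bar>\<phi> F\<bar> \<le> C * Lip_norm A g F"
    proof (intro exI[of _ "\<integral>p. tnorm g p (X p) \<partial>cvol"] ballI)
      fix F assume F: "F \<in> Lip0 A g z"
      have "\<bar>\<phi> F\<bar> \<le> (\<integral>p. \<bar>differential A F p (X p)\<bar> \<partial>cvol)" unfolding \<phi>[OF F] by (rule integral_abs_bound)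
      also have "\<dots> \<le> (\<integral>p. Lip_norm A g F * tnorm g p (X p) \<partial>cvol)"
        by (rule integral_mono[OF integrable_abs[OF int[OF F]] integrable_mult_right[OF L1_fieldsD(2)[OF X]]])
           (rule differential_le_lipschitz[OF norm_bound[OF F] L1_fieldsD(1)[OF X]])
      finally show "\<bar>\<phi> F\<bar> \<le> (\<integral>p. tnorm g p (X p) \<partial>cvol) * Lip_norm A g F" by (simp add: mult.commute)
    qed
  qed (simp add: \<phi>_def)
  have "span_approx z \<phi>" by (rule span_approx_cong[OF integration_against_field(2)[OF X] \<phi>])
  note approx = this
  have "\<exists>\<psi>\<in>point_eval_span A g z. Lip0_dual_norm A g z (\<lambda>F. \<phi> F - \<psi> F) < \<epsilon>" if e: "\<epsilon> > 0" for \<epsilon>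
  proof -
    have e2: "\<epsilon> / 2 > 0" using e by simp
    obtain \<psi> where \<psi>: "\<psi> \<in> point_eval_span A g z"
      "\<And>F L. F \<in> Lip0 A g z \<Longrightarrow> L \<in> lipschitz_bounds A g F \<Longrightarrow> \<bar>\<phi> F - \<psi> F\<bar> \<le> \<epsilon> / 2 * L"
      by (rule span_approxE[OF approx e2]) (rule that; assumption)
    have "Lip0_dual_norm A g z (\<lambda>F. \<phi> F - \<psi> F) \<le> \<epsilon> / 2"
      unfolding Lip0_dual_norm_def
    proof (rule cSup_least)
      have "Lip_norm A g (\<lambda>_. 0) \<le> 1" using Lip_norm_zero by linarith
      then show "{\<bar>\<phi> F - \<psi> F\<bar> |F. F \<in> Lip0 A g z \<and> Lip_norm A g F \<le> 1} \<noteq> {}" using zero_Lip0 by blast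
      fix r assume "r \<in> {\<bar>\<phi> F - \<psi> F\<bar> |F. F \<in> Lip0 A g z \<and> Lip_norm A g F \<le> 1}"
      then obtain F where F: "r = \<bar>\<phi> F - \<psi> F\<bar>" "F \<in> Lip0 A g z" "Lip_norm A g F \<le> 1" by blast
      have "r \<le> \<epsilon> / 2 * Lip_norm A g F" unfolding F(1) by (rule \<psi>(2)[OF F(2) norm_bound[OF F(2)]])
      also have "\<dots> \<le> \<epsilon> / 2 * 1" using F(3) e by (intro mult_left_mono) simp_all
      finally show "r \<le> \<epsilon> / 2" by simp
    qed
    then have "Lip0_dual_norm A g z (\<lambda>F. \<phi> F - \<psi> F) < \<epsilon>" using e by linarith
    then show ?thesis using \<psi>(1) by blast
  qed
  then have "\<phi> \<in> free_space A g z" unfolding free_space_def using dual by blast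
  moreover have "(\<lambda>F. if F \<in> Lip0 A g z then Linf_L1_pairing A g (D_op A g F) \<Gamma> else 0) = \<phi>" by (simp add: \<phi>_def fun_eq_iff)
  ultimately show ?thesis by simp
qed

text \<open>
  The preimage of a subbasic open set given by \<open>\<Gamma>\<close> is the subbasic open set given by the image of \<open>\<Gamma>\<close>
  under the preadjoint.
\<close>

lemma D_op_weak_star_continuous: "continuous_map (weak_star_Lip0 A g z) (weak_star_Linf A g) (D_op A g)"
proof -
  have top: "topspace (weak_star_Lip0 A g z) = Lip0 A g z"
    unfolding weak_star_Lip0_def weak_star_topology_def topology_generated_by_topspace by blast
  have whole: "openin (weak_star_Lip0 A g z) (Lip0 A g z)" using openin_topspace[of "weak_star_Lip0 A g z"] unfolding top .
  show ?thesis
    unfolding weak_star_Linf_def weak_star_topology_def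
  proof (rule continuous_on_generated_topo)
    fix W assume "W \<in> insert (Linf_space A g) {{\<Phi> \<in> Linf_space A g. Linf_L1_pairing A g \<Phi> \<Gamma> \<in> U} |\<Gamma> U. \<Gamma> \<in> L1_space A g \<and> open U}"
    then consider "W = Linf_space A g" | \<Gamma> U where "W = {\<Phi> \<in> Linf_space A g. Linf_L1_pairing A g \<Phi> \<Gamma> \<in> U}" "\<Gamma> \<in> L1_space A g" "open U"
      by blast
    then show "openin (weak_star_Lip0 A g z) (D_op A g -` W \<inter> topspace (weak_star_Lip0 A g z))"
    proof cases
      case 1
      then have "D_op A g -` W \<inter> Lip0 A g z = Lip0 A g z" using D_op_space by blast
      then show ?thesis unfolding top using whole by simp
    next
      case 2
      let ?\<phi> = "\<lambda>F. if F \<in> Lip0 A g z then Linf_L1_pairing A g (D_op A g F) \<Gamma> else 0"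
      have "D_op A g -` W \<inter> Lip0 A g z = {F \<in> Lip0 A g z. ?\<phi> F \<in> U}" using D_op_space unfolding 2(1) by auto
      moreover have "openin (weak_star_Lip0 A g z) {F \<in> Lip0 A g z. ?\<phi> F \<in> U}"
        unfolding weak_star_Lip0_def weak_star_topology_def
        by (intro topology_generated_by_Basis insertI2 CollectI exI[of _ ?\<phi>] exI[of _ U] conjI refl
            pairing_in_free_space[OF 2(2)] 2(3))
      ultimately show ?thesis unfolding top by simp
    qed
  next
    show "D_op A g ` topspace (weak_star_Lip0 A g z) \<subseteq> \<Union> (insert (Linf_space A g) {{\<Phi> \<in> Linf_space A g. Linf_L1_pairing A g \<Phi> \<Gamma> \<in> U} |\<Gamma> U. \<Gamma> \<in> L1_space A g \<and> open U})"
      unfolding top by (intro image_subsetI UnionI[OF insertI1] D_op_space)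
  qed
qed

end

theorem proposition4p1:
  fixes A :: "('m::{t2_space, second_countable_topology}, 'n::finite) chart set"
    and g :: "('m, 'n) metric_tensor"
    and z :: 'm
  assumes "smooth_atlas A"
    and "riemannian_metric A g"
    and "connected (UNIV :: 'm set)"
    and "orientable A"
  shows "D_op A g \<in> Lip0 A g z \<rightarrow> Linf_space A g \<and>
    (\<forall>F \<in> Lip0 A g z. \<forall>G \<in> Lip0 A g z. \<forall>a b.
       D_op A g (\<lambda>x. a * F x + b * G x) = Linf_lincomb A g a (D_op A g F) b (D_op A g G)) \<and>
    (\<forall>F \<in> Lip0 A g z. Linf_norm A g (D_op A g F) = Lip_norm A g F) \<and>
    continuous_map (weak_star_Lip0 A g z) (weak_star_Linf A g) (D_op A g)"
proof -
  interpret connected_riemannian_manifold A g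
    using assms by unfold_locales
  show ?thesis
  proof (intro conjI ballI allI)
    show "D_op A g \<in> Lip0 A g z \<rightarrow> Linf_space A g" by (rule funcsetI) (rule D_op_space)
  qed (rule D_op_lincomb D_op_isometry D_op_weak_star_continuous; assumption)+
qed

end
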